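(* Let $\Bbbk$ be a commutative ring, let $\mathbf{S}$ be the associative unital monoid in $\mathbb{N}$-graded spaces given by configurations of little squares (see context), let $\mathbf{M}$ be a right $\mathbf{S}$-module in $\mathsf{Top}^{\mathbb{N}}$, and let $f:\mathbb{N}\to\mathbb{N}$ be such that $$H_{n,d}(\mathbf{M},|R_\bullet(\mathbf{M})|;\Bbbk)=0\quad\text{for } d<f(n).$$ Then, setting $\bar f(n):=\min\{\lfloor f(p)+\tfrac12(n-p)\rfloor \mid 0\le p\le n\}$, we have $$\widetilde H_{n,d}(\mathbf{M}/\sigma;\Bbbk)=0\quad\text{for } d<\bar f(n).$$
   Context: **Graded spaces.** $\mathsf{Top}$ is compactly generated weak Hausdorff spaces, $\mathsf{Top}^{\mathbb{N}}$ is the category of $\mathbb{N}$-graded spaces, with monoidal structure $(X\otimes Y)(n)=\coprod_{a+b=n}X(a)\times Y(b)$. For a space $V$, $n_*(V)$ is $V$ in grading $n$ and empty otherwise. $H_{n,d}(X;\Bbbk):=H_d(X(n);\Bbbk)$, and similarly for reduced homology of pointed $\mathbb{N}$-graded spaces. **The monoid $\mathbf{S}$.** $\mathcal{C}_2(n)$ is the space of $n$-tuples of rectilinear embeddings $I^2\to I^2$ with disjoint interiors. $\mathbf{S}(0)=\{(0,\emptyset)\}$, and $\mathbf{S}(n)=(0,\infty)\times\mathcal{C}_2(n)/\Sigma_n$ for $n>0$, regarded (by rescaling) as the space of pairs of a $t>0$ and an unordered set $E$ of $n$ rectilinear embeddings $I^2\to[0,t]\times[0,1]$ with disjoint interiors.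 The product is $(t,E)\cdot(t',E')=(t+t',E\sqcup(E'+(t,0)))$, with unit $(0,\emptyset)$. Let $\sigma=(1,\mathrm{id}_{I^2})\in\mathbf{S}(1)$. One has $\pi_1(\mathbf{S}(n),\sigma^n)\cong\beta_n$, Artin's braid group. **$\mathbf{M}/\sigma$.** This is the homotopy cofibre (a pointed $\mathbb{N}$-graded space) of $-\cdot\sigma:\mathbf{M}\otimes1_*( * )\to\mathbf{M}$; in grading $n$ it is the homotopy cofibre of $-\cdot\sigma:\mathbf{M}(n-1)\to\mathbf{M}(n)$, with $\mathbf{M}(-1)=\emptyset$. **The category $\widetilde{\Delta}_{\mathrm{inj}}$.** Write $*$ for concatenation of Moore paths. Let $U$ be the topologically enriched category with objects $[p]=\{0,\dots,p\}$, $p\ge 0$, and with $U([q],[p])$ the space of pairs $(d,\mu)$ of $d\in\mathbf{S}(p-q)$ and a Moore path $\mu$ in $\mathbf{S}(p+1)$ from $\sigma^{p+1}$ to $d\cdot\sigma^{q+1}$; composition $U([l],[q])\times U([q],[p])\to U([l],[p])$ is $((e,\gamma),(d,\mu))\mapsto(d\cdot e,\mu*(d\cdot\gamma))$. For an injective order-preserving map $i:[q]\to[p]$ consider the point $(\sigma^{p-q},\mu_i)$ where $\mu_i$ is a Moore loop at $\sigma^{p+1}$ representing the braid in which the strands starting at positions $i([q])$ end, in order, at the last $q+1$ positions, and the remaining strands end, in order, at the first $p-q$ positions, the strands starting at $i([q])$ passing behind the remaining ones. $\widetilde{\Delta}_{\mathrm{inj}}([q],[p])\subset U([q],[p])$ is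 the union of the path components of these points over all $i$. This is a subcategory of $U$ with homotopy discrete morphism spaces, equivalent to $\Delta_{\mathrm{inj}}$. **Canonical resolution.** $R_p(\mathbf{M})(n)$ is the space of pairs $(a,\gamma)$ of $a\in\mathbf{M}(n-p-1)$ (no such points if $n<p+1$) and a Moore path $\gamma$ in $\mathbf{M}(n)$ ending at $a\cdot\sigma^{p+1}$. The maps $((d,\mu),(a,\gamma))\mapsto(a\cdot d,\gamma*(a\cdot\mu))$ make $R_\bullet(\mathbf{M})$ an enriched functor on $\widetilde{\Delta}_{\mathrm{inj}}^{op}$, and evaluating $\gamma$ at $0$ gives an augmentation to $\mathbf{M}$. Set $|R_\bullet(\mathbf{M})|:=\operatorname{hocolim}_{[p]\in\widetilde{\Delta}_{\mathrm{inj}}^{op}}R_p(\mathbf{M})$ (enriched homotopy colimit), with induced map $\epsilon_{\mathbf{M}}:|R_\bullet(\mathbf{M})|\to\mathbf{M}$. $H_{n,d}(\mathbf{M},|R_\bullet(\mathbf{M})|;\Bbbk)$ is the relative homology of the map $\epsilon_{\mathbf{M}}$ in grading $n$ and degree $d$, i.e. the reduced homology of its homotopy cofibre. *)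

theory Defs
  imports "HOL-Homology.Homology"
begin

section \<open>Final topologies\<close>

definition final_topology ::
    "'b set \<Rightarrow> 'i set \<Rightarrow> ('i \<Rightarrow> 'a topology) \<Rightarrow> ('i \<Rightarrow> 'a \<Rightarrow> 'b) \<Rightarrow> 'b topology" where
  "final_topology P I X f = topology (\<lambda>U. U \<subseteq> P \<and>
     (\<forall>i\<in>I. openin (X i) {x \<in> topspace (X i). f i x \<in> U}))"

lemma openin_preimage_Int:
  assumes "openin X {x \<in> topspace X. f x \<in> U}" "openin X {x \<in> topspace X. f x \<in> V}"
  shows "openin X {x \<in> topspace X. f x \<in> U \<inter> V}"
proof -
  have "{x \<in> topspace X. f x \<in> U \<inter> V} = {x \<in> topspace X. f x \<in> U} \<inter> {x \<in> topspace X. f x \<in> V}"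
    by auto
  with assms show ?thesis by (simp add: openin_Int)
qed

lemma openin_preimage_Union:
  assumes "\<And>U. U \<in> \<U> \<Longrightarrow> openin X {x \<in> topspace X. f x \<in> U}"
  shows "openin X {x \<in> topspace X. f x \<in> \<Union>\<U>}"
proof -
  have "{x \<in> topspace X. f x \<in> \<Union>\<U>} = (\<Union>U\<in>\<U>. {x \<in> topspace X. f x \<in> U})"
    by auto
  with assms show ?thesis by auto
qed

lemma openin_final_topology:
  "openin (final_topology P I X f) U \<longleftrightarrow>
     U \<subseteq> P \<and> (\<forall>i\<in>I. openin (X i) {x \<in> topspace (X i). f i x \<in> U})"
proof -
  have "istopology (\<lambda>U. U \<subseteq> P \<and> (\<forall>i\<in>I. openin (X i) {x \<in> topspace (X i). f i x \<in> U}))"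
    unfolding istopology_def
    by (intro conjI allI impI ballI openin_preimage_Int openin_preimage_Union) blast+
  then show ?thesis
    by (simp add: final_topology_def topology_inverse')
qed

lemma topspace_final_topology:
  assumes "\<And>i. i \<in> I \<Longrightarrow> f i \<in> topspace (X i) \<rightarrow> P"
  shows "topspace (final_topology P I X f) = P"
proof
  show "topspace (final_topology P I X f) \<subseteq> P"
    by (metis openin_final_topology openin_topspace)
  have "openin (X i) {x \<in> topspace (X i). f i x \<in> P}" if "i \<in> I" for i
  proof -
    have "{x \<in> topspace (X i). f i x \<in> P} = topspace (X i)"
      using assms[OF that] by auto
    then show ?thesis by simp
  qed
  then have "openin (final_topology P I X f) P"
    by (simp add: openin_final_topology)
  then show "P \<subseteq> topspace (final_topology P I X f)"
    by (rule openin_subset)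
qed

definition quotient_topology :: "'a topology \<Rightarrow> ('a \<Rightarrow> 'b) \<Rightarrow> 'b topology" where
  "quotient_topology X f = final_topology (f ` topspace X) {()} (\<lambda>_. X) (\<lambda>_. f)"

lemma quotient_map_quotient_topology: "quotient_map X (quotient_topology X f) f"
  by (auto simp: quotient_map_def quotient_topology_def openin_final_topology
      topspace_final_topology)

lemma topspace_quotient_topology [simp]: "topspace (quotient_topology X f) = f ` topspace X"
  using quotient_imp_surjective_map[OF quotient_map_quotient_topology] by metis


section \<open>Compactly generated weak Hausdorff spaces\<close>

text \<open>
  The test maps of the category of compactly generated spaces are the continuous maps from
  compact Hausdorff spaces. Since a definition cannot quantify over types, the points of a test
  space for a topology on 'a are taken in the type 'a set set. This loses nothing for the notions
  below. Given \<open>u : K \<rightarrow> X\<close>, let \<open>K'\<close> be the closure in \<open>K\<close> of a set with one preimage of every point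
  of \<open>u(K)\<close>. Then \<open>u(K') = u(K)\<close>, and \<open>K'\<close> has at most \<open>2^(2^|X|)\<close> points, because a Hausdorff space
  with a dense subset of cardinality \<open>c\<close> has at most \<open>2^(2^c)\<close> points (and \<open>K'\<close> is finite if \<open>u(K)\<close> is).
  Hence the weak Hausdorff property is the usual one. If \<open>X\<close> is weak Hausdorff and \<open>F\<close> has closed
  preimages in all small test spaces, then the preimage \<open>F'\<close> of \<open>F\<close> in \<open>K'\<close> is compact, so
  \<open>F \<inter> u(K) = u(F')\<close> is closed in \<open>X\<close>, so \<open>F\<close> has closed preimage in \<open>K\<close>. Hence k-ification of weak
  Hausdorff spaces, the only ones to which it is applied, is the usual one too.

  The function kification of the library tests on all compact subsets, including
  non-Hausdorff ones, and is a different notion.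
\<close>

definition test_maps :: "'a topology \<Rightarrow> ('a set set topology \<times> ('a set set \<Rightarrow> 'a)) set" where
  "test_maps X = {(K, u). compact_space K \<and> Hausdorff_space K \<and> continuous_map K X u}"

definition kify :: "'a topology \<Rightarrow> 'a topology" where
  "kify X = final_topology (topspace X) (test_maps X) fst snd"

lemma topspace_kify [simp]: "topspace (kify X) = topspace X"
  unfolding kify_def
  by (rule topspace_final_topology) (auto simp: test_maps_def continuous_map_def)

definition weak_Hausdorff :: "'a topology \<Rightarrow> bool" where
  "weak_Hausdorff X \<longleftrightarrow> (\<forall>(K, u) \<in> test_maps X. closedin X (u ` topspace K))"

definition compactly_generated :: "'a topology \<Rightarrow> bool" where
  "compactly_generated X \<longleftrightarrow> kify X = X"

definition CGWH :: "'a topology \<Rightarrow> bool" where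
  "CGWH X \<longleftrightarrow> compactly_generated X \<and> weak_Hausdorff X"

definition cg_prod :: "'a topology \<Rightarrow> 'b topology \<Rightarrow> ('a \<times> 'b) topology" where
  "cg_prod X Y = kify (prod_topology X Y)"

lemma topspace_cg_prod [simp]: "topspace (cg_prod X Y) = topspace X \<times> topspace Y"
  by (simp add: cg_prod_def)

definition cg_subspace :: "'a topology \<Rightarrow> 'a set \<Rightarrow> 'a topology" where
  "cg_subspace X A = kify (subtopology X A)"

abbreviation empty_space :: "'a topology" where
  "empty_space \<equiv> discrete_topology {}"


section \<open>Moore paths\<close>

definition compact_open_topology :: "'a topology \<Rightarrow> 'b topology \<Rightarrow> ('a \<Rightarrow> 'b) topology" where
  "compact_open_topology X Y = topology_generated_by
     {{f. continuous_map X Y f \<and> f ` K \<subseteq> U} | K U. compactin X K \<and> openin Y U}"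

text \<open>
  A Moore path is a pair of a length \<open>r \<ge> 0\<close> and a map \<open>[0,\<infinity>) \<rightarrow> X\<close> that is constant on \<open>[r,\<infinity>)\<close>; the
  map is extended to the real line by its value at \<open>0\<close>.
\<close>

type_synonym 'a mpath = "real \<times> (real \<Rightarrow> 'a)"

definition mpath_space :: "'a topology \<Rightarrow> 'a mpath topology" where
  "mpath_space X = cg_subspace (prod_topology euclideanreal (compact_open_topology euclideanreal X))
     {(r, \<gamma>). 0 \<le> r \<and> (\<forall>t\<le>0. \<gamma> t = \<gamma> 0) \<and> (\<forall>t\<ge>r. \<gamma> t = \<gamma> r)}"

definition mstart :: "'a mpath \<Rightarrow> 'a" where
  "mstart \<gamma> = snd \<gamma> 0"

definition mend :: "'a mpath \<Rightarrow> 'a" where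
  "mend \<gamma> = snd \<gamma> (fst \<gamma>)"

definition mconcat :: "'a mpath \<Rightarrow> 'a mpath \<Rightarrow> 'a mpath" where
  "mconcat \<gamma> \<delta> = (fst \<gamma> + fst \<delta>, \<lambda>t. if t \<le> fst \<gamma> then snd \<gamma> t else snd \<delta> (t - fst \<gamma>))"

definition mmap :: "('a \<Rightarrow> 'b) \<Rightarrow> 'a mpath \<Rightarrow> 'b mpath" where
  "mmap h \<gamma> = (fst \<gamma>, h \<circ> snd \<gamma>)"


section \<open>The monoid of configurations of little squares\<close>

text \<open>
  The square \<open>((x, y), (w, h))\<close> stands for the rectilinear embedding
  \<open>(s, t) \<mapsto> (x + w s, y + h t)\<close> of the unit square.
\<close>

type_synonym square = "(real \<times> real) \<times> (real \<times> real)"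

definition square_map :: "square \<Rightarrow> real \<times> real \<Rightarrow> real \<times> real" where
  "square_map e z = (fst (fst e) + fst (snd e) * fst z, snd (fst e) + snd (snd e) * snd z)"

abbreviation unit_square :: "(real \<times> real) set" where
  "unit_square \<equiv> {0..1} \<times> {0..1}"

definition C2 :: "nat \<Rightarrow> (nat \<Rightarrow> square) topology" where
  "C2 n = subtopology (product_topology (\<lambda>_. euclidean) {..<n})
     {c. (\<forall>i<n. 0 < fst (snd (c i)) \<and> 0 < snd (snd (c i)) \<and>
                square_map (c i) ` unit_square \<subseteq> unit_square) \<and>
         (\<forall>i<n. \<forall>j<n. i \<noteq> j \<longrightarrow>
            interior (square_map (c i) ` unit_square) \<inter>
            interior (square_map (c j) ` unit_square) = {})}"

type_synonym conf = "real \<times> square set"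

definition stretch :: "real \<Rightarrow> square \<Rightarrow> square" where
  "stretch t e = ((t * fst (fst e), snd (fst e)), (t * fst (snd e), snd (snd e)))"

definition shift :: "real \<Rightarrow> square \<Rightarrow> square" where
  "shift t e = ((fst (fst e) + t, snd (fst e)), snd e)"

text \<open>
  The fibres of the map below are the orbits of the symmetric group on \<open>(0,\<infinity>) \<times> C2 n\<close>.
\<close>

definition \<S> :: "nat \<Rightarrow> conf topology" where
  "\<S> n = (if n = 0 then discrete_topology {(0, {})}
          else quotient_topology (prod_topology (top_of_set {0<..}) (C2 n))
                 (\<lambda>(t, c). (t, (\<lambda>i. stretch t (c i)) ` {..<n})))"

definition smult :: "conf \<Rightarrow> conf \<Rightarrow> conf" where
  "smult x y = (fst x + fst y, snd x \<union> shift (fst x) ` snd y)"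

definition sunit :: conf where
  "sunit = (0, {})"

definition \<sigma> :: conf where
  "\<sigma> = (1, {((0, 0), (1, 1))})"

primrec spow :: "nat \<Rightarrow> conf" where
  "spow 0 = sunit"
| "spow (Suc n) = smult (spow n) \<sigma>"


section \<open>Right modules\<close>

text \<open>
  \<open>act a b\<close> is the component \<open>M(a) \<times> S(b) \<rightarrow> M(a + b)\<close> of the action. The points of the spaces
  \<open>M(n)\<close> share a type, but the spaces need not be disjoint.
\<close>

type_synonym 'a action = "nat \<Rightarrow> nat \<Rightarrow> 'a \<Rightarrow> conf \<Rightarrow> 'a"

definition right_S_module :: "(nat \<Rightarrow> 'a topology) \<Rightarrow> 'a action \<Rightarrow> bool" where
  "right_S_module M act \<longleftrightarrow>
     (\<forall>n. CGWH (M n)) \<and>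
     (\<forall>a b. continuous_map (cg_prod (M a) (\<S> b)) (M (a + b)) (\<lambda>(x, s). act a b x s)) \<and>
     (\<forall>a. \<forall>x \<in> topspace (M a). act a 0 x sunit = x) \<and>
     (\<forall>a b c. \<forall>x \<in> topspace (M a). \<forall>s \<in> topspace (\<S> b). \<forall>t \<in> topspace (\<S> c).
        act (a + b) c (act a b x s) t = act a (b + c) x (smult s t))"


section \<open>The enriched category of injections\<close>

definition U_hom :: "nat \<Rightarrow> nat \<Rightarrow> (conf \<times> conf mpath) topology" where
  "U_hom q p = (if q \<le> p
     then cg_subspace (prod_topology (\<S> (p - q)) (mpath_space (\<S> (p + 1))))
            {(d, \<mu>). mstart \<mu> = spow (p + 1) \<and> mend \<mu> = smult d (spow (q + 1))}
     else empty_space)"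

text \<open>
  The composite of \<open>x \<in> U([l],[q])\<close> and \<open>y \<in> U([q],[p])\<close>.
\<close>

definition U_comp :: "conf \<times> conf mpath \<Rightarrow> conf \<times> conf mpath \<Rightarrow> conf \<times> conf mpath" where
  "U_comp x y = (case x of (e, \<gamma>) \<Rightarrow> case y of (d, \<mu>) \<Rightarrow>
     (smult d e, mconcat \<mu> (mmap (smult d) \<gamma>)))"

definition slot :: "nat \<Rightarrow> square" where
  "slot k = ((real k, 0), (1, 1))"

lemma spow_eq: "spow n = (real n, slot ` {..<n})"
  by (induction n)
    (auto simp: sunit_def smult_def \<sigma>_def shift_def slot_def lessThan_Suc)

definition centre :: "square \<Rightarrow> real \<times> real" where
  "centre e = square_map e (1/2, 1/2)"

definition delta_inj :: "nat \<Rightarrow> nat \<Rightarrow> (nat \<Rightarrow> nat) set" where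
  "delta_inj q p = {i. strict_mono_on {..q} i \<and> i ` {..q} \<subseteq> {..p}}"

text \<open>
  The loop moves labelled squares \<open>e 0, \<dots>, e p\<close>, starting at positions \<open>0, \<dots>, p\<close>. The braid traced
  out by their centres is drawn by projecting to the first coordinate; behind means larger second
  coordinate. In this projection no two strands starting in \<open>i([q])\<close> cross, and no two of the
  remaining strands cross, so the crossings, and hence the braid, are determined. The reflection
  \<open>y \<mapsto> 1 - y\<close> induces an automorphism of the monoid that fixes \<open>\<sigma>\<close> and interchanges the two
  conventions for behind.
\<close>

definition shuffle_loop :: "nat \<Rightarrow> nat \<Rightarrow> (nat \<Rightarrow> nat) \<Rightarrow> conf mpath \<Rightarrow> bool" where
  "shuffle_loop q p i \<mu> \<longleftrightarrow>
     \<mu> \<in> topspace (mpath_space (\<S> (p + 1))) \<and>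
     (\<exists>e :: nat \<Rightarrow> real \<Rightarrow> square.
        (\<forall>k\<le>p. continuous_on {0..fst \<mu>} (e k)) \<and>
        (\<forall>t\<in>{0..fst \<mu>}. snd (snd \<mu> t) = (\<lambda>k. e k t) ` {..p}) \<and>
        mstart \<mu> = spow (p + 1) \<and> mend \<mu> = spow (p + 1) \<and>
        (\<forall>k\<le>p. e k 0 = slot k) \<and>
        (\<forall>j\<le>q. e (i j) (fst \<mu>) = slot (p - q + j)) \<and>
        (\<forall>k\<le>p. k \<notin> i ` {..q} \<longrightarrow> e k (fst \<mu>) = slot (card ({..<k} - i ` {..q}))) \<and>
        (\<forall>t\<in>{0..fst \<mu>}. \<forall>k\<le>p. \<forall>l\<le>p.
           (k < l \<and> (k \<in> i ` {..q} \<longleftrightarrow> l \<in> i ` {..q}) \<longrightarrow>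
              fst (centre (e k t)) < fst (centre (e l t))) \<and>
           (k \<in> i ` {..q} \<and> l \<notin> i ` {..q} \<and> fst (centre (e k t)) = fst (centre (e l t)) \<longrightarrow>
              snd (centre (e k t)) > snd (centre (e l t)))))"

definition Delta_hom :: "nat \<Rightarrow> nat \<Rightarrow> (conf \<times> conf mpath) topology" where
  "Delta_hom q p = cg_subspace (U_hom q p)
     {x. \<exists>i \<in> delta_inj q p. \<exists>\<mu>. shuffle_loop q p i \<mu> \<and>
           path_component_of (U_hom q p) (spow (p - q), \<mu>) x}"


section \<open>The canonical resolution\<close>

definition Res :: "(nat \<Rightarrow> 'a topology) \<Rightarrow> 'a action \<Rightarrow> nat \<Rightarrow> nat \<Rightarrow> ('a \<times> 'a mpath) topology" where
  "Res M act n p = (if p + 1 \<le> n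
     then cg_subspace (prod_topology (M (n - (p + 1))) (mpath_space (M n)))
            {(a, \<gamma>). mend \<gamma> = act (n - (p + 1)) (p + 1) a (spow (p + 1))}
     else empty_space)"

definition Res_map ::
    "'a action \<Rightarrow> nat \<Rightarrow> nat \<Rightarrow> nat \<Rightarrow> conf \<times> conf mpath \<Rightarrow> 'a \<times> 'a mpath \<Rightarrow> 'a \<times> 'a mpath" where
  "Res_map act n q p x r = (case x of (d, \<mu>) \<Rightarrow> case r of (a, \<gamma>) \<Rightarrow>
     (act (n - (p + 1)) (p - q) a d, mconcat \<gamma> (mmap (act (n - (p + 1)) (p + 1) a) \<mu>)))"


section \<open>Enriched homotopy colimits\<close>

text \<open>
  The enriched homotopy colimit over \<open>C\<^sup>o\<^sup>p\<close> of a functor \<open>F\<close> is the geometric realization of the bar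
  construction with \<open>k\<close>-simplices
  \<open>\<Coprod>\<^bsub>p 0, \<dots>, p k\<^esub> F(p 0) \<times> C(p 1, p 0) \<times> \<dots> \<times> C(p k, p (k - 1))\<close>. The realization is the thick one,
  formed from the face maps only, which preserves levelwise weak equivalences without
  cofibrancy assumptions. Here objects are natural numbers, \<open>H q p\<close> is the space of
  morphisms from \<open>q\<close> to \<open>p\<close>, \<open>cmp x y\<close> is the composite of \<open>x \<in> H l q\<close> and \<open>y \<in> H q p\<close>, and
  \<open>Fm q p : H q p \<times> F p \<rightarrow> F q\<close> is the functoriality.
\<close>

type_synonym ('r, 'h) bar = "(nat \<Rightarrow> nat) \<times> 'r \<times> (nat \<Rightarrow> 'h)"

definition bar_space ::
    "(nat \<Rightarrow> nat \<Rightarrow> 'h topology) \<Rightarrow> (nat \<Rightarrow> 'r topology) \<Rightarrow> nat \<Rightarrow> ('r, 'h) bar topology" where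
  "bar_space H F k = sum_topology
     (\<lambda>p. cg_prod (F (p 0)) (product_topology (\<lambda>j. H (p (Suc j)) (p j)) {..<k}))
     ({..k} \<rightarrow>\<^sub>E UNIV)"

definition bar_face ::
    "('h \<Rightarrow> 'h \<Rightarrow> 'h) \<Rightarrow> (nat \<Rightarrow> nat \<Rightarrow> 'h \<Rightarrow> 'r \<Rightarrow> 'r) \<Rightarrow> nat \<Rightarrow> nat \<Rightarrow> ('r, 'h) bar \<Rightarrow> ('r, 'h) bar" where
  "bar_face cmp Fm k i b = (case b of (p, r, m) \<Rightarrow>
     (\<lambda>j\<in>{..<k}. if j < i then p j else p (Suc j),
      if i = 0 then Fm (p 1) (p 0) (m 0) r else r,
      \<lambda>j\<in>{..<k - 1}. if j + 1 < i then m j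
                     else if j + 1 = i then cmp (m (Suc j)) (m j)
                     else m (Suc j)))"

definition simplex_space :: "nat \<Rightarrow> (nat \<Rightarrow> real) topology" where
  "simplex_space k = subtopology (powertop_real UNIV) (standard_simplex k)"

definition realization_rel ::
    "(nat \<Rightarrow> 'x topology) \<Rightarrow> (nat \<Rightarrow> nat \<Rightarrow> 'x \<Rightarrow> 'x) \<Rightarrow>
     ((nat \<times> 'x \<times> (nat \<Rightarrow> real)) \<times> (nat \<times> 'x \<times> (nat \<Rightarrow> real))) set" where
  "realization_rel X d =
     {((k, d (Suc k) i x, t), (Suc k, x, simplical_face i t)) | k i x t.
        i \<le> Suc k \<and> x \<in> topspace (X (Suc k)) \<and> t \<in> standard_simplex k}"

definition realization ::
    "(nat \<Rightarrow> 'x topology) \<Rightarrow> (nat \<Rightarrow> nat \<Rightarrow> 'x \<Rightarrow> 'x) \<Rightarrow> (nat \<times> 'x \<times> (nat \<Rightarrow> real)) set topology" where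
  "realization X d = quotient_topology
     (sum_topology (\<lambda>k. cg_prod (X k) (simplex_space k)) UNIV)
     (\<lambda>z. (realization_rel X d \<union> (realization_rel X d)\<inverse>)\<^sup>* `` {z})"

definition hocolim ::
    "(nat \<Rightarrow> nat \<Rightarrow> 'h topology) \<Rightarrow> ('h \<Rightarrow> 'h \<Rightarrow> 'h) \<Rightarrow>
     (nat \<Rightarrow> 'r topology) \<Rightarrow> (nat \<Rightarrow> nat \<Rightarrow> 'h \<Rightarrow> 'r \<Rightarrow> 'r) \<Rightarrow>
     (nat \<times> ('r, 'h) bar \<times> (nat \<Rightarrow> real)) set topology" where
  "hocolim H cmp F Fm = realization (bar_space H F) (bar_face cmp Fm)"

text \<open>
  The map induced by an augmentation \<open>\<alpha>\<close>, given as one function because it need not depend on the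
  object.
\<close>

definition hocolim_aug ::
    "('r \<Rightarrow> 'a) \<Rightarrow> (nat \<times> ('r, 'h) bar \<times> (nat \<Rightarrow> real)) set \<Rightarrow> 'a" where
  "hocolim_aug \<alpha> c = (THE y. \<forall>(k, (p, r, m), t) \<in> c. \<alpha> r = y)"

lemma hocolim_aug_eq:
  fixes H :: "nat \<Rightarrow> nat \<Rightarrow> 'h topology" and F :: "nat \<Rightarrow> 'r topology" and \<alpha> :: "'r \<Rightarrow> 'a"
  assumes "\<And>q p x r. r \<in> topspace (F p) \<Longrightarrow> \<alpha> (Fm q p x r) = \<alpha> r"
    and "c \<in> topspace (hocolim H cmp F Fm)" and mem: "(k, (p, r, m), t) \<in> c"
  shows "hocolim_aug \<alpha> c = \<alpha> r"
proof -
  let ?R = "realization_rel (bar_space H F) (bar_face cmp Fm)"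
  from assms(2) obtain z where c: "c = (?R \<union> ?R\<inverse>)\<^sup>* `` {z}"
    unfolding hocolim_def realization_def topspace_quotient_topology by (elim imageE)
  define g where "g = (\<lambda>w :: nat \<times> ('r, 'h) bar \<times> (nat \<Rightarrow> real). \<alpha> (fst (snd (fst (snd w)))))"
  have R: "g v = g w" if "(v, w) \<in> ?R" for v w
    using that assms(1)
    by (auto simp: realization_rel_def bar_space_def bar_face_def g_def split: if_splits)
  have star: "g v = g w" if "(v, w) \<in> (?R \<union> ?R\<inverse>)\<^sup>*" for v w
    using that
  proof (induction rule: rtrancl_induct)
    case (step y z)
    then show ?case using R[of y z] R[of z y] by auto
  qed simp
  have "g w = \<alpha> r" if "w \<in> c" for w
    using star[of z w] star[of z "(k, (p, r, m), t)"] that mem by (simp add: g_def c)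
  then have "\<forall>(k, (p, r', m), t) \<in> c. \<alpha> r' = \<alpha> r"
    by (force simp: g_def)
  then show ?thesis
    unfolding hocolim_aug_def using mem by (intro the_equality) auto
qed

definition abs_Res ::
    "(nat \<Rightarrow> 'a topology) \<Rightarrow> 'a action \<Rightarrow> nat \<Rightarrow>
     (nat \<times> ('a \<times> 'a mpath, conf \<times> conf mpath) bar \<times> (nat \<Rightarrow> real)) set topology" where
  "abs_Res M act n = hocolim Delta_hom U_comp (Res M act n) (Res_map act n)"

definition \<epsilon> ::
    "(nat \<times> ('a \<times> 'a mpath, conf \<times> conf mpath) bar \<times> (nat \<Rightarrow> real)) set \<Rightarrow> 'a" where
  "\<epsilon> = hocolim_aug (\<lambda>(a, \<gamma>). mstart \<gamma>)"

lemma \<epsilon>_eq: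
  assumes "c \<in> topspace (abs_Res M act n)" "(k, (p, (a, \<gamma>), m), t) \<in> c"
  shows "\<epsilon> c = mstart \<gamma>"
proof -
  have "(case Res_map act n q p x r of (a, \<gamma>) \<Rightarrow> mstart \<gamma>) = (case r of (a, \<gamma>) \<Rightarrow> mstart \<gamma>)"
    if "r \<in> topspace (Res M act n p)" for q p x r
    using that
    by (auto simp: Res_def Res_map_def mstart_def mconcat_def cg_subspace_def mpath_space_def
        split: if_splits prod.splits)
  then show ?thesis
    using hocolim_aug_eq[where \<alpha> = "\<lambda>(a, \<gamma>). mstart \<gamma>", OF _ assms(1)[unfolded abs_Res_def] assms(2)]
    by (simp add: \<epsilon>_def)
qed


section \<open>Homotopy cofibres\<close>

text \<open>
  The unreduced mapping cone, with the cone point as base point. For the empty source the cone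
  point is disjoint.
\<close>

datatype ('a, 'b) cone = Apex | Cyl 'a real | Base 'b

definition cone_in :: "('a \<Rightarrow> 'b) \<Rightarrow> 'a \<times> real \<Rightarrow> ('a, 'b) cone" where
  "cone_in h z = (case z of (x, s) \<Rightarrow>
     if s = 0 then Apex else if s = 1 then Base (h x) else Cyl x s)"

definition hcofibre :: "'a topology \<Rightarrow> 'b topology \<Rightarrow> ('a \<Rightarrow> 'b) \<Rightarrow> ('a, 'b) cone topology" where
  "hcofibre X Y h = topology (\<lambda>U.
     U \<subseteq> insert Apex (cone_in h ` (topspace X \<times> {0..1}) \<union> Base ` topspace Y) \<and>
     openin (cg_prod X (top_of_set {0..1})) {z \<in> topspace X \<times> {0..1}. cone_in h z \<in> U} \<and>
     openin Y {y \<in> topspace Y. Base y \<in> U})"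

lemma openin_hcofibre:
  "openin (hcofibre X Y h) U \<longleftrightarrow>
     U \<subseteq> insert Apex (cone_in h ` (topspace X \<times> {0..1}) \<union> Base ` topspace Y) \<and>
     openin (cg_prod X (top_of_set {0..1})) {z \<in> topspace X \<times> {0..1}. cone_in h z \<in> U} \<and>
     openin Y {y \<in> topspace Y. Base y \<in> U}"
proof -
  let ?Z = "cg_prod X (top_of_set {0..1::real})"
  have eq: "topspace X \<times> {0..1} = topspace ?Z"
    by (simp add: cg_prod_def)
  have "istopology (\<lambda>U.
     U \<subseteq> insert Apex (cone_in h ` (topspace X \<times> {0..1}) \<union> Base ` topspace Y) \<and>
     openin ?Z {z \<in> topspace X \<times> {0..1}. cone_in h z \<in> U} \<and>
     openin Y {y \<in> topspace Y. Base y \<in> U})"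
    unfolding istopology_def eq
    by (intro conjI allI impI openin_preimage_Int openin_preimage_Union) blast+
  then show ?thesis
    by (simp add: hcofibre_def topology_inverse')
qed

definition M_mod_\<sigma> :: "(nat \<Rightarrow> 'a topology) \<Rightarrow> 'a action \<Rightarrow> nat \<Rightarrow> ('a, 'a) cone topology" where
  "M_mod_\<sigma> M act n = hcofibre (if n = 0 then empty_space else M (n - 1)) (M n)
     (\<lambda>a. act (n - 1) 1 a \<sigma>)"


section \<open>Singular homology with coefficients\<close>

text \<open>
  This follows the library's integral homology with \<open>int\<close> replaced by an abelian group of
  coefficients.
\<close>

type_synonym ('a, 'k) coeff_chain = "((nat \<Rightarrow> real) \<Rightarrow> 'a) \<Rightarrow>\<^sub>0 'k"

definition coeff_boundary :: "nat \<Rightarrow> ('a, 'k::ab_group_add) coeff_chain \<Rightarrow> ('a, 'k) coeff_chain" where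
  "coeff_boundary p c = (if p = 0 then 0 else
     (\<Sum>s\<in>Poly_Mapping.keys c. \<Sum>i\<le>p. Poly_Mapping.single (singular_face p i s)
        (if even i then Poly_Mapping.lookup c s else - Poly_Mapping.lookup c s)))"

definition coeff_relcycle ::
    "nat \<Rightarrow> 'a topology \<Rightarrow> 'a set \<Rightarrow> ('a, 'k::ab_group_add) coeff_chain set" where
  "coeff_relcycle p X A = {c. Poly_Mapping.keys c \<subseteq> singular_simplex_set p X \<and>
     Poly_Mapping.keys (coeff_boundary p c) \<subseteq> singular_simplex_set (p - 1) (subtopology X A)}"

definition coeff_relboundary ::
    "nat \<Rightarrow> 'a topology \<Rightarrow> 'a set \<Rightarrow> ('a, 'k::ab_group_add) coeff_chain set" where
  "coeff_relboundary p X A = {coeff_boundary (Suc p) b + a | a b.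
     Poly_Mapping.keys b \<subseteq> singular_simplex_set (Suc p) X \<and>
     Poly_Mapping.keys a \<subseteq> singular_simplex_set p (subtopology X A)}"

definition coeff_homology_group ::
    "'k itself \<Rightarrow> nat \<Rightarrow> 'a topology \<Rightarrow> 'a set \<Rightarrow> ('a, 'k::ab_group_add) coeff_chain set monoid" where
  "coeff_homology_group _ p X A =
     \<lparr>carrier = coeff_relcycle p X A, monoid.mult = (+), one = 0\<rparr> Mod coeff_relboundary p X A"

lemma coeff_boundary_superset:
  assumes "finite T" "Poly_Mapping.keys c \<subseteq> T"
  shows "coeff_boundary p c = (if p = 0 then 0 else
     (\<Sum>s\<in>T. \<Sum>i\<le>p. Poly_Mapping.single (singular_face p i s)
        (if even i then Poly_Mapping.lookup c s else - Poly_Mapping.lookup c s)))"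
proof -
  have "(\<Sum>i\<le>p. Poly_Mapping.single (singular_face p i s)
        (if even i then Poly_Mapping.lookup c s else - Poly_Mapping.lookup c s)) = 0"
    if "s \<in> T - Poly_Mapping.keys c" for s
    using that by (intro sum.neutral) (simp add: in_keys_iff)
  then show ?thesis
    unfolding coeff_boundary_def
    by (intro if_cong refl sum.mono_neutral_left[OF assms]) auto
qed

lemma coeff_boundary_add: "coeff_boundary p (a + b) = coeff_boundary p a + coeff_boundary p b"
proof -
  define G where "G = (\<lambda>c :: ('a, 'b) coeff_chain. \<lambda>s. \<Sum>i\<le>p. Poly_Mapping.single (singular_face p i s)
        (if even i then Poly_Mapping.lookup c s else - Poly_Mapping.lookup c s))"
  let ?T = "Poly_Mapping.keys a \<union> Poly_Mapping.keys b"
  have G: "G (a + b) s = G a s + G b s" for s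
    unfolding G_def sum.distrib[symmetric]
    by (intro sum.cong) (auto simp: lookup_add simp flip: single_add)
  have "coeff_boundary p c = (if p = 0 then 0 else (\<Sum>s\<in>?T. G c s))"
    if "Poly_Mapping.keys c \<subseteq> ?T" for c
    unfolding G_def by (rule coeff_boundary_superset) (use that in auto)
  then show ?thesis
    using Poly_Mapping.keys_add[of a b] by (simp add: G sum.distrib)
qed

lemma coeff_boundary_0 [simp]: "coeff_boundary p 0 = 0"
  by (simp add: coeff_boundary_def)

lemma coeff_boundary_uminus: "coeff_boundary p (- a) = - coeff_boundary p a"
  by (rule minus_unique[symmetric]) (simp flip: coeff_boundary_add)

lemma coeff_boundary_sum: "coeff_boundary p (sum g I) = (\<Sum>i\<in>I. coeff_boundary p (g i))"
  by (induction I rule: infinite_finite_induct) (simp_all add: coeff_boundary_add)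

lemma keys_coeff_boundary:
  assumes "Poly_Mapping.keys c \<subseteq> singular_simplex_set p X"
  shows "Poly_Mapping.keys (coeff_boundary p c) \<subseteq> singular_simplex_set (p - 1) X"
proof (cases "p = 0")
  case False
  have "Poly_Mapping.keys (\<Sum>s\<in>Poly_Mapping.keys c. \<Sum>i\<le>p. Poly_Mapping.single (singular_face p i s)
        (if even i then Poly_Mapping.lookup c s else - Poly_Mapping.lookup c s))
     \<subseteq> (\<Union>s\<in>Poly_Mapping.keys c. \<Union>i\<in>{..p}. {singular_face p i s})"
    by (rule order.trans[OF Poly_Mapping.keys_sum], rule UN_mono[OF order.refl],
        rule order.trans[OF Poly_Mapping.keys_sum], rule UN_mono[OF order.refl]) simp
  also have "\<dots> \<subseteq> singular_simplex_set (p - 1) X"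
    using assms False by (auto intro: singular_simplex_singular_face)
  finally show ?thesis using False by (simp add: coeff_boundary_def)
qed (simp add: coeff_boundary_def)

lemma coeff_boundary_single:
  "coeff_boundary (Suc p) (Poly_Mapping.single s v) =
     (\<Sum>i\<le>Suc p. Poly_Mapping.single (singular_face (Suc p) i s) (if even i then v else - v))"
  by (subst coeff_boundary_superset[of "{s}"]) (auto intro!: sum.cong simp del: sum.atMost_Suc)

lemma singular_face_singular_face:
  assumes "i \<le> j" "j \<le> Suc p"
  shows "singular_face (Suc p) i (singular_face (Suc (Suc p)) (Suc j) g) =
         singular_face (Suc p) j (singular_face (Suc (Suc p)) i g)"
proof (rule ext)
  fix t
  show "singular_face (Suc p) i (singular_face (Suc (Suc p)) (Suc j) g) t =
        singular_face (Suc p) j (singular_face (Suc (Suc p)) i g) t"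
  proof (cases "t \<in> standard_simplex p")
    case True
    have "simplical_face i t \<in> standard_simplex (Suc p)"
         "simplical_face j t \<in> standard_simplex (Suc p)"
      using True assms by (auto intro!: simplical_face_in_standard_simplex)
    moreover have "simplical_face (Suc j) (simplical_face i t) = simplical_face i (simplical_face j t)"
      using assms by (fastforce simp: simplical_face_def)
    ultimately show ?thesis
      by (simp add: singular_face_def)
  qed (simp add: singular_face_def)
qed

lemma coeff_boundary_boundary_single:
  "coeff_boundary p (coeff_boundary (Suc p) (Poly_Mapping.single s v)) = 0"
proof (cases p)
  case (Suc p')
  define F where "F = (\<lambda>(j, i). Poly_Mapping.single
       (singular_face p i (singular_face (Suc p) j s)) (if even (i + j) then v else - v))"
  have 1: "coeff_boundary p (coeff_boundary (Suc p) (Poly_Mapping.single s v)) =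
      (\<Sum>j\<le>Suc p. \<Sum>i\<le>p. F (j, i))"
    unfolding coeff_boundary_single coeff_boundary_sum
    unfolding Suc coeff_boundary_single F_def
    by (intro sum.cong refl) auto
  let ?A = "{(j, i). j \<le> Suc p \<and> i \<le> p \<and> i < j}"
  let ?B = "{(j, i). j \<le> Suc p \<and> i \<le> p \<and> j \<le> i}"
  have fin: "finite ?A" "finite ?B"
    by (rule finite_subset[of _ "{..Suc p} \<times> {..p}"]; force)+
  have "(\<Sum>j\<le>Suc p. \<Sum>i\<le>p. F (j, i)) = sum F ({..Suc p} \<times> {..p})"
    by (simp add: sum.cartesian_product)
  also have "{..Suc p} \<times> {..p} = ?A \<union> ?B" by auto
  also have "sum F (?A \<union> ?B) = sum F ?A + sum F ?B"
    by (rule sum.union_disjoint[OF fin]) force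
  also have "sum F ?A = sum (\<lambda>x. - F x) ?B"
  proof (rule sum.reindex_bij_witness[where i = "\<lambda>(j, i). (Suc i, j)" and j = "\<lambda>(j, i). (i, j - 1)"])
    fix x assume "x \<in> ?A"
    then obtain j i where x: "x = (Suc j, i)" and ij: "i \<le> j" "j \<le> p"
      by (cases x; cases "fst x") auto
    have "singular_face p i (singular_face (Suc p) (Suc j) s) =
          singular_face p j (singular_face (Suc p) i s)"
      using singular_face_singular_face[of i j p' s] ij Suc by simp
    then show "- F ((\<lambda>(j, i). (i, j - 1)) x) = F x"
      by (simp add: F_def x add.commute flip: single_uminus)
    show "(\<lambda>(j, i). (Suc i, j)) ((\<lambda>(j, i). (i, j - 1)) x) = x" by (simp add: x)
    show "(\<lambda>(j, i). (i, j - 1)) x \<in> ?B" using ij by (simp add: x)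
  next
    fix y assume "y \<in> ?B"
    then obtain j i where y: "y = (j, i)" and ij: "j \<le> Suc p" "i \<le> p" "j \<le> i" by auto
    show "(\<lambda>(j, i). (i, j - 1)) ((\<lambda>(j, i). (Suc i, j)) y) = y" by (simp add: y)
    show "(\<lambda>(j, i). (Suc i, j)) y \<in> ?A" using ij by (simp add: y)
  qed
  finally show ?thesis using 1 by (simp add: sum_negf)
qed (simp add: coeff_boundary_def)

lemma coeff_boundary_boundary: "coeff_boundary p (coeff_boundary (Suc p) c) = 0"
proof -
  have "c = (\<Sum>s\<in>Poly_Mapping.keys c. Poly_Mapping.single s (Poly_Mapping.lookup c s))"
    by (rule poly_mapping_eqI) (simp add: lookup_sum lookup_single when_def in_keys_iff)
  then have "coeff_boundary p (coeff_boundary (Suc p) c) = 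
     (\<Sum>s\<in>Poly_Mapping.keys c. coeff_boundary p (coeff_boundary (Suc p) 
         (Poly_Mapping.single s (Poly_Mapping.lookup c s))))"
    by (metis (no_types, lifting) coeff_boundary_sum sum.cong)
  then show ?thesis by (simp add: coeff_boundary_boundary_single)
qed

lemma group_coeff_homology_group: "group (coeff_homology_group K p X A)"
proof -
  let ?Z = "coeff_relcycle p X A :: ('a, 'b) coeff_chain set"
  let ?B = "coeff_relboundary p X A :: ('a, 'b) coeff_chain set"
  let ?G = "\<lparr>carrier = ?Z, monoid.mult = (+), one = 0\<rparr>"
  have add: "a + b \<in> ?Z" if "a \<in> ?Z" "b \<in> ?Z" for a b
    using that Poly_Mapping.keys_add[of a b]
      Poly_Mapping.keys_add[of "coeff_boundary p a" "coeff_boundary p b"]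
    by (auto simp: coeff_relcycle_def coeff_boundary_add)
  have neg: "- a \<in> ?Z" if "a \<in> ?Z" for a
    using that by (simp add: coeff_relcycle_def coeff_boundary_uminus)
  have comm: "comm_group ?G"
  proof (rule comm_groupI)
    fix x assume "x \<in> carrier ?G"
    then show "\<exists>y\<in>carrier ?G. y \<otimes>\<^bsub>?G\<^esub> x = \<one>\<^bsub>?G\<^esub>"
      using neg by (intro bexI[of _ "- x"]) auto
  qed (use add in \<open>auto simp: algebra_simps\<close>, simp add: coeff_relcycle_def)
  interpret G: comm_group ?G by fact
  have inv: "inv\<^bsub>?G\<^esub> a = - a" if "a \<in> ?Z" for a
    by (rule G.inv_equality) (use that neg in auto)
  have BZ: "?B \<subseteq> ?Z"
  proof
    fix c assume "c \<in> ?B"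
    then obtain a b where c: "c = coeff_boundary (Suc p) b + a"
      and b: "Poly_Mapping.keys b \<subseteq> singular_simplex_set (Suc p) X"
      and a: "Poly_Mapping.keys a \<subseteq> singular_simplex_set p (subtopology X A)"
      by (auto simp: coeff_relboundary_def)
    have "Poly_Mapping.keys a \<subseteq> singular_simplex_set p X"
      using a by (auto simp: singular_simplex_subtopology)
    then have "Poly_Mapping.keys c \<subseteq> singular_simplex_set p X"
      using keys_coeff_boundary[OF b] Poly_Mapping.keys_add[of "coeff_boundary (Suc p) b" a] c
      by auto
    moreover have "coeff_boundary p c = coeff_boundary p a"
      by (simp add: c coeff_boundary_add coeff_boundary_boundary)
    ultimately show "c \<in> ?Z"
      using keys_coeff_boundary[OF a] by (simp add: coeff_relcycle_def)
  qed
  have "subgroup ?B ?G"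
  proof
    show "?B \<subseteq> carrier ?G" using BZ by simp
    show "\<one>\<^bsub>?G\<^esub> \<in> ?B"
      by (auto simp: coeff_relboundary_def intro!: exI[of _ 0])
    fix x assume x: "x \<in> ?B"
    then obtain a b where ab: "x = coeff_boundary (Suc p) b + a"
      "Poly_Mapping.keys b \<subseteq> singular_simplex_set (Suc p) X"
      "Poly_Mapping.keys a \<subseteq> singular_simplex_set p (subtopology X A)"
      by (auto simp: coeff_relboundary_def)
    have "- x = coeff_boundary (Suc p) (- b) + - a"
      by (simp add: ab(1) coeff_boundary_uminus)
    then have "- x \<in> ?B"
      unfolding coeff_relboundary_def using ab(2,3) by (intro CollectI exI conjI) (assumption | simp)+
    then show "inv\<^bsub>?G\<^esub> x \<in> ?B" using inv x BZ by auto
    fix y assume "y \<in> ?B"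
    then obtain a' b' where ab': "y = coeff_boundary (Suc p) b' + a'"
      "Poly_Mapping.keys b' \<subseteq> singular_simplex_set (Suc p) X"
      "Poly_Mapping.keys a' \<subseteq> singular_simplex_set p (subtopology X A)"
      by (auto simp: coeff_relboundary_def)
    have "x + y = coeff_boundary (Suc p) (b + b') + (a + a')"
      by (simp add: ab(1) ab'(1) coeff_boundary_add)
    moreover have "Poly_Mapping.keys (b + b') \<subseteq> singular_simplex_set (Suc p) X"
      using Poly_Mapping.keys_add[of b b'] ab(2) ab'(2) by blast
    moreover have "Poly_Mapping.keys (a + a') \<subseteq> singular_simplex_set p (subtopology X A)"
      using Poly_Mapping.keys_add[of a a'] ab(3) ab'(3) by blast
    ultimately show "x \<otimes>\<^bsub>?G\<^esub> y \<in> ?B"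
      unfolding coeff_relboundary_def by auto
  qed
  then have "?B \<lhd> ?G" by (rule G.subgroup_imp_normal)
  then show ?thesis
    unfolding coeff_homology_group_def by (rule normal.factorgroup_is_group)
qed

definition reduced_homology ::
    "'k itself \<Rightarrow> nat \<Rightarrow> 'a topology \<Rightarrow> 'a \<Rightarrow> ('a, 'k::ab_group_add) coeff_chain set monoid" where
  "reduced_homology K d X x = coeff_homology_group K d X {x}"

definition rel_homology_Res where
  "rel_homology_Res K n d M act =
     reduced_homology K d (hcofibre (abs_Res M act n) (M n) \<epsilon>) Apex"

definition homology_M_mod_\<sigma> where
  "homology_M_mod_\<sigma> K n d M act = reduced_homology K d (M_mod_\<sigma> M act n) Apex"

definition f_bar :: "(nat \<Rightarrow> nat) \<Rightarrow> nat \<Rightarrow> int" where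
  "f_bar f n = Min {\<lfloor>real (f p) + 1/2 * (real n - real p)\<rfloor> | p. 0 \<le> p \<and> p \<le> n}"

end

theory Submission
 imports Defs "HOL-Analysis.Abstract_Topological_Spaces"
begin

text \<open>
  Let \<open>V(n, d)\<close> say that stabilization \<open>\<sigma> : M(n - 1) \<rightarrow> M(n)\<close> is onto on homology in degree \<open>d\<close> and injective in
  degree \<open>d - 1\<close>, which is equivalent to the vanishing of the reduced homology of its cofibre in degree \<open>d\<close>.
  Following its Moore paths for a time that depends on the barycentric coordinates, a point of \<open>|R|\<close>
  determines a point of \<open>M\<close> together with a configuration of squares, up to moving squares from the one to the other.
  The squares whose middle lies to the right of all left edges lie above each other and
  can be moved to the right without hitting other squares. Singular simplices of \<open>|R|\<close> with \<open>k\<close>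
  continuous choices of such squares form a double complex; its rows are exact on small
  simplices, because the lowest possible square can be added to a choice. Removing the chosen squares
  maps it to a double complex whose \<open>k\<close>-th column computes the homology of \<open>M(n - k)\<close> and whose
  horizontal differential, a sum of \<open>k\<close> maps homotopic to \<open>\<sigma>\<close> with alternating signs, is \<open>\<sigma>\<close> for
  odd \<open>k\<close> and \<open>0\<close> for even \<open>k\<close>. A zigzag through these complexes derives \<open>V(n, d)\<close> from the hypothesis on
  \<open>|R|\<close> and from \<open>V(n - 2 j, d + 1 - 2 j)\<close> for \<open>j \<ge> 1\<close>.
\<close>

text \<open>A point of \<open>M (n - k)\<close> does not tell how to put back only some of the k
  removed squares, so the second double complex cannot consist of simplices of
  \<open>M (n - k)\<close> alone. Its members record, for each set of removed squares and all
  distances, the point obtained by putting these squares back that far to the right. Far to the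
  right this is multiplication by a configuration; pushing all squares there retracts the column
  onto \<open>M (n - k)\<close>. A second obstacle: the only configuration without squares has width
  0, so a strip that loses all its squares must lose its width, continuously. The time scale
  \<open>tau\<close> and the margin \<open>mu\<close> therefore change behaviour at half of the
  barycentric weight: from there on the chosen squares lie in a right factor of the configuration,
  whose width can be removed gradually. The columns 2 j + 1 and 2 j together model the cofibre at
  \<open>M (n - 2 j)\<close>. Two columns cost two gradings and two degrees, and the zigzag begins
  one degree higher; the slope 1/2 of \<open>f_bar\<close> pays for this if j \<ge> 1.\<close>

abbreviation "lcs \<equiv> locally_compact_space"
abbreviation "haus \<equiv> Hausdorff_space"
abbreviation "cotop \<equiv> compact_open_topology"
abbreviation "smap \<equiv> simplex_map"
lemmas cts_fst = continuous_map_fst and cts_snd = continuous_map_snd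
abbreviation cts :: "'a topology => 'b topology => ('a => 'b) => bool" where "cts == continuous_map"
abbreviation pts :: "'a topology => 'a set" where "pts == topspace"
abbreviation ptop :: "'a topology => 'b topology => ('a \<times> 'b) topology" where "ptop == prod_topology"
abbreviation rtop :: "real topology" where "rtop == euclidean"
abbreviation Spx :: "nat => (nat => real) topology" where "Spx == simplex_space"
abbreviation stop :: "'a topology => 'a set => 'a topology" where "stop == subtopology"
abbreviation sface :: "nat => (nat => real) => nat => real" where "sface == simplical_face"
abbreviation rmod :: "(nat => 'a topology) => 'a action => bool" where "rmod == right_S_module"
abbreviation spx :: "nat => (nat => real) set" where "spx == standard_simplex"
abbreviation supp :: "('a \<Rightarrow>\<^sub>0 'b::zero) => 'a set" where "supp == Poly_Mapping.keys"
abbreviation cbd :: "nat => ('a, 'k::ab_group_add) coeff_chain => ('a, 'k) coeff_chain" where "cbd == coeff_boundary"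

lemmas cts_compose = continuous_map_compose
lemmas cts_sub = continuous_map_from_subtopology
lemmas cts_preimage = openin_continuous_map_preimage
lemmas cts_def = continuous_map_def
lemmas cts_into = continuous_map_into_subtopology
lemmas cts_full = continuous_map_into_fulltopology
lemmas cts_pair = continuous_map_pairedI
lemmas cts_eq = continuous_map_eq

section \<open>Singular chains with coefficients: induced maps, prisms, subdivision\<close>

section \<open>Chains with coefficients\<close>

text \<open>The coefficients form an abelian group, on which integers act by repeated addition.
  \<open>tens\<close> and \<open>ext\<close> use this to turn integral chain operators into
  operators on chains with coefficients.\<close>

definition zmult :: "int => 'v::ab_group_add => 'v" where
 "zmult n v = (if 0 <= n then (\<Sum>i<nat n. v) else - (\<Sum>i<nat (-n). v))"

lemma zmult_simps [simp]: "zmult 0 v = 0" "zmult 1 v = v" "zmult (-1) v = - v" "zmult n 0 = 0"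
 by (simp_all add: zmult_def)

lemma zmult_plus_1: "zmult (n + 1) v = zmult n v + v"
proof (cases "0 <= n")
 case True
 thus ?thesis by (simp add: zmult_def nat_add_distrib)
next
 case False
 hence "n = - 1 - int (nat (- 1 - n))" by simp
 then obtain m where "n = - 1 - int m" by blast
 thus ?thesis
  by (cases "m = 0") (simp_all add: zmult_def nat_add_distrib Suc_nat_eq_nat_zadd1)
qed

lemma zmult_add_left: "zmult (m + n) v = zmult m v + zmult n v"
proof (induction n rule: int_induct[where k = 0])
 case (step1 i)
 thus ?case by (metis add.assoc zmult_plus_1)
next
 case (step2 i)
 thus ?case
  using zmult_plus_1[of "m + (i - 1)" v] zmult_plus_1[of "i - 1" v]
  by (simp add: algebra_simps)
qed simp

lemma zmult_uminus_left: "zmult (- n) v = - zmult n v"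
 by (metis add_eq_0_iff zmult_add_left zmult_simps(1))

lemma zmult_add_right: "zmult n (v + w) = zmult n v + zmult n w"
 by (simp add: zmult_def sum.distrib)

definition tens :: "('s \<Rightarrow>\<^sub>0 int) => 'v::ab_group_add => ('s \<Rightarrow>\<^sub>0 'v)" where
 "tens c v = (\<Sum>s\<in>supp c. Poly_Mapping.single s (zmult (Poly_Mapping.lookup c s) v))"

lemma lookup_tens: "Poly_Mapping.lookup (tens c v) s = zmult (Poly_Mapping.lookup c s) v"
 by (auto simp: tens_def lookup_sum lookup_single when_def in_keys_iff)

lemma tens_0 [simp]: "tens 0 v = 0" "tens c 0 = 0"
 by (simp_all add: tens_def)

lemma tens_add_left: "tens (a + b) v = tens a v + tens b v"
 by (rule poly_mapping_eqI) (simp add: lookup_tens lookup_add zmult_add_left)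

lemma tens_uminus_left: "tens (- a) v = - tens a v"
 by (rule poly_mapping_eqI) (simp add: lookup_tens zmult_uminus_left)

lemma tens_diff_left: "tens (a - b) v = tens a v - tens b v"
 using tens_add_left[of a "- b" v] by (simp add: tens_uminus_left)

lemma tens_add_right: "tens a (v + w) = tens a v + tens a w"
 by (rule poly_mapping_eqI) (simp add: lookup_tens lookup_add zmult_add_right)

lemma tens_frag_of: "tens (frag_of s) v = Poly_Mapping.single s v"
 by (simp add: tens_def)

lemma tens_sign:
 "tens (frag_cmul ((- 1) ^ k) (frag_of x)) v = Poly_Mapping.single x (if even k then v else - v)"
 by (simp add: tens_uminus_left tens_frag_of single_uminus)

lemma tens_sum: "tens (sum g I) v = (\<Sum>i\<in>I. tens (g i) v)"
 by (induction I rule: infinite_finite_induct) (simp_all add: tens_add_left)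

lemma keys_tens: "supp (tens c v) \<subseteq> supp c"
 by (auto simp: in_keys_iff lookup_tens)

text \<open>The coefficient version of the linear extension \<open>frag_extend\<close>. Boundary,
  induced maps, prisms and iterated subdivision all have this form. By \<open>ext_ext\<close> and
  \<open>ext_cong\<close> an identity between them has to be checked only on single simplices with
  integral coefficients, where known results apply.\<close>

definition ext :: "('s => ('t \<Rightarrow>\<^sub>0 int)) => ('s \<Rightarrow>\<^sub>0 'v::ab_group_add) => ('t \<Rightarrow>\<^sub>0 'v)" where
 "ext h c = (\<Sum>s\<in>supp c. tens (h s) (Poly_Mapping.lookup c s))"

lemma ext_superset:
 assumes "finite T" "supp c \<subseteq> T"
 shows "ext h c = (\<Sum>s\<in>T. tens (h s) (Poly_Mapping.lookup c s))"
 unfolding ext_def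
 by (intro sum.mono_neutral_left assms) (auto simp: in_keys_iff)

lemma ext_add: "ext h (a + b) = ext h a + ext h b"
proof -
 let ?T = "supp a \<union> supp b"
 have "ext h (a + b) = (\<Sum>s\<in>?T. tens (h s) (Poly_Mapping.lookup (a + b) s))"
  by (rule ext_superset) (use Poly_Mapping.keys_add[of a b] in auto)
 also have "\<dots> = ext h a + ext h b"
  by (simp add: lookup_add tens_add_right sum.distrib flip: ext_superset)
 finally show ?thesis .
qed

lemma ext_0 [simp]: "ext h 0 = 0"
 by (simp add: ext_def)

lemma ext_uminus: "ext h (- a) = - ext h a"
 by (metis add_eq_0_iff ext_0 ext_add)

lemma ext_diff: "ext h (a - b) = ext h a - ext h b"
 using ext_add[of h a "- b"] by (simp add: ext_uminus)

lemma ext_sum: "ext h (sum g I) = (\<Sum>i\<in>I. ext h (g i))"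
 by (induction I rule: infinite_finite_induct) (simp_all add: ext_add)

lemma ext_single: "ext h (Poly_Mapping.single s v) = tens (h s) v"
 by (cases "v = 0") (simp_all add: ext_def)

lemma ext_tens: "ext h (tens c v) = tens (frag_extend h c) v"
proof (rule frag_induction[of c UNIV])
 show "ext h (tens (frag_of x) v) = tens (frag_extend h (frag_of x)) v" for x
  by (simp add: tens_frag_of ext_single)
qed (simp_all add: tens_diff_left ext_diff frag_extend_diff)

lemma ext_cong: "(!!s. s : supp c ==> h s = g s) ==> ext h c = ext g c"
 by (simp add: ext_def)

lemma ext_ext: "ext h (ext g c) = ext (%s. frag_extend h (g s)) c"
 by (simp add: ext_def[of g] ext_def[of "%s. frag_extend h (g s)"] ext_sum ext_tens)

lemma ext_add_fun: "ext (%s. h s + g s) c = ext h c + ext g c"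
 by (simp add: ext_def tens_add_left sum.distrib)

lemma ext_diff_fun: "ext (%s. h s - g s) c = ext h c - ext g c"
 by (simp add: ext_def tens_diff_left sum_subtractf)

lemma ext_zero_fun: "ext (%s. 0) c = 0"
 by (simp add: ext_def)

lemma ext_frag_of: "ext frag_of c = c"
proof -
 have "ext frag_of c = (\<Sum>s\<in>supp c. Poly_Mapping.single s (Poly_Mapping.lookup c s))"
  by (simp add: ext_def tens_frag_of)
 also have "\<dots> = c"
  by (rule poly_mapping_eqI) (simp add: lookup_sum lookup_single when_def in_keys_iff)
 finally show ?thesis .
qed

lemma keys_ext: "supp (ext h c) \<subseteq> (\<Union>s\<in>supp c. supp (h s))"
 unfolding ext_def
 by (rule order.trans[OF Poly_Mapping.keys_sum]) (intro UN_mono keys_tens order.refl)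

lemma keys_ext_subset:
 assumes "supp c \<subseteq> A" "!!s. s : A ==> supp (h s) \<subseteq> B"
 shows "supp (ext h c) \<subseteq> B"
 using keys_ext[of h c] assms by blast

lemma keys_add_subset:
 "supp a \<subseteq> A ==> supp b \<subseteq> A ==> supp (a + b) \<subseteq> A"
 using Poly_Mapping.keys_add[of a b] by blast

lemma keys_diff_subset:
 "supp a \<subseteq> A ==> supp b \<subseteq> A ==>
  supp (a - b :: _ \<Rightarrow>\<^sub>0 _::ab_group_add) \<subseteq> A"
 using keys_add_subset[of a A "- b"] by simp

lemma keys_sum_subset:
 "(!!i. i : I ==> supp (g i) \<subseteq> A) ==> supp (sum g I) \<subseteq> A"
 using Poly_Mapping.keys_sum[of g I] by blast

lemma keys_frag_extend_subset:
 assumes "supp c \<subseteq> A" "!!s. s : A ==> supp (h s) \<subseteq> B"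
 shows "supp (frag_extend h c) \<subseteq> B"
 by (rule frag_induction[OF assms(1)]) (simp_all add: assms(2) frag_extend_diff keys_diff_subset)

lemma frag_extend_cong:
 "(!!s. s : supp c ==> h s = g s) ==> frag_extend h c = frag_extend g c"
 by (rule frag_extend_eq)

lemma frag_extend_diff_fun: "frag_extend (%s. h s - g s) c = frag_extend h c - frag_extend g c"
 by (rule frag_induction[of c UNIV]) (auto simp: frag_extend_diff)

lemma frag_extend_ext: "frag_extend h (frag_extend g c) = frag_extend (%s. frag_extend h (g s)) c"
 by (rule frag_induction[of c UNIV]) (auto simp: frag_extend_diff)

definition bdry1 :: "nat => ((nat => real) => 'a) => 'a chain" where
 "bdry1 p f = chain_boundary p (frag_of f)"

lemma chain_boundary_ext: "chain_boundary p c = frag_extend (bdry1 p) c"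
 by (rule frag_induction[of c UNIV]) (auto simp: bdry1_def frag_extend_diff chain_boundary_diff)

lemma cbd_ext: "cbd p c = ext (bdry1 p) c"
proof -
 have 1: "cbd p (Poly_Mapping.single s v) = ext (bdry1 p) (Poly_Mapping.single s v)" for s v
 proof (cases p)
  case 0
  thus ?thesis by (simp add: coeff_boundary_def ext_single bdry1_def chain_boundary_def)
 next
  case (Suc q)
  show ?thesis
   unfolding Suc
   by (simp add: coeff_boundary_single ext_single bdry1_def chain_boundary_of tens_sum tens_sign
     del: sum.atMost_Suc)
 qed
 have c: "c = (\<Sum>s\<in>supp c. Poly_Mapping.single s (Poly_Mapping.lookup c s))"
  by (rule poly_mapping_eqI) (simp add: lookup_sum lookup_single when_def in_keys_iff)
 show ?thesis
  by (subst (1 2) c) (simp add: coeff_boundary_sum ext_sum 1)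
qed

lemma cbd_zero_dim [simp]: "cbd 0 c = 0"
 by (simp add: coeff_boundary_def)

lemma cbd_diff: "cbd p (a - b) = cbd p a - cbd p b"
 by (simp add: cbd_ext ext_diff)

lemma keys_bdry1:
 "supp (bdry1 (Suc p) f) \<subseteq> (%k. singular_face (Suc p) k f) ` {..Suc p}"
 unfolding bdry1_def chain_boundary_of
 by (auto intro!: keys_sum_subset simp del: sum.atMost_Suc)

text \<open>The function acts on the points of simplices and carries no topology. It is applied
  later to families such as those in \<open>Bs\<close>, whose values are not points of a topological
  space.\<close>

definition cmap :: "nat => ('b => 'a) => ('b, 'k::ab_group_add) coeff_chain => ('a, 'k) coeff_chain" where
 "cmap p g = ext (%s. frag_of (smap p g s))"

lemma cmap_0 [simp]: "cmap p g 0 = 0"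
 by (simp add: cmap_def)

lemma cmap_add: "cmap p g (a + b) = cmap p g a + cmap p g b"
 by (simp add: cmap_def ext_add)

lemma cmap_diff: "cmap p g (a - b) = cmap p g a - cmap p g b"
 by (simp add: cmap_def ext_diff)

lemma keys_cmap:
 assumes "supp c \<subseteq> A" "!!s. s : A ==> smap p g s : B"
 shows "supp (cmap p g c) \<subseteq> B"
 unfolding cmap_def by (rule keys_ext_subset[OF assms(1)]) (use assms(2) in simp)

lemma bdry1_simplex_map:
 "bdry1 p (smap p g f) = frag_extend (%s. frag_of (smap (p - 1) g s)) (bdry1 p f)"
proof (cases p)
 case 0
 thus ?thesis by (simp add: bdry1_def chain_boundary_def)
next
 case (Suc q)
 have "singular_face (Suc q) i (smap (Suc q) g f) = smap q g (singular_face (Suc q) i f)"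
  if "i <= Suc q" for i
  using that
  by (fastforce simp: singular_face_def simplex_map_def simplical_face_in_standard_simplex)
 thus ?thesis
  by (simp add: Suc bdry1_def chain_boundary_of frag_extend_sum frag_extend_cmul del: sum.atMost_Suc)
qed

lemma cbd_cmap: "cbd p (cmap p g c) = cmap (p - 1) g (cbd p c)"
 by (simp add: cbd_ext cmap_def ext_ext bdry1_simplex_map)

lemma simplex_map_simplex_map:
 "smap p h (smap p g f) = smap p (%x. h (g x)) f"
 by (auto simp: simplex_map_def)

lemma cmap_cmap: "cmap p h (cmap p g c) = cmap p (%x. h (g x)) c"
 by (simp add: cmap_def ext_ext simplex_map_simplex_map)

lemma cmap_cong:
 assumes "!!s x. s : supp c ==> x : spx p ==> g (s x) = h (s x)"
 shows "cmap p g c = cmap p h c"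
 unfolding cmap_def using assms by (intro ext_cong arg_cong[where f = frag_of]) (auto simp: simplex_map_def)

lemma cmap_ident:
 assumes "supp c \<subseteq> extensional (spx p)"
 shows "cmap p (%x. x) c = c"
proof -
 have "cmap p (%x. x) c = ext frag_of c"
  unfolding cmap_def
  by (intro ext_cong arg_cong[where f = frag_of])
   (use assms in \<open>auto simp: simplex_map_def extensional_def fun_eq_iff\<close>)
 thus ?thesis by (simp add: ext_frag_of)
qed


section \<open>The prism operator\<close>

abbreviation cylinder :: "nat => ((nat => real) \<times> real) topology" where
 "cylinder q \<equiv> ptop (Spx q) (top_of_set {0..1})"

lemma contractible_simplex_space: "contractible_space (Spx q)"
proof -
 define a where "a = (%j::nat. if j = 0 then 1 else (0::real))"
 define h where "h = (%(s::real, x::nat => real) i. (1 - s) * x i + s * a i)"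
 have a: "a : spx q" by (simp add: a_def)
 have "h z : spx q" if "z : {0..1} \<times> spx q" for z
  using convex_standard_simplex[of "snd z" q a "fst z"] a that
  by (auto simp: h_def case_prod_beta)
 moreover have "cts (ptop (top_of_set {0..1}) (Spx q)) rtop (%z. h z i)" for i
 proof -
  have "cts (ptop (top_of_set {0..1}) (Spx q)) rtop (%z. snd z i)"
   unfolding simplex_space_def
   by (rule cts_compose[OF cts_snd, unfolded o_def])
    (auto intro: cts_sub continuous_map_product_projection)
  moreover have "cts (ptop (top_of_set {0..1}) (Spx q)) rtop fst"
   by (rule cts_full[OF cts_fst])
  ultimately show ?thesis
   unfolding h_def case_prod_beta
   by (intro continuous_map_add continuous_map_real_mult continuous_map_diff) auto
 qed
 ultimately have "cts (ptop (top_of_set {0..1}) (Spx q)) (Spx q) h"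
  by (auto simp: simplex_space_def continuous_map_in_subtopology continuous_map_componentwise_UNIV)
 hence "homotopic_with (%_. True) (Spx q) (Spx q) id (%_. a)"
  by (subst homotopic_with) (auto intro!: exI[of _ h] simp: h_def)
 thus ?thesis by (auto simp: contractible_space_def)
qed

text \<open>The identity is homotopic to a constant map, so the cycle is homologous to one in a
  single point, and there every cycle of positive degree bounds.\<close>

lemma cycle_in_contractible:
 assumes X: "contractible_space X" and c: "singular_chain p X c" "chain_boundary p c = 0" and "1 <= p"
 shows "\<exists>d. singular_chain (Suc p) X d \<and> chain_boundary (Suc p) d = c"
proof -
 obtain a where a: "homotopic_with (%_. True) X X id (%_. a)"
  using X by (auto simp: contractible_space_def)
 have cyc: "singular_relcycle p X {} c"
  using c by (simp add: singular_cycle)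
 have "homologous_rel p X {} (chain_map p id c) (chain_map p (%_. a) c)"
  by (rule homotopic_imp_homologous_rel_chain_maps[OF _ cyc]) (use a in simp)
 hence 1: "singular_relboundary p X {} (c - chain_map p (%_. a) c)"
  by (simp add: homologous_rel_def chain_map_ident[OF c(1)])
 show ?thesis
 proof (cases "pts X = {}")
  case True
  hence "c = 0" using c singular_chain_empty by blast
  thus ?thesis by (auto intro!: exI[of _ 0])
 next
  case False
  have "cts X X (%_. a)"
   using homotopic_with_imp_continuous_maps[OF a] by simp
  with False have aX: "a : pts X" by (auto simp: cts_def)
  have "cts X (stop X {a}) (%_. a)"
   using aX by simp
  hence "singular_relcycle p (stop X {a}) {} (chain_map p (%_. a) c)"
   by (rule singular_relcycle_chain_map[OF cyc]) simp
  hence "singular_relboundary p (stop X {a}) {} (chain_map p (%_. a) c)"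
   using singular_boundary_eq_cycle_singleton[of "stop X {a}" a p] aX \<open>1 <= p\<close> by auto
  hence "singular_relboundary p X {} (chain_map p (%_. a) c)"
   using singular_boundary_mono[of "{a}" UNIV p X] by auto
  with 1 have "singular_relboundary p X {} c"
   using singular_relboundary_add by fastforce
  thus ?thesis by (simp add: singular_boundary)
 qed
qed

definition cyl_level :: "nat => real => (nat => real) => (nat => real) \<times> real" where
 "cyl_level q s = (\<lambda>x\<in>spx q. (x, s))"

definition id_simplex :: "nat => (nat => real) => nat => real" where
 "id_simplex q = restrict id (spx q)"

text \<open>What the next prism has to bound: top minus bottom minus the prisms over the
  faces.\<close>

definition prism_step :: "nat => ((nat => real) \<times> real) chain => ((nat => real) \<times> real) chain" where
 "prism_step q P = frag_of (cyl_level (Suc q) 1) - frag_of (cyl_level (Suc q) 0)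
  - frag_extend (%f. chain_map (Suc q) (%(x, s). (f x, s)) P) (bdry1 (Suc q) (id_simplex (Suc q)))"

text \<open>
 The universal prism, found degree by degree because the cylinder over a simplex is contractible.
\<close>

primrec prism_chain :: "nat => ((nat => real) \<times> real) chain" where
 "prism_chain 0 = frag_of (\<lambda>y\<in>spx 1. ((%j. if j = 0 then 1 else 0), y 1))"
| "prism_chain (Suc q) = (SOME c. singular_chain (Suc (Suc q)) (cylinder (Suc q)) c \<and>
   chain_boundary (Suc (Suc q)) c = prism_step q (prism_chain q))"

text \<open>Like \<open>cmap\<close>, this takes a pointwise rule \<open>F\<close> in place of a
  continuous homotopy; \<open>homotopy_bdr\<close> states which simplices the rule has to
  produce.\<close>

definition prism :: "nat => ('d \<times> real => 'e) => ((nat => real) => 'd) => 'e chain" where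
 "prism q F f = chain_map (Suc q) (%(x, s). F (f x, s)) (prism_chain q)"

lemma singular_simplex_id: "singular_simplex q (Spx q) (id_simplex q)"
 unfolding singular_simplex_def simplex_space_def id_simplex_def by simp

lemma simplex_map_cyl_level:
 "smap q (%(x, s). F (f x, s)) (cyl_level q u) = smap q (%d. F (d, u)) f"
 by (auto simp: simplex_map_def cyl_level_def)

lemma cts_apply_simplex:
 assumes "f : singular_simplex_set q X"
 shows "cts (cylinder q) (ptop X (top_of_set {0..1})) (%(x, s). (f x, s))"
proof -
 have f: "cts (Spx q) X f"
  using assms by (simp add: singular_simplex_def simplex_space_def)
 have "cts (cylinder q) X (%z. f (fst z))"
  using cts_compose[OF cts_fst f] by (simp add: o_def)
 thus ?thesis
  by (auto simp: case_prod_beta continuous_map_pairwise o_def intro: cts_snd)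
qed

lemma singular_simplex_restrict:
 assumes "cts (Spx q) X f"
 shows "singular_simplex q X (restrict f (spx q))"
 using cts_eq[OF assms, of "restrict f (spx q)"]
 by (simp add: singular_simplex_def simplex_space_def)

lemma singular_simplex_cyl_level:
 assumes "u : {0..1}"
 shows "singular_simplex q (cylinder q) (cyl_level q u)"
 unfolding cyl_level_def
 by (rule singular_simplex_restrict) (use assms in \<open>auto simp: continuous_map_pairwise o_def\<close>)

lemma prism_comp:
 assumes "singular_chain (Suc r) (cylinder r) (prism_chain r)"
 shows "chain_map (Suc r) (%(x, s). F (f x, s)) (prism r id g) = prism r F (smap r f g)"
proof -
 have "chain_map (Suc r) (%(x, s). F (f x, s)) (prism r id g) =
   chain_map (Suc r) ((%(x, s). F (f x, s)) \<circ> (%(x, s). id (g x, s))) (prism_chain r)"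
  unfolding prism_def chain_map_compose by simp
 also have "\<dots> = prism r F (smap r f g)"
  unfolding prism_def
  by (rule chain_map_eq[OF assms]) (auto simp: simplex_map_def simplex_space_def)
 finally show ?thesis .
qed

text \<open>The facts about the universal prism in degrees q and q - 1 are hypotheses, so that the
  lemma can serve inside the induction that establishes them. The formula is the universal one
  transported along \<open>f\<close> and \<open>F\<close>; the faces are handled by naturality,
  \<open>prism_comp\<close>.\<close>

lemma prism_boundary_aux:
 assumes P: "singular_chain (Suc q) (cylinder q) (prism_chain q)"
  and bd: "chain_boundary (Suc q) (prism_chain q) =
   frag_of (cyl_level q 1) - frag_of (cyl_level q 0) - frag_extend (prism (q - 1) id) (bdry1 q (id_simplex q))"
  and P': "0 < q ==> singular_chain q (cylinder (q - 1)) (prism_chain (q - 1))"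
  and f: "f : extensional (spx q)"
 shows "chain_boundary (Suc q) (prism q F f) =
  frag_of (smap q (%d. F (d, 1)) f) - frag_of (smap q (%d. F (d, 0)) f)
  - frag_extend (prism (q - 1) F) (bdry1 q f)"
proof -
 let ?m = "chain_map q (%(x, s). F (f x, s))"
 have "chain_boundary (Suc q) (prism q F f) = ?m (chain_boundary (Suc q) (prism_chain q))"
  unfolding prism_def using chain_boundary_chain_map[OF P] by simp
 also have "\<dots> = frag_of (smap q (%d. F (d, 1)) f) - frag_of (smap q (%d. F (d, 0)) f)
  - ?m (frag_extend (prism (q - 1) id) (bdry1 q (id_simplex q)))"
  by (simp add: bd chain_map_diff simplex_map_cyl_level)
 also have "?m (frag_extend (prism (q - 1) id) (bdry1 q (id_simplex q))) = frag_extend (prism (q - 1) F) (bdry1 q f)"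
 proof (cases q)
  case 0
  thus ?thesis by (simp add: bdry1_def chain_boundary_def)
 next
  case (Suc r)
  have f': "f = smap q f (id_simplex q)"
   using f by (auto simp: simplex_map_def extensional_def fun_eq_iff id_simplex_def)
  have "?m (frag_extend (prism r id) (bdry1 q (id_simplex q))) =
    frag_extend (%g. ?m (prism r id g)) (bdry1 q (id_simplex q))"
   unfolding chain_map_def by (simp add: frag_extend_ext)
  also have "\<dots> = frag_extend (%g. prism r F (smap r f g)) (bdry1 q (id_simplex q))"
   using prism_comp[of r F f] P' Suc by simp
  also have "\<dots> = frag_extend (prism r F) (bdry1 q f)"
   by (subst f') (simp add: bdry1_simplex_map frag_extend_ext Suc)
  finally show ?thesis by (simp add: Suc)
 qed
 finally show ?thesis .
qed

lemma prism_chain_props: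
 "singular_chain (Suc q) (cylinder q) (prism_chain q) \<and>
 chain_boundary (Suc q) (prism_chain q) =
  frag_of (cyl_level q 1) - frag_of (cyl_level q 0) -
  frag_extend (prism (q - 1) id) (bdry1 q (id_simplex q))"
proof (induction q rule: less_induct)
 case (less r)
 show ?case
 proof (cases r)
  case 0
  let ?e = "%j::nat. if j = 0 then 1 else (0::real)"
  have c: "cts (stop (powertop_real UNIV) (spx 1)) (top_of_set {0..1}) (%y. y 1)"
   by (auto simp: continuous_map_in_subtopology standard_simplex_def
     intro: cts_sub continuous_map_product_projection)
  have e: "?e : spx 0" by (simp add: standard_simplex_0)
  have "cts (Spx 1) (cylinder 0) (%y. (?e, y 1))"
   using c e by (auto simp: continuous_map_pairwise o_def simplex_space_def)
  hence s: "singular_simplex 1 (cylinder 0) (\<lambda>y\<in>spx 1. (?e, y 1))"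
   by (rule singular_simplex_restrict)
  \<comment> \<open>The prism over a point is the edge itself. Its face opposite to vertex 0 has
    second coordinate 1, hence is the top.\<close>
  have f: "singular_face 1 k (\<lambda>y\<in>spx 1. (?e, y 1)) = cyl_level 0 (if k = 0 then 1 else 0)"
   if "k <= 1" for k
  proof (rule HOL.ext)
   fix t
   have "sface k t : spx 1" if "t : spx 0"
    using simplical_face_in_standard_simplex[of 1 k t] that \<open>k <= 1\<close> by simp
   thus "singular_face 1 k (\<lambda>y\<in>spx 1. (?e, y 1)) t = cyl_level 0 (if k = 0 then 1 else 0) t"
    using \<open>k <= 1\<close>
    by (cases "k = 0") (auto simp: singular_face_def cyl_level_def standard_simplex_0 simplical_face_def)
  qed
  have "chain_boundary (Suc 0) (prism_chain 0) = frag_of (cyl_level 0 1) - frag_of (cyl_level 0 0)"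
   using f[of 0] f[of 1] by (simp add: chain_boundary_of)
  thus ?thesis
   using s 0 by (simp add: singular_chain_of bdry1_def chain_boundary_def)
 next
  case (Suc q)
  let ?W = "cylinder (Suc q)" and ?P = "prism_chain q"
  let ?op = "prism q id"
  let ?B = "bdry1 (Suc q) (id_simplex (Suc q))"
  have "q < r" using Suc by simp
  from less[OF this] have IH: "singular_chain (Suc q) (cylinder q) (prism_chain q)"
   "chain_boundary (Suc q) (prism_chain q) = frag_of (cyl_level q 1) - frag_of (cyl_level q 0) -
    frag_extend (prism (q - 1) id) (bdry1 q (id_simplex q))"
   by blast+
  have IH': "singular_chain q (cylinder (q - 1)) (prism_chain (q - 1))" if "0 < q"
   using conjunct1[OF less[of "q - 1"]] Suc that by simp
  have step: "prism_step q ?P = frag_of (cyl_level (Suc q) 1) - frag_of (cyl_level (Suc q) 0) - frag_extend ?op ?B"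
   by (simp add: prism_step_def prism_def[abs_def])
  have face: "supp ?B \<subseteq> singular_simplex_set q (Spx (Suc q))"
   using singular_chain_boundary[of "Suc q" "Spx (Suc q)" "frag_of (id_simplex (Suc q))"]
    singular_simplex_id[of "Suc q"]
   by (simp add: singular_chain_of bdry1_def singular_chain_def)
  have op_in: "singular_chain (Suc q) ?W (?op f)" if "f : singular_simplex_set q (Spx (Suc q))" for f
   unfolding prism_def id_def
   by (rule singular_chain_chain_map[OF IH(1) cts_apply_simplex[OF that]])
  have in1: "singular_chain (Suc q) ?W (prism_step q ?P)"
   unfolding step using singular_simplex_cyl_level[of 0 "Suc q"] singular_simplex_cyl_level[of 1 "Suc q"]
   by (intro singular_chain_diff singular_chain_extend op_in) (use face in \<open>auto simp: singular_chain_of\<close>)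
  have "chain_boundary (Suc q) (frag_extend ?op ?B) =
    frag_extend (%f. frag_of (smap q (%d. (d, 1)) f) - frag_of (smap q (%d. (d, 0)) f)
     - frag_extend (prism (q - 1) id) (bdry1 q f)) ?B"
   unfolding chain_boundary_ext frag_extend_ext
  proof (rule frag_extend_cong)
   fix f assume "f : supp ?B"
   hence "f : extensional (spx q)"
    using face by (auto simp: singular_simplex_def)
   from prism_boundary_aux[OF IH IH' this, of id]
   show "frag_extend (bdry1 (Suc q)) (prism q id f) = frag_of (smap q (%d. (d, 1)) f)
     - frag_of (smap q (%d. (d, 0)) f) - frag_extend (prism (q - 1) id) (bdry1 q f)"
    by (simp add: chain_boundary_ext)
  qed
  \<comment> \<open>The prisms over faces of codimension two cancel because the boundary of a
    boundary vanishes.\<close>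
  moreover have "frag_extend (prism (q - 1) id) (frag_extend (bdry1 q) ?B) = 0"
  proof -
   have "chain_boundary q (chain_boundary (Suc q) (frag_of (id_simplex (Suc q)))) = 0"
    by (rule chain_boundary_boundary_alt[of _ "Spx (Suc q)"])
     (use singular_simplex_id[of "Suc q"] in \<open>simp add: singular_chain_of\<close>)
   thus ?thesis by (simp add: bdry1_def flip: chain_boundary_ext)
  qed
  ultimately have 1: "chain_boundary (Suc q) (frag_extend ?op ?B) =
    frag_extend (%f. frag_of (smap q (%d. (d, 1)) f)) ?B
    - frag_extend (%f. frag_of (smap q (%d. (d, 0)) f)) ?B"
   unfolding frag_extend_diff_fun frag_extend_ext by simp
  have 2: "chain_boundary (Suc q) (frag_of (cyl_level (Suc q) u)) =
    frag_extend (%f. frag_of (smap q (%d. (d, u)) f)) ?B" for u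
  proof -
   have "cyl_level (Suc q) u = smap (Suc q) (%d. (d, u)) (id_simplex (Suc q))"
    by (auto simp: cyl_level_def simplex_map_def id_simplex_def)
   thus ?thesis
    using bdry1_simplex_map[of "Suc q" "%d. (d, u)" "id_simplex (Suc q)"] by (simp add: bdry1_def)
  qed
  have "chain_boundary (Suc q) (prism_step q ?P) = 0"
   unfolding step by (simp add: chain_boundary_diff 1 2)
  moreover have "contractible_space (top_of_set {0..1::real})"
   by (simp only: contractible_space_top_of_set, rule convex_imp_contractible, rule convex_real_interval)
  hence "contractible_space ?W"
   by (intro contractible_space_prod_topology[THEN iffD2] disjI2 conjI contractible_simplex_space)
  ultimately have "\<exists>c. singular_chain (Suc (Suc q)) ?W c \<and> chain_boundary (Suc (Suc q)) c = prism_step q ?P"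
   using cycle_in_contractible[OF _ in1] by auto
  from someI_ex[OF this] show ?thesis
   unfolding Suc prism_chain.simps step diff_Suc_1 .
 qed
qed

lemma prism_boundary:
 assumes "f : extensional (spx q)"
 shows "chain_boundary (Suc q) (prism q F f) =
  frag_of (smap q (%d. F (d, 1)) f) - frag_of (smap q (%d. F (d, 0)) f)
  - frag_extend (prism (q - 1) F) (bdry1 q f)"
 using prism_chain_props[of q] prism_chain_props[of "q - 1"]
 by (intro prism_boundary_aux assms) auto

lemma keys_prism:
 assumes "!!g. cts (Spx (Suc q)) (cylinder q) g ==>
   (\<lambda>y\<in>spx (Suc q). F (f (fst (g y)), snd (g y))) : B"
 shows "supp (prism q F f) \<subseteq> B"
proof -
 have P: "supp (prism_chain q) \<subseteq> singular_simplex_set (Suc q) (cylinder q)"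
  using prism_chain_props[of q] by (simp add: singular_chain_def)
 have "smap (Suc q) (%(x, s). F (f x, s)) g : B" if "g : singular_simplex_set (Suc q) (cylinder q)" for g
 proof -
  have "smap (Suc q) (%(x, s). F (f x, s)) g = (\<lambda>y\<in>spx (Suc q). F (f (fst (g y)), snd (g y)))"
   by (auto simp: simplex_map_def case_prod_beta)
  thus ?thesis using assms[of g] that by (simp add: singular_simplex_def simplex_space_def)
 qed
 thus ?thesis
  unfolding prism_def chain_map_def by (intro keys_frag_extend_subset[OF P]) simp
qed

lemma cbd_prism:
 assumes "supp c \<subseteq> extensional (spx q)"
 shows "cbd (Suc q) (ext (prism q F) c) =
  cmap q (%d. F (d, 1)) c - cmap q (%d. F (d, 0)) c - ext (prism (q - 1) F) (cbd q c)"
proof -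
 have "cbd (Suc q) (ext (prism q F) c) = ext (%f. chain_boundary (Suc q) (prism q F f)) c"
  by (simp add: cbd_ext chain_boundary_ext ext_ext)
 also have "\<dots> = ext (%f. frag_of (smap q (%d. F (d, 1)) f) - frag_of (smap q (%d. F (d, 0)) f)
  - frag_extend (prism (q - 1) F) (bdry1 q f)) c"
  using assms by (intro ext_cong prism_boundary) auto
 finally show ?thesis
  by (simp add: ext_diff_fun cmap_def cbd_ext ext_ext)
qed

section \<open>Subdivision\<close>

definition subdiv :: "nat => nat => ('a, 'k::ab_group_add) coeff_chain => ('a, 'k) coeff_chain" where
 "subdiv n p = ext (%f. (singular_subdivision p ^^ n) (frag_of f))"

lemma singular_subdivision_power_ext:
 "(singular_subdivision p ^^ n) c = frag_extend (%f. (singular_subdivision p ^^ n) (frag_of f)) c"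
 by (rule frag_induction[of c UNIV]) (auto simp: frag_extend_diff singular_subdivision_power_diff)

lemma singular_chain_subdivision_power:
 "singular_chain p X c ==> singular_chain p X ((singular_subdivision p ^^ n) c)"
 by (induction n) (auto intro: singular_chain_singular_subdivision)

lemma chain_boundary_subdivision_power:
 "singular_chain p X c ==> chain_boundary p ((singular_subdivision p ^^ n) c) =
  (singular_subdivision (p - 1) ^^ n) (chain_boundary p c)"
proof (induction n)
 case (Suc n)
 thus ?case
  using chain_boundary_singular_subdivision[OF singular_chain_subdivision_power[of p X c n]] by simp
qed simp

lemma keys_subdiv:
 assumes "supp c \<subseteq> singular_simplex_set p X"
 shows "supp (subdiv n p c) \<subseteq> singular_simplex_set p X"
 unfolding subdiv_def
proof (rule keys_ext_subset[OF assms])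
 fix s assume "s : singular_simplex_set p X"
 hence "singular_chain p X (frag_of s)" by (simp add: singular_chain_of)
 from singular_chain_subdivision_power[OF this]
 show "supp ((singular_subdivision p ^^ n) (frag_of s)) \<subseteq> singular_simplex_set p X"
  by (simp add: singular_chain_def)
qed

lemma cbd_subdiv:
 assumes "supp c \<subseteq> singular_simplex_set p X"
 shows "cbd p (subdiv n p c) = subdiv n (p - 1) (cbd p c)"
 unfolding cbd_ext subdiv_def ext_ext
proof (rule ext_cong)
 fix f assume "f : supp c"
 hence "singular_chain p X (frag_of f)" using assms by (auto simp: singular_chain_of)
 from chain_boundary_subdivision_power[OF this, of n]
 show "frag_extend (bdry1 p) ((singular_subdivision p ^^ n) (frag_of f)) =
   frag_extend (%f. (singular_subdivision (p - 1) ^^ n) (frag_of f)) (bdry1 p f)"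
  by (simp add: bdry1_def flip: chain_boundary_ext singular_subdivision_power_ext)
qed

lemma subdiv_add: "subdiv n p (a + b) = subdiv n p a + subdiv n p b"
 by (simp add: subdiv_def ext_add)

lemma subdiv_0 [simp]: "subdiv n p 0 = 0"
 by (simp add: subdiv_def)

lemma subdiv_cmap:
 assumes "supp c \<subseteq> singular_simplex_set p X"
 shows "subdiv n p (cmap p g c) = cmap p g (subdiv n p c)"
 unfolding cmap_def subdiv_def ext_ext
proof (rule ext_cong)
 fix f assume "f : supp c"
 hence f: "singular_chain p X (frag_of f)" using assms by (auto simp: singular_chain_of)
 have "(singular_subdivision p ^^ n) (chain_map p g (frag_of f)) = chain_map p g ((singular_subdivision p ^^ n) (frag_of f))"
  by (induction n) (simp_all add: naturality_singular_subdivision[OF singular_chain_subdivision_power[OF f]])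
 thus "frag_extend (%f. (singular_subdivision p ^^ n) (frag_of f)) (frag_of (smap p g f)) =
   frag_extend (%s. frag_of (smap p g s)) ((singular_subdivision p ^^ n) (frag_of f))"
  by (simp add: chain_map_def o_def)
qed

text \<open>A single operator serves all spaces at once, so it also keeps chains of a subspace
  inside the subspace; relative cycles need this. The integral homotopy is additive, hence
  determined by its values on simplices, which \<open>ext\<close> extends to coefficients.\<close>

lemma subdiv_homotopy:
 "\<exists>h. \<forall>p X (c :: ('a, 'k::ab_group_add) coeff_chain). supp c \<subseteq> singular_simplex_set p X -->
  supp (ext (h p) c) \<subseteq> singular_simplex_set (Suc p) X \<and>
  cbd (Suc p) (ext (h p) c) + ext (h (p - 1)) (cbd p c) = subdiv n p c - c"
proof -
 obtain h :: "nat => 'a chain => 'a chain" where h: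
  "!!p. h p 0 = 0" "!!p c1 c2. h p (c1 - c2) = h p c1 - h p c2"
  "!!p X c. singular_chain p X c ==> singular_chain (Suc p) X (h p c)"
  "!!p X c. singular_chain p X c ==>
   chain_boundary (Suc p) (h p c) + h (p - Suc 0) (chain_boundary p c) = (singular_subdivision p ^^ n) c - c"
  by (blast intro: chain_homotopic_iterated_singular_subdivision[of n])
 define k where "k = (%p f. h p (frag_of f))"
 have hk: "h p c = frag_extend (k p) c" for p c
  by (rule frag_induction[of c UNIV]) (auto simp: h k_def frag_extend_diff)
 show ?thesis
 proof (intro exI[of _ k] allI impI conjI)
  fix p X and c :: "('a, 'k) coeff_chain"
  assume c: "supp c \<subseteq> singular_simplex_set p X"
  show "supp (ext (k p) c) \<subseteq> singular_simplex_set (Suc p) X"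
  proof (rule keys_ext_subset[OF c])
   fix s assume "s : singular_simplex_set p X"
   hence "singular_chain p X (frag_of s)" by (simp add: singular_chain_of)
   from h(3)[OF this] show "supp (k p s) \<subseteq> singular_simplex_set (Suc p) X"
    by (simp add: k_def singular_chain_def)
  qed
  have "ext (%s. frag_extend (bdry1 (Suc p)) (k p s) + frag_extend (k (p - 1)) (bdry1 p s)) c =
   ext (%s. (singular_subdivision p ^^ n) (frag_of s) - frag_of s) c"
  proof (rule ext_cong)
   fix f assume "f : supp c"
   hence "singular_chain p X (frag_of f)" using c by (auto simp: singular_chain_of)
   moreover have "frag_extend (bdry1 (Suc p)) (k p f) = chain_boundary (Suc p) (h p (frag_of f))"
    by (simp add: chain_boundary_ext k_def)
   moreover have "frag_extend (k (p - 1)) (bdry1 p f) = h (p - 1) (chain_boundary p (frag_of f))"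
    by (simp only: hk bdry1_def)
   ultimately show "frag_extend (bdry1 (Suc p)) (k p f) + frag_extend (k (p - 1)) (bdry1 p f) =
    (singular_subdivision p ^^ n) (frag_of f) - frag_of f"
    using h(4) by simp
  qed
  thus "cbd (Suc p) (ext (k p) c) + ext (k (p - 1)) (cbd p c) = subdiv n p c - c"
   by (simp add: cbd_ext ext_ext ext_add_fun ext_diff_fun subdiv_def ext_frag_of)
 qed
qed

lemma subdiv_small:
 assumes "!!U. U : \<C> ==> openin X U" "pts X \<subseteq> \<Union>\<C>"
  and c: "supp c \<subseteq> singular_simplex_set p X"
 shows "\<exists>n. \<forall>f\<in>supp (subdiv n p c). \<exists>V\<in>\<C>. f : spx p \<rightarrow> V"
proof -
 have "\<exists>n. \<forall>m\<ge>n. \<forall>f\<in>supp ((singular_subdivision p ^^ m) (frag_of s)). \<exists>V\<in>\<C>. f : spx p \<rightarrow> V"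
  if "s : supp c" for s
 proof -
  have "singular_chain p X (frag_of s)" using c that by (auto simp: singular_chain_of)
  from sufficient_iterated_singular_subdivision_exists[OF assms(1,2) this] show ?thesis by metis
 qed
 hence "\<forall>s. \<exists>n. s : supp c --> (\<forall>m\<ge>n. \<forall>f\<in>supp ((singular_subdivision p ^^ m) (frag_of s)).
   \<exists>V\<in>\<C>. f : spx p \<rightarrow> V)"
  by blast
 then obtain N where N: "\<forall>s. s : supp c --> (\<forall>m\<ge>N s. \<forall>f\<in>supp ((singular_subdivision p ^^ m) (frag_of s)).
   \<exists>V\<in>\<C>. f : spx p \<rightarrow> V)"
  by (rule choice[THEN exE])
 define m where "m = Max (insert 0 (N ` supp c))"
 have m: "N s <= m" if "s : supp c" for s
  unfolding m_def by (rule Max_ge) (use that in simp_all)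
 show ?thesis
 proof (intro exI[of _ m] ballI)
  fix f assume "f : supp (subdiv m p c)"
  then obtain s where "s : supp c" "f : supp ((singular_subdivision p ^^ m) (frag_of s))"
   using keys_ext[of "%f. (singular_subdivision p ^^ m) (frag_of f)" c] unfolding subdiv_def by blast
  thus "\<exists>V\<in>\<C>. f : spx p \<rightarrow> V"
   using N m by blast
 qed
qed

section \<open>k-ifications, and the language of cycles and boundaries\<close>

section \<open>Continuity into k-ifications\<close>

lemma openin_kify:
 fixes Z :: "'z topology"
 shows "openin (kify Z) U \<longleftrightarrow> U \<subseteq> pts Z \<and>
  (\<forall>(K :: 'z set set topology) u. compact_space K --> haus K --> cts K Z u -->
    openin K {x : pts K. u x : U})"
 unfolding kify_def openin_final_topology test_maps_def by auto

lemma openin_kify_mono: "openin Z U ==> openin (kify Z) U"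
 by (auto simp: openin_kify openin_subset cts_preimage)

lemma cts_of_kify: "cts W (kify Z) f ==> cts W Z f"
 unfolding cts_def topspace_kify using openin_kify_mono by blast

text \<open>
 Test spaces are restricted to points of type \<open>'z set set\<close>, so a compact Hausdorff space of another
 type must first be copied there along an injection.
\<close>

lemma cts_into_kify_gen:
 fixes j :: "'k => 'z set set" and Z :: "'z topology"
 assumes K: "compact_space K" "haus K" and j: "inj_on j (pts K)"
  and u: "cts K Z u"
 shows "cts K (kify Z) u"
proof -
 define K' where "K' = quotient_topology K j"
 have h: "homeomorphic_map K K' j"
  unfolding homeomorphic_map_def K'_def using quotient_map_quotient_topology j by blast
 hence K': "compact_space K'" "haus K'"
  using K homeomorphic_compact_space homeomorphic_Hausdorff_space homeomorphic_map_imp_homeomorphic_space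
  by blast+
 let ?i = "inv_into (pts K) j"
 have top': "pts K' = j ` pts K" by (simp add: K'_def)
 have u': "cts K' Z (u \<circ> ?i)"
  by (rule continuous_compose_quotient_map[OF h[unfolded homeomorphic_map_def, THEN conjunct1]])
   (rule cts_eq[OF u], use j in simp)
 show ?thesis
  unfolding cts_def
 proof (intro conjI allI impI)
  show "u : pts K \<rightarrow> pts (kify Z)"
   using u by (simp add: cts_def)
  fix U assume "openin (kify Z) U"
  hence "openin K' {x : pts K'. (u \<circ> ?i) x : U}"
   unfolding openin_kify using K' u' by blast
  hence "openin K {x : pts K. j x : {x : pts K'. (u \<circ> ?i) x : U}}"
   by (rule cts_preimage[OF homeomorphic_imp_continuous_map[OF h]])
  moreover have "{x : pts K. j x : {x : pts K'. (u \<circ> ?i) x : U}} = {x : pts K. u x : U}"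
   using j by (auto simp: top')
  ultimately show "openin K {x : pts K. u x : U}" by simp
 qed
qed

text \<open>\<open>c\<close> packs a natural number and a real into one real: the integral part is
  n, and the fractional part 1 / (2 + exp x) determines x. A sequence is then coded by its graph.
  This makes room for copies of simplices in the type of test spaces.\<close>

lemma ex_inj_fun_real:
 fixes i :: "real => 'z"
 assumes "inj i"
 shows "\<exists>j :: (nat => real) => 'z set set. inj j"
proof -
 define c where "c = (%(n::nat, x::real). real n + 1 / (2 + exp x))"
 have c: "inj c"
 proof (rule injI)
  fix p q assume eq: "c p = c q"
  obtain n x m y where pq: "p = (n, x)" "q = (m, y)" by fastforce
  have b: "0 < 1 / (2 + exp z)" "1 / (2 + exp z) < 1" for z :: real
   using exp_gt_zero[of z] by (simp_all add: add_pos_pos field_simps)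
  have e: "real n + 1 / (2 + exp x) = real m + 1 / (2 + exp y)" using eq by (simp add: c_def pq)
  hence "n = m" using b[of x] b[of y] by linarith
  moreover from this e have "2 + exp x = 2 + exp y" by simp
  ultimately show "p = q" by (simp add: pq)
 qed
 define j where "j = (%f. {i ` c ` {(n, f n) | n. True}} :: 'z set set)"
 have "inj j"
 proof (rule injI)
  fix f g :: "nat => real" assume "j f = j g"
  hence "c ` {(n, f n) | n. True} = c ` {(n, g n) | n. True}"
   by (simp add: j_def inj_image_eq_iff[OF assms])
  hence "{(n, f n) | n. True} = {(n, g n) | n. True}"
   by (simp add: inj_image_eq_iff[OF c])
  thus "f = g" by (auto simp: set_eq_iff)
 qed
 thus ?thesis by (rule exI[of _ j])
qed

lemma compact_space_simplex_space: "compact_space (Spx q)"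
 unfolding simplex_space_def using compactin_standard_simplex compact_space_subtopology by blast

lemma Hausdorff_space_simplex_space: "haus (Spx q)"
 unfolding simplex_space_def by (intro Hausdorff_space_subtopology) (simp add: Hausdorff_space_product_topology)

lemma topspace_simplex_space [simp]: "pts (Spx q) = spx q"
 by (simp add: simplex_space_def)

text \<open>The injection \<open>i\<close> witnesses that the type of points is large enough to hold
  a copy of a simplex as a test space.\<close>

lemma cts_simplex_into_kify:
 fixes i :: "real => 'z" and Z :: "'z topology"
 assumes "inj i" "cts (Spx q) Z u"
 shows "cts (Spx q) (kify Z) u"
proof -
 obtain j :: "(nat => real) => 'z set set" where "inj j"
  using ex_inj_fun_real[OF assms(1)] by (rule exE)
 thus ?thesis
  by (intro cts_into_kify_gen[where j = j] compact_space_simplex_space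
    Hausdorff_space_simplex_space assms(2)) (auto intro: inj_on_subset)
qed

lemma ex_inj_pair:
 assumes "infinite (UNIV :: 'b set)"
 shows "\<exists>f :: 'b \<times> 'b => 'b. inj f"
proof -
 have "|UNIV \<times> UNIV :: ('b \<times> 'b) set| \<le>o |UNIV :: 'b set|"
  using card_of_Times_same_infinite[OF assms] by (rule ordIso_imp_ordLeq)
 thus ?thesis
  unfolding card_of_ordLeq[symmetric] by (auto simp: UNIV_Times_UNIV)
qed

text \<open>This gives room for the product of a test space with an interval in
  \<open>openin_cg_prod_tube\<close>.\<close>

lemma ex_inj_times_real:
 "\<exists>f :: ('x \<times> real) set set \<times> real => ('x \<times> real) set set. inj f"
proof -
 let ?i = "%r::real. {{(undefined :: 'x, r)}}"
 have i: "inj ?i" by (auto simp: inj_def)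
 have "infinite (UNIV :: ('x \<times> real) set set set)"
  using i infinite_UNIV_char_0[where 'a = real] finite_subset[OF subset_UNIV] finite_imageD by metis
 from ex_inj_pair[OF this]
 obtain f :: "('x \<times> real) set set \<times> ('x \<times> real) set set => ('x \<times> real) set set" where f: "inj f"
  by (rule exE)
 have "inj (%(a, r). f (a, ?i r))"
 proof (rule injI)
  fix p q assume "(%(a, r). f (a, ?i r)) p = (%(a, r). f (a, ?i r)) q"
  hence "f (fst p, ?i (snd p)) = f (fst q, ?i (snd q))"
   by (simp add: case_prod_beta)
  from injD[OF f this] show "p = q" by (simp add: prod_eq_iff)
 qed
 thus ?thesis by (rule exI[of _ "%(a, r). f (a, ?i r)"])
qed


section \<open>Cycles and boundaries\<close>

abbreviation SS :: "'a topology => nat => ((nat => real) => 'a) set" where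
 "SS X q \<equiv> singular_simplex_set q X"

text \<open>Cycles and boundaries refer to a graded set \<open>A\<close> of simplices instead of a
  space, because the two double complexes are built from sets of simplices with extra
  structure.\<close>

definition cyc :: "(nat => ((nat => real) => 'a) set) => nat => ('a, 'k::ab_group_add) coeff_chain => bool" where
 "cyc A q c \<longleftrightarrow> supp c \<subseteq> A q \<and> cbd q c = 0"

definition bdr :: "(nat => ((nat => real) => 'a) set) => nat => ('a, 'k::ab_group_add) coeff_chain => bool" where
 "bdr A q c \<longleftrightarrow> (\<exists>b. supp b \<subseteq> A (Suc q) \<and> cbd (Suc q) b = c)"

lemma bdr_add: "bdr A q a ==> bdr A q b ==> bdr A q (a + b)"
 unfolding bdr_def using keys_add_subset coeff_boundary_add by metis

lemma bdr_diff: "bdr A q a ==> bdr A q b ==> bdr A q (a - b)"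
 unfolding bdr_def using keys_diff_subset cbd_diff by metis

lemma bdr_0: "bdr A q 0"
 unfolding bdr_def by (rule exI[of _ 0]) simp

lemma bdr_uminus: "bdr A q a ==> bdr A q (- a)"
 using bdr_diff[OF bdr_0, of A q a] by simp

lemma bdr_sum: "(!!i. i : I ==> bdr A q (g i)) ==> bdr A q (sum g I)"
 by (induction I rule: infinite_finite_induct) (auto intro: bdr_add bdr_0)

lemma bdr_cmap:
 assumes "bdr A q c" "!!s. s : A (Suc q) ==> smap (Suc q) g s : B (Suc q)"
 shows "bdr B q (cmap q g c)"
proof -
 from assms(1) obtain b where b: "supp b \<subseteq> A (Suc q)" "cbd (Suc q) b = c"
  by (auto simp: bdr_def)
 have "supp (cmap (Suc q) g b) \<subseteq> B (Suc q)"
  by (rule keys_cmap[OF b(1) assms(2)])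
 moreover have "cbd (Suc q) (cmap (Suc q) g b) = cmap q g c"
  by (simp add: cbd_cmap b(2))
 ultimately show ?thesis by (auto simp: bdr_def)
qed

lemma cyc_cmap:
 assumes "cyc A q c" "!!s. s : A q ==> smap q g s : B q"
 shows "cyc B q (cmap q g c)"
 using keys_cmap[of c "A q" q g "B q", OF _ assms(2)] assms(1) by (simp add: cyc_def cbd_cmap)

lemma cyc_diff: "cyc A q a ==> cyc A q b ==> cyc A q (a - b)"
 unfolding cyc_def using keys_diff_subset cbd_diff by (metis diff_zero)

text \<open>The condition on \<open>F\<close> replaces continuity of a homotopy: prisms over members
  of \<open>A\<close> consist of the displayed composites, with g a map from a simplex to the
  cylinder, so it suffices that these belong to \<open>B\<close>.\<close>

lemma homotopy_bdr:
 assumes ext: "A q \<subseteq> extensional (spx q)"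
  and H: "!!f g. f : A q ==> cts (Spx (Suc q)) (cylinder q) g ==>
   (\<lambda>y\<in>spx (Suc q). F (f (fst (g y)), snd (g y))) : B (Suc q)"
  and c: "cyc A q c"
 shows "bdr B q (cmap q (%d. F (d, 1)) c - cmap q (%d. F (d, 0)) c)"
proof -
 have k: "supp c \<subseteq> A q" and z: "cbd q c = 0"
  using c by (auto simp: cyc_def)
 have "supp (ext (prism q F) c) \<subseteq> B (Suc q)"
  by (rule keys_ext_subset[OF k]) (rule keys_prism, rule H)
 thus ?thesis
  using cbd_prism[of c q F] k ext z unfolding bdr_def by auto
qed

lemma simplex_map_SS:
 assumes "cts X Y g" "s : SS X q"
 shows "smap q g s : SS Y q"
 using assms singular_simplex_simplex_map by blast

lemma SS_extensional: "SS X q \<subseteq> extensional (spx q)"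
 by (auto simp: singular_simplex_def)

lemma SS_continuous: "s : SS X q ==> cts (Spx q) X s"
 by (simp add: singular_simplex_def simplex_space_def)

lemma restrict_SS: "cts (Spx q) X f ==> restrict f (spx q) : SS X q"
 using singular_simplex_restrict by blast

lemma bdr_subdiv:
 assumes "cyc (SS X) q c"
 shows "bdr (SS X) q (subdiv n q c - c)"
proof -
 obtain h where "supp (ext (h q) c) \<subseteq> SS X (Suc q)"
   "cbd (Suc q) (ext (h q) c) + ext (h (q - 1)) (cbd q c) = subdiv n q c - c"
  using subdiv_homotopy[of n] assms unfolding cyc_def by metis
 thus ?thesis
  using assms by (auto simp: bdr_def cyc_def)
qed

lemma chain_split:
 assumes "supp (c :: 's \<Rightarrow>\<^sub>0 'k::ab_group_add) \<subseteq> P \<union> Q"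
 obtains a b where "c = a + b" "supp a \<subseteq> P" "supp b \<subseteq> Q"
proof
 let ?a = "ext (%s. if s : P then frag_of s else 0) c"
 let ?b = "ext (%s. if s : P then 0 else frag_of s) c"
 have "?a + ?b = ext frag_of c"
  unfolding ext_add_fun[symmetric] by (rule ext_cong) simp
 thus "c = ?a + ?b" by (simp add: ext_frag_of)
 show "supp ?a \<subseteq> P" "supp ?b \<subseteq> Q"
  by (rule keys_ext_subset[OF assms]; auto)+
qed

definition hsurj where
 "hsurj (_ :: 'k::ab_group_add itself) X Y h d \<longleftrightarrow> (\<forall>w :: (_, 'k) coeff_chain. cyc (SS Y) d w -->
  (\<exists>x. cyc (SS X) d x \<and> bdr (SS Y) d (w - cmap d h x)))"

definition hinj where
 "hinj (_ :: 'k::ab_group_add itself) X Y h d \<longleftrightarrow> (\<forall>x :: (_, 'k) coeff_chain. cyc (SS X) d x -->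
  bdr (SS Y) d (cmap d h x) --> bdr (SS X) d x)"

lemma trivial_coeff_homology_iff:
 "trivial_group (coeff_homology_group (K :: 'k itself) p X A) \<longleftrightarrow>
  (coeff_relcycle p X A :: ('a, 'k::ab_group_add) coeff_chain set) \<subseteq> coeff_relboundary p X A"
  (is "trivial_group ?H \<longleftrightarrow> ?Z \<subseteq> ?B")
proof -
 have car: "carrier ?H = (%c. (%b. b + c) ` ?B) ` ?Z"
  by (auto simp: coeff_homology_group_def FactGroup_def RCOSETS_def r_coset_def image_def)
 have one: "\<one>\<^bsub>?H\<^esub> = ?B"
  by (simp add: coeff_homology_group_def)
 have z: "0 : ?B" and zZ: "0 : ?Z"
  by (auto simp: coeff_relboundary_def coeff_relcycle_def intro!: exI[of _ 0])
 have closed: "b + c : ?B" "b - c : ?B" if "b : ?B" "c : ?B" for b c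
 proof -
  from that obtain x y x' y' where
   bc: "b = cbd (Suc p) x + y" "c = cbd (Suc p) x' + y'"
   and k: "supp x \<subseteq> SS X (Suc p)" "supp x' \<subseteq> SS X (Suc p)"
    "supp y \<subseteq> SS (stop X A) p" "supp y' \<subseteq> SS (stop X A) p"
   unfolding coeff_relboundary_def by blast
  have "b + c = cbd (Suc p) (x + x') + (y + y')" "b - c = cbd (Suc p) (x - x') + (y - y')"
   unfolding bc coeff_boundary_add cbd_diff
   by (simp only: ac_simps, simp only: add_diff_add)
  moreover have "supp (x + x') \<subseteq> SS X (Suc p)" "supp (y + y') \<subseteq> SS (stop X A) p"
    "supp (x - x') \<subseteq> SS X (Suc p)" "supp (y - y') \<subseteq> SS (stop X A) p"
   by (rule keys_add_subset keys_diff_subset k)+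
  ultimately show "b + c : ?B" "b - c : ?B"
   unfolding coeff_relboundary_def mem_Collect_eq by - (rule exI conjI | assumption)+
 qed
 show ?thesis
 proof
  assume "trivial_group ?H"
  hence tr: "carrier ?H = {?B}" by (simp add: trivial_group_def one)
  show "?Z \<subseteq> ?B"
  proof
   fix c assume "c : ?Z"
   hence "(%b. b + c) ` ?B : carrier ?H" unfolding car by (rule imageI)
   hence "(%b. b + c) ` ?B = ?B" unfolding tr by (rule singletonD)
   moreover have "0 + c : (%b. b + c) ` ?B" using z by (rule imageI)
   ultimately show "c : ?B" by simp
  qed
 next
  assume ZB: "?Z \<subseteq> ?B"
  have "(%b. b + c) ` ?B = ?B" if "c : ?Z" for c
  proof
   show "(%b. b + c) ` ?B \<subseteq> ?B" using closed that ZB by blast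
   show "?B \<subseteq> (%b. b + c) ` ?B"
   proof
    fix b assume "b : ?B"
    hence "b - c : ?B" using closed that ZB by blast
    thus "b : (%b. b + c) ` ?B" by (metis diff_add_cancel image_eqI)
   qed
  qed
  hence "carrier ?H = {?B}" using zZ unfolding car by blast
  thus "trivial_group ?H"
   using group_coeff_homology_group by (simp add: trivial_group_def one)
 qed
qed

section \<open>The exact sequence of a homotopy cofibre, in terms of cycles\<close>

section \<open>The homology of a homotopy cofibre\<close>

abbreviation I01 :: "real topology" where
 "I01 \<equiv> top_of_set {0..1}"

lemma SS_image: "s : SS X q ==> x : spx q ==> s x : pts X"
 using continuous_map_image_subset_topspace[OF SS_continuous] by (auto simp: image_subset_iff)

lemma compact_Hausdorff_prod:
 assumes "compact_space X" "haus X" "compact_space Y" "haus Y"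
 shows "compact_space (ptop X Y)" "haus (ptop X Y)"
 using assms by (simp_all add: compact_space_prod_topology Hausdorff_space_prod_topology)

lemma compact_Hausdorff_interval: "compact J ==> compact_space (top_of_set (J :: real set))"
  "haus (top_of_set (J :: real set))"
 by (simp_all add: compact_space_subtopology Hausdorff_space_subtopology)

text \<open>
 Reparametrizing a family over a compact interval preserves openness in the k-ified cylinder,
 because the projection along a compact factor is closed.
\<close>

lemma openin_cg_prod_tube:
 fixes X :: "'x topology"
 assumes U: "openin (cg_prod X I01) U"
  and \<phi>: "cts (ptop I01 I01) I01 (%(u, s). \<phi> u s)"
  and J: "compact J" "J \<subseteq> {0..1}"
 shows "openin (cg_prod X I01)
  {z : pts X \<times> {0..1}. \<forall>s\<in>J. (fst z, \<phi> (snd z) s) : U}"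
proof -
 let ?Z = "ptop X I01" and ?J = "top_of_set J"
 have "openin K {\<kappa> : pts K. v \<kappa> : {z : pts X \<times> {0..1}. \<forall>s\<in>J. (fst z, \<phi> (snd z) s) : U}}"
  if K: "compact_space K" "haus K" and v: "cts K ?Z v"
  for K :: "('x \<times> real) set set topology" and v
 proof -
  let ?G = "%p. (fst (v (fst p)), \<phi> (snd (v (fst p))) (snd p))"
  have v1: "cts (ptop K ?J) X (%p. fst (v (fst p)))"
   and v2: "cts (ptop K ?J) I01 (%p. snd (v (fst p)))"
   using cts_compose[OF cts_compose[OF cts_fst v] cts_fst]
    cts_compose[OF cts_compose[OF cts_fst v] cts_snd]
   by (simp_all add: o_def)
  have "cts (ptop K ?J) I01 snd"
   by (rule cts_into[OF cts_full[OF cts_snd]])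
    (use J(2) in auto)
  with v2 have "cts (ptop K ?J) (ptop I01 I01)
    (%p. (snd (v (fst p)), snd p))"
   by (rule cts_pair)
  from cts_compose[OF this \<phi>]
  have G: "cts (ptop K ?J) ?Z ?G"
   by (intro cts_pair v1) (simp add: o_def)
  obtain j :: "('x \<times> real) set set \<times> real => ('x \<times> real) set set" where j: "inj j"
   using ex_inj_times_real by (rule exE)
  \<comment> \<open>The product of \<open>K\<close> and the compact \<open>J\<close> is compact
    Hausdorff and fits the type of test spaces, so continuity into the product lifts to its
    k-ification.\<close>
  have "cts (ptop K ?J) (kify ?Z) ?G"
   by (rule cts_into_kify_gen[where j = j, OF _ _ _ G])
    (use compact_Hausdorff_prod[OF K compact_Hausdorff_interval(1)[OF J(1)] compact_Hausdorff_interval(2)]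
     inj_on_subset[OF j subset_UNIV] in auto)
  from cts_preimage[OF this U[unfolded cg_prod_def]]
  have O: "openin (ptop K ?J) {p : pts (ptop K ?J). ?G p : U}" .
  let ?N = "pts (ptop K ?J) - {p : pts (ptop K ?J). ?G p : U}"
  have "closedin (ptop K ?J) ?N"
   using O by blast
  hence cl: "closedin K (fst ` ?N)"
   using closed_map_fst[OF compact_Hausdorff_interval(1)[OF J(1)], of K] by (simp add: closed_map_def)
  have "{\<kappa> : pts K. v \<kappa> : {z : pts X \<times> {0..1}. \<forall>s\<in>J. (fst z, \<phi> (snd z) s) : U}} = pts K - fst ` ?N"
  proof (intro equalityI subsetI)
   fix \<kappa> assume "\<kappa> : {\<kappa> : pts K. v \<kappa> : {z : pts X \<times> {0..1}. \<forall>s\<in>J. (fst z, \<phi> (snd z) s) : U}}"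
   thus "\<kappa> : pts K - fst ` ?N" by auto
  next
   fix \<kappa> assume \<kappa>: "\<kappa> : pts K - fst ` ?N"
   hence "v \<kappa> : pts X \<times> {0..1}"
    using v by (auto simp: cts_def Pi_iff)
   moreover have "(fst (v \<kappa>), \<phi> (snd (v \<kappa>)) s) : U" if "s : J" for s
   proof (rule ccontr)
    assume "\<not> ?thesis"
    hence "(\<kappa>, s) : ?N" using \<kappa> that by simp
    thus False using \<kappa> by force
   qed
   ultimately show "\<kappa> : {\<kappa> : pts K. v \<kappa> : {z : pts X \<times> {0..1}. \<forall>s\<in>J. (fst z, \<phi> (snd z) s) : U}}"
    using \<kappa> by simp
  qed
  thus ?thesis using cl by auto
 qed
 thus ?thesis
  unfolding cg_prod_def openin_kify[of ?Z] by auto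
qed

context
 fixes X :: "'x topology" and Y :: "'y topology" and h :: "'x => 'y"
 assumes h: "cts X Y h"
begin

abbreviation "hC \<equiv> hcofibre X Y h"

lemma pts_hcofibre:
 "pts hC = insert Apex ({Cyl x u | x u. x : pts X \<and> 0 < u \<and> u < 1} \<union> Base ` pts Y)"
  (is "_ = ?P")
proof -
 let ?Q = "insert Apex (cone_in h ` (pts X \<times> {0..1}) \<union> Base ` pts Y)"
 have hY: "h x : pts Y" if "x : pts X" for x
  using h that by (auto simp: cts_def)
 have "?Q \<subseteq> ?P"
  using hY by (auto simp: cone_in_def)
 moreover have "?P \<subseteq> ?Q"
 proof -
  have "Cyl x u = cone_in h (x, u)" if "0 < u" "u < 1" for x u
   using that by (simp add: cone_in_def)
  thus ?thesis by force
 qed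
 ultimately have QP: "?Q = ?P" by blast
 have "{z : pts X \<times> {0..1}. cone_in h z : ?Q} = pts (cg_prod X I01)"
  by auto
 moreover have "{y : pts Y. Base y : ?Q} = pts Y" by auto
 ultimately have "openin hC ?Q"
  unfolding openin_hcofibre by (simp only: openin_topspace subset_refl simp_thms)
 from openin_subset[OF this] have "?Q \<subseteq> pts hC" .
 moreover have "pts hC \<subseteq> ?Q"
  by (rule openin_topspace[of hC, unfolded openin_hcofibre[of X Y h], THEN conjunct1])
 ultimately have "pts hC = ?Q" by (rule equalityI[rotated])
 thus ?thesis using QP by (rule trans)
qed

lemma cone_in_topspace: "z : pts X \<times> {0..1} ==> cone_in h z : pts hC"
 using h by (auto simp: pts_hcofibre cone_in_def cts_def Pi_iff)

lemma openin_hcofibre_iff: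
 "openin hC U \<longleftrightarrow> U \<subseteq> pts hC \<and>
  openin (cg_prod X I01) {z : pts X \<times> {0..1}. cone_in h z : U} \<and>
  openin Y {y : pts Y. Base y : U}"
proof -
 have "insert Apex (cone_in h ` (pts X \<times> {0..1}) \<union> Base ` pts Y) = pts hC"
 proof
  show "insert Apex (cone_in h ` (pts X \<times> {0..1}) \<union> Base ` pts Y) \<subseteq> pts hC"
   using cone_in_topspace by (auto simp: pts_hcofibre)
  show "pts hC \<subseteq> insert Apex (cone_in h ` (pts X \<times> {0..1}) \<union> Base ` pts Y)"
   by (rule openin_topspace[of hC, unfolded openin_hcofibre[of X Y h], THEN conjunct1])
 qed
 thus ?thesis by (simp only: openin_hcofibre)
qed

lemma continuous_cone_in: "cts (cg_prod X I01) hC (cone_in h)"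
 unfolding cts_def using cone_in_topspace by (auto simp: openin_hcofibre_iff)

lemma continuous_Base: "cts Y hC Base"
 unfolding cts_def by (auto simp: openin_hcofibre_iff pts_hcofibre)

lemma openin_cyl:
 assumes "openin X U" "open T"
 shows "openin (cg_prod X I01) {z : pts X \<times> {0..1}. fst z : U \<and> snd z : T}"
proof -
 have "openin (ptop X I01) (U \<times> ({0..1} \<inter> T))"
  using assms by (simp add: openin_prod_Times_iff openin_open_Int)
 moreover have "U \<times> ({0..1} \<inter> T) = {z : pts X \<times> {0..1}. fst z : U \<and> snd z : T}"
  using openin_subset[OF assms(1)] by auto
 ultimately show ?thesis
  unfolding cg_prod_def by (simp add: openin_kify_mono)
qed

text \<open>The two open sets of a Mayer-Vietoris argument: the open cone, which contracts to the
  apex, and the complement of the apex, which retracts to \<open>Y\<close>. They meet in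
  \<open>X\<close> times an open interval.\<close>

definition "offBase = pts hC - range Base"
definition "offApex = pts hC - {Apex}"

lemma openin_offBase: "openin hC offBase"
proof -
 have "{z : pts X \<times> {0..1}. cone_in h z : offBase} =
   {z : pts X \<times> {0..1}. fst z : pts X \<and> snd z : - {1}}"
  using cone_in_topspace by (auto simp: offBase_def cone_in_def split: if_splits)
 moreover have "{y : pts Y. Base y : offBase} = {}" by (auto simp: offBase_def)
 ultimately show ?thesis
  unfolding openin_hcofibre_iff using openin_cyl[of "pts X" "- {1}"] by (auto simp: offBase_def)
qed

lemma openin_offApex: "openin hC offApex"
proof -
 have "{z : pts X \<times> {0..1}. cone_in h z : offApex} =
   {z : pts X \<times> {0..1}. fst z : pts X \<and> snd z : - {0}}"
  using cone_in_topspace by (auto simp: offApex_def cone_in_def split: if_splits)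
 moreover have "{y : pts Y. Base y : offApex} = pts Y"
  by (auto simp: offApex_def pts_hcofibre)
 ultimately show ?thesis
  unfolding openin_hcofibre_iff using openin_cyl[of "pts X" "- {0}"] by (auto simp: offApex_def)
qed

definition cpr :: "('x, 'y) cone => 'x" where
 "cpr c = (case c of Cyl x u => x | _ => undefined)"

definition cret :: "('x, 'y) cone => 'y" where
 "cret c = (case c of Cyl x u => h x | Base y => y | Apex => undefined)"

lemma cts_open_subtopology:
 assumes "openin Z W" "f : W \<rightarrow> pts V" "!!U. openin V U ==> openin Z {z : W. f z : U}"
 shows "cts (stop Z W) V f"
proof -
 have W: "pts (stop Z W) = W"
  using openin_subset[OF assms(1)] by auto
 show ?thesis
  unfolding cts_def W using assms by (auto simp: openin_open_subtopology)
qed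

lemma continuous_cpr: "cts (stop hC (offBase \<inter> offApex)) X cpr"
proof (rule cts_open_subtopology)
 show "openin hC (offBase \<inter> offApex)" using openin_offBase openin_offApex by blast
 show "cpr : offBase \<inter> offApex \<rightarrow> pts X"
  by (auto simp: offBase_def offApex_def pts_hcofibre cpr_def)
 fix U assume U: "openin X U"
 have "{z : pts X \<times> {0..1}. cone_in h z : {c : offBase \<inter> offApex. cpr c : U}} =
   {z : pts X \<times> {0..1}. fst z : U \<and> snd z : - {0, 1}}"
  using cone_in_topspace by (auto simp: offBase_def offApex_def cone_in_def cpr_def split: if_splits)
 moreover have "{y : pts Y. Base y : {c : offBase \<inter> offApex. cpr c : U}} = {}"
  by (auto simp: offBase_def)
 ultimately show "openin hC {c : offBase \<inter> offApex. cpr c : U}"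
  unfolding openin_hcofibre_iff using openin_cyl[OF U, of "- {0, 1}"]
  by (auto simp: offBase_def open_Compl)
qed

lemma continuous_cret: "cts (stop hC offApex) Y cret"
proof (rule cts_open_subtopology[OF openin_offApex])
 have hY: "h x : pts Y" if "x : pts X" for x
  using h that by (auto simp: cts_def)
 show "cret : offApex \<rightarrow> pts Y"
  using hY by (auto simp: offApex_def pts_hcofibre cret_def)
 fix U assume U: "openin Y U"
 have V: "openin X {x : pts X. h x : U}"
  using cts_preimage[OF h U] .
 have "{z : pts X \<times> {0..1}. cone_in h z : {c : offApex. cret c : U}} =
   {z : pts X \<times> {0..1}. fst z : {x : pts X. h x : U} \<and> snd z : - {0}}"
  using cone_in_topspace by (auto simp: offApex_def cone_in_def cret_def split: if_splits)
 moreover have "{y : pts Y. Base y : {c : offApex. cret c : U}} = U"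
  using openin_subset[OF U] by (auto simp: offApex_def pts_hcofibre cret_def)
 ultimately show "openin hC {c : offApex. cret c : U}"
  unfolding openin_hcofibre_iff using openin_cyl[OF V, of "- {0}"] U by (auto simp: offApex_def)
qed

definition reparam :: "(real => real => real) => ('x, 'y) cone \<times> real => ('x, 'y) cone" where
 "reparam \<phi> z = (case fst z of Apex => Apex | Cyl x u => cone_in h (x, \<phi> u (snd z)) | Base y => Base y)"

text \<open>Apex and base points stay fixed, which is compatible with \<open>cone_in\<close> only if
  \<open>\<phi>\<close> fixes 0 or 1, respectively; this is demanded where \<open>W\<close> contains
  such points. The cofibre carries a quotient topology of a k-ified cylinder, so openness in the
  time direction comes from \<open>openin_cg_prod_tube\<close>, for a compact interval of
  times.\<close>

lemma continuous_reparam: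
 assumes \<phi>: "cts (ptop I01 I01) I01 (%(u, s). \<phi> u s)"
  and W: "openin hC W"
  and 0: "!!s. Apex : W ==> s : {0..1} ==> \<phi> 0 s = 0"
  and 1: "!!s y. Base y : W ==> s : {0..1} ==> \<phi> 1 s = 1"
 shows "cts (ptop (stop hC W) I01) hC (reparam \<phi>)"
proof -
 have topW: "pts (stop hC W) = W"
  using openin_subset[OF W] by auto
 have \<phi>I: "\<phi> u s : {0..1}" if "u : {0..1}" "s : {0..1}" for u s
 proof -
  have "(%(u, s). \<phi> u s) (u, s) : pts I01"
   using continuous_map_image_subset_topspace[OF \<phi>] that by (auto simp: image_subset_iff)
  thus ?thesis by simp
 qed
 have rc: "reparam \<phi> (cone_in h z, s) = cone_in h (fst z, \<phi> (snd z) s)"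
  if "cone_in h z : W" "s : {0..1}" "z : pts X \<times> {0..1}" for z s
  using that 0[of s] 1[of "h (fst z)" s]
  by (cases z) (auto simp: reparam_def cone_in_def split: if_splits)
 have mem: "reparam \<phi> z : pts hC" if "z : W \<times> {0..1}" for z
 proof -
  have c: "fst z : pts hC" and s: "snd z : {0..1}"
   using that openin_subset[OF W] by auto
  show ?thesis
  proof (cases "fst z")
   case (Cyl x u)
   hence "x : pts X" "u : {0..1}" using c by (auto simp: pts_hcofibre)
   with \<phi>I[OF _ s] have "(x, \<phi> u (snd z)) : pts X \<times> {0..1}" by blast
   from cone_in_topspace[OF this] show ?thesis by (simp add: reparam_def Cyl)
  qed (use c in \<open>simp_all add: reparam_def\<close>)
 qed
 have "openin (ptop (stop hC W) I01) {z : W \<times> {0..1}. reparam \<phi> z : U}"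
  if U: "openin hC U" for U
 proof (subst openin_subopen, rule ballI)
  fix z0 assume "z0 : {z : W \<times> {0..1}. reparam \<phi> z : U}"
  then obtain c0 s0 where z0: "z0 = (c0, s0)" "c0 : W" "s0 : {0..1}" "reparam \<phi> (c0, s0) : U"
   by auto
  have "{s::real. 0 <= s \<and> s <= 1} = pts I01" by auto
  hence I: "openin I01 {s. 0 <= s \<and> s <= 1}" by (simp only: openin_topspace)
  have "openin I01 {s : {0..1}. reparam \<phi> (c0, s) : U}"
  proof (cases c0)
   case (Cyl x u)
   have xu: "x : pts X" "u : {0..1}"
    using z0(2) openin_subset[OF W] Cyl by (auto simp: pts_hcofibre)
   have "cts I01 (ptop I01 I01) (%s. (u, s))"
    by (rule cts_pair) (use xu in auto)
   from cts_compose[OF this \<phi>]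
   have "cts I01 (ptop X I01) (%s. (x, \<phi> u s))"
    by (intro cts_pair) (use xu in \<open>auto simp: o_def\<close>)
   hence "cts I01 (cg_prod X I01) (%s. (x, \<phi> u s))"
    unfolding cg_prod_def
    by (intro cts_into_kify_gen[where j = "%r::real. {{(undefined :: 'x, r)}}"] compact_Hausdorff_interval)
     (auto simp: inj_on_def)
   from cts_compose[OF this continuous_cone_in]
   have "cts I01 hC (%s. cone_in h (x, \<phi> u s))" by (simp add: o_def)
   from cts_preimage[OF this U] show ?thesis
    by (simp add: Cyl reparam_def)
  qed (use z0 I in \<open>auto simp: reparam_def\<close>)
  then obtain T where T: "open T" "{s : {0..1}. reparam \<phi> (c0, s) : U} = {0..1} \<inter> T"
   by (auto simp: openin_open)
  hence "s0 : T" using z0 by auto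
  then obtain e where e: "0 < e" "cball s0 e \<subseteq> T"
   using T(1) open_contains_cball by blast
  define J where "J = {0..1} \<inter> cball s0 e"
  have J: "compact J" "J \<subseteq> {0..1}" "s0 : J"
   using e z0 by (auto simp: J_def intro: compact_Int_closed)
  \<comment> \<open>The tube around \<open>c0\<close>: points that stay in \<open>U\<close> during
    all times of the compact interval \<open>J\<close>.\<close>
  define V where "V = {c : W. \<forall>s\<in>J. reparam \<phi> (c, s) : U}"
  have "openin hC V"
   unfolding openin_hcofibre_iff
  proof (intro conjI)
   show "V \<subseteq> pts hC" using openin_subset[OF W] by (auto simp: V_def)
   let ?U = "{z : pts X \<times> {0..1}. cone_in h z : U}"
   have "{z : pts X \<times> {0..1}. cone_in h z : V} =
    {z : pts X \<times> {0..1}. cone_in h z : W} \<inter>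
    {z : pts X \<times> {0..1}. \<forall>s\<in>J. (fst z, \<phi> (snd z) s) : ?U}" (is "?A = ?B \<inter> ?C")
   proof (intro equalityI subsetI)
    fix z assume z: "z : ?A"
    have "(fst z, \<phi> (snd z) s) : ?U" if "s : J" for s
     using z that rc[of z s] J(2) \<phi>I[of "snd z" s] by (auto simp: V_def subset_iff)
    thus "z : ?B \<inter> ?C" using z by (simp add: V_def)
   next
    fix z assume z: "z : ?B \<inter> ?C"
    hence "reparam \<phi> (cone_in h z, s) : U" if "s : J" for s
     using that rc[of z s] J(2) by (auto simp: subset_iff)
    thus "z : ?A" using z by (simp add: V_def)
   qed
   moreover have "openin (cg_prod X I01) ?B" using W by (simp add: openin_hcofibre_iff)
   moreover have "openin (cg_prod X I01) ?C"
    by (rule openin_cg_prod_tube[OF _ \<phi> J(1,2)]) (use U in \<open>simp add: openin_hcofibre_iff\<close>)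
   ultimately show "openin (cg_prod X I01) {z : pts X \<times> {0..1}. cone_in h z : V}"
    by (simp add: openin_Int)
   have "{y : pts Y. Base y : V} = {y : pts Y. Base y : W} \<inter> {y : pts Y. Base y : U}"
    using J(3) by (auto simp: V_def reparam_def)
   thus "openin Y {y : pts Y. Base y : V}"
    using U W by (simp add: openin_hcofibre_iff openin_Int)
  qed
  hence "openin (stop hC W) V"
   using W by (auto simp: openin_open_subtopology V_def)
  moreover have "openin I01 ({0..1} \<inter> ball s0 e)" by (simp add: openin_open_Int)
  ultimately have "openin (ptop (stop hC W) I01) (V \<times> ({0..1} \<inter> ball s0 e))"
   by (simp add: openin_prod_Times_iff)
  moreover have "c0 : V"
   using z0(2) e T(2) by (auto simp: V_def J_def)
  hence "z0 : V \<times> ({0..1} \<inter> ball s0 e)" using z0 e by simp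
  moreover have "V \<times> ({0..1} \<inter> ball s0 e) \<subseteq> {z : W \<times> {0..1}. reparam \<phi> z : U}"
   by (auto simp: V_def J_def)
  ultimately show "\<exists>T. openin (ptop (stop hC W) I01) T \<and> z0 : T \<and>
    T \<subseteq> {z : W \<times> {0..1}. reparam \<phi> z : U}" by blast
 qed
 thus ?thesis
  unfolding cts_def topspace_prod_topology topW using mem by auto
qed

lemma reparam_homotopy_SS:
 assumes \<phi>: "cts (ptop I01 I01) I01 (%(u, s). \<phi> u s)"
  and W: "openin hC W"
  and 0: "!!s. Apex : W ==> s : {0..1} ==> \<phi> 0 s = 0"
  and 1: "!!s y. Base y : W ==> s : {0..1} ==> \<phi> 1 s = 1"
  and V: "!!z. z : W \<times> {0..1} ==> reparam \<phi> z : V"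
  and f: "f : SS (stop hC W) q" and g: "cts (Spx (Suc q)) (cylinder q) g"
 shows "(\<lambda>y\<in>spx (Suc q). reparam \<phi> (f (fst (g y)), snd (g y))) : SS (stop hC V) (Suc q)"
proof (rule restrict_SS)
 have W': "pts (stop hC W) = W" using openin_subset[OF W] by auto
 from cts_compose[OF g cts_apply_simplex[OF f]]
 have 2: "cts (Spx (Suc q)) (ptop (stop hC W) I01) (%y. (f (fst (g y)), snd (g y)))"
  by (simp add: o_def case_prod_beta)
 from cts_compose[OF 2 continuous_reparam[OF \<phi> W 0 1]]
 have 3: "cts (Spx (Suc q)) hC (%y. reparam \<phi> (f (fst (g y)), snd (g y)))"
  by (simp add: o_def)
 have "reparam \<phi> (f (fst (g y)), snd (g y)) : V" if "y : spx (Suc q)" for y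
 proof (rule V)
  show "(f (fst (g y)), snd (g y)) : W \<times> {0..1}"
   using continuous_map_image_subset_topspace[OF 2] that W' by (auto simp: image_subset_iff)
 qed
 thus "cts (Spx (Suc q)) (stop hC V) (%y. reparam \<phi> (f (fst (g y)), snd (g y)))"
  by (intro cts_into 3) auto
qed

lemma cone_homotopy_SS:
 assumes \<psi>: "cts I01 I01 \<psi>"
  and V: "!!x s. x : pts X ==> s : {0..1} ==> cone_in h (x, \<psi> s) : V"
  and f: "f : SS X q" and g: "cts (Spx (Suc q)) (cylinder q) g"
 shows "(\<lambda>y\<in>spx (Suc q). cone_in h (f (fst (g y)), \<psi> (snd (g y)))) : SS (stop hC V) (Suc q)"
proof (rule restrict_SS)
 from cts_compose[OF g cts_apply_simplex[OF f]]
 have 2: "cts (Spx (Suc q)) (ptop X I01) (%y. (f (fst (g y)), snd (g y)))"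
  by (simp add: o_def case_prod_beta)
 from cts_compose[OF 2 cts_fst] cts_compose[OF cts_compose[OF 2 cts_snd] \<psi>]
 have "cts (Spx (Suc q)) (ptop X I01) (%y. (f (fst (g y)), \<psi> (snd (g y))))"
  by (intro cts_pair) (simp_all add: o_def)
 hence "cts (Spx (Suc q)) (cg_prod X I01) (%y. (f (fst (g y)), \<psi> (snd (g y))))"
  unfolding cg_prod_def by (rule cts_simplex_into_kify[where i = "%r::real. (undefined :: 'x, r)", rotated]) (simp add: inj_def)
 from cts_compose[OF this continuous_cone_in]
 have 3: "cts (Spx (Suc q)) hC (%y. cone_in h (f (fst (g y)), \<psi> (snd (g y))))"
  by (simp add: o_def)
 have "cone_in h (f (fst (g y)), \<psi> (snd (g y))) : V" if "y : spx (Suc q)" for y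
  using continuous_map_image_subset_topspace[OF 2] that V by (auto simp: image_subset_iff)
 thus "cts (Spx (Suc q)) (stop hC V) (%y. cone_in h (f (fst (g y)), \<psi> (snd (g y))))"
  by (intro cts_into 3) auto
qed

lemma subdiv_diff: "subdiv n p (a - b) = subdiv n p a - subdiv n p b"
 by (simp add: subdiv_def ext_diff)

lemma SS_subtopology_Int: "SS (stop Z (V \<inter> W)) q = SS (stop Z V) q \<inter> SS (stop Z W) q"
 by (auto simp: singular_simplex_subtopology)

lemma SS_subtopology_mono: "V \<subseteq> W ==> SS (stop Z V) q \<subseteq> SS (stop Z W) q"
 unfolding singular_simplex_subtopology by blast

lemma keys_ext_prism_cone:
 assumes \<psi>: "cts I01 I01 \<psi>"
  and V: "!!x s. x : pts X ==> s : {0..1} ==> cone_in h (x, \<psi> s) : V"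
  and y: "supp y \<subseteq> SS X e"
 shows "supp (ext (prism e (%(x, s). cone_in h (x, \<psi> s))) y) \<subseteq> SS (stop hC V) (Suc e)"
proof (rule keys_ext_subset[OF y], rule keys_prism)
 fix f g assume "f : SS X e" "cts (Spx (Suc e)) (cylinder e) g"
 from cone_homotopy_SS[OF \<psi> V this]
 show "(\<lambda>y\<in>spx (Suc e). (%(x, s). cone_in h (x, \<psi> s)) (f (fst (g y)), snd (g y)))
   : SS (stop hC V) (Suc e)" by simp
qed

lemma SS_subtopology_subset: "SS (stop Z V) q \<subseteq> SS Z q"
 by (auto simp: singular_simplex_subtopology)

lemma hcofibre_split:
 assumes "supp (c :: (_, 'k::ab_group_add) coeff_chain) \<subseteq> SS hC q"
 obtains n a b where "subdiv n q c = a + b" "supp a \<subseteq> SS (stop hC offBase) q"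
  "supp b \<subseteq> SS (stop hC offApex) q"
proof -
 have cov: "pts hC \<subseteq> \<Union> {offBase, offApex}"
  by (auto simp: offBase_def offApex_def)
 have op: "openin hC U" if "U : {offBase, offApex}" for U
  using that openin_offBase openin_offApex by blast
 obtain n where n: "\<forall>f\<in>supp (subdiv n q c). \<exists>V\<in>{offBase, offApex}. f : spx q \<rightarrow> V"
  using subdiv_small[OF op cov assms] by (rule exE)
 have "supp (subdiv n q c) \<subseteq> SS (stop hC offBase) q \<union> SS (stop hC offApex) q"
 proof
  fix f assume f: "f : supp (subdiv n q c)"
  hence "singular_simplex q hC f" using keys_subdiv[OF assms, of n] by auto
  moreover have "f ` spx q \<subseteq> offBase \<or> f ` spx q \<subseteq> offApex"
   using n f by auto
  ultimately show "f : SS (stop hC offBase) q \<union> SS (stop hC offApex) q"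
   by (auto simp: singular_simplex_subtopology)
 qed
 from chain_split[OF this] show thesis using that by metis
qed

abbreviation cmid :: "'x => ('x, 'y) cone" where
 "cmid \<equiv> %x. Cyl x (1/2)"

lemma continuous_half: "cts I01 I01 (%s. 1 - s / 2)"
  "cts I01 I01 (%s. (1 - s) / 2)"
  "cts I01 I01 (%s. 1 - s)"
 by (auto intro!: continuous_intros)

text \<open>The chain \<open>w\<close> in \<open>Y\<close> is closed up by the cone on
  \<open>y\<close>. If the resulting relative cycle bounds, then cutting a bounding chain along the
  two open sets leaves a chain in the overlap, and its projection to \<open>X\<close> bounds a
  subdivision of \<open>y\<close>. The case \<open>y = 0\<close> gives surjectivity, the general
  case injectivity.\<close>

lemma hcofibre_forward:
 fixes w :: "('y, 'k::ab_group_add) coeff_chain" and y :: "('x, 'k) coeff_chain"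
 assumes tr: "(coeff_relcycle d hC {Apex} :: (_, 'k) coeff_chain set) \<subseteq> coeff_relboundary d hC {Apex}"
  and w: "supp w \<subseteq> SS Y d" and y: "cyc (SS X) (d - 1) y" "d = 0 ==> y = 0"
  and wy: "cbd d w = cmap (d - 1) h y"
 shows "\<exists>N \<theta>. supp \<theta> \<subseteq> SS X d \<and> cbd d \<theta> = subdiv N (d - 1) y \<and>
  (y = 0 --> bdr (SS Y) d (subdiv N d w - cmap d h \<theta>))"
proof -
 let ?A = "SS (stop hC offBase)" and ?B = "SS (stop hC offApex)"
 let ?P = "SS (stop hC {Apex})"
 \<comment> \<open>\<open>K1\<close> leads from the base to the middle level and avoids the apex;
   \<open>K2\<close> leads from the middle level to the apex and avoids the base.\<close>
 define K1 where "K1 = (if d = 0 then 0 else ext (prism (d - 1) (%(x, s). cone_in h (x, 1 - s / 2))) y)"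
 define K2 where "K2 = (if d = 0 then 0 else ext (prism (d - 1) (%(x, s). cone_in h (x, (1 - s) / 2))) y)"
 have ky: "supp y \<subseteq> SS X (d - 1)" and zy: "cbd (d - 1) y = 0"
  using y(1) by (auto simp: cyc_def)
 have yext: "supp y \<subseteq> extensional (spx (d - 1))"
  using ky SS_extensional by blast
 have kK1: "supp K1 \<subseteq> ?B d"
 proof (cases d)
  case (Suc e)
  have "cone_in h (x, 1 - s / 2) : offApex" if "x : pts X" "s : {0..1}" for x s
  proof -
   have "(x, 1 - s / 2) : pts X \<times> {0..1}" using that by auto
   from cone_in_topspace[OF this] that show ?thesis
    by (auto simp: offApex_def cone_in_def split: if_splits)
  qed
  from keys_ext_prism_cone[OF continuous_half(1) this] ky show ?thesis
   unfolding K1_def Suc by simp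
 qed (simp add: K1_def)
 have kK2: "supp K2 \<subseteq> ?A d"
 proof (cases d)
  case (Suc e)
  have "cone_in h (x, (1 - s) / 2) : offBase" if "x : pts X" "s : {0..1}" for x s
  proof -
   have "(x, (1 - s) / 2) : pts X \<times> {0..1}" using that by auto
   from cone_in_topspace[OF this] that show ?thesis
    by (auto simp: offBase_def cone_in_def split: if_splits)
  qed
  from keys_ext_prism_cone[OF continuous_half(2) this] ky show ?thesis
   unfolding K2_def Suc by simp
 qed (simp add: K2_def)
 have bK1: "cbd d K1 = cmap (d - 1) cmid y - cmap (d - 1) Base (cmap (d - 1) h y)"
 proof (cases d)
  case (Suc e)
  show ?thesis
   using cbd_prism[OF yext, of "%(x, s). cone_in h (x, 1 - s / 2)"] zy
   by (simp add: K1_def Suc cmap_cmap cone_in_def)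
 qed (simp add: K1_def y(2))
 have bK2: "cbd d K2 = cmap (d - 1) (%_. Apex) y - cmap (d - 1) cmid y"
 proof (cases d)
  case (Suc e)
  show ?thesis
   using cbd_prism[OF yext, of "%(x, s). cone_in h (x, (1 - s) / 2)"] zy
   by (simp add: K2_def Suc cone_in_def)
 qed (simp add: K2_def y(2))
 define \<zeta> where "\<zeta> = cmap d Base w + K1 + K2"
 have kw: "supp (cmap d Base w) \<subseteq> ?B d"
 proof (rule keys_cmap[OF w])
  fix s assume "s : SS Y d"
  moreover have "cts Y (stop hC offApex) Base"
   by (intro cts_into continuous_Base) (auto simp: offApex_def pts_hcofibre)
  ultimately show "smap d Base s : ?B d" using simplex_map_SS by blast
 qed
 have AC: "?A q \<subseteq> SS hC q" and BC: "?B q \<subseteq> SS hC q" for q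
  by (rule SS_subtopology_subset)+
 have k\<zeta>: "supp \<zeta> \<subseteq> SS hC d"
  unfolding \<zeta>_def using kw kK1 kK2 AC[of d] BC[of d] by (intro keys_add_subset) (rule order.trans, assumption+)+
 have "cbd d \<zeta> = cmap (d - 1) (%_. Apex) y"
  by (simp add: \<zeta>_def coeff_boundary_add cbd_cmap wy bK1 bK2)
 moreover have "supp (cmap (d - 1) (%_. Apex) y) \<subseteq> ?P (d - 1)"
 proof (rule keys_cmap[OF ky])
  fix s assume s: "s : SS X (d - 1)"
  have "cts X (stop hC {Apex}) (%_. Apex)" by (auto simp: pts_hcofibre)
  from simplex_map_SS[OF this s] show "smap (d - 1) (%_. Apex) s : ?P (d - 1)" .
 qed
 ultimately have "\<zeta> : coeff_relcycle d hC {Apex}"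
  using k\<zeta> by (simp add: coeff_relcycle_def)
 with tr obtain \<beta> a where \<beta>: "\<zeta> = cbd (Suc d) \<beta> + a" "supp \<beta> \<subseteq> SS hC (Suc d)"
  and a: "supp a \<subseteq> ?P d"
  unfolding coeff_relboundary_def by blast
 obtain N \<beta>A \<beta>B where N: "subdiv N (Suc d) \<beta> = \<beta>A + \<beta>B"
  and kA: "supp \<beta>A \<subseteq> ?A (Suc d)" and kB: "supp \<beta>B \<subseteq> ?B (Suc d)"
  using hcofibre_split[OF \<beta>(2)] by metis
 define w' where "w' = subdiv N d w"
 define y' where "y' = subdiv N (d - 1) y"
 define K1' where "K1' = subdiv N d K1"
 define K2' where "K2' = subdiv N d K2"
 define a' where "a' = subdiv N d a"
 have sw: "subdiv N d (cmap d Base w) = cmap d Base w'"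
  unfolding w'_def by (rule subdiv_cmap[OF w])
 have "subdiv N d \<zeta> = cbd (Suc d) (\<beta>A + \<beta>B) + a'"
  using cbd_subdiv[OF \<beta>(2), of N] by (simp add: \<beta>(1) subdiv_add N a'_def)
 hence eq: "cmap d Base w' + K1' + K2' = cbd (Suc d) \<beta>A + cbd (Suc d) \<beta>B + a'"
  by (simp add: \<zeta>_def subdiv_add sw K1'_def K2'_def coeff_boundary_add)
 \<comment> \<open>By \<open>eq\<close> this chain also equals
   \<open>cbd (Suc d) \<beta>A - K2' + a'\<close>, so it lies in both open sets.\<close>
 define \<theta>0 where "\<theta>0 = cmap d Base w' + K1' - cbd (Suc d) \<beta>B"
 have \<theta>A: "\<theta>0 = cbd (Suc d) \<beta>A - K2' + a'"
  using eq unfolding \<theta>0_def by (simp add: algebra_simps)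
 have kw': "supp w' \<subseteq> SS Y d" unfolding w'_def by (rule keys_subdiv[OF w])
 have "supp \<theta>0 \<subseteq> ?B d"
  unfolding \<theta>0_def K1'_def sw[symmetric]
  by (intro keys_diff_subset keys_add_subset keys_subdiv[OF kw] keys_subdiv[OF kK1])
   (use keys_coeff_boundary[OF kB] in simp)
 moreover have "supp \<theta>0 \<subseteq> ?A d"
 proof -
  have "?P d \<subseteq> ?A d" by (rule SS_subtopology_mono) (auto simp: offBase_def pts_hcofibre)
  hence "supp a' \<subseteq> ?A d"
   unfolding a'_def using keys_subdiv[OF a, of N] by (rule order.trans[rotated])
  thus ?thesis
   unfolding \<theta>A K2'_def
   by (intro keys_diff_subset keys_add_subset keys_subdiv[OF kK2]) (use keys_coeff_boundary[OF kA] in simp)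
 qed
 ultimately have k\<theta>0: "supp \<theta>0 \<subseteq> SS (stop hC (offBase \<inter> offApex)) d"
  unfolding SS_subtopology_Int by (rule Int_greatest[rotated])
 have bw': "cbd d w' = cmap (d - 1) h y'"
  unfolding w'_def y'_def cbd_subdiv[OF w] wy subdiv_cmap[OF ky] ..
 have b1: "cbd d K1' = cmap (d - 1) cmid y' - cmap (d - 1) Base (cmap (d - 1) h y')"
  unfolding K1'_def cbd_subdiv[OF kK1] bK1 cmap_cmap subdiv_diff subdiv_cmap[OF ky] y'_def ..
 have b\<theta>0: "cbd d \<theta>0 = cmap (d - 1) cmid y'"
  by (simp add: \<theta>0_def cbd_diff coeff_boundary_add cbd_cmap bw' b1 coeff_boundary_boundary)
 define \<theta> where "\<theta> = cmap d cpr \<theta>0"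
 have "supp \<theta> \<subseteq> SS X d"
  unfolding \<theta>_def by (rule keys_cmap[OF k\<theta>0]) (rule simplex_map_SS[OF continuous_cpr])
 moreover have "cbd d \<theta> = y'"
 proof -
  have "supp y' \<subseteq> extensional (spx (d - 1))"
   unfolding y'_def using keys_subdiv[OF ky, of N] SS_extensional by (rule order.trans)
  thus ?thesis
   unfolding \<theta>_def cbd_cmap b\<theta>0 cmap_cmap by (simp add: cpr_def cmap_ident)
 qed
 moreover have "bdr (SS Y) d (w' - cmap d h \<theta>)" if "y = 0"
 proof -
  have "cmap d cret \<theta>0 = cmap d h \<theta>"
   unfolding \<theta>_def cmap_cmap
  proof (rule cmap_cong)
   fix s x assume "s : supp \<theta>0" "x : spx d"
   hence "s ` spx d \<subseteq> offBase \<inter> offApex"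
    using k\<theta>0 unfolding singular_simplex_subtopology by blast
   hence "s x : offBase \<inter> offApex" using \<open>x : spx d\<close> by blast
   thus "cret (s x) = h (cpr (s x))"
    by (auto simp: offBase_def offApex_def cret_def cpr_def split: cone.splits)
  qed
  moreover have "K1' = 0" using that by (simp add: K1'_def K1_def)
  hence "cmap d cret \<theta>0 = w' - cbd (Suc d) (cmap (Suc d) cret \<beta>B)"
   using cmap_ident[of w' d] order.trans[OF kw' SS_extensional]
   by (simp add: \<theta>0_def cmap_diff cmap_cmap cbd_cmap cret_def)
  moreover have "supp (cmap (Suc d) cret \<beta>B) \<subseteq> SS Y (Suc d)"
   by (rule keys_cmap[OF kB]) (rule simplex_map_SS[OF continuous_cret])
  ultimately show ?thesis unfolding bdr_def by (metis add_diff_cancel_left' diff_add_cancel)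
 qed
 ultimately show ?thesis unfolding w'_def y'_def by blast
qed

lemma hcofibre_trivial_imp:
 fixes K :: "'k::ab_group_add itself"
 assumes "trivial_group (reduced_homology K d hC Apex)"
 shows "hsurj K X Y h d" "0 < d ==> hinj K X Y h (d - 1)"
proof -
 have tr: "(coeff_relcycle d hC {Apex} :: (_, 'k) coeff_chain set) \<subseteq> coeff_relboundary d hC {Apex}"
  using assms by (simp add: reduced_homology_def trivial_coeff_homology_iff)
 show "hsurj K X Y h d"
  unfolding hsurj_def
 proof (intro allI impI)
  fix w :: "('y, 'k) coeff_chain" assume w: "cyc (SS Y) d w"
  have "cyc (SS X) (d - 1) (0 :: ('x, 'k) coeff_chain)" by (simp add: cyc_def)
  from hcofibre_forward[OF tr _ this, of w] w obtain N \<theta> where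
   t: "supp \<theta> \<subseteq> SS X d" "cbd d \<theta> = 0" "bdr (SS Y) d (subdiv N d w - cmap d h \<theta>)"
   by (auto simp: cyc_def)
  have "bdr (SS Y) d ((subdiv N d w - cmap d h \<theta>) - (subdiv N d w - w))"
   by (rule bdr_diff[OF t(3) bdr_subdiv[OF w]])
  thus "\<exists>x. cyc (SS X) d x \<and> bdr (SS Y) d (w - cmap d h x)"
   using t(1,2) by (intro exI[of _ \<theta>]) (simp add: cyc_def algebra_simps)
 qed
 show "hinj K X Y h (d - 1)" if d: "0 < d"
  unfolding hinj_def
 proof (intro allI impI)
  fix x :: "('x, 'k) coeff_chain" assume x: "cyc (SS X) (d - 1) x" and "bdr (SS Y) (d - 1) (cmap (d - 1) h x)"
  then obtain w where w: "supp w \<subseteq> SS Y d" "cbd d w = cmap (d - 1) h x"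
   using d by (auto simp: bdr_def)
  from hcofibre_forward[OF tr w(1) x _ w(2)] d obtain N \<theta> where
   t: "supp \<theta> \<subseteq> SS X d" "cbd d \<theta> = subdiv N (d - 1) x"
   by auto
  hence "bdr (SS X) (d - 1) (subdiv N (d - 1) x)" using d by (auto simp: bdr_def)
  from bdr_diff[OF this bdr_subdiv[OF x, of N]] show "bdr (SS X) (d - 1) x" by simp
 qed
qed

text \<open>In this order: contraction of the open cone to the apex, retraction of the complement of
  the apex to the base, and retraction of the overlap to the middle level.\<close>

lemma continuous_reparam_maps:
 "cts (ptop I01 I01) I01 (%(u, s). u * (1 - s))"
 "cts (ptop I01 I01) I01 (%(u, s). u + s * (1 - u))"
 "cts (ptop I01 I01) I01 (%(u, s). (1 - s) * u + s / 2)"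
proof -
 have b: "u * (1 - s) : {0..1}" "u + s * (1 - u) : {0..1}" "(1 - s) * u + s / 2 : {0..1}"
  if "u : {0..1}" "s : {0..1}" for u s :: real
 proof -
  have us: "0 <= u" "u <= 1" "0 <= s" "s <= 1" using that by auto
  have "u * (1 - s) <= 1 * 1" by (rule mult_mono) (use us in auto)
  thus "u * (1 - s) : {0..1}" using us by simp
  have "(1 - u) * (1 - s) \<ge> 0" "0 <= s * (1 - u)" using us by simp_all
  thus "u + s * (1 - u) : {0..1}" using us by (auto simp: algebra_simps)
  have "(1 - s) * u <= (1 - s) * 1" "0 <= (1 - s) * u" using us by (simp_all add: mult_left_le)
  thus "(1 - s) * u + s / 2 : {0..1}" using us by auto
 qed
 have f: "cts (ptop I01 I01) rtop fst"
  "cts (ptop I01 I01) rtop snd"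
  by (rule cts_full[OF cts_fst] cts_full[OF cts_snd])+
 show "cts (ptop I01 I01) I01 (%(u, s). u * (1 - s))"
  unfolding case_prod_beta
  by (rule cts_into)
   (intro continuous_map_real_mult continuous_map_diff f continuous_map_const[THEN iffD2], use b in auto)
 show "cts (ptop I01 I01) I01 (%(u, s). u + s * (1 - u))"
  unfolding case_prod_beta
  by (rule cts_into)
   (intro continuous_map_add continuous_map_real_mult continuous_map_diff f continuous_map_const[THEN iffD2], use b in auto)
 show "cts (ptop I01 I01) I01 (%(u, s). (1 - s) * u + s / 2)"
  unfolding case_prod_beta
  by (rule cts_into)
   (intro continuous_map_add continuous_map_real_mult continuous_map_diff continuous_map_real_divide f
    continuous_map_const[THEN iffD2], use b in auto)
qed

lemma reparam_mem:
 assumes c: "c : pts hC" and v: "!!x u. c = Cyl x u ==> 0 < \<phi> u s \<and> \<phi> u s < 1"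
 shows "reparam \<phi> (c, s) : pts hC" "c : offBase ==> reparam \<phi> (c, s) : offBase"
  "c : offApex ==> reparam \<phi> (c, s) : offApex"
 using c v by (auto simp: reparam_def cone_in_def offBase_def offApex_def pts_hcofibre split: cone.splits)

lemma hcofibre_trivialI_aux:
 fixes z :: "'v::ab_group_add"
 assumes "cH + H' = S - z" and *: "S = \<alpha> + \<eta>" "cb = \<eta> - ap" "cP = r - \<alpha> - P'"
 shows "z = (cb - cP - cH) + (r - P' + ap - H')"
proof -
 have cH: "cH = S - z - H'" using assms(1) by (simp add: eq_diff_eq)
 show ?thesis unfolding cH * by (simp add: algebra_simps)
qed

text \<open>The boundary between the two parts of a subdivided relative cycle is a cycle in the
  overlap that bounds in \<open>Y\<close>, hence by injectivity in \<open>X\<close>. After this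
  correction the part off the apex is a cycle, by surjectivity homologous to one coming from
  \<open>X\<close> and thus to one at the apex; the other part contracts to the apex.\<close>

lemma hcofibre_trivialI:
 fixes K :: "'k::ab_group_add itself"
 assumes surj: "hsurj K X Y h d" and inj: "0 < d ==> hinj K X Y h (d - 1)"
 shows "trivial_group (reduced_homology K d hC Apex)"
 unfolding reduced_homology_def trivial_coeff_homology_iff
proof
 fix \<zeta> :: "(('x, 'y) cone, 'k) coeff_chain"
 let ?A = "SS (stop hC offBase)" and ?B = "SS (stop hC offApex)"
 let ?AB = "SS (stop hC (offBase \<inter> offApex))" and ?P = "SS (stop hC {Apex})"
 assume "\<zeta> : coeff_relcycle d hC {Apex}"
 hence k\<zeta>: "supp \<zeta> \<subseteq> SS hC d" and b\<zeta>: "supp (cbd d \<zeta>) \<subseteq> ?P (d - 1)"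
  by (auto simp: coeff_relcycle_def)
 have AC: "?A q \<subseteq> SS hC q" and BC: "?B q \<subseteq> SS hC q" and ABA: "?AB q \<subseteq> ?A q" and ABB: "?AB q \<subseteq> ?B q" for q
  by (rule SS_subtopology_subset SS_subtopology_mono Int_lower1 Int_lower2)+
 have PA: "?P q \<subseteq> ?A q" for q
  by (rule SS_subtopology_mono) (auto simp: offBase_def pts_hcofibre)
 obtain N \<zeta>A \<zeta>B where N: "subdiv N d \<zeta> = \<zeta>A + \<zeta>B"
  and kA: "supp \<zeta>A \<subseteq> ?A d" and kB: "supp \<zeta>B \<subseteq> ?B d"
  using hcofibre_split[OF k\<zeta>] by metis
 define dz' where "dz' = cbd d (subdiv N d \<zeta>)"
 have kdz: "supp dz' \<subseteq> ?P (d - 1)"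
  unfolding dz'_def cbd_subdiv[OF k\<zeta>] by (rule keys_subdiv[OF b\<zeta>])
 define \<xi> where "\<xi> = cbd d \<zeta>B"
 have \<xi>A: "\<xi> = dz' - cbd d \<zeta>A"
  unfolding \<xi>_def dz'_def N coeff_boundary_add by simp
 have "supp \<xi> \<subseteq> ?A (d - 1)"
  unfolding \<xi>A by (intro keys_diff_subset order.trans[OF kdz PA] keys_coeff_boundary kA)
 moreover have "supp \<xi> \<subseteq> ?B (d - 1)"
  unfolding \<xi>_def by (intro keys_coeff_boundary kB)
 ultimately have k\<xi>: "supp \<xi> \<subseteq> ?AB (d - 1)"
  unfolding SS_subtopology_Int by (rule Int_greatest)
 have \<xi>0: "cbd (d - 1) \<xi> = 0"
  using coeff_boundary_boundary[of "d - 1" \<zeta>B] by (cases d) (simp_all add: \<xi>_def)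
 have opAB: "openin hC (offBase \<inter> offApex)" using openin_offBase openin_offApex by blast
 have ident: "cmap q (%c. reparam \<phi> (c, 0)) c = c"
  if "!!u. \<phi> u 0 = u" "supp c \<subseteq> SS hC q" for \<phi> q and c :: "(('x, 'y) cone, 'k) coeff_chain"
 proof -
  have "cmap q (%c. reparam \<phi> (c, 0)) c = cmap q (%c. c) c"
  proof (rule cmap_cong)
   fix s x assume "s : supp c" "x : spx q"
   hence "s x : pts hC"
    using that(2) SS_image by blast
   thus "reparam \<phi> (s x, 0) = s x"
    using that(1) by (auto simp: reparam_def cone_in_def pts_hcofibre)
  qed
  also have "\<dots> = c" by (rule cmap_ident[OF order.trans[OF that(2) SS_extensional]])
  finally show ?thesis .
 qed
 have "\<exists>\<xi>'. supp \<xi>' \<subseteq> ?AB d \<and> cbd d \<xi>' = \<xi>"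
 proof (cases d)
  case 0
  thus ?thesis by (intro exI[of _ 0]) (simp add: \<xi>_def)
 next
  case (Suc e)
  have k\<xi>': "supp \<xi> \<subseteq> ?AB e" using k\<xi> Suc by simp
  have c\<xi>: "cyc ?AB e \<xi>" using k\<xi>' \<xi>0 Suc by (simp add: cyc_def)
  have "cyc (SS X) e (cmap e cpr \<xi>)"
   by (rule cyc_cmap[OF c\<xi>]) (rule simplex_map_SS[OF continuous_cpr])
  moreover have "bdr (SS Y) e (cmap e h (cmap e cpr \<xi>))"
  proof -
   have "cmap e h (cmap e cpr \<xi>) = cmap e cret \<xi>"
    unfolding cmap_cmap
   proof (rule cmap_cong)
    fix s x assume "s : supp \<xi>" "x : spx e"
    hence "s x : offBase \<inter> offApex"
     using k\<xi>' unfolding singular_simplex_subtopology by blast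
    thus "h (cpr (s x)) = cret (s x)"
     by (auto simp: offBase_def offApex_def cret_def cpr_def split: cone.splits)
   qed
   moreover have "bdr ?B e \<xi>" unfolding bdr_def \<xi>_def using kB Suc by auto
   ultimately show ?thesis
    using bdr_cmap[of ?B e \<xi> cret "SS Y"] simplex_map_SS[OF continuous_cret] by metis
  qed
  ultimately have "bdr (SS X) e (cmap e cpr \<xi>)"
   using inj Suc unfolding hinj_def by simp
  hence m1: "bdr ?AB e (cmap e cmid (cmap e cpr \<xi>))"
  proof (rule bdr_cmap)
   fix s assume s: "s : SS X (Suc e)"
   have "cts X (ptop X I01) (%x. (x, 1 / 2))"
    by (intro cts_pair) auto
   have st: "cts (Spx (Suc e)) (ptop X I01) (%t. (s t, 1/2))"
    by (intro cts_pair SS_continuous[OF s]) auto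
   have "cts (Spx (Suc e)) (cg_prod X I01) (%t. (s t, 1/2))"
    unfolding cg_prod_def
    by (rule cts_simplex_into_kify[where i = "%r::real. (undefined :: 'x, r)", OF _ st]) (simp add: inj_def)
   from cts_compose[OF this continuous_cone_in]
   have "cts (Spx (Suc e)) hC (%t. cmid (s t))" by (simp add: o_def cone_in_def)
   hence "cts (Spx (Suc e)) (stop hC (offBase \<inter> offApex)) (%t. cmid (s t))"
    using continuous_map_image_subset_topspace[of _ hC]
    by (intro cts_into) (auto simp: offBase_def offApex_def cts_def Pi_iff)
   from restrict_SS[OF this] show "smap (Suc e) cmid s : ?AB (Suc e)"
    by (simp add: simplex_map_def o_def)
  qed
  have m2: "bdr ?AB e (cmap e (%c. reparam (%u s. (1 - s) * u + s / 2) (c, 1)) \<xi> - cmap e (%c. reparam (%u s. (1 - s) * u + s / 2) (c, 0)) \<xi>)"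
  proof (rule homotopy_bdr[OF _ _ c\<xi>])
   show "?AB e \<subseteq> extensional (spx e)" by (rule SS_extensional)
   fix f g assume f: "f : ?AB e" and g: "cts (Spx (Suc e)) (cylinder e) g"
   show "(\<lambda>y\<in>spx (Suc e). reparam (%u s. (1 - s) * u + s / 2) (f (fst (g y)), snd (g y))) : ?AB (Suc e)"
   proof (rule reparam_homotopy_SS[OF continuous_reparam_maps(3) opAB _ _ _ f g])
    fix z assume z: "z : (offBase \<inter> offApex) \<times> {0..1::real}"
    have "0 < (1 - snd z) * u + snd z / 2 \<and> (1 - snd z) * u + snd z / 2 < 1" if "fst z = Cyl x u" for x u
    proof -
     have u: "0 < u" "u < 1" and s: "0 <= snd z" "snd z <= 1"
      using z that by (auto simp: offBase_def pts_hcofibre)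
     show ?thesis
     proof (cases "snd z = 1")
      case False
      hence "0 < (1 - snd z) * u" "(1 - snd z) * u < (1 - snd z) * 1"
       using u s by (auto intro!: mult_strict_left_mono mult_pos_pos simp del: mult_1_right)
      thus ?thesis using s by simp
     qed simp
    qed
    thus "reparam (%u s. (1 - s) * u + s / 2) z : offBase \<inter> offApex"
     using reparam_mem(2,3)[of "fst z" "%u s. (1 - s) * u + s / 2" "snd z"] z by (auto simp: offBase_def)
   qed (auto simp: offBase_def offApex_def)
  qed
  have m3: "cmap e (%c. reparam (%u s. (1 - s) * u + s / 2) (c, 0)) \<xi> = \<xi>"
   using k\<xi>' ABA[of e] AC[of e] by (intro ident) auto
  have m4: "cmap e (%c. reparam (%u s. (1 - s) * u + s / 2) (c, 1)) \<xi> = cmap e cmid (cmap e cpr \<xi>)"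
   unfolding cmap_cmap
  proof (rule cmap_cong)
   fix s x assume "s : supp \<xi>" "x : spx e"
   hence "s x : offBase \<inter> offApex"
    using k\<xi>' unfolding singular_simplex_subtopology by blast
   thus "reparam (%u s. (1 - s) * u + s / 2) (s x, 1) = cmid (cpr (s x))"
    by (auto simp: offBase_def offApex_def reparam_def cone_in_def cpr_def split: cone.splits)
  qed
  from bdr_diff[OF m1 m2[unfolded m3 m4]] show ?thesis unfolding bdr_def Suc by simp
 qed
 then obtain \<xi>' where \<xi>': "supp \<xi>' \<subseteq> ?AB d" "cbd d \<xi>' = \<xi>" by blast
 \<comment> \<open>Correcting both parts by \<open>\<xi>'\<close> makes the part off the apex a
   cycle; the part \<open>\<alpha>\<close> off the base then has its boundary at the apex.\<close>
 define \<eta> where "\<eta> = \<zeta>B - \<xi>'"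
 have c\<eta>: "cyc ?B d \<eta>"
  unfolding cyc_def \<eta>_def cbd_diff \<xi>'(2) \<xi>_def
  by (simp add: keys_diff_subset[OF kB order.trans[OF \<xi>'(1) ABB]])
 have "cyc (SS Y) d (cmap d cret \<eta>)"
  by (rule cyc_cmap[OF c\<eta>]) (rule simplex_map_SS[OF continuous_cret])
 then obtain x2 where x2: "cyc (SS X) d x2" "bdr (SS Y) d (cmap d cret \<eta> - cmap d h x2)"
  using surj unfolding hsurj_def by blast
 have e1: "bdr (SS hC) d (cmap d Base (cmap d cret \<eta> - cmap d h x2))"
  by (rule bdr_cmap[OF x2(2)]) (rule simplex_map_SS[OF continuous_Base])
 let ?\<phi>B = "%u s::real. u + s * (1 - u)"
 have e2: "bdr (SS hC) d (cmap d (%c. reparam ?\<phi>B (c, 1)) \<eta> - cmap d (%c. reparam ?\<phi>B (c, 0)) \<eta>)"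
 proof (rule homotopy_bdr[OF _ _ c\<eta>])
  show "?B d \<subseteq> extensional (spx d)" by (rule SS_extensional)
  fix f g assume f: "f : ?B d" and g: "cts (Spx (Suc d)) (cylinder d) g"
  have "(\<lambda>y\<in>spx (Suc d). reparam ?\<phi>B (f (fst (g y)), snd (g y))) : SS (stop hC UNIV) (Suc d)"
   by (rule reparam_homotopy_SS[OF continuous_reparam_maps(2) openin_offApex _ _ _ f g]) (auto simp: offApex_def)
  thus "(\<lambda>y\<in>spx (Suc d). reparam ?\<phi>B (f (fst (g y)), snd (g y))) : SS hC (Suc d)" by simp
 qed
 have e2a: "cmap d (%c. reparam ?\<phi>B (c, 0)) \<eta> = \<eta>"
  using c\<eta> BC[of d] by (intro ident) (auto simp: cyc_def)
 have e2b: "cmap d (%c. reparam ?\<phi>B (c, 1)) \<eta> = cmap d Base (cmap d cret \<eta>)"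
  unfolding cmap_cmap
 proof (rule cmap_cong)
  fix s x assume "s : supp \<eta>" "x : spx d"
  hence "s x : offApex"
   using c\<eta> unfolding singular_simplex_subtopology cyc_def by blast
  thus "reparam ?\<phi>B (s x, 1) = Base (cret (s x))"
   by (auto simp: offApex_def reparam_def cone_in_def cret_def split: cone.splits)
 qed
 have kx2: "supp x2 \<subseteq> SS X d" and zx2: "cbd d x2 = 0"
  using x2(1) by (auto simp: cyc_def)
 let ?a = "cmap d (%_. Apex) x2 :: (('x, 'y) cone, 'k) coeff_chain"
 \<comment> \<open>The cone on \<open>x2\<close> connects the image of \<open>x2\<close> in the base
   with a chain at the apex.\<close>
 have e3: "bdr (SS hC) d (?a - cmap d Base (cmap d h x2))"
 proof -
  have "supp (ext (prism d (%(x, s). cone_in h (x, 1 - s))) x2) \<subseteq> SS (stop hC UNIV) (Suc d)"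
   by (rule keys_ext_prism_cone[OF continuous_half(3) _ kx2]) simp
  moreover have "cbd (Suc d) (ext (prism d (%(x, s). cone_in h (x, 1 - s))) x2) = ?a - cmap d Base (cmap d h x2)"
   using cbd_prism[of x2 d "%(x, s). cone_in h (x, 1 - s)"] order.trans[OF kx2 SS_extensional] zx2
   by (simp add: cmap_cmap cone_in_def)
  ultimately show ?thesis unfolding bdr_def by auto
 qed
 have "bdr (SS hC) d (cmap d Base (cmap d cret \<eta> - cmap d h x2) - (cmap d Base (cmap d cret \<eta>) - \<eta>) - (?a - cmap d Base (cmap d h x2)))"
  by (rule bdr_diff[OF bdr_diff[OF e1 e2[unfolded e2a e2b]] e3])
 hence "bdr (SS hC) d (\<eta> - ?a)" by (simp add: cmap_diff algebra_simps)
 then obtain b2 where b2: "supp b2 \<subseteq> SS hC (Suc d)" "cbd (Suc d) b2 = \<eta> - ?a"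
  by (auto simp: bdr_def)
 define \<alpha> where "\<alpha> = \<zeta>A + \<xi>'"
 have k\<alpha>: "supp \<alpha> \<subseteq> ?A d"
  unfolding \<alpha>_def by (rule keys_add_subset[OF kA order.trans[OF \<xi>'(1) ABA]])
 have b\<alpha>: "cbd d \<alpha> = dz'"
  unfolding \<alpha>_def coeff_boundary_add \<xi>'(2) \<xi>A by simp
 let ?\<phi>A = "%u s::real. u * (1 - s)"
 let ?Pr = "ext (prism d (reparam ?\<phi>A)) \<alpha>" and ?Pr' = "ext (prism (d - 1) (reparam ?\<phi>A)) dz'"
 have kPr: "supp ?Pr \<subseteq> SS hC (Suc d)"
 proof (rule keys_ext_subset[OF k\<alpha>], rule keys_prism)
  fix f g assume f: "f : ?A d" and g: "cts (Spx (Suc d)) (cylinder d) g"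
  have "(\<lambda>y\<in>spx (Suc d). reparam ?\<phi>A (f (fst (g y)), snd (g y))) : SS (stop hC UNIV) (Suc d)"
   by (rule reparam_homotopy_SS[OF continuous_reparam_maps(1) openin_offBase _ _ _ f g]) (auto simp: offBase_def)
  thus "(\<lambda>y\<in>spx (Suc d). reparam ?\<phi>A (f (fst (g y)), snd (g y))) : SS hC (Suc d)" by simp
 qed
 have kPr': "supp ?Pr' \<subseteq> ?P d"
 proof (cases d)
  case 0
  thus ?thesis using b\<alpha> by simp
 next
  case (Suc e)
  have "supp (prism e (reparam ?\<phi>A) f) \<subseteq> ?P (Suc e)" if f: "f : ?P e" for f
  proof (rule keys_prism)
   fix g assume g: "cts (Spx (Suc e)) (cylinder e) g"
   have f': "f : ?A e" using f PA by blast
   have "f x = Apex" if "x : spx e" for x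
    using f that unfolding singular_simplex_subtopology by auto
   hence "reparam ?\<phi>A (f (fst (g y)), snd (g y)) = Apex" if "y : spx (Suc e)" for y
    using continuous_map_image_subset_topspace[OF g] that by (auto simp: image_subset_iff reparam_def)
   moreover have "(\<lambda>y\<in>spx (Suc e). Apex) : ?P (Suc e)"
    by (rule restrict_SS) (auto simp: pts_hcofibre)
   ultimately show "(\<lambda>y\<in>spx (Suc e). reparam ?\<phi>A (f (fst (g y)), snd (g y))) : ?P (Suc e)"
    by (simp cong: restrict_cong)
  qed
  moreover have "supp dz' \<subseteq> ?P e" using kdz Suc by simp
  ultimately have "supp (ext (prism e (reparam ?\<phi>A)) dz') \<subseteq> ?P (Suc e)"
   by (rule keys_ext_subset[rotated])
  thus ?thesis using Suc by simp
 qed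
 have bPr: "cbd (Suc d) ?Pr = cmap d (%c. reparam ?\<phi>A (c, 1)) \<alpha> - \<alpha> - ?Pr'"
  using cbd_prism[of \<alpha> d "reparam ?\<phi>A"] order.trans[OF k\<alpha> SS_extensional]
   ident[of ?\<phi>A \<alpha> d] order.trans[OF k\<alpha> AC] b\<alpha> by simp
 have kap: "supp (cmap d (%c. reparam ?\<phi>A (c, 1)) \<alpha>) \<subseteq> ?P d"
 proof (rule keys_cmap[OF k\<alpha>])
  fix f assume f: "f : ?A d"
  have "reparam ?\<phi>A (f x, 1) = Apex" if "x : spx d" for x
  proof -
   have "f x : offBase" using f that unfolding singular_simplex_subtopology by blast
   thus ?thesis by (auto simp: reparam_def offBase_def cone_in_def split: cone.splits)
  qed
  moreover have "(\<lambda>y\<in>spx d. Apex) : ?P d"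
   by (rule restrict_SS) (auto simp: pts_hcofibre)
  ultimately show "smap d (%c. reparam ?\<phi>A (c, 1)) f : ?P d"
   by (simp add: simplex_map_def o_def cong: restrict_cong)
 qed
 have ka: "supp ?a \<subseteq> ?P d"
 proof (rule keys_cmap[OF kx2])
  fix s assume s: "s : SS X d"
  have "cts X (stop hC {Apex}) (%_. Apex)" by (auto simp: pts_hcofibre)
  from simplex_map_SS[OF this s] show "smap d (%_. Apex) s : ?P d" .
 qed
 obtain hh where hh: "!!q X (c :: (('x, 'y) cone, 'k) coeff_chain). supp c \<subseteq> SS X q ==>
   supp (ext (hh q) c) \<subseteq> SS X (Suc q) \<and>
   cbd (Suc q) (ext (hh q) c) + ext (hh (q - 1)) (cbd q c) = subdiv N q c - c"
  using subdiv_homotopy[of N] by blast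
 define H where "H = ext (hh d) \<zeta>"
 define H' where "H' = ext (hh (d - 1)) (cbd d \<zeta>)"
 have kH: "supp H \<subseteq> SS hC (Suc d)" and eH: "cbd (Suc d) H + H' = subdiv N d \<zeta> - \<zeta>"
  using hh[OF k\<zeta>] by (auto simp: H_def H'_def)
 have kH': "supp H' \<subseteq> ?P d"
  using hh[OF b\<zeta>] by (cases d) (simp_all add: H'_def)
 define \<beta> where "\<beta> = b2 - ?Pr - H"
 define a where "a = cmap d (%c. reparam ?\<phi>A (c, 1)) \<alpha> - ?Pr' + ?a - H'"
 have "subdiv N d \<zeta> = \<alpha> + \<eta>" by (simp add: N \<alpha>_def \<eta>_def)
 from hcofibre_trivialI_aux[OF eH this b2(2) bPr]
 have "\<zeta> = cbd (Suc d) \<beta> + a"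
  unfolding \<beta>_def a_def cbd_diff .
 moreover have "supp \<beta> \<subseteq> SS hC (Suc d)"
  unfolding \<beta>_def by (intro keys_diff_subset b2(1) kPr kH)
 moreover have "supp a \<subseteq> ?P d"
  unfolding a_def by (intro keys_diff_subset keys_add_subset kap kPr' ka kH')
 ultimately show "\<zeta> : coeff_relboundary d hC {Apex}"
  unfolding coeff_relboundary_def by blast
qed

end

section \<open>Continuity into products: the action, configurations and paths\<close>

section \<open>Maps from large compact spaces into k-ified products\<close>

text \<open>
 A Hausdorff space with a dense subset \<open>D\<close> embeds into the sets of subsets of \<open>D\<close>, hence into
 \<open>'z set set\<close> if \<open>D\<close> is mapped injectively to \<open>'z\<close>.
\<close>

lemma closure_embedding:
 fixes u :: "'k => 'z"
 assumes H: "haus K" and D: "D \<subseteq> pts K" "inj_on u D"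
 shows "\<exists>j :: 'k => 'z set set. inj_on j (K closure_of D)"
proof
 let ?j = "%x. {u ` (D \<inter> U) | U. openin K U \<and> x : U}"
 show "inj_on ?j (K closure_of D)"
 proof (rule inj_onI, rule ccontr)
  fix x y assume x: "x : K closure_of D" and y: "y : K closure_of D" and eq: "?j x = ?j y" and "x ~= y"
  hence "x : pts K" "y : pts K" by (auto simp: in_closure_of)
  with H \<open>x ~= y\<close> obtain U V where UV: "openin K U" "openin K V" "x : U" "y : V" "disjnt U V"
   unfolding Hausdorff_space_def by metis
  have "u ` (D \<inter> U) : ?j x" using UV by blast
  hence "u ` (D \<inter> U) : ?j y" using eq by (rule subst[rotated])
  then obtain W where W: "openin K W" "y : W" "u ` (D \<inter> U) = u ` (D \<inter> W)" by blast
  hence DUW: "D \<inter> U = D \<inter> W"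
   using inj_on_image_eq_iff[OF D(2), of "D \<inter> U" "D \<inter> W"] by blast
  have "openin K (V \<inter> W)" "y : V \<inter> W" using UV W by auto
  then obtain z where "z : D" "z : V \<inter> W" using y unfolding in_closure_of by blast
  thus False using DUW UV(5) by (auto simp: disjnt_iff)
 qed
qed

text \<open>Choose one preimage of every point of the image and take the closure: the image does not
  change, and by \<open>closure_embedding\<close> the closure fits into
  \<open>'z set set\<close>.\<close>

lemma section_closure:
 fixes u :: "'k => 'z"
 assumes K: "compact_space K" "haus K"
 obtains K' and j :: "'k => 'z set set" where "closedin K K'" "inj_on j K'" "u ` K' = u ` pts K"
  "compact_space (stop K K')" "haus (stop K K')"
proof -
 define D where "D = inv_into (pts K) u ` (u ` pts K)"
 have D: "D \<subseteq> pts K" "u ` D = u ` pts K"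
  by (auto simp: D_def inv_into_into f_inv_into_f image_image)
 have "inj_on u D" by (auto simp: D_def inj_on_def f_inv_into_f)
 from closure_embedding[OF K(2) D(1) this] obtain j :: "'k => 'z set set" where j: "inj_on j (K closure_of D)"
  by (rule exE)
 have cl: "closedin K (K closure_of D)" by simp
 moreover have "u ` (K closure_of D) = u ` pts K"
 proof
  show "u ` (K closure_of D) \<subseteq> u ` pts K" using closedin_subset[OF cl] by blast
  show "u ` pts K \<subseteq> u ` (K closure_of D)"
   using closure_of_subset[OF D(1)] D(2) by blast
 qed
 moreover have "compact_space (stop K (K closure_of D))"
  using closedin_compact_space[OF K(1) cl] compact_space_subtopology by blast
 ultimately show thesis
  using that[of "K closure_of D" j] j Hausdorff_space_subtopology[OF K(2)] by blast
qed

text \<open>Weak Hausdorffness speaks of test spaces of one type. By \<open>section_closure\<close>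
  every compact Hausdorff space can be replaced by one of these without changing the image.\<close>

lemma weak_Hausdorff_closed_image:
 fixes X :: "'x topology" and K :: "'k topology"
 assumes X: "weak_Hausdorff X" and K: "compact_space K" "haus K" and u: "cts K X u"
 shows "closedin X (u ` pts K)"
proof -
 obtain K' and j :: "'k => 'x set set" where K': "closedin K K'" "inj_on j K'" "u ` K' = u ` pts K"
  "compact_space (stop K K')" "haus (stop K K')"
  using section_closure[OF K, of u] by metis
 let ?L = "stop K K'"
 have topL: "pts ?L = K'" using closedin_subset[OF K'(1)] by auto
 define L where "L = quotient_topology ?L j"
 have h: "homeomorphic_map ?L L j"
  unfolding homeomorphic_map_def L_def using quotient_map_quotient_topology K'(2) topL by auto
 have L: "compact_space L" "haus L"
  using K'(4,5) homeomorphic_map_imp_homeomorphic_space[OF h] homeomorphic_compact_space homeomorphic_Hausdorff_space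
  by blast+
 have "cts L X (u \<circ> inv_into K' j)"
  by (rule continuous_compose_quotient_map[OF h[unfolded homeomorphic_map_def, THEN conjunct1]])
   (rule cts_eq[OF cts_sub[OF u]], use K'(2) topL in simp)
 with L have "(L, u \<circ> inv_into K' j) : test_maps X" by (simp add: test_maps_def)
 with X have "closedin X ((u \<circ> inv_into K' j) ` pts L)" unfolding weak_Hausdorff_def by blast
 moreover have "(u \<circ> inv_into K' j) ` pts L = u ` K'"
  using K'(2) topL by (auto simp: L_def image_image)
 ultimately show ?thesis using K'(3) by simp
qed

text \<open>The fibres of \<open>v\<close> over the two points are disjoint closed sets of the
  normal space \<open>K\<close>. If \<open>P\<close> and \<open>Q\<close> separate them, the images
  of the complements of \<open>P\<close> and \<open>Q\<close> are closed, and the complements of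
  these images pull back to the required neighbourhoods.\<close>

lemma weak_Hausdorff_separate:
 assumes X: "weak_Hausdorff X" and K: "compact_space K" "haus K"
  and v: "cts K X v" "cts L X w"
  and xy: "x : pts K" "y : pts L" "v x ~= w y"
 shows "\<exists>U V. openin K U \<and> openin L V \<and> x : U \<and> y : V \<and> (\<forall>a\<in>U. \<forall>b\<in>V. v a ~= w b)"
proof -
 have cl: "closedin X (v ` C)" if C: "closedin K C" for C
 proof -
  have "pts (stop K C) = C" using closedin_subset[OF C] by auto
  moreover have "closedin X (v ` pts (stop K C))"
   by (rule weak_Hausdorff_closed_image[OF X _ _ cts_sub[OF v(1)]])
    (use closedin_compact_space[OF K(1) C] compact_space_subtopology Hausdorff_space_subtopology[OF K(2)] in blast)+
  ultimately show ?thesis by simp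
 qed
 have pt: "closedin X {z}" if "z : pts X" for z
 proof -
  have "closedin X ((%_::unit. z) ` pts (discrete_topology {()}))"
   by (rule weak_Hausdorff_closed_image[OF X]) (use that in \<open>auto simp: compact_space_discrete_topology\<close>)
  thus ?thesis by simp
 qed
 have vw: "v x : pts X" "w y : pts X"
  using xy v by (auto simp: cts_def)
 have c: "closedin K {a : pts K. v a : {v x}}" "closedin K {a : pts K. v a : {w y}}"
  by (rule closedin_continuous_map_preimage[OF v(1) pt[OF vw(1)]] closedin_continuous_map_preimage[OF v(1) pt[OF vw(2)]])+
 have N: "normal_space K"
  using K compact_Hausdorff_or_regular_imp_normal_space by blast
 have dj: "disjnt {a : pts K. v a : {v x}} {a : pts K. v a : {w y}}"
  using xy(3) by (auto simp: disjnt_iff)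
 obtain P Q where PQ: "openin K P" "openin K Q" "{a : pts K. v a : {v x}} \<subseteq> P"
   "{a : pts K. v a : {w y}} \<subseteq> Q" "disjnt P Q"
  using N[unfolded normal_space_def, rule_format, OF conjI[OF c(1) conjI[OF c(2) dj]]]
  by (elim exE conjE)
 have o1: "openin X (pts X - v ` (pts K - P))" and o2: "openin X (pts X - v ` (pts K - Q))"
  using cl PQ(1,2) by blast+
 let ?U = "{a : pts K. v a : pts X - v ` (pts K - P)}"
 let ?V = "{b : pts L. w b : pts X - v ` (pts K - Q)}"
 have "openin K ?U" "openin L ?V"
  by (rule cts_preimage[OF v(1) o1] cts_preimage[OF v(2) o2])+
 moreover have "x : ?U" using xy(1) PQ(3) vw by auto
 moreover have "y : ?V" using xy(2) PQ(4) vw by auto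
 moreover have "\<forall>a\<in>?U. \<forall>b\<in>?V. v a ~= w b"
 proof (intro ballI notI)
  fix a b assume a: "a : ?U" and b: "b : ?V" and eq: "v a = w b"
  have "v a \<notin> v ` (pts K - Q)" "v a \<notin> v ` (pts K - P)"
   using a b eq by auto
  hence "a : P" "a : Q" using a by blast+
  thus False using PQ(5) by (auto simp: disjnt_iff)
 qed
 ultimately show ?thesis by (intro exI[of _ ?U] exI[of _ ?V] conjI)
qed

text \<open>Continuity into the k-ification is available on a closed subset \<open>K'\<close> that
  fits the type of test spaces and has the same image. For closed \<open>C\<close> the preimage
  \<open>C'\<close> in \<open>K'\<close> is compact, and the preimage in \<open>K\<close> is the
  projection of the set of pairs in \<open>K\<close> times \<open>C'\<close> with equal values. That
  set is closed by \<open>weak_Hausdorff_separate\<close>, and projection along a compact space is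
  closed.\<close>

lemma cts_into_cg_prod:
 fixes X :: "'x topology" and Y :: "'y topology" and K :: "'k topology"
 assumes X: "weak_Hausdorff X" and Y: "haus Y"
  and K: "compact_space K" "haus K"
  and u: "cts K X u" and v: "cts K Y v"
 shows "cts K (cg_prod X Y) (%x. (u x, v x))"
proof -
 let ?w = "%x. (u x, v x)"
 have w: "cts K (ptop X Y) ?w" using u v by (rule cts_pair)
 obtain K' and j :: "'k => ('x \<times> 'y) set set" where K': "closedin K K'" "inj_on j K'" "?w ` K' = ?w ` pts K"
  "compact_space (stop K K')" "haus (stop K K')"
  using section_closure[OF K, of ?w] by metis
 have topK': "pts (stop K K') = K'" using closedin_subset[OF K'(1)] by auto
 have w': "cts (stop K K') (kify (ptop X Y)) ?w"
  by (rule cts_into_kify_gen[OF K'(4,5) _ cts_sub[OF w]]) (use K'(2) topK' in simp)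
 have "closedin K {x : pts K. ?w x : C}" if C: "closedin (cg_prod X Y) C" for C
 proof -
  define C' where "C' = {x : K'. ?w x : C}"
  have "{x : pts (stop K K'). ?w x : C} = C'"
   by (simp only: topK' C'_def)
  with closedin_continuous_map_preimage[OF w' C[unfolded cg_prod_def]]
  have "closedin (stop K K') C'" by (simp only:)
  hence clC': "closedin K C'" using K'(1) closedin_trans_full by blast
  have topC': "pts (stop K C') = C'" using closedin_subset[OF clC'] by auto
  have cC': "compact_space (stop K C')"
   using closedin_compact_space[OF K(1) clC'] compact_space_subtopology by blast
  let ?P = "ptop K (stop K C')"
  let ?E = "{p : pts ?P. ?w (fst p) = ?w (snd p)}"
  have "openin ?P (pts ?P - ?E)"
  proof (subst openin_subopen, rule ballI)
   fix p assume p: "p : pts ?P - ?E"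
   obtain x y where xy: "p = (x, y)" "x : pts K" "y : C'" "?w x ~= ?w y"
    using p topC' by (cases p) auto
   have yK: "y : pts K" using xy(3) closedin_subset[OF clC'] by blast
   obtain U V where UV: "openin K U" "openin K V" "x : U" "y : V" "\<forall>a\<in>U. \<forall>b\<in>V. ?w a ~= ?w b"
   proof (cases "u x = u y")
    case False
    from weak_Hausdorff_separate[OF X K u u xy(2) yK this]
    obtain U V where "openin K U" "openin K V" "x : U" "y : V" "\<forall>a\<in>U. \<forall>b\<in>V. u a ~= u b"
     by (elim exE conjE)
    thus ?thesis by (intro that[of U V]) auto
   next
    case True
    hence "v x ~= v y" using xy by auto
    moreover have "v x : pts Y" "v y : pts Y"
     using v xy(2) yK by (auto simp: cts_def)
    ultimately obtain P Q where PQ: "openin Y P" "openin Y Q" "v x : P" "v y : Q" "disjnt P Q"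
     using Y unfolding Hausdorff_space_def by metis
    show ?thesis
    proof (rule that)
     show "openin K {a : pts K. v a : P}" "openin K {a : pts K. v a : Q}"
      by (rule cts_preimage[OF v] PQ)+
     show "x : {a : pts K. v a : P}" "y : {a : pts K. v a : Q}"
      using xy yK PQ by auto
     show "\<forall>a\<in>{a : pts K. v a : P}. \<forall>b\<in>{a : pts K. v a : Q}. ?w a ~= ?w b"
      using PQ(5) by (auto simp: disjnt_iff)
    qed
   qed
   have "openin ?P (U \<times> (C' \<inter> V))"
    using UV(1,2) by (simp add: openin_prod_Times_iff openin_subtopology_Int2)
   moreover have "U \<times> (C' \<inter> V) \<subseteq> pts ?P - ?E"
   proof
    fix q assume "q : U \<times> (C' \<inter> V)"
    hence q: "fst q : U" "snd q : V" "snd q : C'" by auto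
    with UV(5) have "?w (fst q) ~= ?w (snd q)" by blast
    moreover have "q : pts ?P"
     using q openin_subset[OF UV(1)] topC' by (auto simp: mem_Times_iff)
    ultimately show "q : pts ?P - ?E" by blast
   qed
   moreover have "p : U \<times> (C' \<inter> V)" using UV xy by simp
   ultimately show "\<exists>T. openin ?P T \<and> p : T \<and> T \<subseteq> pts ?P - ?E"
    by (intro exI[of _ "U \<times> (C' \<inter> V)"] conjI)
  qed
  hence "closedin ?P ?E" unfolding closedin_def by simp
  hence "closedin K (fst ` ?E)"
   by (rule closed_map_fst[OF cC', of K, unfolded closed_map_def, rule_format])
  moreover have "fst ` ?E = {x : pts K. ?w x : C}"
  proof (intro equalityI subsetI)
   fix x assume "x : fst ` ?E"
   then obtain p where p: "p : ?E" "x = fst p" by blast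
   have "fst p : pts K" "snd p : C'"
    using p(1) topC' by (simp_all add: mem_Times_iff)
   moreover from this have "?w (snd p) : C" by (simp only: C'_def mem_Collect_eq)
   moreover have "?w (fst p) = ?w (snd p)" using p(1) by blast
   ultimately show "x : {x : pts K. ?w x : C}" by (simp only: p(2) mem_Collect_eq simp_thms)
  next
   fix x assume x: "x : {x : pts K. ?w x : C}"
   hence "?w x : ?w ` K'" unfolding K'(3) by blast
   then obtain y where "y : K'" "?w x = ?w y" by blast
   moreover from this have "y : C'" using x by (simp only: C'_def mem_Collect_eq simp_thms)
   ultimately have "(x, y) : ?E" using x topC' by simp
   hence "fst (x, y) : fst ` ?E" by (rule imageI)
   thus "x : fst ` ?E" by simp
  qed
  ultimately show ?thesis by simp
 qed
 moreover have "?w : pts K \<rightarrow> pts (cg_prod X Y)"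
  using u v by (auto simp: cts_def)
 ultimately show ?thesis unfolding continuous_map_closedin by blast
qed

lemma cts_locally:
 assumes "!!x. x : pts X ==> \<exists>U. openin X U \<and> x : U \<and> cts (stop X U) Y f"
 shows "cts X Y f"
 unfolding cts_def
proof (intro conjI allI impI)
 show "f : pts X \<rightarrow> pts Y"
 proof
  fix x assume "x : pts X"
  with assms[OF this] show "f x : pts Y" by (auto simp: cts_def)
 qed
 fix W assume W: "openin Y W"
 show "openin X {x : pts X. f x : W}"
 proof (subst openin_subopen, rule ballI)
  fix x assume x: "x : {x : pts X. f x : W}"
  then obtain U where U: "openin X U" "x : U" "cts (stop X U) Y f" using assms by blast
  have "openin (stop X U) {z : pts (stop X U). f z : W}"
   by (rule cts_preimage[OF U(3) W])
  hence "openin X {z : pts (stop X U). f z : W}"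
   using U(1) openin_trans_full by blast
  thus "\<exists>T. openin X T \<and> x : T \<and> T \<subseteq> {x : pts X. f x : W}"
   using x U(2) by (intro exI[of _ "{z : pts (stop X U). f z : W}"]) auto
 qed
qed

text \<open>Every point has a compact Hausdorff neighbourhood, to which
  \<open>cts_into_cg_prod\<close> applies.\<close>

lemma cts_act_gen:
 fixes X :: "'x topology"
 assumes M: "weak_Hausdorff M" and S: "haus S" and act: "cts (cg_prod M S) N (%(x, s). a x s)"
  and X: "lcs X" "haus X"
  and u: "cts X M u" and v: "cts X S v"
 shows "cts X N (%x. a (u x) (v x))"
proof (rule cts_locally)
 fix x assume "x : pts X"
 then obtain U C where UC: "openin X U" "compactin X C" "x : U" "U \<subseteq> C"
  using X(1) unfolding locally_compact_space_def by blast
 have "cts (stop X C) (cg_prod M S) (%x. (u x, v x))"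
  by (rule cts_into_cg_prod[OF M S])
   (use UC(2) compact_space_subtopology Hausdorff_space_subtopology[OF X(2)] cts_sub u v in blast)+
 from cts_compose[OF this act] have "cts (stop X C) N (%x. a (u x) (v x))"
  by (simp add: o_def)
 hence "cts (stop X U) N (%x. a (u x) (v x))"
  using continuous_map_from_subtopology_mono UC(4) by blast
 thus "\<exists>U. openin X U \<and> x : U \<and> cts (stop X U) N (%x. a (u x) (v x))"
  using UC by blast
qed

section \<open>The topology of the monoid of little squares\<close>

lemma cm_comp: "cts X euclidean f ==> continuous_on UNIV g ==> cts X euclidean (%x. g (f x))"
 using cts_compose[of X euclidean f euclidean g] by (simp add: o_def)

lemma cm_pair:
 "cts X euclidean f ==> cts X euclidean g ==> cts X euclidean (%x. (f x, g x))"
 using cts_pair[of X euclidean f euclidean g] by simp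

definition good :: "real => square => bool" where
 "good t e \<longleftrightarrow> 0 <= fst (fst e) \<and> fst (fst e) + fst (snd e) <= t \<and> 0 <= snd (fst e) \<and>
  snd (fst e) + snd (snd e) <= 1 \<and> 0 < fst (snd e) \<and> 0 < snd (snd e)"

definition ysep :: "square => square => bool" where
 "ysep e e' \<longleftrightarrow> snd (fst e) + snd (snd e) <= snd (fst e') \<or> snd (fst e') + snd (snd e') <= snd (fst e)"

definition sep :: "square => square => bool" where
 "sep e e' \<longleftrightarrow> fst (fst e) + fst (snd e) <= fst (fst e') \<or> fst (fst e') + fst (snd e') <= fst (fst e) \<or> ysep e e'"

lemma square_map_image:
 assumes "0 < w" "0 < h"
 shows "square_map ((x, y), (w, h)) ` unit_square = {x..x + w} \<times> {y..y + h}"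
proof (intro equalityI subsetI)
 fix z assume "z : {x..x + w} \<times> {y..y + h}"
 then obtain a b where z: "z = (a, b)" "x <= a" "a <= x + w" "y <= b" "b <= y + h" by auto
 have "z = square_map ((x, y), (w, h)) ((a - x) / w, (b - y) / h)"
  using assms by (simp add: z(1) square_map_def)
 moreover have "((a - x) / w, (b - y) / h) : unit_square"
  using assms z by (simp add: field_simps)
 ultimately show "z : square_map ((x, y), (w, h)) ` unit_square" by blast
next
 fix z assume "z : square_map ((x, y), (w, h)) ` unit_square"
 then obtain a b where ab: "0 <= a" "a <= 1" "0 <= b" "b <= 1" "z = (x + w * a, y + h * b)"
  by (auto simp: square_map_def)
 have "w * a <= w * 1" "h * b <= h * 1" using assms ab by (auto intro: mult_left_mono simp del: mult_1_right)
 thus "z : {x..x + w} \<times> {y..y + h}" using assms ab by simp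
qed

lemma unit_square_good:
 assumes "0 < fst (snd e)" "0 < snd (snd e)"
 shows "square_map e ` unit_square \<subseteq> unit_square \<longleftrightarrow> good 1 e"
proof -
 obtain x y w h where e: "e = ((x, y), (w, h))" by (metis prod.collapse)
 show ?thesis
  using assms unfolding e square_map_image[OF assms[unfolded e fst_conv snd_conv]]
  by (auto simp: good_def times_subset_iff)
qed

lemma disjoint_iff_sep:
 assumes "0 < fst (snd e)" "0 < snd (snd e)" "0 < fst (snd e')" "0 < snd (snd e')"
 shows "interior (square_map e ` unit_square) \<inter> interior (square_map e' ` unit_square) = {} \<longleftrightarrow> sep e e'"
proof -
 obtain x y w h where e: "e = ((x, y), (w, h))" by (metis prod.collapse)
 obtain x' y' w' h' where e': "e' = ((x', y'), (w', h'))" by (metis prod.collapse)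
 have pos: "0 < w" "0 < h" "0 < w'" "0 < h'" using assms by (auto simp: e e')
 have I: "{a<..<b} \<inter> {c<..<d} = {} \<longleftrightarrow> b <= c \<or> d <= a" if "a < b" "c < d" for a b c d :: real
 proof
  assume em: "{a<..<b} \<inter> {c<..<d} = {}"
  show "b <= c \<or> d <= a"
  proof (rule ccontr)
   assume "\<not> ?thesis"
   hence "(max a c + min b d) / 2 : {a<..<b} \<inter> {c<..<d}" using that by (auto simp: max_def min_def)
   thus False using em by blast
  qed
 qed auto
 have "interior (square_map e ` unit_square) \<inter> interior (square_map e' ` unit_square) =
   ({x<..<x + w} \<inter> {x'<..<x' + w'}) \<times> ({y<..<y + h} \<inter> {y'<..<y' + h'})"
  unfolding e e' square_map_image[OF pos(1,2)] square_map_image[OF pos(3,4)] interior_Times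
  by (auto simp: interior_atLeastAtMost_real)
 thus ?thesis
  using I[of x "x + w" x' "x' + w'"] I[of y "y + h" y' "y' + h'"] pos
  by (simp add: sep_def ysep_def e e' Times_empty)
qed

lemma good_stretch: "0 < t ==> good 1 e \<longleftrightarrow> good t (stretch t e)"
 by (auto simp: good_def stretch_def zero_le_mult_iff zero_less_mult_iff simp flip: distrib_left
   intro: mult_left_le dest: mult_left_le_imp_le[of t _ 1, simplified])

lemma sep_stretch: "0 < t ==> sep (stretch t e) (stretch t e') \<longleftrightarrow> sep e e'"
 by (simp add: sep_def ysep_def stretch_def flip: distrib_left)

lemma sep_sym: "sep e e' \<longleftrightarrow> sep e' e"
 by (auto simp: sep_def ysep_def)

lemma stretch_inverse: "t ~= 0 ==> stretch t (stretch (1 / t) e) = e"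
 by (simp add: stretch_def)

lemma topspace_C2:
 "pts (C2 n) = {c : {..<n} \<rightarrow>\<^sub>E UNIV. (\<forall>i<n. good 1 (c i)) \<and> (\<forall>i<n. \<forall>j<n. i ~= j --> sep (c i) (c j))}"
proof (rule Set.set_eqI)
 fix c :: "nat => square"
 have g: "0 < fst (snd e) \<and> 0 < snd (snd e) \<and> square_map e ` unit_square \<subseteq> unit_square \<longleftrightarrow> good 1 e" for e
 proof (cases "0 < fst (snd e) \<and> 0 < snd (snd e)")
  case True
  thus ?thesis using unit_square_good[of e] by simp
 next
  case False
  thus ?thesis unfolding good_def by blast
 qed
 show "c : pts (C2 n) \<longleftrightarrow> c : {c : {..<n} \<rightarrow>\<^sub>E UNIV. (\<forall>i<n. good 1 (c i)) \<and>
   (\<forall>i<n. \<forall>j<n. i ~= j --> sep (c i) (c j))}"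
 proof (cases "\<forall>i<n. good 1 (c i)")
  case True
  hence "interior (square_map (c i) ` unit_square) \<inter> interior (square_map (c j) ` unit_square) = {} \<longleftrightarrow> sep (c i) (c j)"
   if "i < n" "j < n" for i j
   using disjoint_iff_sep that by (simp add: good_def)
  hence B: "(\<forall>i<n. \<forall>j<n. i ~= j -->
      interior (square_map (c i) ` unit_square) \<inter> interior (square_map (c j) ` unit_square) = {}) \<longleftrightarrow>
   (\<forall>i<n. \<forall>j<n. i ~= j --> sep (c i) (c j))" by blast
  show ?thesis
   unfolding C2_def topspace_subtopology topspace_product_topology topspace_euclidean Int_iff mem_Collect_eq g B
   by (rule refl)
 next
  case False
  thus ?thesis
   unfolding C2_def topspace_subtopology topspace_product_topology topspace_euclidean Int_iff mem_Collect_eq g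
   by blast
 qed
qed

definition confs :: "nat => conf set" where
 "confs n = (if n = 0 then {sunit} else {(t, E). 0 < t \<and> finite E \<and> card E = n \<and> (\<forall>e\<in>E. good t e) \<and>
  (\<forall>e\<in>E. \<forall>e'\<in>E. e ~= e' --> sep e e')})"

lemma sep_irrefl: "good t e ==> \<not> sep e e"
 by (auto simp: good_def sep_def ysep_def)

lemma topspace_S: "pts (\<S> n) = confs n"
proof (cases "n = 0")
 case False
 let ?q = "%(t, c). (t, (%i. stretch t (c i)) ` {..<n})"
 have "pts (\<S> n) = ?q ` ({0<..} \<times> pts (C2 n))"
  using False by (simp add: \<S>_def)
 also have "\<dots> = confs n"
 proof (intro equalityI subsetI)
  fix s assume "s : ?q ` ({0<..} \<times> pts (C2 n))"
  then obtain t c where s: "s = (t, (%i. stretch t (c i)) ` {..<n})" "0 < t" "c : pts (C2 n)" by auto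
  have g: "good t (stretch t (c i))" if "i < n" for i
   using s that good_stretch[OF s(2)] by (auto simp: topspace_C2)
  have sp: "sep (stretch t (c i)) (stretch t (c j))" if "i < n" "j < n" "i ~= j" for i j
   using s that sep_stretch[OF s(2)] by (auto simp: topspace_C2)
  have "inj_on (%i. stretch t (c i)) {..<n}"
  proof (rule inj_onI, rule ccontr)
   fix i j assume ij: "i : {..<n}" "j : {..<n}" "stretch t (c i) = stretch t (c j)" "i ~= j"
   hence "sep (stretch t (c j)) (stretch t (c j))" using sp[of i j] by simp
   thus False using sep_irrefl[OF g[of j]] ij(2) by simp
  qed
  from card_image[OF this] show "s : confs n"
   using False s(2) g sp by (auto simp: confs_def s(1))
 next
  fix s assume "s : confs n"
  then obtain t E where s: "s = (t, E)" "0 < t" "finite E" "card E = n" "\<forall>e\<in>E. good t e"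
    "\<forall>e\<in>E. \<forall>e'\<in>E. e ~= e' --> sep e e'"
   using False by (auto simp: confs_def)
  obtain f where f: "bij_betw f {..<n} E"
   using s(3,4) by (metis ex_bij_betw_nat_finite atLeast0LessThan)
  define c where "c = (\<lambda>i\<in>{..<n}. stretch (1 / t) (f i))"
  have st: "stretch t (c i) = f i" if "i < n" for i
   using s(2) that by (simp add: c_def stretch_inverse)
  have fE: "f i : E" if "i < n" for i using f that by (auto simp: bij_betw_def)
  have "good 1 (c i)" if "i < n" for i
   using good_stretch[OF s(2), of "c i"] st[OF that] s(5) fE[OF that] by simp
  moreover have "sep (c i) (c j)" if "i < n" "j < n" "i ~= j" for i j
  proof -
   have "f i ~= f j" using f that by (auto simp: bij_betw_def inj_on_def)
   thus ?thesis
    using sep_stretch[OF s(2), of "c i" "c j"] st that s(6) fE by simp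
  qed
  ultimately have "c : pts (C2 n)" by (auto simp: topspace_C2 c_def)
  moreover have "(%i. stretch t (c i)) ` {..<n} = E"
   using st f by (auto simp: bij_betw_def image_iff)
  ultimately show "s : ?q ` ({0<..} \<times> pts (C2 n))"
   using s(1,2) by (intro image_eqI[of _ _ "(t, c)"]) auto
 qed
 finally show ?thesis .
qed (simp add: \<S>_def confs_def sunit_def)

lemma quotient_map_S:
 "0 < n ==> quotient_map (ptop (top_of_set {0<..}) (C2 n)) (\<S> n)
  (%(t, c). (t, (%i. stretch t (c i)) ` {..<n}))"
 unfolding \<S>_def using quotient_map_quotient_topology by auto

lemma continuous_C2_component:
 assumes "i < n"
 shows "cts (ptop (top_of_set {0<..}) (C2 n)) euclidean (%p. stretch (fst p) (snd p i))"
proof -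
 let ?P = "ptop (top_of_set {0<..}) (C2 n)"
 have 1: "cts ?P rtop fst"
  by (rule cts_full[OF cts_fst])
 have "cts (C2 n) euclidean (%c. c i)"
  unfolding C2_def by (intro cts_sub continuous_map_product_projection) (use assms in auto)
 from cts_compose[OF cts_snd this]
 have 2: "cts ?P euclidean (%p. snd p i)" by (simp add: o_def)
 from cm_comp[OF cm_pair[OF 1 2], of "%(t, e). stretch t e"]
 show ?thesis
  by (simp add: stretch_def case_prod_beta continuous_intros)
qed

lemma cts_S_fst: "cts (\<S> n) rtop fst"
proof (cases "n = 0")
 case False
 thus ?thesis
  by (intro continuous_compose_quotient_map[OF quotient_map_S])
   (auto simp: o_def case_prod_beta intro!: cts_full[OF cts_fst])
qed (simp add: \<S>_def)

text \<open>In the source of the quotient map, where squares are labelled, the condition is a union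
  over the labels.\<close>

lemma openin_S_hit:
 assumes "open N"
 shows "openin (\<S> n) {s : pts (\<S> n). snd s \<inter> N ~= {}}"
proof (cases "n = 0")
 case False
 let ?P = "ptop (top_of_set {0<..}) (C2 n)"
 let ?q = "%(t, c). (t, (%i. stretch t (c i)) ` {..<n})"
 have q: "quotient_map ?P (\<S> n) ?q" using False by (simp add: quotient_map_S)
 have "{p : pts ?P. ?q p : {s : pts (\<S> n). snd s \<inter> N ~= {}}} =
   (\<Union>i\<in>{..<n}. {p : pts ?P. stretch (fst p) (snd p i) : N})"
  using quotient_imp_surjective_map[OF q] by fastforce
 moreover have "openin ?P {p : pts ?P. stretch (fst p) (snd p i) : N}" if "i < n" for i
  by (rule cts_preimage[OF continuous_C2_component[OF that]]) (use assms in simp)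
 ultimately have "openin ?P {p : pts ?P. ?q p : {s : pts (\<S> n). snd s \<inter> N ~= {}}}"
  by auto
 thus ?thesis
  by (rule iffD1[OF q[unfolded quotient_map_def, THEN conjunct2, rule_format], rotated]) blast
qed (auto simp: \<S>_def)

lemma closedin_S_hit:
 assumes "closed N"
 shows "closedin (\<S> n) {s : pts (\<S> n). snd s \<inter> N ~= {}}"
proof (cases "n = 0")
 case False
 let ?P = "ptop (top_of_set {0<..}) (C2 n)"
 let ?q = "%(t, c). (t, (%i. stretch t (c i)) ` {..<n})"
 have q: "quotient_map ?P (\<S> n) ?q" using False by (simp add: quotient_map_S)
 have "{p : pts ?P. ?q p : {s : pts (\<S> n). snd s \<inter> N ~= {}}} =
   (\<Union>i\<in>{..<n}. {p : pts ?P. stretch (fst p) (snd p i) : N})"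
  using quotient_imp_surjective_map[OF q] by fastforce
 moreover have "closedin ?P {p : pts ?P. stretch (fst p) (snd p i) : N}" if "i < n" for i
  by (rule closedin_continuous_map_preimage[OF continuous_C2_component[OF that]]) (use assms in simp)
 ultimately have "closedin ?P {p : pts ?P. ?q p : {s : pts (\<S> n). snd s \<inter> N ~= {}}}"
  by (auto intro!: closedin_Union)
 thus ?thesis
  by (rule iffD1[OF q[unfolded quotient_map_closedin, THEN conjunct2, rule_format], rotated]) blast
qed (auto simp: \<S>_def)

text \<open>Different widths separate configurations. For equal widths, equal cardinality provides a
  square of the first that the second lacks; a small ball around it is hit by the first, and its
  closure is missed by the second.\<close>

lemma Hausdorff_space_S: "haus (\<S> n)"
 unfolding Hausdorff_space_def
proof (intro allI impI)
 fix s s' assume *: "s : pts (\<S> n) \<and> s' : pts (\<S> n) \<and> s ~= s'"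
 hence n: "n ~= 0" by (auto simp: \<S>_def split: if_splits)
 show "\<exists>U V. openin (\<S> n) U \<and> openin (\<S> n) V \<and> s : U \<and> s' : V \<and> disjnt U V"
 proof (cases "fst s = fst s'")
  case False
  obtain U V where UV: "open U" "open V" "fst s : U" "fst s' : V" "U \<inter> V = {}"
   using hausdorff[OF False] by (elim exE conjE)
  let ?U = "{s : pts (\<S> n). fst s : U}" and ?V = "{s : pts (\<S> n). fst s : V}"
  have "openin (\<S> n) ?U" "openin (\<S> n) ?V"
   using UV by (auto intro!: cts_preimage[OF cts_S_fst])
  moreover have "s : ?U" "s' : ?V" using * UV by simp_all
  moreover have "disjnt ?U ?V" using UV(5) by (auto simp: disjnt_iff)
  ultimately show ?thesis by (intro exI[of _ ?U] exI[of _ ?V] conjI)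
 next
  case True
  have fin: "finite (snd s)" "finite (snd s')" and crd: "card (snd s) = n" "card (snd s') = n"
   using * n by (auto simp: topspace_S confs_def)
  have "snd s ~= snd s'" using * True by (auto simp: prod_eq_iff)
  hence "\<not> snd s \<subseteq> snd s'" using card_subset_eq[OF fin(2)] crd by metis
  then obtain e where e: "e : snd s" "e \<notin> snd s'" by blast
  have "open (- snd s')" using fin(2) by (simp add: finite_imp_closed open_Compl)
  then obtain d where d: "0 < d" "cball e d \<subseteq> - snd s'"
   using e(2) open_contains_cball by blast
  let ?U = "{s : pts (\<S> n). snd s \<inter> ball e d ~= {}}"
  let ?V = "pts (\<S> n) - {s : pts (\<S> n). snd s \<inter> cball e d ~= {}}"
  have "openin (\<S> n) ?U" "openin (\<S> n) ?V"
   using openin_S_hit[of "ball e d" n] closedin_S_hit[of "cball e d" n] by auto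
  moreover have "e : snd s \<inter> ball e d" using e d by simp
  hence "s : ?U" using * by blast
  moreover have "s' : ?V" using * d(2) by blast
  moreover have "disjnt ?U ?V"
   using ball_subset_cball[of e d] unfolding disjnt_def by blast
  ultimately show ?thesis by (intro exI[of _ ?U] exI[of _ ?V] conjI)
 qed
qed

text \<open>Rescaling to width 1 lifts the family to the source of the quotient map.\<close>

lemma cts_into_S:
 assumes n: "0 < n" and t: "cts X rtop t"
  and e: "!!i. i < n ==> cts X euclidean (e i)"
  and pos: "!!x. x : pts X ==> 0 < t x"
  and good: "!!x i. x : pts X ==> i < n ==> good (t x) (e i x)"
  and sep: "!!x i j. x : pts X ==> i < n ==> j < n ==> i ~= j ==> sep (e i x) (e j x)"
 shows "cts X (\<S> n) (%x. (t x, (%i. e i x) ` {..<n}))"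
proof -
 let ?c = "%x. \<lambda>i\<in>{..<n}. stretch (1 / t x) (e i x)"
 have ti: "cts X rtop (%x. 1 / t x)"
  by (intro continuous_map_real_divide t) (use pos in fastforce)+
 have "cts X euclidean (%x. stretch (1 / t x) (e i x))" if "i < n" for i
  using cm_comp[OF cm_pair[OF ti e[OF that]], of "%(t, e). stretch t e"]
  by (simp add: stretch_def case_prod_beta continuous_intros)
 hence "cts X (product_topology (%_. euclidean) {..<n}) ?c"
  by (auto simp: continuous_map_componentwise)
 moreover have "?c x : pts (C2 n)" if x: "x : pts X" for x
  using good_stretch[OF pos[OF x], of "stretch (1 / t x) (e _ x)"] good[OF x] pos[OF x]
   sep_stretch[OF pos[OF x], of "stretch (1 / t x) (e _ x)" "stretch (1 / t x) (e _ x)"] sep[OF x]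
  by (auto simp: topspace_C2 stretch_inverse)
 moreover have "C2 n = stop (product_topology (%_. euclidean) {..<n}) (pts (C2 n))"
  unfolding C2_def topspace_subtopology by (simp only: subtopology_restrict)
 ultimately have "cts X (C2 n) ?c"
  by (metis (no_types, lifting) PiE cts_into funcsetI)
 moreover have "cts X (top_of_set {0<..}) t"
  by (intro cts_into t) (use pos in auto)
 ultimately have "cts X (ptop (top_of_set {0<..}) (C2 n)) (%x. (t x, ?c x))"
  by (rule cts_pair[rotated])
 from cts_compose[OF this quotient_imp_continuous_map[OF quotient_map_S[OF n]]]
 have "cts X (\<S> n) (%x. (t x, (%i. stretch (t x) (?c x i)) ` {..<n}))" by (simp add: o_def)
 thus ?thesis
  by (rule cts_eq) (use pos in \<open>force simp: stretch_inverse intro!: image_cong\<close>)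
qed

text \<open>
 A configuration has at most one square in such a neighbourhood, and the neighbourhoods of
 separated squares are disjoint.
\<close>

definition near :: "square => square set" where
 "near a = {e. \<bar>fst (fst e) - fst (fst a)\<bar> < fst (snd a) / 8 \<and> \<bar>fst (snd e) - fst (snd a)\<bar> < fst (snd a) / 8 \<and>
  \<bar>snd (fst e) - snd (fst a)\<bar> < snd (snd a) / 8 \<and> \<bar>snd (snd e) - snd (snd a)\<bar> < snd (snd a) / 8}"

lemma open_near: "open (near a)"
 unfolding near_def by (intro open_Collect_conj open_Collect_less continuous_intros)

lemma near_self: "good t a ==> a : near a"
 by (simp add: near_def good_def)

lemma near_bounds:
 assumes "e : near a"
 shows "fst (fst e) < fst (fst a) + fst (snd a) / 8" "fst (fst a) - fst (snd a) / 8 < fst (fst e)"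
  "fst (snd e) < 9 / 8 * fst (snd a)" "7 / 8 * fst (snd a) < fst (snd e)"
  "snd (fst e) < snd (fst a) + snd (snd a) / 8" "snd (fst a) - snd (snd a) / 8 < snd (fst e)"
  "snd (snd e) < 9 / 8 * snd (snd a)" "7 / 8 * snd (snd a) < snd (snd e)"
proof -
 have *: "x < b + c / 8 \<and> b - c / 8 < x" if "\<bar>x - b\<bar> < c / 8" for x b c :: real
  using that by linarith
 have **: "x < 9 / 8 * c \<and> 7 / 8 * c < x" if "\<bar>x - c\<bar> < c / 8" for x c :: real
  using that by linarith
 have n: "\<bar>fst (fst e) - fst (fst a)\<bar> < fst (snd a) / 8" "\<bar>fst (snd e) - fst (snd a)\<bar> < fst (snd a) / 8"
  "\<bar>snd (fst e) - snd (fst a)\<bar> < snd (snd a) / 8" "\<bar>snd (snd e) - snd (snd a)\<bar> < snd (snd a) / 8"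
  using assms by (simp_all add: near_def)
 show "fst (fst e) < fst (fst a) + fst (snd a) / 8" "fst (fst a) - fst (snd a) / 8 < fst (fst e)"
  by (use *[OF n(1)] in blast)+
 show "fst (snd e) < 9 / 8 * fst (snd a)" "7 / 8 * fst (snd a) < fst (snd e)"
  by (use **[OF n(2)] in blast)+
 show "snd (fst e) < snd (fst a) + snd (snd a) / 8" "snd (fst a) - snd (snd a) / 8 < snd (fst e)"
  by (use *[OF n(3)] in blast)+
 show "snd (snd e) < 9 / 8 * snd (snd a)" "7 / 8 * snd (snd a) < snd (snd e)"
  by (use **[OF n(4)] in blast)+
qed

lemma near_not_sep:
 assumes "e : near a" "e' : near a"
 shows "\<not> sep e e'"
 using near_bounds[OF assms(1)] near_bounds[OF assms(2)]
 unfolding sep_def ysep_def de_Morgan_disj not_le by (intro conjI; linarith)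

lemma near_disjoint:
 assumes "sep a b" "e : near a"
 shows "e \<notin> near b"
proof
 assume "e : near b"
 note n = near_bounds[OF assms(2)] near_bounds[OF this]
 from assms(1) show False
  unfolding sep_def ysep_def by (elim disjE; use n in linarith)
qed

lemma confs_facts:
 assumes "c : confs l"
 shows "0 <= fst c" "finite (snd c)" "card (snd c) = l" "!!e. e : snd c ==> good (fst c) e"
  "!!e e'. e : snd c ==> e' : snd c ==> e ~= e' ==> sep e e'"
proof -
 have "0 <= fst c \<and> finite (snd c) \<and> card (snd c) = l \<and> (\<forall>e\<in>snd c. good (fst c) e) \<and>
  (\<forall>e\<in>snd c. \<forall>e'\<in>snd c. e ~= e' --> sep e e')"
  using assms by (cases "l = 0") (simp_all add: confs_def sunit_def case_prod_beta less_imp_le)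
 thus "0 <= fst c" "finite (snd c)" "card (snd c) = l" "!!e. e : snd c ==> good (fst c) e"
  "!!e e'. e : snd c ==> e' : snd c ==> e ~= e' ==> sep e e'" by blast+
qed

lemma confs_pos:
 assumes "c : confs l" "0 < l"
 shows "0 < fst c" "finite (snd c)" "card (snd c) = l" "!!e. e : snd c ==> good (fst c) e"
  "!!e e'. e : snd c ==> e' : snd c ==> e ~= e' ==> sep e e'"
proof -
 show "0 < fst c" using assms by (simp add: confs_def case_prod_beta)
qed (use confs_facts[OF assms(1)] in blast)+

lemma conf_near_unique:
 assumes "s : pts (\<S> n)" "e : snd s" "e' : snd s" "e : near a" "e' : near a"
 shows "e = e'"
proof (rule ccontr)
 assume ne: "e ~= e'"
 have "s : confs n" using assms(1) by (simp add: topspace_S)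
 hence "\<forall>e\<in>snd s. \<forall>e'\<in>snd s. e ~= e' --> sep e e'"
  unfolding confs_def by (cases "n = 0") (simp_all add: sunit_def case_prod_beta)
 thus False using near_not_sep[OF assms(4,5)] assms(2,3) ne by blast
qed

text \<open>Close to \<open>x0\<close> every neighbourhood \<open>near (f i)\<close> is hit, hence
  contains exactly one square of the configuration, and this square carries the label i.\<close>

lemma cts_into_confs:
 assumes c: "cts X (\<S> n) c" and x0: "x0 : pts X"
 obtains O' e where "openin X O'" "x0 : O'" "!!i. i < n ==> cts (stop X O') euclidean (e i)"
  "!!x. x : O' ==> snd (c x) = (%i. e i x) ` {..<n}" "!!x. x : O' ==> inj_on (%i. e i x) {..<n}"
proof (cases "n = 0")
 case True
 have "snd (c x) = {}" if "x : pts X" for x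
  using c that by (auto simp: True \<S>_def cts_def Pi_iff)
 thus thesis using that[of "pts X" "%_ _. undefined"] x0 True by simp
next
 case False
 have cS: "c x : confs n" if "x : pts X" for x
  using c that by (auto simp: cts_def Pi_iff topspace_S)
 obtain f where f: "bij_betw f {..<n} (snd (c x0))"
  using confs_facts(2,3)[OF cS[OF x0]] by (metis ex_bij_betw_nat_finite atLeast0LessThan)
 have f0: "f i : snd (c x0)" if "i < n" for i using f that by (auto simp: bij_betw_def)
 define O' where "O' = {x : pts X. \<forall>i<n. snd (c x) \<inter> near (f i) ~= {}}"
 have hit: "openin X {x : pts X. snd (c x) \<inter> N ~= {}}" if "open N" for N
 proof -
  have "{x : pts X. c x : {s : pts (\<S> n). snd s \<inter> N ~= {}}} = {x : pts X. snd (c x) \<inter> N ~= {}}"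
   using c by (auto simp: cts_def)
  thus ?thesis using cts_preimage[OF c openin_S_hit[OF that]] by simp
 qed
 have "O' = pts X \<inter> (\<Inter>i\<in>{..<n}. {x : pts X. snd (c x) \<inter> near (f i) ~= {}})"
  by (auto simp: O'_def)
 hence O': "openin X O'"
  using False by (auto intro!: openin_Int openin_Inter hit open_near)
 have x0O: "x0 : O'"
 proof -
  have "f i : near (f i)" if "i < n" for i
   by (rule near_self[OF confs_facts(4)[OF cS[OF x0] f0[OF that]]])
  thus ?thesis using x0 f0 by (auto simp: O'_def)
 qed
 define e where "e = (%i x. SOME a. a : snd (c x) \<inter> near (f i))"
 have e: "e i x : snd (c x)" "e i x : near (f i)" if "x : O'" "i < n" for i x
 proof -
  have "\<exists>a. a : snd (c x) \<inter> near (f i)" using that by (auto simp: O'_def)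
  from someI_ex[OF this] show "e i x : snd (c x)" "e i x : near (f i)" by (auto simp: e_def)
 qed
 have OX: "O' \<subseteq> pts X" by (auto simp: O'_def)
 have u: "a = e i x" if "x : O'" "i < n" "a : snd (c x)" "a : near (f i)" for a i x
  using conf_near_unique[of "c x" n a "e i x" "f i"] that e OX cS by (auto simp: topspace_S)
 have inj: "inj_on (%i. e i x) {..<n}" if "x : O'" for x
 proof (rule inj_onI, rule ccontr)
  fix i j assume ij: "i : {..<n}" "j : {..<n}" "e i x = e j x" "i ~= j"
  hence "f i ~= f j" using f by (auto simp: bij_betw_def inj_on_def)
  hence "sep (f i) (f j)" using f0 ij cS[OF x0] False by (auto simp: confs_def)
  thus False using near_disjoint e[OF that] ij by (metis lessThan_iff)
 qed
 show thesis
 proof (rule that[OF O' x0O])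
  fix i assume i: "i < n"
  show "cts (stop X O') euclidean (e i)"
  proof (rule cts_open_subtopology[OF continuous_map_id[of X] O'])
   fix T :: "square set" assume "openin euclidean T"
   hence "open (near (f i) \<inter> T)" by (simp add: open_Int open_near)
   moreover have "{z : O'. e i z : T} = O' \<inter> {x : pts X. snd (c x) \<inter> (near (f i) \<inter> T) ~= {}}"
    using e u[OF _ i] i OX by fastforce
   ultimately show "openin X {z : O'. e i z : T}" using O' hit by (simp add: openin_Int)
  qed simp
 next
  fix x assume x: "x : O'"
  have "(%i. e i x) ` {..<n} \<subseteq> snd (c x)" using e x by auto
  moreover have "finite (snd (c x))" "card (snd (c x)) = n"
   by (rule confs_facts[OF cS[OF subsetD[OF OX x]]])+
  ultimately show "snd (c x) = (%i. e i x) ` {..<n}"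
   using card_subset_eq[of "snd (c x)" "(%i. e i x) ` {..<n}"] card_image[OF inj[OF x]] by auto
  show "inj_on (%i. e i x) {..<n}" by (rule inj[OF x])
 qed
qed

lemma lessThan_add_split: "{..<a + b} = {..<a} \<union> (%i. i + a) ` {..<b::nat}"
proof (intro equalityI subsetI)
 fix x assume x: "x : {..<a + b}"
 show "x : {..<a} \<union> (%i. i + a) ` {..<b}"
 proof (cases "x < a")
  case False
  hence "x = x - a + a" "x - a : {..<b}" using x by auto
  thus ?thesis by (intro UnI2 image_eqI[of x "%i. i + a" "x - a" "{..<b}"])
 qed simp
qed auto

lemma smult_unit [simp]: "smult sunit s = s" "smult s sunit = s"
 by (simp_all add: smult_def sunit_def shift_def prod_eq_iff)

lemma smult_assoc: "smult (smult a b) c = smult a (smult b c)"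
 by (auto simp: smult_def shift_def image_Un image_image add.assoc add.commute[of "fst a"])

lemma good_mono: "good t e ==> t <= t' ==> good t' e"
 by (auto simp: good_def)

lemma good_shift: "good t e ==> 0 <= r ==> good (r + t) (shift r e)"
 by (auto simp: good_def shift_def)

lemma sep_shift: "sep (shift r e) (shift r e') \<longleftrightarrow> sep e e'"
 by (auto simp: sep_def ysep_def shift_def)

lemma sep_shift_right: "good t e ==> good t' e' ==> sep e (shift t e')"
 by (auto simp: sep_def good_def shift_def)

lemma inj_shift: "inj (shift r)"
 by (auto simp: inj_def shift_def prod_eq_iff)

lemma cts_smult:
 assumes c: "cts X (\<S> a) c" and d: "cts X (\<S> b) d"
 shows "cts X (\<S> (a + b)) (%x. smult (c x) (d x))"
proof (cases "a = 0 \<or> b = 0")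
 case True
 have "c x = sunit" if "a = 0" "x : pts X" for x
  using c that by (auto simp: cts_def topspace_S confs_def Pi_iff)
 moreover have "d x = sunit" if "b = 0" "x : pts X" for x
  using d that by (auto simp: cts_def topspace_S confs_def Pi_iff)
 ultimately show ?thesis
  using True by (elim disjE) (simp, rule cts_eq[OF d], simp, simp, rule cts_eq[OF c], simp)
next
 case False
 have cS: "c x : confs a" and dS: "d x : confs b" if "x : pts X" for x
  using c d that by (auto simp: cts_def topspace_S Pi_iff)
 show ?thesis
 proof (rule cts_locally)
  fix x0 assume x0: "x0 : pts X"
  obtain O1 e1 where 1: "openin X O1" "x0 : O1" "!!i. i < a ==> cts (stop X O1) euclidean (e1 i)"
   "!!x. x : O1 ==> snd (c x) = (%i. e1 i x) ` {..<a}" "!!x. x : O1 ==> inj_on (%i. e1 i x) {..<a}"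
   using cts_into_confs[OF c x0] by metis
  obtain O2 e2 where 2: "openin X O2" "x0 : O2" "!!i. i < b ==> cts (stop X O2) euclidean (e2 i)"
   "!!x. x : O2 ==> snd (d x) = (%i. e2 i x) ` {..<b}" "!!x. x : O2 ==> inj_on (%i. e2 i x) {..<b}"
   using cts_into_confs[OF d x0] by metis
  let ?O = "O1 \<inter> O2" and ?X = "stop X (O1 \<inter> O2)"
  define e where "e = (%i x. if i < a then e1 i x else shift (fst (c x)) (e2 (i - a) x))"
  have OX: "?O \<subseteq> pts X" using openin_subset[OF 1(1)] by blast
  have ab: "0 < a" "0 < b" using False by auto
  have ft: "cts ?X rtop (%x. fst (c x))" "cts ?X rtop (%x. fst (d x))"
   using cts_compose[OF c cts_S_fst] cts_compose[OF d cts_S_fst]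
   by (auto simp: o_def intro: cts_sub)
  have g1: "e1 i x : snd (c x)" if "x : ?O" "i < a" for i x using 1(4) that by auto
  have g2: "e2 i x : snd (d x)" if "x : ?O" "i < b" for i x using 2(4) that by auto
  have C: "fst (c x) > 0" "\<forall>e\<in>snd (c x). good (fst (c x)) e" "\<forall>e\<in>snd (c x). \<forall>e'\<in>snd (c x). e ~= e' --> sep e e'"
   "fst (d x) > 0" "\<forall>e\<in>snd (d x). good (fst (d x)) e" "\<forall>e\<in>snd (d x). \<forall>e'\<in>snd (d x). e ~= e' --> sep e e'"
   if "x : ?O" for x using confs_pos[OF cS[OF subsetD[OF OX that]] ab(1)] confs_pos[OF dS[OF subsetD[OF OX that]] ab(2)] by blast+
  have "cts ?X (\<S> (a + b)) (%x. (fst (c x) + fst (d x), (%i. e i x) ` {..<a + b}))"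
  proof (rule cts_into_S)
   show "0 < a + b" using False by simp
   show "cts ?X rtop (%x. fst (c x) + fst (d x))"
    using ft by (rule continuous_map_add)
   show "cts ?X euclidean (e i)" if "i < a + b" for i
   proof (cases "i < a")
    case True
    thus ?thesis
     using continuous_map_from_subtopology_mono[OF 1(3)[OF True], of ?O] by (simp add: e_def[abs_def])
   next
    case F: False
    hence "i - a < b" using that by simp
    from continuous_map_from_subtopology_mono[OF 2(3)[OF this], of ?O]
    have "cts ?X euclidean (e2 (i - a))" by simp
    from cm_comp[OF cm_pair[OF ft(1) this], of "%(t, e). shift t e"]
    show ?thesis using F by (simp add: e_def[abs_def] shift_def case_prod_beta continuous_intros)
   qed
  next
   fix x assume "x : pts ?X" hence x: "x : ?O" by simp
   show "0 < fst (c x) + fst (d x)" using C[OF x] by simp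
   show "good (fst (c x) + fst (d x)) (e i x)" if "i < a + b" for i
    using C(1,4)[OF x] bspec[OF C(2)[OF x] g1[OF x, of i]] bspec[OF C(5)[OF x] g2[OF x, of "i - a"]] that
     good_mono[of "fst (c x)" "e1 i x" "fst (c x) + fst (d x)"] good_shift[of "fst (d x)" "e2 (i - a) x" "fst (c x)"]
    by (cases "i < a") (simp_all add: e_def)
   show "sep (e i x) (e j x)" if ij: "i < a + b" "j < a + b" "i ~= j" for i j
   proof -
    have 11: "sep (e1 i x) (e1 j x)" if "i < a" "j < a" "i ~= j" for i j
    proof -
     have "e1 i x ~= e1 j x" using 1(5)[of x] x that by (auto simp: inj_on_def)
     thus ?thesis using C(3)[OF x] g1[OF x] that by blast
    qed
    have 22: "sep (e2 i x) (e2 j x)" if "i < b" "j < b" "i ~= j" for i j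
    proof -
     have "e2 i x ~= e2 j x" using 2(5)[of x] x that by (auto simp: inj_on_def)
     thus ?thesis using C(6)[OF x] g2[OF x] that by blast
    qed
    have 12: "sep (e1 i x) (shift (fst (c x)) (e2 j x))" if "i < a" "j < b" for i j
     using sep_shift_right C(2,5)[OF x] g1[OF x] g2[OF x] that by blast
    consider "i < a" "j < a" | "i < a" "\<not> j < a" | "\<not> i < a" "j < a" | "\<not> i < a" "\<not> j < a" by blast
    thus ?thesis
    proof cases
     case 1 thus ?thesis using 11 ij by (simp add: e_def)
    next
     case 2 thus ?thesis using 12[of i "j - a"] ij by (simp add: e_def)
    next
     case 3 thus ?thesis using 12[of j "i - a"] ij by (simp add: e_def sep_sym)
    next
     case 4 thus ?thesis using 22[of "i - a" "j - a"] ij by (simp add: e_def sep_shift)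
    qed
   qed
  qed
  moreover have "smult (c x) (d x) = (fst (c x) + fst (d x), (%i. e i x) ` {..<a + b})" if "x : ?O" for x
  proof -
   have "(%i. e i x) ` {..<a + b} = (%i. e1 i x) ` {..<a} \<union> (%i. shift (fst (c x)) (e2 i x)) ` {..<b}"
    unfolding lessThan_add_split image_Un image_image
    by (intro arg_cong2[where f = "(\<union>)"] image_cong) (simp_all add: e_def)
   thus ?thesis using 1(4)[of x] 2(4)[of x] that by (simp add: smult_def image_image)
  qed
  ultimately have "cts ?X (\<S> (a + b)) (%x. smult (c x) (d x))"
   by (elim cts_eq) auto
  thus "\<exists>U. openin X U \<and> x0 : U \<and> cts (stop X U) (\<S> (a + b)) (%x. smult (c x) (d x))"
   using 1 2 by (intro exI[of _ ?O]) auto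
 qed
qed

section \<open>Evaluation of Moore paths\<close>

lemma topspace_compact_open: "f : pts (cotop X Y) ==> cts X Y f"
 by (auto simp: compact_open_topology_def topology_generated_by_topspace)

text \<open>A closed ball around \<open>s x0\<close> is compact and so yields a subbasic open set of
  the compact-open topology.\<close>

lemma cts_eval:
 assumes g: "cts X (cotop rtop Y) g" and s: "cts X rtop s"
 shows "cts X Y (%x. g x (s x))"
proof -
 have gx: "continuous_map rtop Y (g x)" if "x : pts X" for x
  using g that by (intro topspace_compact_open) (auto simp: cts_def)
 have "openin X {x : pts X. g x (s x) : U}" if U: "openin Y U" for U
 proof (subst openin_subopen, rule ballI)
  fix x0 assume x0: "x0 : {x : pts X. g x (s x) : U}"
  hence "open {r. g x0 r : U}"
   using cts_preimage[OF gx U, of x0] by simp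
  then obtain d where d: "0 < d" "cball (s x0) d \<subseteq> {r. g x0 r : U}"
   using x0 open_contains_cball by blast
  let ?W = "{f. continuous_map rtop Y f \<and> f ` cball (s x0) d \<subseteq> U}"
  have "openin (cotop rtop Y) ?W"
   unfolding compact_open_topology_def
   by (rule topology_generated_by_Basis, rule CollectI, rule exI[of _ "cball (s x0) d"], rule exI[of _ U])
    (simp add: U)
  from cts_preimage[OF g this]
  have "openin X {x : pts X. g x : ?W}" .
  moreover have "openin X {x : pts X. s x : ball (s x0) d}"
   by (rule cts_preimage[OF s]) simp
  ultimately have "openin X ({x : pts X. g x : ?W} \<inter> {x : pts X. s x : ball (s x0) d})"
   by (rule openin_Int)
  moreover have "x0 : {x : pts X. g x : ?W} \<inter> {x : pts X. s x : ball (s x0) d}"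
   using x0 d gx by auto
  moreover have "{x : pts X. g x : ?W} \<inter> {x : pts X. s x : ball (s x0) d} \<subseteq> {x : pts X. g x (s x) : U}"
   using ball_subset_cball by blast
  ultimately show "\<exists>T. openin X T \<and> x0 : T \<and> T \<subseteq> {x : pts X. g x (s x) : U}" by blast
 qed
 moreover have "(%x. g x (s x)) : pts X \<rightarrow> pts Y"
  using gx by (auto simp: cts_def)
 ultimately show ?thesis by (auto simp: cts_def)
qed

section \<open>Right modules\<close>

lemma act_in:
 assumes "rmod M act" "x : pts (M a)" "s : pts (\<S> b)"
 shows "act a b x s : pts (M (a + b))"
proof -
 have "cts (cg_prod (M a) (\<S> b)) (M (a + b)) (%(x, s). act a b x s)"
  using assms(1) by (simp add: right_S_module_def)
 hence "(%(x, s). act a b x s) : pts (M a) \<times> pts (\<S> b) \<rightarrow> pts (M (a + b))"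
  by (simp add: cts_def)
 thus ?thesis using assms(2,3) by (fastforce simp: Pi_iff)
qed

lemma act_unit: "rmod M act ==> x : pts (M a) ==> act a 0 x sunit = x"
 by (simp add: right_S_module_def)

lemma act_assoc:
 "rmod M act ==> x : pts (M a) ==> s : pts (\<S> b) ==> t : pts (\<S> c) ==>
  act (a + b) c (act a b x s) t = act a (b + c) x (smult s t)"
 by (simp add: right_S_module_def)

lemma cts_act:
 assumes "rmod M act" "lcs X" "haus X"
  "cts X (M a) u" "cts X (\<S> b) v"
 shows "cts X (M (a + b)) (%x. act a b (u x) (v x))"
 by (rule cts_act_gen[OF _ Hausdorff_space_S _ assms(2-5)])
  (use assms(1) in \<open>auto simp: right_S_module_def CGWH_def\<close>)


section \<open>The second double complex: columns of squares and ways to put them back\<close>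

section \<open>Columns of squares that can be moved to the right\<close>

text \<open>A pair in \<open>F\<close> consists of a square and the distance by which it is moved to
  the right. The strip has to be lengthened by \<open>mx F\<close> to hold the moved squares; the
  inserted 0 covers the empty set.\<close>

definition mx :: "(square \<times> real) set => real" where
 "mx F = Max (insert 0 (snd ` F))"

definition mv :: "real => square \<times> real => square" where
 "mv d p = shift (snd p + d) (fst p)"

definition validF :: "square set => (square \<times> real) set => bool" where
 "validF C F \<longleftrightarrow> finite F \<and> inj_on fst F \<and> (\<forall>p\<in>F. fst p : C \<and> 0 <= snd p)"

definition rgood :: "square => bool" where
 "rgood e \<longleftrightarrow> fst (fst e) + fst (snd e) <= 0 \<and> 0 <= snd (fst e) \<and> snd (fst e) + snd (snd e) <= 1 \<and>
  0 < fst (snd e) \<and> 0 < snd (snd e)"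

text \<open>
 The first coordinate of the squares of a column is measured from the right end of the strip,
 because the right end is not changed by multiplication on the left.
\<close>

definition column :: "square list => bool" where
 "column C \<longleftrightarrow> (\<forall>e\<in>set C. rgood e) \<and> sorted_wrt (%e e'. snd (fst e) + snd (snd e) <= snd (fst e')) C"

lemma mx_ge_0: "finite F ==> 0 <= mx F"
 by (simp add: mx_def)

lemma mx_ge: "finite F ==> p : F ==> snd p <= mx F"
 unfolding mx_def by (rule Max_ge) auto

lemma mx_empty [simp]: "mx {} = 0"
 by (simp add: mx_def)

lemma mx_insert_0: "mx (insert (e, 0) F) = mx F"
 by (simp add: mx_def insert_commute)

lemma mx_translate:
 assumes "finite F" "F ~= {}" "\<forall>p\<in>F. 0 <= snd p" "0 <= c"
 shows "mx ((%p. (fst p, snd p + c)) ` F) = mx F + c"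
proof -
 have *: "mx G = Max (snd ` G)" if "finite G" "G ~= {}" "\<forall>p\<in>G. 0 <= snd p" for G :: "(square \<times> real) set"
 proof -
  obtain p where p: "p : G" using \<open>G ~= {}\<close> by blast
  have "0 <= snd p" using that(3) p by blast
  also have "snd p <= Max (snd ` G)" by (rule Max_ge) (use that(1) p in auto)
  finally have "0 <= Max (snd ` G)" .
  thus ?thesis using that by (simp add: mx_def)
 qed
 have "mx ((%p. (fst p, snd p + c)) ` F) = Max ((%r. r + c) ` snd ` F)"
  using assms by (subst *) (auto simp: image_image)
 also have "\<dots> = Max (snd ` F) + c"
  using assms by (subst Max_add_commute[symmetric]) (auto simp: image_image)
 finally show ?thesis using *[OF assms(1-3)] by simp
qed

lemma mx_union:
 assumes "finite F" "finite G" "G ~= {}" "\<forall>p\<in>G. mx F <= snd p"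
 shows "mx (F \<union> G) = mx G"
proof -
 obtain p where p: "p : G" using assms(3) by blast
 have "mx F <= mx G" using assms(4) p mx_ge[OF assms(2) p] by force
 moreover have "mx (F \<union> G) = max (mx F) (mx G)"
  using Max_Un[of "insert 0 (snd ` F)" "insert 0 (snd ` G)"] assms(1,2) by (simp add: mx_def image_Un)
 ultimately show ?thesis by simp
qed

lemma column_nth:
 assumes "column C" "i < length C" "j < length C" "i ~= j"
 shows "ysep (C ! i) (C ! j)"
 using assms unfolding column_def sorted_wrt_iff_nth_less ysep_def
 by (meson linorder_neqE_nat)

lemma column_ysep: "column C ==> e : set C ==> e' : set C ==> e ~= e' ==> ysep e e'"
 by (metis column_nth in_set_conv_nth)

lemma rgood_not_ysep: "rgood e ==> \<not> ysep e e"
 by (auto simp: rgood_def ysep_def)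

lemma column_distinct:
 assumes "column C"
 shows "distinct C"
 unfolding distinct_conv_nth
proof (intro allI impI notI)
 fix i j assume "i < length C" "j < length C" "i ~= j" "C ! i = C ! j"
 hence "ysep (C ! j) (C ! j)" using column_nth[OF assms, of i j] by simp
 moreover have "rgood (C ! j)" using assms \<open>j < length C\<close> by (simp add: column_def)
 ultimately show False using rgood_not_ysep by blast
qed

lemma ysep_mv: "ysep (mv c p) (mv d q) \<longleftrightarrow> ysep (fst p) (fst q)"
 by (simp add: ysep_def mv_def shift_def)

text \<open>Squares of a column lie above each other, and horizontal moves do not disturb this; so
  moved squares stay disjoint whatever the distances. The strip of width \<open>mx F + d\<close>
  begins at distance d before the original right end.\<close>

lemma column_conf:
 assumes C: "column C" and F: "validF (set C) F" "F ~= {}"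
  and d: "!!p. p : F ==> 0 <= fst (fst (fst p)) + snd p + d"
 shows "inj_on (mv d) F" "(mx F + d, mv d ` F) : pts (\<S> (card F))"
proof -
 have fin: "finite F" and inj: "inj_on fst F" using F(1) by (auto simp: validF_def)
 have ys: "ysep (fst p) (fst q)" if "p : F" "q : F" "p ~= q" for p q
 proof -
  have "fst p ~= fst q" using inj that by (auto simp: inj_on_def)
  thus ?thesis using column_ysep[OF C] F(1) that by (auto simp: validF_def)
 qed
 have rg: "rgood (fst p)" if "p : F" for p
  using C F(1) that by (auto simp: column_def validF_def)
 have g: "good (mx F + d) (mv d p)" if p: "p : F" for p
  using rg[OF p] d[OF p] mx_ge[OF fin p] by (auto simp: good_def rgood_def mv_def shift_def)
 show inj': "inj_on (mv d) F"
 proof (rule inj_onI, rule ccontr)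
  fix p q assume pq: "p : F" "q : F" "mv d p = mv d q" "p ~= q"
  hence "ysep (mv d q) (mv d q)" using ys[of p q] ysep_mv[of d p d q] by simp
  hence "ysep (fst q) (fst q)" by (simp add: ysep_mv)
  thus False using rg[OF pq(2)] rgood_not_ysep by blast
 qed
 obtain p where p: "p : F" using F(2) by blast
 have "0 < mx F + d" using g[OF p] by (auto simp: good_def)
 moreover have "sep (mv d p) (mv d q)" if "p : F" "q : F" "mv d p ~= mv d q" for p q
  using ys[of p q] that ysep_mv[of d p d q] by (auto simp: sep_def)
 ultimately show "(mx F + d, mv d ` F) : pts (\<S> (card F))"
  using g fin F(2) card_image[OF inj'] by (auto simp: topspace_S confs_def)
qed

lemma smult_mv:
 "smult (mx F + a, mv a ` F) (b, mv c ` G) = (mx F + a + b, mv a ` F \<union> mv (mx F + a + c) ` G)"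
 by (simp add: smult_def image_image mv_def shift_def add.assoc add.commute add.left_commute)

text \<open>\<open>G F\<close> stands for the point obtained by removing all squares of
  \<open>C\<close> and putting those in \<open>F\<close> back, each moved to the right by its
  distance. Relative to its original end the strip then ends at \<open>mx F\<close>, and at
  \<open>- \<mu>\<close> if nothing is put back. Squares put back beyond the original end and beyond
  \<open>mx F1\<close> act by right multiplication; their coordinates are measured from the end that
  the strip has for \<open>F1\<close>.\<close>

definition mlaw :: "'a action => nat => square set => real => ((square \<times> real) set => 'a) => bool" where
 "mlaw act m C \<mu> G \<longleftrightarrow> (\<forall>F1 F2. validF C (F1 \<union> F2) \<and> fst ` F1 \<inter> fst ` F2 = {} \<and> F2 ~= {} \<and>
   (\<forall>p\<in>F2. mx F1 <= fst (fst (fst p)) + snd p) -->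
   G (F1 \<union> F2) = act (m + card F1) (card F2) (G F1)
    (mx F2 + ((if F1 = {} then \<mu> else 0) - mx F1), mv ((if F1 = {} then \<mu> else 0) - mx F1) ` F2))"

text \<open>The values of \<open>G\<close> that result when a single point \<open>x\<close>, whose
  strip ends at distance \<open>\<nu>\<close> before the original end, is multiplied by the squares
  to be put back.\<close>

definition pureG :: "'a action => nat => 'a => real => (square \<times> real) set => 'a" where
 "pureG act m x \<nu> F = (if F = {} then x else act m (card F) x (mx F + \<nu>, mv \<nu> ` F))"

lemma validF_subset: "validF C F ==> G \<subseteq> F ==> validF C G"
 by (auto simp: validF_def finite_subset inj_on_subset)

lemma far_snd: "column C ==> validF (set C) F ==> p : F ==> r <= fst (fst (fst p)) + snd p ==> r <= snd p"
proof -
 assume *: "column C" "validF (set C) F" "p : F" "r <= fst (fst (fst p)) + snd p"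
 hence "rgood (fst p)" by (auto simp: column_def validF_def)
 thus ?thesis using *(4) by (auto simp: rgood_def)
qed

lemma mlaw_pure:
 assumes M: "rmod M act" and x: "x : pts (M m)" and C: "column C"
  and \<nu>: "!!e. e : set C ==> 0 <= fst (fst e) + \<nu>"
 shows "mlaw act m (set C) \<nu> (pureG act m x \<nu>)"
 unfolding mlaw_def
proof (intro allI impI, elim conjE)
 fix F1 F2 assume V: "validF (set C) (F1 \<union> F2)" and dis: "fst ` F1 \<inter> fst ` F2 = {}" and ne: "F2 ~= {}"
  and far: "\<forall>p\<in>F2. mx F1 <= fst (fst (fst p)) + snd p"
 have V1: "validF (set C) F1" and V2: "validF (set C) F2" using V validF_subset by blast+
 have fin: "finite F1" "finite F2" using V by (auto simp: validF_def)
 have \<nu>F: "0 <= fst (fst (fst p)) + snd p + \<nu>" if "p : F1 \<union> F2" for p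
  using V \<nu>[of "fst p"] that unfolding validF_def by (smt (verit))
 show "pureG act m x \<nu> (F1 \<union> F2) = act (m + card F1) (card F2) (pureG act m x \<nu> F1)
    (mx F2 + ((if F1 = {} then \<nu> else 0) - mx F1), mv ((if F1 = {} then \<nu> else 0) - mx F1) ` F2)"
 proof (cases "F1 = {}")
  case True
  thus ?thesis using ne by (simp add: pureG_def)
 next
  case False
  have U: "mx (F1 \<union> F2) = mx F2"
   by (rule mx_union[OF fin ne]) (use far_snd[OF C V2] far in blast)
  have crd: "card (F1 \<union> F2) = card F1 + card F2"
   using fin dis by (intro card_Un_disjoint) auto
  have s1: "(mx F1 + \<nu>, mv \<nu> ` F1) : pts (\<S> (card F1))"
   by (rule column_conf[OF C V1 False]) (use \<nu>F in auto)
  have s2: "(mx F2 + (- mx F1), mv (- mx F1) ` F2) : pts (\<S> (card F2))"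
   by (rule column_conf[OF C V2 ne]) (use far in auto)
  show ?thesis
   using False ne act_assoc[OF M x s1 s2] by (simp add: pureG_def U crd smult_mv image_Un add.commute[of \<nu>])
 qed
qed

lemma mlaw_translate:
 assumes L: "mlaw act m (set C) \<mu> G" and C: "column C" and c: "0 <= c"
 shows "mlaw act m (set C) (\<mu> + c) (%F. G ((%p. (fst p, snd p + c)) ` F))"
 unfolding mlaw_def
proof (intro allI impI, elim conjE)
 let ?t = "%p. (fst p, snd p + c) :: square \<times> real"
 fix F1 F2 assume V: "validF (set C) (F1 \<union> F2)" and dis: "fst ` F1 \<inter> fst ` F2 = {}" and ne: "F2 ~= {}"
  and far: "\<forall>p\<in>F2. mx F1 <= fst (fst (fst p)) + snd p"
 have fin: "finite F1" "finite F2" and nn: "\<forall>p\<in>F1. 0 <= snd p" "\<forall>p\<in>F2. 0 <= snd p"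
  using V by (auto simp: validF_def)
 have inj: "inj_on ?t F" for F by (auto simp: inj_on_def prod_eq_iff)
 have V': "validF (set C) (?t ` F1 \<union> ?t ` F2)"
 proof -
  have "inj_on fst (?t ` (F1 \<union> F2))" using V by (intro inj_on_imageI) (simp add: validF_def o_def)
  moreover have "\<forall>q\<in>?t ` (F1 \<union> F2). fst q : set C \<and> 0 <= snd q"
  proof
   fix q assume "q : ?t ` (F1 \<union> F2)"
   then obtain p where p: "p : F1 \<union> F2" "q = ?t p" by blast
   have "fst p : set C \<and> 0 <= snd p" using V p(1) unfolding validF_def by blast
   thus "fst q : set C \<and> 0 <= snd q" using c p(2) by simp
  qed
  ultimately show ?thesis
   unfolding validF_def image_Un[symmetric] using finite_imageI[OF finite_UnI[OF fin]] by blast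
 qed
 have mvt: "mv d ` ?t ` F = mv (d + c) ` F" for d F
  by (simp add: image_image mv_def add.assoc add.commute add.left_commute)
 have m1: "mx (?t ` F1) = (if F1 = {} then 0 else mx F1 + c)"
  using mx_translate[OF fin(1) _ nn(1) c] by simp
 have m2: "mx (?t ` F2) = mx F2 + c"
  by (rule mx_translate[OF fin(2) ne nn(2) c])
 have "G (?t ` F1 \<union> ?t ` F2) = act (m + card (?t ` F1)) (card (?t ` F2)) (G (?t ` F1))
    (mx (?t ` F2) + ((if ?t ` F1 = {} then \<mu> else 0) - mx (?t ` F1)),
    mv ((if ?t ` F1 = {} then \<mu> else 0) - mx (?t ` F1)) ` ?t ` F2)"
 proof (rule L[unfolded mlaw_def, rule_format], intro conjI)
  show "fst ` ?t ` F1 \<inter> fst ` ?t ` F2 = {}" using dis by (simp add: image_image)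
  show "\<forall>p\<in>?t ` F2. mx (?t ` F1) <= fst (fst (fst p)) + snd p"
   using far c by (auto simp: m1)
 qed (use V' ne in auto)
 thus "G (?t ` (F1 \<union> F2)) = act (m + card F1) (card F2) (G (?t ` F1))
    (mx F2 + ((if F1 = {} then \<mu> + c else 0) - mx F1), mv ((if F1 = {} then \<mu> + c else 0) - mx F1) ` F2)"
  by (simp add: image_Un card_image[OF inj] mvt m1 m2 split: if_splits) (simp add: algebra_simps)
qed

text \<open>After a translation past the original right end all squares are far, so the law with
  \<open>F1 = {}\<close> determines the value from \<open>G {}\<close>.\<close>

lemma translated_pure:
 assumes L: "mlaw act m (set C) \<mu> G" and C: "column C" and V: "validF (set C) F"
  and c: "0 <= c" "!!e. e : set C ==> 0 <= fst (fst e) + c"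
 shows "G ((%p. (fst p, snd p + c)) ` F) = pureG act m (G {}) (\<mu> + c) F"
proof (cases "F = {}")
 case False
 have "mlaw act m (set C) (\<mu> + c) (%F. G ((%p. (fst p, snd p + c)) ` F))"
  by (rule mlaw_translate[OF L C c(1)])
 let ?t = "%p. (fst p, snd p + c) :: square \<times> real"
 have fin: "finite F" and nn: "\<forall>p\<in>F. 0 <= snd p" using V by (auto simp: validF_def)
 have inj: "inj_on ?t F" by (auto simp: inj_on_def prod_eq_iff)
 have "inj_on fst (?t ` F)" using V by (intro inj_on_imageI) (simp add: validF_def o_def)
 hence V': "validF (set C) ({} \<union> ?t ` F)" using V c(1) by (auto simp: validF_def)
 have far: "\<forall>p\<in>?t ` F. mx {} <= fst (fst (fst p)) + snd p"
 proof
  fix q assume "q : ?t ` F"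
  then obtain p where p: "p : F" "q = ?t p" by blast
  have "fst p : set C" "0 <= snd p" using V p(1) unfolding validF_def by blast+
  thus "mx {} <= fst (fst (fst q)) + snd q" using c(2)[of "fst p"] p(2) by simp
 qed
 have "G ({} \<union> ?t ` F) = act (m + card ({} :: (square \<times> real) set)) (card (?t ` F)) (G {})
    (mx (?t ` F) + (\<mu> - 0), mv (\<mu> - 0) ` ?t ` F)"
  using L[unfolded mlaw_def, rule_format, of "{}" "?t ` F"] V' far False
  by simp
 thus ?thesis
  using False mx_translate[OF fin False nn c(1)] card_image[OF inj]
  by (simp add: pureG_def image_image mv_def add.assoc add.commute add.left_commute)
qed (simp add: pureG_def)

section \<open>Families of moving columns\<close>

type_synonym 'a bdata = "square list \<times> real \<times> ((square \<times> real) set => 'a)"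

definition PP :: "nat => (nat => real) topology" where
 "PP k = product_topology (%_. top_of_set {0..}) {..<k}"

text \<open>No topology is put on \<open>'a bdata\<close>. A family counts as continuous if its
  column and margin are and if, for each set \<open>I\<close> of indices, the point obtained by
  putting the squares in \<open>I\<close> back depends continuously on the parameter and on the
  distances, which form a point of \<open>PP k\<close>.\<close>

definition Bfam :: "(nat => 'a topology) => 'a action => nat => nat => 'x topology => ('x => 'a bdata) => bool" where
 "Bfam M act n k X f \<longleftrightarrow> k <= n \<and>
  (\<forall>x\<in>pts X. length (fst (f x)) = k \<and> column (fst (f x)) \<and>
   mlaw act (n - k) (set (fst (f x))) (fst (snd (f x))) (snd (snd (f x)))) \<and>
  (\<forall>x\<in>pts X. 0 <= fst (snd (f x))) \<and>
  (\<forall>i<k. cts X euclidean (%x. fst (f x) ! i)) \<and>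
  cts X rtop (%x. fst (snd (f x))) \<and>
  (\<forall>I\<subseteq>{..<k}. cts (ptop X (PP k)) (M (n - k + card I))
   (%p. snd (snd (f (fst p))) ((%i. (fst (f (fst p)) ! i, snd p i)) ` I)))"

definition Bs :: "(nat => 'a topology) => 'a action => nat => nat => nat => ((nat => real) => 'a bdata) set" where
 "Bs M act n k q = {f. f : extensional (spx q) \<and> Bfam M act n k (Spx q) f}"

lemma Bfam_cong:
 assumes "!!x. x : pts X ==> f x = g x" "Bfam M act n k X f"
 shows "Bfam M act n k X g"
 unfolding Bfam_def
proof (intro conjI allI impI ballI)
 show "k <= n" using assms(2) by (simp add: Bfam_def)
 show "length (fst (g x)) = k" "column (fst (g x))"
   "mlaw act (n - k) (set (fst (g x))) (fst (snd (g x))) (snd (snd (g x)))" "0 <= fst (snd (g x))"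
  if "x : pts X" for x
  using assms(1)[OF that, symmetric] assms(2) that by (simp_all add: Bfam_def)
 show "cts X euclidean (%x. fst (g x) ! i)" if "i < k" for i
  by (rule cts_eq[of _ _ "%x. fst (f x) ! i"]) (use assms that in \<open>auto simp: Bfam_def\<close>)
 show "cts X rtop (%x. fst (snd (g x)))"
  by (rule cts_eq[of _ _ "%x. fst (snd (f x))"]) (use assms in \<open>auto simp: Bfam_def\<close>)
 show "cts (ptop X (PP k)) (M (n - k + card I))
   (%p. snd (snd (g (fst p))) ((%i. (fst (g (fst p)) ! i, snd p i)) ` I))" if "I \<subseteq> {..<k}" for I
  by (rule cts_eq[of _ _ "%p. snd (snd (f (fst p))) ((%i. (fst (f (fst p)) ! i, snd p i)) ` I)"])
   (use assms that in \<open>auto simp: Bfam_def\<close>)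
qed

lemma Bfam_comp:
 assumes f: "Bfam M act n k X f" and g: "cts Y X g"
 shows "Bfam M act n k Y (%y. f (g y))"
proof -
 have gX: "g y : pts X" if "y : pts Y" for y using g that by (auto simp: cts_def)
 have gp: "cts (ptop Y (PP k)) (ptop X (PP k)) (%p. (g (fst p), snd p))"
  using cts_compose[OF cts_fst g]
  by (intro cts_pair cts_snd) (simp add: o_def)
 show ?thesis
  unfolding Bfam_def
 proof (intro conjI allI impI ballI)
  show "k <= n" using f by (simp add: Bfam_def)
  show "length (fst (f (g y))) = k" "column (fst (f (g y)))"
    "mlaw act (n - k) (set (fst (f (g y)))) (fst (snd (f (g y)))) (snd (snd (f (g y))))" "0 <= fst (snd (f (g y)))"
   if "y : pts Y" for y using f gX[OF that] by (auto simp: Bfam_def)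
  show "cts Y euclidean (%y. fst (f (g y)) ! i)" if "i < k" for i
   using cts_compose[OF g, of euclidean "%x. fst (f x) ! i"] f that by (simp add: Bfam_def o_def)
  show "cts Y rtop (%y. fst (snd (f (g y))))"
   using cts_compose[OF g, of rtop "%x. fst (snd (f x))"] f by (simp add: Bfam_def o_def)
  show "cts (ptop Y (PP k)) (M (n - k + card I))
   (%p. snd (snd (f (g (fst p)))) ((%i. (fst (f (g (fst p))) ! i, snd p i)) ` I))" if "I \<subseteq> {..<k}" for I
   using cts_compose[OF gp f[unfolded Bfam_def, THEN conjunct2, THEN conjunct2, THEN conjunct2, THEN conjunct2,
     THEN conjunct2, rule_format, OF that]] by (simp only: o_def fst_conv snd_conv)
 qed
qed

lemma Bs_restrict:
 assumes "Bfam M act n k (Spx q) f"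
 shows "restrict f (spx q) : Bs M act n k q"
 unfolding Bs_def using Bfam_cong[OF _ assms, of "restrict f (spx q)"] by simp

definition brho :: "'a bdata => 'a" where
 "brho b = snd (snd b) {}"

lemma cts_brho:
 assumes "Bfam M act n k X f"
 shows "cts X (M (n - k)) (%x. brho (f x))"
proof -
 have "cts X (ptop X (PP k)) (%x. (x, \<lambda>i\<in>{..<k}. 0))"
  by (intro cts_pair) (auto simp: PP_def)
 from cts_compose[OF this, of "M (n - k)" "%p. snd (snd (f (fst p))) ((%i. (fst (f (fst p)) ! i, snd p i)) ` {})"]
 show ?thesis using assms[unfolded Bfam_def] by (auto simp: o_def brho_def)
qed

lemma brho_SS: "f : Bs M act n k q ==> smap q brho f : SS (M (n - k)) q"
 using restrict_SS[OF cts_brho] by (auto simp: Bs_def simplex_map_def o_def)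

lemma validF_index:
 assumes "column C" "I \<subseteq> {..<length C}" "!!i. i : I ==> 0 <= \<rho> i"
 shows "validF (set C) ((%i. (C ! i, \<rho> i)) ` I)" "card ((%i. (C ! i, \<rho> i)) ` I) = card I"
proof -
 have inj: "inj_on ((!) C) {..<length C}"
  using column_distinct[OF assms(1)] by (simp add: inj_on_nth)
 hence "inj_on ((!) C) I" using assms(2) inj_on_subset by blast
 hence i2: "inj_on (%i. (C ! i, \<rho> i)) I" by (auto simp: inj_on_def)
 thus "card ((%i. (C ! i, \<rho> i)) ` I) = card I" by (rule card_image)
 have "inj_on fst ((%i. (C ! i, \<rho> i)) ` I)"
  using \<open>inj_on ((!) C) I\<close> by (auto simp: inj_on_def)
 moreover have "finite I" using assms(2) finite_subset by blast
 ultimately show "validF (set C) ((%i. (C ! i, \<rho> i)) ` I)"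
  using assms(2,3) by (auto simp: validF_def)
qed

lemma PP_facts:
 "lcs (PP k)" "haus (PP k)"
 "i < k ==> cts (PP k) rtop (%\<rho>. \<rho> i)"
 "\<rho> : pts (PP k) ==> i < k ==> 0 <= \<rho> i"
proof -
 have "lcs (top_of_set {0::real..})"
  by (intro locally_compact_space_closed_subset locally_compact_space_euclidean) auto
 thus "lcs (PP k)"
  unfolding PP_def locally_compact_space_product_topology by (auto intro: finite_subset)
 show "haus (PP k)"
  unfolding PP_def by (simp add: Hausdorff_space_product_topology Hausdorff_space_subtopology)
 show "i < k ==> cts (PP k) rtop (%\<rho>. \<rho> i)"
  unfolding PP_def
  using cts_full[of "product_topology (%_. top_of_set {0..}) {..<k}" rtop "{0..}" "%\<rho>. \<rho> i"]
   continuous_map_product_projection[of i "{..<k}" "%_. top_of_set {0::real..}"] by simp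
 show "\<rho> : pts (PP k) ==> i < k ==> 0 <= \<rho> i"
  by (auto simp: PP_def)
qed

lemma cts_mx:
 assumes "finite I" "!!i. i : I ==> cts X rtop (r i)"
 shows "cts X rtop (%x. mx ((%i. (e i x, r i x)) ` I))"
 using assms
proof (induction I rule: finite_induct)
 case (insert i I)
 have "mx ((%i. (e i x, r i x)) ` insert i I) = max (r i x) (mx ((%i. (e i x, r i x)) ` I))" for x
  unfolding mx_def image_insert snd_conv insert_commute[of 0] using insert(1) by (intro Max.insert) auto
 thus ?case using insert by (simp add: continuous_map_real_max)
qed simp

lemma cts_column_conf:
 assumes C: "!!i. i < k ==> cts X euclidean (%x. C x ! i)"
  and col: "!!x. x : pts X ==> length (C x) = k \<and> column (C x)"
  and r: "!!i. i < k ==> cts X rtop (r i)" "!!i x. i < k ==> x : pts X ==> 0 <= r i x"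
  and \<nu>: "cts X rtop \<nu>"
   "!!x i. x : pts X ==> i < k ==> 0 <= fst (fst (C x ! i)) + r i x + \<nu> x"
  and I: "I \<subseteq> {..<k}" "I ~= {}"
 shows "cts X (\<S> (card I)) (%x. (mx ((%i. (C x ! i, r i x)) ` I) + \<nu> x, mv (\<nu> x) ` (%i. (C x ! i, r i x)) ` I))"
proof -
 have fin: "finite I" using I(1) finite_subset by blast
 obtain g where g: "bij_betw g {..<card I} I"
  using fin by (metis ex_bij_betw_nat_finite atLeast0LessThan)
 have gI: "g i : I" "g i < k" if "i < card I" for i using g that I(1) by (auto simp: bij_betw_def)
 let ?F = "%x. (%i. (C x ! i, r i x)) ` I"
 have S: "(mx (?F x) + \<nu> x, mv (\<nu> x) ` ?F x) : confs (card I)" and inj: "inj_on (mv (\<nu> x)) (?F x)"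
  and inj2: "inj_on (%i. (C x ! i, r i x)) I"
  if x: "x : pts X" for x
 proof -
  have V: "validF (set (C x)) (?F x)" "card (?F x) = card I"
   using validF_index[of "C x" I "%i. r i x"] col[OF x] I(1) r(2) x by auto
  have p: "0 <= fst (fst (fst p)) + snd p + \<nu> x" if "p : ?F x" for p
   using that \<nu>(2)[OF x] I(1) by auto
  show "(mx (?F x) + \<nu> x, mv (\<nu> x) ` ?F x) : confs (card I)" "inj_on (mv (\<nu> x)) (?F x)"
   using column_conf[OF _ V(1) _ p] col[OF x] I(2) V(2) by (auto simp: topspace_S)
  show "inj_on (%i. (C x ! i, r i x)) I" using V(2) fin by (simp add: eq_card_imp_inj_on)
 qed
 have c: "0 < card I" using fin I(2) by (simp add: card_gt_0_iff)
 have "cts X (\<S> (card I)) (%x. (mx (?F x) + \<nu> x, (%j. mv (\<nu> x) (C x ! g j, r (g j) x)) ` {..<card I}))"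
 proof (rule cts_into_S[OF c])
  show "cts X rtop (%x. mx (?F x) + \<nu> x)"
   by (intro continuous_map_add \<nu> cts_mx fin r(1)) (use I(1) in auto)
  show "cts X euclidean (%x. mv (\<nu> x) (C x ! g j, r (g j) x))" if "j < card I" for j
   using cm_comp[OF cm_pair[OF cm_pair[OF r(1) \<nu>(1)] C], of "g j" "g j" "%((a, b), e). shift (a + b) e"] gI[OF that]
   by (simp add: mv_def shift_def case_prod_beta continuous_intros)
 next
  fix x assume x: "x : pts X"
  have mem: "mv (\<nu> x) (C x ! g j, r (g j) x) : mv (\<nu> x) ` ?F x" if "j < card I" for j
   using gI[OF that] by blast
  show "0 < mx (?F x) + \<nu> x" using S[OF x] c by (simp add: confs_def)
  show "good (mx (?F x) + \<nu> x) (mv (\<nu> x) (C x ! g j, r (g j) x))" if "j < card I" for j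
   by (rule confs_facts(4)[OF S[OF x], unfolded fst_conv snd_conv, OF mem[OF that]])
  show "sep (mv (\<nu> x) (C x ! g i, r (g i) x)) (mv (\<nu> x) (C x ! g j, r (g j) x))"
   if ij: "i < card I" "j < card I" "i ~= j" for i j
  proof -
   have "g i ~= g j" using g ij by (auto simp: bij_betw_def inj_on_def)
   hence "(C x ! g i, r (g i) x) ~= (C x ! g j, r (g j) x)"
    using inj2[OF x] gI ij unfolding inj_on_def by metis
   hence "mv (\<nu> x) (C x ! g i, r (g i) x) ~= mv (\<nu> x) (C x ! g j, r (g j) x)"
    using inj[OF x] gI(1) ij unfolding inj_on_def by blast
   thus ?thesis by (rule confs_facts(5)[OF S[OF x], unfolded fst_conv snd_conv, OF mem[OF ij(1)] mem[OF ij(2)]])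
  qed
 qed
 moreover have "(%j. mv (\<nu> x) (C x ! g j, r (g j) x)) ` {..<card I} = mv (\<nu> x) ` ?F x" for x
  proof -
   have "I = g ` {..<card I}" using g by (simp add: bij_betw_def)
   hence "?F x = (%i. (C x ! i, r i x)) ` g ` {..<card I}" by simp
   thus ?thesis by (simp only: image_image)
  qed
 ultimately show ?thesis by simp
qed

lemma cts_pureG:
 assumes M: "rmod M act" and X: "lcs X" "haus X"
  and x: "cts X (M m) u"
  and C: "!!i. i < k ==> cts X euclidean (%x. C x ! i)"
  and col: "!!x. x : pts X ==> length (C x) = k \<and> column (C x)"
  and r: "!!i. i < k ==> cts X rtop (r i)" "!!i x. i < k ==> x : pts X ==> 0 <= r i x"
  and \<nu>: "cts X rtop \<nu>"
   "!!x i. x : pts X ==> i < k ==> 0 <= fst (fst (C x ! i)) + \<nu> x"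
  and I: "I \<subseteq> {..<k}"
 shows "cts X (M (m + card I)) (%x. pureG act m (u x) (\<nu> x) ((%i. (C x ! i, r i x)) ` I))"
proof (cases "I = {}")
 case True
 thus ?thesis using x by (simp add: pureG_def)
next
 case False
 have "cts X (\<S> (card I)) (%x. (mx ((%i. (C x ! i, r i x)) ` I) + \<nu> x, mv (\<nu> x) ` (%i. (C x ! i, r i x)) ` I))"
 proof (rule cts_column_conf[OF C col r \<nu>(1) _ I False])
  show "0 <= fst (fst (C x ! i)) + r i x + \<nu> x" if "x : pts X" "i < k" for x i
   using \<nu>(2)[OF that] r(2)[OF that(2,1)] by simp
 qed
 from cts_act[OF M X x this]
 have "cts X (M (m + card I)) (%x. act m (card I) (u x)
   (mx ((%i. (C x ! i, r i x)) ` I) + \<nu> x, mv (\<nu> x) ` (%i. (C x ! i, r i x)) ` I))" .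
 thus ?thesis
 proof (rule cts_eq)
  fix x assume "x : pts X"
  hence "card ((%i. (C x ! i, r i x)) ` I) = card I"
   using validF_index(2)[of "C x" I "%i. r i x"] col I r(2) by auto
  thus "act m (card I) (u x) (mx ((%i. (C x ! i, r i x)) ` I) + \<nu> x, mv (\<nu> x) ` (%i. (C x ! i, r i x)) ` I) =
   pureG act m (u x) (\<nu> x) ((%i. (C x ! i, r i x)) ` I)"
   using False by (simp add: pureG_def)
 qed
qed

lemma cm_into_product:
 "(!!x. x : pts X ==> f x : extensional I) ==> (!!i. i : I ==> cts X (Y i) (%x. f x i)) ==>
  cts X (product_topology Y I) f"
 unfolding continuous_map_componentwise by auto


section \<open>Removing squares\<close>

definition del :: "nat => 'b list => 'b list" where
 "del i C = take i C @ drop (Suc i) C"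

lemma length_del [simp]: "i < length C ==> length (del i C) = length C - 1"
 by (simp add: del_def)

lemma nth_del:
 assumes "i < length C" "j < length C - 1"
 shows "del i C ! j = C ! (if j < i then j else Suc j)"
 using assms by (auto simp: del_def nth_append)

lemma del_del:
 assumes "i < j" "j < length C"
 shows "del i (del j C) = del (j - 1) (del i C)"
proof (rule nth_equalityI)
 show "length (del i (del j C)) = length (del (j - 1) (del i C))" using assms by simp
 fix l assume "l < length (del i (del j C))"
 hence l: "l < length C - 2" using assms by simp
 show "del i (del j C) ! l = del (j - 1) (del i C) ! l"
  using l assms by (auto simp: nth_del)
qed

lemma set_del_subset: "set (del i C) \<subseteq> set C"
 by (auto simp: del_def dest: in_set_takeD in_set_dropD)

lemma nth_notin_set_del:
 assumes "distinct C" "i < length C"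
 shows "C ! i \<notin> set (del i C)"
proof -
 have "C = take i C @ C ! i # drop (Suc i) C" using assms(2) by (rule id_take_nth_drop)
 hence "distinct (take i C @ C ! i # drop (Suc i) C)" using assms(1) by simp
 thus ?thesis by (auto simp: del_def)
qed

lemma set_del:
 assumes "distinct C" "i < length C"
 shows "set (del i C) = set C - {C ! i}"
proof -
 have "C = take i C @ C ! i # drop (Suc i) C" using assms(2) by (rule id_take_nth_drop)
 hence "set C = set (take i C @ C ! i # drop (Suc i) C)" by simp
 thus ?thesis using nth_notin_set_del[OF assms] by (auto simp: del_def)
qed

lemma sorted_wrt_del: "sorted_wrt P C ==> sorted_wrt P (del i C)"
proof (induction C arbitrary: i)
 case (Cons a C)
 thus ?case
  using set_del_subset[of "i - 1" C] by (cases i) (auto simp: del_def)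
qed (simp add: del_def)

lemma column_del: "column C ==> column (del i C)"
 using set_del_subset[of i C] sorted_wrt_del by (auto simp: column_def)

definition sg :: "nat => 'v::ab_group_add => 'v" where
 "sg i v = (if even i then v else - v)"

definition dd :: "(nat => 'b => 'b) => nat => nat => ('b, 'k::ab_group_add) coeff_chain => ('b, 'k) coeff_chain" where
 "dd D k q c = (\<Sum>i<k. sg i (cmap q (D i) c))"

lemma sg_add: "sg i (v + w) = sg i v + sg i w"
 by (simp add: sg_def)

lemma sg_diff: "sg i (v - w) = sg i v - sg i w"
 by (simp add: sg_def)

lemma sg_sum: "sg i (sum f I) = (\<Sum>j\<in>I. sg i (f j))"
 by (simp add: sg_def sum_negf)

lemma sg_sg: "sg i (sg j v) = sg (i + j) v"
 by (simp add: sg_def)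

lemma sg_0 [simp]: "sg i 0 = 0"
 by (simp add: sg_def)

lemma cmap_uminus: "cmap q g (- c) = - cmap q g c"
 by (simp add: cmap_def ext_uminus)

lemma cmap_sg: "cmap q g (sg i c) = sg i (cmap q g c)"
 by (simp add: sg_def cmap_uminus)

lemma cmap_sum: "cmap q g (sum f I) = (\<Sum>i\<in>I. cmap q g (f i))"
 by (simp add: cmap_def ext_sum)

lemma cbd_sg: "cbd q (sg i c) = sg i (cbd q c)"
 by (simp add: sg_def coeff_boundary_uminus)

lemma keys_sg [simp]: "supp (sg i c) = supp c"
 by (auto simp: sg_def in_keys_iff)

lemma dd_0 [simp]: "dd D k q 0 = 0"
 by (simp add: dd_def)

lemma dd_diff: "dd D k q (a - b) = dd D k q a - dd D k q b"
 by (simp add: dd_def cmap_diff sg_diff sum_subtractf)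

lemma dd_add: "dd D k q (a + b) = dd D k q a + dd D k q b"
 by (simp add: dd_def cmap_add sg_add sum.distrib)

lemma keys_dd:
 assumes "supp c \<subseteq> A" "!!i s. i < k ==> s : A ==> smap q (D i) s : B"
 shows "supp (dd D k q c) \<subseteq> B"
 unfolding dd_def
proof (rule keys_sum_subset)
 fix i assume "i : {..<k}"
 thus "supp (sg i (cmap q (D i) c)) \<subseteq> B"
  using keys_cmap[OF assms(1), of q "D i" B] assms(2) by simp
qed

lemma cbd_dd: "cbd q (dd D k q c) = dd D k (q - 1) (cbd q c)"
 by (simp add: dd_def coeff_boundary_sum cbd_sg cbd_cmap)

lemma cmap_dd:
 assumes "!!i s x. i < k ==> s : supp c ==> x : spx q ==> g (D i (s x)) = D' i (g (s x))"
 shows "cmap q g (dd D k q c) = dd D' k q (cmap q g c)"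
 unfolding dd_def cmap_sum cmap_sg cmap_cmap
 by (intro sum.cong arg_cong[where f = "sg _"] cmap_cong) (use assms in auto)

lemma dd_dd:
 assumes D: "!!i j s x. i < j ==> j < Suc k ==> s : supp c ==> x : spx q ==>
   D i (D j (s x)) = D (j - 1) (D i (s x))"
 shows "dd D k q (dd D (Suc k) q c) = 0"
proof -
 define F where "F = (%(i, j). sg (i + j) (cmap q (%x. D i (D j x)) c))"
 have "dd D k q (dd D (Suc k) q c) = (\<Sum>i<k. \<Sum>j<Suc k. F (i, j))"
  by (simp only: dd_def cmap_sum cmap_sg cmap_cmap sg_sum sg_sg F_def case_prod_conv)
 also have "\<dots> = sum F ({..<k} \<times> {..<Suc k})"
  by (simp only: sum.cartesian_product case_prod_eta)
 also have "\<dots> = sum F {(i, j). i < j \<and> j < Suc k} + sum F {(i, j). j <= i \<and> i < k}"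
 proof (subst sum.union_disjoint[symmetric])
  show "finite {(i, j). i < j \<and> j < Suc k}" by (rule finite_subset[of _ "{..k} \<times> {..k}"]) auto
  show "finite {(i, j). j <= i \<and> i < k}" by (rule finite_subset[of _ "{..k} \<times> {..k}"]) auto
  show "{(i, j). i < j \<and> j < Suc k} \<inter> {(i, j). j <= i \<and> i < k} = {}" by auto
  have "{..<k} \<times> {..<Suc k} = {(i, j). i < j \<and> j < Suc k} \<union> {(i, j). j <= i \<and> i < k}" by auto
  thus "sum F ({..<k} \<times> {..<Suc k}) = sum F ({(i, j). i < j \<and> j < Suc k} \<union> {(i, j). j <= i \<and> i < k})" by simp
 qed
 also have "sum F {(i, j). i < j \<and> j < Suc k} = sum (%x. - F x) {(i, j). j <= i \<and> i < k}"
 proof (rule sum.reindex_bij_witness[where i = "%(i, j). (j, Suc i)" and j = "%(i, j). (j - 1, i)"])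
  fix x assume "x : {(i, j). i < j \<and> j < Suc k}"
  then obtain i j where x: "x = (i, Suc j)" "i <= j" "j < k"
   by (cases x; cases "snd x") auto
  show "(%(i, j). (j, Suc i)) ((%(i, j). (j - 1, i)) x) = x" using x by simp
  show "(%(i, j). (j - 1, i)) x : {(i, j). j <= i \<and> i < k}" using x by simp
  have "cmap q (%x. D i (D (Suc j) x)) c = cmap q (%x. D j (D i x)) c"
   by (rule cmap_cong) (use D[of i "Suc j"] x in simp)
  thus "- F ((%(i, j). (j - 1, i)) x) = F x"
   using x by (simp add: F_def sg_def add.commute)
 qed auto
 finally show ?thesis by (simp add: sum_negf)
qed


section \<open>The complex of moving columns\<close>

text \<open>The i-th square is no longer removed, that is, it is always put back at distance 0. Its
  presence already gives the strip its original end, hence the margin 0.\<close>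

definition bdel :: "nat => 'a bdata => 'a bdata" where
 "bdel i b = (del i (fst b), 0, %F. snd (snd b) (insert (fst b ! i, 0) F))"

lemma bdel_bdel:
 assumes "i < j" "j < length (fst b)"
 shows "bdel i (bdel j b) = bdel (j - 1) (bdel i b)"
 using assms by (auto simp: bdel_def del_del nth_del insert_commute)

lemma mlaw_bdel:
 assumes L: "mlaw act m (set C) \<mu> G" and C: "column C" and i: "i < length C"
 shows "mlaw act (Suc m) (set (del i C)) 0 (%F. G (insert (C ! i, 0) F))"
 unfolding mlaw_def
proof (intro allI impI, elim conjE)
 fix F1 F2 assume V: "validF (set (del i C)) (F1 \<union> F2)" and dis: "fst ` F1 \<inter> fst ` F2 = {}" and ne: "F2 ~= {}"
  and far: "\<forall>p\<in>F2. mx F1 <= fst (fst (fst p)) + snd p"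
 have ni: "C ! i \<notin> fst ` (F1 \<union> F2)"
  using V nth_notin_set_del[OF column_distinct[OF C] i] unfolding validF_def by (metis imageE)
 have fin: "finite F1" using V by (simp add: validF_def)
 have V': "validF (set C) (insert (C ! i, 0) F1 \<union> F2)"
  using V ni i set_del_subset[of i C] by (auto simp: validF_def image_Un)
 have c: "card (insert (C ! i, 0) F1) = Suc (card F1)"
  proof -
   have "(C ! i, 0) \<notin> F1" using ni by (metis UnI1 fst_conv image_eqI)
   thus ?thesis using fin by simp
  qed
 have "G (insert (C ! i, 0) F1 \<union> F2) = act (m + card (insert (C ! i, 0) F1)) (card F2) (G (insert (C ! i, 0) F1))
    (mx F2 + ((if insert (C ! i, 0) F1 = {} then \<mu> else 0) - mx (insert (C ! i, 0) F1)),
    mv ((if insert (C ! i, 0) F1 = {} then \<mu> else 0) - mx (insert (C ! i, 0) F1)) ` F2)"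
  using L[unfolded mlaw_def, rule_format, of "insert (C ! i, 0) F1" F2] V' dis ne far ni
  by (auto simp: mx_insert_0 image_iff)
 thus "G (insert (C ! i, 0) (F1 \<union> F2)) = act (Suc m + card F1) (card F2) (G (insert (C ! i, 0) F1))
    (mx F2 + ((if F1 = {} then 0 else 0) - mx F1), mv ((if F1 = {} then 0 else 0) - mx F1) ` F2)"
  by (simp add: c mx_insert_0)
qed

lemma Bfam_bdel:
 assumes f: "Bfam M act n k X f" and i: "i < k"
 shows "Bfam M act n (k - 1) X (%x. bdel i (f x))"
proof -
 have kn: "k <= n" and nk: "n - (k - 1) = Suc (n - k)" using f i by (auto simp: Bfam_def)
 have fx: "length (fst (f x)) = k" "column (fst (f x))"
   "mlaw act (n - k) (set (fst (f x))) (fst (snd (f x))) (snd (snd (f x)))" if "x : pts X" for x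
  using f that by (auto simp: Bfam_def)
 define s where "s = (%j. if j < i then j else Suc j)"
 have s: "s j < k" if "j < k - 1" for j using that i by (auto simp: s_def)
 have inj: "inj s" by (rule strict_mono_imp_inj_on) (auto simp: strict_mono_def s_def)
 have si: "s j ~= i" for j by (auto simp: s_def)
 have nth: "del i (fst (f x)) ! j = fst (f x) ! s j" if "x : pts X" "j < k - 1" for x j
  using nth_del[of i "fst (f x)" j] fx[OF that(1)] that i by (simp add: s_def)
 \<comment> \<open>The map inserts the distance 0 at the position of the square that is put
   back.\<close>
 have PPm: "cts (PP (k - 1)) (PP k) (%\<rho>. \<lambda>l\<in>{..<k}. if l = i then 0 else \<rho> (if l < i then l else l - 1))"
  unfolding PP_def
 proof (rule cm_into_product)
  show "(\<lambda>l\<in>{..<k}. if l = i then 0 else \<rho> (if l < i then l else l - 1)) : extensional {..<k}" for \<rho> :: "nat => real"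
   by simp
  fix l assume l: "l : {..<k}"
  show "cts (product_topology (%_. top_of_set {0..}) {..<k - 1}) (top_of_set {0::real..})
    (%\<rho>. (\<lambda>l\<in>{..<k}. if l = i then 0 else \<rho> (if l < i then l else l - 1)) l)"
   using l i by (cases "l = i") (auto intro!: continuous_map_product_projection)
 qed
 show ?thesis
  unfolding Bfam_def
 proof (intro conjI allI impI ballI)
  show "k - 1 <= n" using kn by simp
  fix x assume x: "x : pts X"
  show "length (fst (bdel i (f x))) = k - 1" using fx[OF x] i by (simp add: bdel_def)
  show "column (fst (bdel i (f x)))" using fx[OF x] by (simp add: bdel_def column_del)
  show "mlaw act (n - (k - 1)) (set (fst (bdel i (f x)))) (fst (snd (bdel i (f x)))) (snd (snd (bdel i (f x))))"
   using mlaw_bdel[OF fx(3)[OF x] fx(2)[OF x], of i] fx(1)[OF x] i unfolding nk by (simp add: bdel_def)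
  show "0 <= fst (snd (bdel i (f x)))" by (simp add: bdel_def)
 next
  fix j assume j: "j < k - 1"
  have "cts X euclidean (%x. fst (f x) ! s j)"
   using f s[OF j] by (simp add: Bfam_def)
  thus "cts X euclidean (%x. fst (bdel i (f x)) ! j)"
   by (rule cts_eq) (simp only: bdel_def fst_conv nth[OF _ j])
 next
  show "cts X rtop (%x. fst (snd (bdel i (f x))))" by (simp add: bdel_def)
 next
  fix I assume I: "I \<subseteq> {..<k - 1}"
  let ?J = "insert i (s ` I)"
  have fin: "finite I" using I finite_subset by blast
  have J: "?J \<subseteq> {..<k}" using I s i by auto
  have cJ: "card ?J = Suc (card I)"
   using fin si card_image[OF inj_on_subset[OF inj subset_UNIV], of I] by (subst card_insert_disjoint) auto
  let ?e = "%\<rho>. \<lambda>l\<in>{..<k}. if l = i then 0 else \<rho> (if l < i then l else l - 1)"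
  have c1: "cts (ptop X (PP (k - 1))) (ptop X (PP k)) (%p. (fst p, ?e (snd p)))"
   using cts_compose[OF cts_snd PPm, of X]
   by (intro cts_pair cts_fst) (simp add: o_def)
  have c2: "cts (ptop X (PP k)) (M (n - k + card ?J))
   (%p. snd (snd (f (fst p))) ((%j. (fst (f (fst p)) ! j, snd p j)) ` ?J))"
   using f J unfolding Bfam_def by blast
  have c3: "cts (ptop X (PP (k - 1))) (M (n - (k - 1) + card I))
   (%p. snd (snd (f (fst p))) ((%j. (fst (f (fst p)) ! j, ?e (snd p) j)) ` ?J))"
   using cts_compose[OF c1 c2] by (simp only: o_def fst_conv snd_conv cJ nk add_Suc_right add_Suc)
  show "cts (ptop X (PP (k - 1))) (M (n - (k - 1) + card I))
   (%p. snd (snd (bdel i (f (fst p)))) ((%j. (fst (bdel i (f (fst p))) ! j, snd p j)) ` I))"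
  proof (rule cts_eq[OF c3])
   fix p assume "p : pts (ptop X (PP (k - 1)))"
   hence x: "fst p : pts X" by auto
   have a: "?e (snd p) i = 0" using i by simp
   have b: "?e (snd p) (s j) = snd p j" if "j : I" for j
    using that I s[of j] by (auto simp: s_def)
   have "(%j. (fst (f (fst p)) ! j, ?e (snd p) j)) ` ?J =
     insert (fst (f (fst p)) ! i, 0) ((%j. (fst (f (fst p)) ! s j, snd p j)) ` I)"
    unfolding image_insert image_image a by (intro arg_cong2[where f = insert] refl image_cong) (simp only: b)
   also have "(%j. (fst (f (fst p)) ! s j, snd p j)) ` I = (%j. (fst (bdel i (f (fst p))) ! j, snd p j)) ` I"
    by (intro image_cong refl) (use I nth[OF x] in \<open>auto simp: bdel_def\<close>)
   finally show "snd (snd (f (fst p))) ((%j. (fst (f (fst p)) ! j, ?e (snd p) j)) ` ?J) =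
    snd (snd (bdel i (f (fst p)))) ((%j. (fst (bdel i (f (fst p))) ! j, snd p j)) ` I)"
    by (simp add: bdel_def)
  qed
 qed
qed

lemma bdel_Bs: "i < k ==> s : Bs M act n k q ==> smap q (bdel i) s : Bs M act n (k - 1) q"
 using Bs_restrict[OF Bfam_bdel] by (auto simp: Bs_def simplex_map_def o_def)

lemma Bfam_pure:
 assumes M: "rmod M act" and X: "lcs X" "haus X" and kn: "k <= n"
  and u: "cts X (M (n - k)) u"
  and C: "!!i. i < k ==> cts X euclidean (%x. C x ! i)"
  and col: "!!x. x : pts X ==> length (C x) = k \<and> column (C x)"
  and \<nu>: "cts X rtop \<nu>"
   "!!x. x : pts X ==> 0 <= \<nu> x" "!!x e. x : pts X ==> e : set (C x) ==> 0 <= fst (fst e) + \<nu> x"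
 shows "Bfam M act n k X (%x. (C x, \<nu> x, pureG act (n - k) (u x) (\<nu> x)))"
 unfolding Bfam_def fst_conv snd_conv
proof (intro conjI allI impI ballI)
 show "k <= n" by (rule kn)
 show "length (C x) = k" "column (C x)" "0 <= \<nu> x" if "x : pts X" for x
  using col[OF that] \<nu>(2)[OF that] by auto
 show "mlaw act (n - k) (set (C x)) (\<nu> x) (pureG act (n - k) (u x) (\<nu> x))" if "x : pts X" for x
  by (rule mlaw_pure[OF M]) (use that u col \<nu>(3) in \<open>auto simp: cts_def\<close>)
 show "cts X euclidean (%x. C x ! i)" if "i < k" for i by (rule C[OF that])
 show "cts X rtop \<nu>" by (rule \<nu>(1))
 fix I assume I: "I \<subseteq> {..<k}"
 have p: "cts (ptop X (PP k)) Z (%p. g (fst p))" if "cts X Z g" for Z and g :: "_ => 'z"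
  using cts_compose[OF cts_fst that, of "PP k"] by (simp add: o_def)
 have p2: "cts (ptop X (PP k)) rtop (%p. snd p i)" if "i < k" for i
  using cts_compose[OF cts_snd PP_facts(3)[OF that], of X] by (simp add: o_def)
 show "cts (ptop X (PP k)) (M (n - k + card I))
   (%p. pureG act (n - k) (u (fst p)) (\<nu> (fst p)) ((%i. (C (fst p) ! i, snd p i)) ` I))"
 proof (rule cts_pureG[OF M _ _ p[OF u] p[OF C] _ p2 _ p[OF \<nu>(1)] _ I])
  show "lcs (ptop X (PP k))" "haus (ptop X (PP k))"
   using X PP_facts(1,2) by (auto simp: locally_compact_space_prod_topology Hausdorff_space_prod_topology)
  show "length (C (fst p)) = k \<and> column (C (fst p))" if "p : pts (ptop X (PP k))" for p
   using that by (intro col) auto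
  show "0 <= snd p i" if "i < k" "p : pts (ptop X (PP k))" for i p
   using that by (intro PP_facts(4)[of _ k]) auto
  show "0 <= fst (fst (C (fst p) ! i)) + \<nu> (fst p)" if "p : pts (ptop X (PP k))" "i < k" for i p
   using that col[of "fst p"] by (intro \<nu>(3)) auto
 qed
qed

definition slots :: "nat => square list" where
 "slots k = map (%i. ((- 1, real i / real k), (1, 1 / real k))) [0..<k]"

lemma slots_nth: "i < k ==> slots k ! i = ((- 1, real i / real k), (1, 1 / real k))"
 by (simp add: slots_def)

lemma length_slots [simp]: "length (slots k) = k"
 by (simp add: slots_def)

lemma column_nth_iff:
 "column C \<longleftrightarrow> (\<forall>i<length C. rgood (C ! i)) \<and>
  (\<forall>i j. i < j --> j < length C --> snd (fst (C ! i)) + snd (snd (C ! i)) <= snd (fst (C ! j)))"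
 by (simp add: column_def all_set_conv_all_nth sorted_wrt_iff_nth_less)

lemma column_slots: "column (slots k)"
 unfolding column_nth_iff
proof (intro conjI allI impI)
 show "rgood (slots k ! i)" if "i < length (slots k)" for i
  using that by (simp add: slots_nth rgood_def field_simps)
 show "snd (fst (slots k ! i)) + snd (snd (slots k ! i)) <= snd (fst (slots k ! j))" if "i < j" "j < length (slots k)" for i j
 proof -
  have "real i + 1 <= real j" using that by simp
  hence "(real i + 1) / real k <= real j / real k" using that by (intro divide_right_mono) auto
  thus ?thesis using that by (simp add: slots_nth add_divide_distrib)
 qed
qed

text \<open>The margin 1 is the width of the standard squares, so the strip of \<open>x\<close> ends
  where the squares begin.\<close>

definition iota :: "'a action => nat => nat => 'a => 'a bdata" where
 "iota act n k x = (slots k, 1, pureG act (n - k) x 1)"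

text \<open>A continuous bound: moving by it takes every square of the column past the right end,
  see \<open>offs_ge\<close>.\<close>

definition offs :: "square list => real" where
 "offs C = (\<Sum>i<length C. \<bar>fst (fst (C ! i))\<bar>)"

text \<open>First half of the retraction: everything that is put back is moved further to the right.
  At time 1 both branches would agree on valid sets by \<open>translated_pure\<close>; the second
  one also fixes the values on all other sets, so that the end is literally the start of
  \<open>bmix\<close>.\<close>

definition btrans :: "'a action => nat => nat => 'a bdata \<times> real => 'a bdata" where
 "btrans act n k z = (case z of ((C, \<mu>, G), s) => (C, \<mu> + s * offs C,
  if s < 1 then (%F. G ((%p. (fst p, snd p + s * offs C)) ` F)) else pureG act (n - k) (G {}) (\<mu> + offs C)))"

definition mixsq :: "real => square => square => square" where
 "mixsq s e e' = (((1 - s) * fst (fst e) + s * fst (fst e'), (1 - s) * snd (fst e) + s * snd (fst e')),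
  ((1 - s) * fst (snd e) + s * fst (snd e'), (1 - s) * snd (snd e) + s * snd (snd e')))"

text \<open>Second half: pure data depend on a column, a margin and one point only, so column and
  margin can be moved linearly to those of \<open>iota\<close>.\<close>

definition bmix :: "'a action => nat => nat => 'a bdata \<times> real => 'a bdata" where
 "bmix act n k z = (case z of ((C, \<mu>, G), s) =>
  (map (%i. mixsq s (C ! i) (slots k ! i)) [0..<k], (1 - s) * (\<mu> + offs C) + s,
   pureG act (n - k) (G {}) ((1 - s) * (\<mu> + offs C) + s)))"

lemma offs_ge:
 assumes "e : set C"
 shows "0 <= fst (fst e) + offs C"
proof -
 obtain i where i: "i < length C" "e = C ! i" using assms by (auto simp: in_set_conv_nth)
 have "\<bar>fst (fst (C ! i))\<bar> <= offs C"
  unfolding offs_def by (rule member_le_sum[of i "{..<length C}" "%i. \<bar>fst (fst (C ! i))\<bar>"]) (use i in auto)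
 thus ?thesis using i by simp
qed

lemma offs_nonneg: "0 <= offs C"
 by (simp add: offs_def sum_nonneg)

lemma cts_offs:
 assumes "Bfam M act n k X f"
 shows "cts X rtop (%x. offs (fst (f x)))"
proof -
 have "cts X rtop (%x. \<bar>fst (fst (fst (f x) ! i))\<bar>)" if "i < k" for i
  using cm_comp[of X "%x. fst (f x) ! i" "%e. \<bar>fst (fst e)\<bar>"] assms that
  by (simp add: Bfam_def continuous_intros)
 hence "cts X rtop (%x. \<Sum>i<k. \<bar>fst (fst (fst (f x) ! i))\<bar>)"
  by (intro continuous_map_sum) auto
 thus ?thesis
  by (rule cts_eq) (use assms in \<open>simp add: Bfam_def offs_def\<close>)
qed

text \<open>For columns of equal length all conditions are inequalities linear in the coordinates,
  so convex combinations preserve them.\<close>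

lemma column_mix:
 assumes "column C" "length C = k" "column C'" "length C' = k" "0 <= s" "s <= 1"
 shows "column (map (%i. mixsq s (C ! i) (C' ! i)) [0..<k])"
proof -
 have mx: "(1 - s) * a + s * b <= (1 - s) * a' + s * b'" if "a <= a'" "b <= b'" for a b a' b' :: real
  using assms(5,6) that by (intro add_mono mult_left_mono) auto
 have mx0: "0 < (1 - s) * a + s * b" if "0 < a" "0 < b" for a b :: real
  using assms(5,6) that by (cases "s = 0") (auto intro: add_nonneg_pos)
 have r: "rgood (C ! i)" "rgood (C' ! i)" if "i < k" for i using assms that by (auto simp: column_nth_iff)
 have st: "snd (fst (C ! i)) + snd (snd (C ! i)) <= snd (fst (C ! j))"
  "snd (fst (C' ! i)) + snd (snd (C' ! i)) <= snd (fst (C' ! j))" if "i < j" "j < k" for i j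
  using assms that by (auto simp: column_nth_iff)
 show ?thesis
  unfolding column_nth_iff
 proof (intro conjI allI impI; simp)
  fix i assume i: "i < k"
  have "(1 - s) * (fst (fst (C ! i)) + fst (snd (C ! i))) + s * (fst (fst (C' ! i)) + fst (snd (C' ! i))) <= (1 - s) * 0 + s * 0"
   by (rule mx) (use r[OF i] in \<open>auto simp: rgood_def\<close>)
  moreover have "(1 - s) * 0 + s * 0 <= (1 - s) * snd (fst (C ! i)) + s * snd (fst (C' ! i))"
   by (rule mx) (use r[OF i] in \<open>auto simp: rgood_def\<close>)
  moreover have "(1 - s) * (snd (fst (C ! i)) + snd (snd (C ! i))) + s * (snd (fst (C' ! i)) + snd (snd (C' ! i))) <= (1 - s) * 1 + s * 1"
   by (rule mx) (use r[OF i] in \<open>auto simp: rgood_def\<close>)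
  moreover have "0 < (1 - s) * fst (snd (C ! i)) + s * fst (snd (C' ! i))" "0 < (1 - s) * snd (snd (C ! i)) + s * snd (snd (C' ! i))"
   by (rule mx0; use r[OF i] in \<open>auto simp: rgood_def\<close>)+
  ultimately show "rgood (mixsq s (C ! i) (C' ! i))"
   unfolding rgood_def mixsq_def fst_conv snd_conv by (simp add: distrib_left add_ac)
 next
  fix i j assume ij: "i < j" "j < k"
  have "(1 - s) * (snd (fst (C ! i)) + snd (snd (C ! i))) + s * (snd (fst (C' ! i)) + snd (snd (C' ! i))) <=
   (1 - s) * snd (fst (C ! j)) + s * snd (fst (C' ! j))"
   by (rule mx) (use st[OF ij] in auto)
  thus "snd (fst (mixsq s (C ! i) (C' ! i))) + snd (snd (mixsq s (C ! i) (C' ! i))) <= snd (fst (mixsq s (C ! j) (C' ! j)))"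
   unfolding mixsq_def fst_conv snd_conv by (simp add: distrib_left add_ac)
 qed
qed

lemma Bfam_btrans:
 assumes f: "Bfam M act n k X f" and s: "cts X rtop s" "!!x. x : pts X ==> s x : {0..1}"
 shows "Bfam M act n k X (%x. btrans act n k (f x, s x))"
proof -
 let ?c = "%x. s x * offs (fst (f x))"
 have fx: "length (fst (f x)) = k" "column (fst (f x))"
   "mlaw act (n - k) (set (fst (f x))) (fst (snd (f x))) (snd (snd (f x)))" "0 <= fst (snd (f x))"
  if "x : pts X" for x
  using f that by (auto simp: Bfam_def)
 have c: "cts X rtop ?c"
  by (intro continuous_map_real_mult s cts_offs[OF f])
 have c0: "0 <= ?c x" if "x : pts X" for x using s(2)[OF that] offs_nonneg by simp
 let ?g = "%x. (fst (f x), fst (snd (f x)) + ?c x, %F. snd (snd (f x)) ((%p. (fst p, snd p + ?c x)) ` F))"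
 have law: "mlaw act (n - k) (set (fst (f x))) (fst (snd (f x)) + ?c x) (%F. snd (snd (f x)) ((%p. (fst p, snd p + ?c x)) ` F))"
  if "x : pts X" for x
  by (rule mlaw_translate[OF fx(3)[OF that] fx(2)[OF that] c0[OF that]])
 have far: "0 <= fst (fst e) + fst (snd (f x)) + offs (fst (f x))" if "x : pts X" "e : set (fst (f x))" for x e
  using offs_ge[OF that(2)] fx(4)[OF that(1)] by simp
 \<comment> \<open>On valid sets the case distinction in \<open>btrans\<close> is invisible; hence
   law and continuity can be checked with the translated values at all times.\<close>
 have eq: "snd (snd (f x)) ((%p. (fst p, snd p + ?c x)) ` F) = snd (snd (btrans act n k (f x, s x))) F"
  if x: "x : pts X" and F: "validF (set (fst (f x))) F" for x F
 proof (cases "s x < 1")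
  case True
  thus ?thesis by (simp add: btrans_def case_prod_beta)
 next
  case False
  hence s1: "s x = 1" using s(2)[OF x] by simp
  have "snd (snd (f x)) ((%p. (fst p, snd p + offs (fst (f x)))) ` F) =
    pureG act (n - k) (snd (snd (f x)) {}) (fst (snd (f x)) + offs (fst (f x))) F"
   using translated_pure[OF fx(3)[OF x] fx(2)[OF x] F offs_nonneg] offs_ge[of _ "fst (f x)"] far[OF x] F fx(4)[OF x] offs_nonneg
   by (auto simp: validF_def)
  thus ?thesis using s1 by (simp add: btrans_def case_prod_beta)
 qed
 have i1: "fst (btrans act n k (f x, s x)) = fst (f x)" and i2: "fst (snd (btrans act n k (f x, s x))) = fst (snd (f x)) + ?c x" for x
  by (simp_all add: btrans_def case_prod_beta)
 show ?thesis
  unfolding Bfam_def i1 i2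
 proof (intro conjI allI impI ballI)
  show "k <= n" using f by (simp add: Bfam_def)
  show "length (fst (f x)) = k" "column (fst (f x))" "0 <= fst (snd (f x)) + ?c x" if "x : pts X" for x
   using fx[OF that] c0[OF that] by auto
  show "mlaw act (n - k) (set (fst (f x))) (fst (snd (f x)) + ?c x) (snd (snd (btrans act n k (f x, s x))))"
   if x: "x : pts X" for x
   unfolding mlaw_def
  proof (intro allI impI, elim conjE)
   fix F1 F2 assume *: "validF (set (fst (f x))) (F1 \<union> F2)" "fst ` F1 \<inter> fst ` F2 = {}" "F2 ~= {}"
    "\<forall>p\<in>F2. mx F1 <= fst (fst (fst p)) + snd p"
   have "validF (set (fst (f x))) F1" using *(1) validF_subset by blast
   thus "snd (snd (btrans act n k (f x, s x))) (F1 \<union> F2) =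
     act (n - k + card F1) (card F2) (snd (snd (btrans act n k (f x, s x))) F1)
     (mx F2 + ((if F1 = {} then fst (snd (f x)) + ?c x else 0) - mx F1),
     mv ((if F1 = {} then fst (snd (f x)) + ?c x else 0) - mx F1) ` F2)"
    using law[OF x, unfolded mlaw_def, rule_format, of F1 F2] * eq[OF x, of F1] eq[OF x, of "F1 \<union> F2"] by simp
  qed
  show "cts X euclidean (%x. fst (f x) ! i)" if "i < k" for i using f that by (simp add: Bfam_def)
  show "cts X rtop (%x. fst (snd (f x)) + ?c x)"
   using f by (intro continuous_map_add c) (simp add: Bfam_def)
  fix I assume I: "I \<subseteq> {..<k}"
  have p1: "cts (ptop X (PP k)) (PP k) (%p. \<lambda>i\<in>{..<k}. snd p i + ?c (fst p))"
   unfolding PP_def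
  proof (rule cm_into_product, goal_cases)
   case (2 i)
   have "cts (ptop X (PP k)) rtop (%p. snd p i + ?c (fst p))"
    using cts_compose[OF cts_snd PP_facts(3)[of i k], of X] cts_compose[OF cts_fst c, of "PP k"] 2
    by (intro continuous_map_add) (auto simp: o_def)
   hence "cts (ptop X (PP k)) (top_of_set {0..}) (%p. snd p i + ?c (fst p))"
    by (rule cts_into) (use PP_facts(4)[of _ k i] c0 2 in fastforce)
   thus ?case using 2 by (simp add: PP_def)
  qed auto
  have "cts (ptop X (PP k)) (ptop X (PP k)) (%p. (fst p, \<lambda>i\<in>{..<k}. snd p i + ?c (fst p)))"
   by (intro cts_pair cts_fst p1)
  from cts_compose[OF this, of "M (n - k + card I)" "%p. snd (snd (f (fst p))) ((%i. (fst (f (fst p)) ! i, snd p i)) ` I)"]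
  have c1: "cts (ptop X (PP k)) (M (n - k + card I))
   (%p. snd (snd (f (fst p))) ((%i. (fst (f (fst p)) ! i, (\<lambda>i\<in>{..<k}. snd p i + ?c (fst p)) i)) ` I))"
   using f I unfolding Bfam_def by (simp only: o_def fst_conv snd_conv)
  show "cts (ptop X (PP k)) (M (n - k + card I))
   (%p. snd (snd (btrans act n k (f (fst p), s (fst p)))) ((%i. (fst (f (fst p)) ! i, snd p i)) ` I))"
  proof (rule cts_eq[OF c1])
   fix p assume "p : pts (ptop X (PP k))"
   hence p: "fst p : pts X" "snd p : pts (PP k)" by auto
   have "validF (set (fst (f (fst p)))) ((%i. (fst (f (fst p)) ! i, snd p i)) ` I)"
    by (rule validF_index) (use fx[OF p(1)] I PP_facts(4)[OF p(2)] in auto)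
   from eq[OF p(1) this]
   have "snd (snd (btrans act n k (f (fst p), s (fst p)))) ((%i. (fst (f (fst p)) ! i, snd p i)) ` I) =
    snd (snd (f (fst p))) ((%i. (fst (f (fst p)) ! i, snd p i + ?c (fst p))) ` I)"
    by (simp add: image_image)
   moreover have "(%i. (fst (f (fst p)) ! i, (\<lambda>i\<in>{..<k}. snd p i + ?c (fst p)) i)) ` I = (%i. (fst (f (fst p)) ! i, snd p i + ?c (fst p))) ` I"
    by (intro image_cong refl) (use I in auto)
   ultimately show "snd (snd (f (fst p))) ((%i. (fst (f (fst p)) ! i, (\<lambda>i\<in>{..<k}. snd p i + ?c (fst p)) i)) ` I) =
    snd (snd (btrans act n k (f (fst p), s (fst p)))) ((%i. (fst (f (fst p)) ! i, snd p i)) ` I)" by simp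
  qed
 qed
qed

lemma Bfam_bmix:
 assumes M: "rmod M act" and X: "lcs X" "haus X"
  and f: "Bfam M act n k X f" and s: "cts X rtop s" "!!x. x : pts X ==> s x : {0..1}"
 shows "Bfam M act n k X (%x. bmix act n k (f x, s x))"
proof -
 have fx: "length (fst (f x)) = k" "column (fst (f x))" "0 <= fst (snd (f x))"
  if "x : pts X" for x
  using f that by (auto simp: Bfam_def)
 let ?C = "%x. map (%i. mixsq (s x) (fst (f x) ! i) (slots k ! i)) [0..<k]"
 let ?\<nu> = "%x. (1 - s x) * (fst (snd (f x)) + offs (fst (f x))) + s x"
 have "Bfam M act n k X (%x. (?C x, ?\<nu> x, pureG act (n - k) (snd (snd (f x)) {}) (?\<nu> x)))"
 proof (rule Bfam_pure[OF M X])
  show "k <= n" using f by (simp add: Bfam_def)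
  show "cts X (M (n - k)) (%x. snd (snd (f x)) {})"
   using cts_brho[OF f] by (simp add: brho_def)
  show "cts X euclidean (%x. ?C x ! i)" if i: "i < k" for i
  proof -
   have "cts X euclidean (%x. fst (f x) ! i)" using f i by (simp add: Bfam_def)
   from cm_comp[OF cm_pair[OF s(1) this], of "%(s, e). mixsq s e (slots k ! i)"]
   show ?thesis using i by (simp add: mixsq_def case_prod_beta continuous_intros)
  qed
  show "length (?C x) = k \<and> column (?C x)" if "x : pts X" for x
   using column_mix[OF fx(2,1)[OF that] column_slots length_slots] s(2)[OF that] by simp
  show "cts X rtop ?\<nu>"
   using f by (intro continuous_map_add continuous_map_real_mult continuous_map_diff s cts_offs[OF f])
    (auto simp: Bfam_def)
  show "0 <= ?\<nu> x" if "x : pts X" for x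
   using fx(3)[OF that] s(2)[OF that] offs_nonneg[of "fst (f x)"] by simp
  show "0 <= fst (fst e) + ?\<nu> x" if x: "x : pts X" and e: "e : set (?C x)" for x e
  proof -
   obtain i where i: "i < k" "e = mixsq (s x) (fst (f x) ! i) (slots k ! i)" using e by auto
   have "0 <= (1 - s x) * (fst (fst (fst (f x) ! i)) + offs (fst (f x)) + fst (snd (f x)))"
    using offs_ge[of "fst (f x) ! i" "fst (f x)"] fx[OF x] s(2)[OF x] i(1) by simp
   thus ?thesis using i by (simp add: mixsq_def slots_nth algebra_simps)
  qed
 qed
 thus ?thesis by (simp add: bmix_def case_prod_beta)
qed

lemma Bfam_iota:
 assumes M: "rmod M act" and X: "lcs X" "haus X" "k <= n"
  and u: "cts X (M (n - k)) u"
 shows "Bfam M act n k X (%x. iota act n k (u x))"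
 unfolding iota_def
 by (rule Bfam_pure[OF M X u]) (auto simp: column_slots slots_nth in_set_conv_nth)

lemma locally_compact_simplex: "lcs (Spx q)"
 by (simp add: compact_imp_locally_compact_space compact_space_simplex_space)

lemma iota_Bs:
 assumes "rmod M act" "k <= n" "s : SS (M (n - k)) q"
 shows "smap q (iota act n k) s : Bs M act n k q"
 using Bs_restrict[OF Bfam_iota[OF assms(1) locally_compact_simplex Hausdorff_space_simplex_space assms(2) SS_continuous[OF assms(3)]]]
 by (simp add: simplex_map_def o_def)

lemma brho_iota [simp]: "brho (iota act n k x) = x"
 by (simp add: brho_def iota_def pureG_def)

lemma cylinder_maps:
 assumes "cts X (cylinder q) g"
 shows "cts X (Spx q) (%y. fst (g y))" "cts X rtop (%y. snd (g y))"
  "!!y. y : pts X ==> snd (g y) : {0..1}"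
proof -
 show "cts X (Spx q) (%y. fst (g y))"
  using cts_compose[OF assms cts_fst] by (simp add: o_def)
 have "cts X (top_of_set {0..1}) (%y. snd (g y))"
  using cts_compose[OF assms cts_snd] by (simp add: o_def)
 thus "cts X rtop (%y. snd (g y))" "!!y. y : pts X ==> snd (g y) : {0..1}"
  by (auto simp: continuous_map_in_subtopology)
qed

text \<open>The homotopies \<open>btrans\<close> and \<open>bmix\<close> lead from the identity to
  \<open>iota\<close> after \<open>brho\<close>. Together with \<open>brho_iota\<close> this
  identifies the homology of the k-th column with that of \<open>M (n - k)\<close>.\<close>

lemma B_retract:
 assumes M: "rmod M act" and b: "cyc (Bs M act n k) q b"
 shows "bdr (Bs M act n k) q (cmap q (iota act n k) (cmap q brho b) - b)"
proof -
 have ext: "Bs M act n k q \<subseteq> extensional (spx q)" by (auto simp: Bs_def)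
 have kx: "supp b \<subseteq> Bs M act n k q" using b by (simp add: cyc_def)
 note lc = locally_compact_simplex[of "Suc q"] Hausdorff_space_simplex_space[of "Suc q"]
 have 1: "bdr (Bs M act n k) q (cmap q (%d. btrans act n k (d, 1)) b - cmap q (%d. btrans act n k (d, 0)) b)"
 proof (rule homotopy_bdr[OF ext _ b])
  fix f g assume f: "f : Bs M act n k q" and g: "cts (Spx (Suc q)) (cylinder q) g"
  show "(\<lambda>y\<in>spx (Suc q). btrans act n k (f (fst (g y)), snd (g y))) : Bs M act n k (Suc q)"
   by (rule Bs_restrict[OF Bfam_btrans[OF Bfam_comp[OF _ cylinder_maps(1)[OF g]] cylinder_maps(2)[OF g]]])
    (use f cylinder_maps(3)[OF g] in \<open>auto simp: Bs_def\<close>)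
 qed
 have 2: "bdr (Bs M act n k) q (cmap q (%d. bmix act n k (d, 1)) b - cmap q (%d. bmix act n k (d, 0)) b)"
 proof (rule homotopy_bdr[OF ext _ b])
  fix f g assume f: "f : Bs M act n k q" and g: "cts (Spx (Suc q)) (cylinder q) g"
  show "(\<lambda>y\<in>spx (Suc q). bmix act n k (f (fst (g y)), snd (g y))) : Bs M act n k (Suc q)"
   by (rule Bs_restrict[OF Bfam_bmix[OF M lc Bfam_comp[OF _ cylinder_maps(1)[OF g]] cylinder_maps(2)[OF g]]])
    (use f cylinder_maps(3)[OF g] in \<open>auto simp: Bs_def\<close>)
 qed
 have len: "length (fst (s x)) = k" if "s : supp b" "x : spx q" for s x
  using kx that by (auto simp: Bs_def Bfam_def)
 have e1: "cmap q (%d. btrans act n k (d, 0)) b = b"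
 proof -
  have "cmap q (%d. btrans act n k (d, 0)) b = cmap q (%d. d) b"
   by (simp add: btrans_def case_prod_beta)
  also have "\<dots> = b" by (rule cmap_ident) (use kx ext in blast)
  finally show ?thesis .
 qed
 have e2: "cmap q (%d. bmix act n k (d, 0)) b = cmap q (%d. btrans act n k (d, 1)) b"
 proof (rule cmap_cong)
  fix s x assume "s : supp b" "x : spx q"
  hence "map (%i. mixsq 0 (fst (s x) ! i) (slots k ! i)) [0..<k] = fst (s x)"
   using len by (intro nth_equalityI) (auto simp: mixsq_def)
  thus "bmix act n k (s x, 0) = btrans act n k (s x, 1)"
   by (simp add: bmix_def btrans_def case_prod_beta)
 qed
 have "map (%i. mixsq 1 (c ! i) (slots k ! i)) [0..<k] = slots k" for c
  by (intro nth_equalityI) (auto simp: mixsq_def)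
 hence e3: "cmap q (%d. bmix act n k (d, 1)) b = cmap q (iota act n k) (cmap q brho b)"
  by (simp add: cmap_cmap bmix_def iota_def brho_def case_prod_beta)
 show ?thesis using bdr_add[OF 2 1] by (simp add: e1 e2 e3)
qed

lemma bdr_brho_imp:
 assumes M: "rmod M act" and b: "cyc (Bs M act n k) q b" and kn: "k <= n"
  and r: "bdr (SS (M (n - k))) q (cmap q brho b)"
 shows "bdr (Bs M act n k) q b"
proof -
 have "bdr (Bs M act n k) q (cmap q (iota act n k) (cmap q brho b))"
  by (rule bdr_cmap[OF r]) (rule iota_Bs[OF M kn])
 from bdr_diff[OF this B_retract[OF M b]] show ?thesis by simp
qed

lemma sum_sg_const: "(\<Sum>i<k. sg i v) = (if odd k then v else 0)"
 by (induction k) (auto simp: sg_def)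

lemma \<sigma>_mem: "\<sigma> : pts (\<S> 1)"
 by (simp add: topspace_S confs_def \<sigma>_def good_def)

text \<open>The standard square grows linearly to the full unit square; right multiplication by the
  resulting path of configurations is the homotopy.\<close>

lemma act_slot_bdr:
 assumes M: "rmod M act" and x: "cyc (SS (M m)) q x" and i: "i < k"
 shows "bdr (SS (M (Suc m))) q (cmap q (%x. act m 1 x \<sigma>) x -
  cmap q (%x. act m 1 x (1, {((0, real i / real k), (1, 1 / real k))})) x)"
proof -
 let ?F = "%(x, s). act m 1 x (1, {((0, (1 - s) * (real i / real k)), (1, (1 - s) * (1 / real k) + s))})"
 have "bdr (SS (M (Suc m))) q (cmap q (%d. ?F (d, 1)) x - cmap q (%d. ?F (d, 0)) x)"
 proof (rule homotopy_bdr[OF SS_extensional _ x])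
  fix f g assume f: "f : SS (M m) q" and g: "cts (Spx (Suc q)) (cylinder q) g"
  note s = cylinder_maps[OF g]
  have "cts (Spx (Suc q)) (\<S> 1) (%y. (1,
    (%_. ((0, (1 - snd (g y)) * (real i / real k)), (1, (1 - snd (g y)) * (1 / real k) + snd (g y)))) ` {..<1::nat}))"
  proof (rule cts_into_S[where t = "%_. 1" and e = "%_ y. ((0, (1 - snd (g y)) * (real i / real k)), (1, (1 - snd (g y)) * (1 / real k) + snd (g y)))"])
   show "cts (Spx (Suc q)) euclidean (%y.
    ((0, (1 - snd (g y)) * (real i / real k)), (1, (1 - snd (g y)) * (1 / real k) + snd (g y))))"
    by (rule cm_comp[OF s(2), of "%s. ((0, (1 - s) * (real i / real k)), (1, (1 - s) * (1 / real k) + s))"])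
     (intro continuous_intros)
   fix y assume "y : pts (Spx (Suc q))"
   from s(3)[OF this] have sy: "0 <= snd (g y)" "snd (g y) <= 1" by auto
   have "(1 - snd (g y)) * ((real i + 1) / real k) <= (1 - snd (g y)) * 1"
    using sy i by (intro mult_left_mono) (auto simp: field_simps)
   moreover have "0 < (1 - snd (g y)) * (1 / real k) + snd (g y)"
    using sy i by (cases "snd (g y) = 0") (auto intro: add_nonneg_pos)
   moreover have "0 <= (1 - snd (g y)) * (real i / real k)" using sy by (intro mult_nonneg_nonneg) auto
   ultimately show "good 1 ((0, (1 - snd (g y)) * (real i / real k)), (1, (1 - snd (g y)) * (1 / real k) + snd (g y)))"
    using sy i by (simp add: good_def add_divide_distrib algebra_simps)
  qed auto
  hence "cts (Spx (Suc q)) (\<S> 1) (%y. (1,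
    {((0, (1 - snd (g y)) * (real i / real k)), (1, (1 - snd (g y)) * (1 / real k) + snd (g y)))}))"
   by (simp add: image_constant_conv lessThan_empty_iff)
  from cts_act[OF M locally_compact_simplex Hausdorff_space_simplex_space
    cts_compose[OF s(1) SS_continuous[OF f]] this]
  show "(\<lambda>y\<in>spx (Suc q). ?F (f (fst (g y)), snd (g y))) : SS (M (Suc m)) (Suc q)"
   by (intro restrict_SS) (simp add: o_def)
 qed
 thus ?thesis by (simp add: \<sigma>_def)
qed

text \<open>By \<open>B_retract\<close> it suffices to look at values of \<open>iota\<close>. There
  a face puts one standard square back, which is stabilization up to \<open>act_slot_bdr\<close>,
  and the k signs cancel in pairs except for one if k is odd.\<close>

lemma brho_dd:
 assumes M: "rmod M act" and b: "cyc (Bs M act n k) q b" and kn: "k <= n"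
 shows "bdr (SS (M (n - (k - 1)))) q (cmap q brho (dd bdel k q b) -
  (if odd k then cmap q (%x. act (n - k) 1 x \<sigma>) (cmap q brho b) else 0))"
proof -
 let ?x = "cmap q brho b"
 have x: "cyc (SS (M (n - k))) q ?x"
  by (rule cyc_cmap[OF b]) (rule brho_SS)
 have one: "bdr (SS (M (n - (k - 1)))) q (cmap q brho (cmap q (bdel i) b) - cmap q (%x. act (n - k) 1 x \<sigma>) ?x)"
  if i: "i < k" for i
 proof -
  have nk: "n - (k - 1) = Suc (n - k)" using kn i by simp
  have "bdr (Bs M act n (k - 1)) q (cmap q (bdel i) (cmap q (iota act n k) ?x - b))"
   by (rule bdr_cmap[OF B_retract[OF M b]]) (rule bdel_Bs[OF i])
  have "bdr (SS (M (n - (k - 1)))) q (cmap q brho (cmap q (bdel i) (cmap q (iota act n k) ?x - b)))"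
   by (rule bdr_cmap[OF \<open>bdr (Bs M act n (k - 1)) q _\<close>]) (rule brho_SS)
  hence 1: "bdr (SS (M (n - (k - 1)))) q (cmap q (%x. brho (bdel i (iota act n k x))) ?x - cmap q brho (cmap q (bdel i) b))"
   by (simp add: cmap_diff cmap_cmap)
  have "brho (bdel i (iota act n k x)) = act (n - k) 1 x (1, {((0, real i / real k), (1, 1 / real k))})" for x
   using i by (simp add: brho_def bdel_def iota_def pureG_def slots_nth mv_def shift_def mx_def)
  with 1 have "bdr (SS (M (n - (k - 1)))) q (cmap q (%x. act (n - k) 1 x (1, {((0, real i / real k), (1, 1 / real k))})) ?x -
    cmap q brho (cmap q (bdel i) b))" by simp
  from bdr_uminus[OF bdr_add[OF act_slot_bdr[OF M x i, folded nk] this]] show ?thesis by simp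
 qed
 have "bdr (SS (M (n - (k - 1)))) q (\<Sum>i<k. sg i (cmap q brho (cmap q (bdel i) b) - cmap q (%x. act (n - k) 1 x \<sigma>) ?x))"
  by (rule bdr_sum) (use one bdr_uminus[OF one] in \<open>auto simp: sg_def\<close>)
 thus ?thesis
  by (cases "odd k") (simp_all add: sg_diff sum_subtractf sum_sg_const dd_def cmap_sum cmap_sg)
qed

section \<open>Configurations attached to points of the bar construction, and their
  invariance\<close>

section \<open>Squares that can be moved to the right\<close>

definition Vc :: "conf => square set" where
 "Vc c = {e : snd c. \<forall>e'\<in>snd c. fst (fst e') < fst (fst e) + fst (snd e) / 2}"

definition Vh :: "conf => square set" where
 "Vh c = shift (- fst c) ` Vc c"

text \<open>If all squares are removed and none is put back, the result has to be the unit, the only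
  element of \<open>confs 0\<close>, of width 0. The margin \<open>\<mu>\<close> achieves this; as
  soon as a square is put back, the strip has at least its original length.\<close>

definition Gs :: "conf => real => square set => (square \<times> real) set => conf" where
 "Gs c \<mu> C F = (if F = {} then (fst c - \<mu>, snd c - shift (fst c) ` C)
  else (fst c + mx F, (snd c - shift (fst c) ` C) \<union> mv (fst c) ` F))"

lemma confsI:
 assumes "0 < t" "finite E" "card E = l" "!!e. e : E ==> good t e"
  "!!e e'. e : E ==> e' : E ==> e ~= e' ==> sep e e'" "0 < l"
 shows "(t, E) : confs l"
 using assms by (auto simp: confs_def)

lemma shift_shift [simp]: "shift a (shift b e) = shift (a + b) e"
 by (simp add: shift_def)

lemma shift_0 [simp]: "shift 0 e = e"
 by (simp add: shift_def)

lemma fst_smult [simp]: "fst (smult d c) = fst d + fst c"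
 by (simp add: smult_def)

lemma Vh_shift:
 assumes "C \<subseteq> Vh c"
 shows "shift (fst c) ` C \<subseteq> Vc c"
proof -
 have "shift (fst c) ` C \<subseteq> shift (fst c) ` Vh c" using assms by (rule image_mono)
 thus ?thesis by (simp add: Vh_def image_image)
qed

lemma Vc_subset: "Vc c \<subseteq> snd c"
 by (auto simp: Vc_def)

lemma smult_disjoint:
 assumes "d : confs j" "c : confs l"
 shows "snd d \<inter> shift (fst d) ` snd c = {}"
proof (rule ccontr)
 assume "\<not> ?thesis"
 then obtain e where e: "e : snd c" "shift (fst d) e : snd d" by auto
 thus False using confs_facts(4)[OF assms(1) e(2)] confs_facts(4)[OF assms(2) e(1)]
  by (simp add: good_def shift_def)
qed

lemma smult_confs:
 assumes "d : confs j" "c : confs l"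
 shows "smult d c : confs (j + l)"
proof (cases "j = 0 \<or> l = 0")
 case True
 thus ?thesis using assms by (auto simp: confs_def[of 0])
next
 case False
 note d = confs_pos[OF assms(1)] and c = confs_pos[OF assms(2)]
 have jl: "0 < j" "0 < l" using False by auto
 show ?thesis
  unfolding smult_def
 proof (rule confsI)
  show "0 < fst d + fst c" using d(1) c(1) jl by (simp add: add_pos_pos)
  show "finite (snd d \<union> shift (fst d) ` snd c)" using d(2) c(2) jl by simp
  show "card (snd d \<union> shift (fst d) ` snd c) = j + l"
   using d(2,3) c(2,3) jl smult_disjoint[OF assms] inj_on_subset[OF inj_shift subset_UNIV]
   by (simp add: card_Un_disjoint card_image)
  show "good (fst d + fst c) e" if "e : snd d \<union> shift (fst d) ` snd c" for e
   using that
  proof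
   assume "e : snd d"
   thus ?thesis using good_mono[OF d(4)[OF jl(1)], of e "fst d + fst c"] c(1)[OF jl(2)] by simp
  next
   assume "e : shift (fst d) ` snd c"
   then obtain f where f: "e = shift (fst d) f" "f : snd c" by (rule imageE)
   show ?thesis unfolding f(1) by (rule good_shift[OF c(4)[OF jl(2) f(2)]]) (use d(1)[OF jl(1)] in simp)
  qed
  show "sep e e'" if "e : snd d \<union> shift (fst d) ` snd c" "e' : snd d \<union> shift (fst d) ` snd c" "e ~= e'" for e e'
  proof -
   note dd = d(4,5)[OF jl(1)] and cc = c(4,5)[OF jl(2)]
   have 1: "sep a (shift (fst d) b)" if "a : snd d" "b : snd c" for a b
    by (rule sep_shift_right[OF dd(1)[OF that(1)] cc(1)[OF that(2)]])
   have 2: "sep (shift (fst d) a) (shift (fst d) b)" if "a : snd c" "b : snd c" "shift (fst d) a ~= shift (fst d) b" for a b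
    unfolding sep_shift by (rule cc(2)[OF that(1,2)]) (use that(3) in blast)
   show ?thesis using that dd(2) 1 2 sep_sym by (elim UnE imageE) blast+
  qed
  show "0 < j + l" using jl by simp
 qed
qed

text \<open>The squares of \<open>c\<close> exist and begin at or beyond the end of the strip of
  \<open>d\<close>. Hence no square of \<open>d\<close> qualifies, and the squares of
  \<open>d\<close> impose no condition on those of \<open>c\<close>.\<close>

lemma Vc_smult:
 assumes d: "d : confs j" and c: "c : confs l" and l: "0 < l"
 shows "Vc (smult d c) = shift (fst d) ` Vc c"
proof (intro equalityI subsetI)
 fix e assume "e : Vc (smult d c)"
 hence e: "e : snd d \<union> shift (fst d) ` snd c"
  and V: "\<forall>e'\<in>snd d \<union> shift (fst d) ` snd c. fst (fst e') < fst (fst e) + fst (snd e) / 2"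
  by (auto simp: Vc_def smult_def)
 have "snd c ~= {}" using confs_facts(3)[OF c] l by auto
 then obtain e0 where e0: "e0 : snd c" by blast
 hence "fst d <= fst (fst (shift (fst d) e0))"
  using confs_facts(4)[OF c e0] by (simp add: good_def shift_def)
 hence lt: "fst d < fst (fst e) + fst (snd e) / 2" using bspec[OF V UnI2[OF imageI[OF e0]]] by linarith
 have "e \<notin> snd d"
 proof
  assume "e : snd d"
  thus False using confs_facts(4)[OF d] lt by (fastforce simp: good_def)
 qed
 then obtain e1 where e1: "e1 : snd c" "e = shift (fst d) e1" using e by auto
 have "fst (fst e') < fst (fst e1) + fst (snd e1) / 2" if "e' : snd c" for e'
  using bspec[OF V UnI2[OF imageI[OF that]]] e1(2) by (simp add: shift_def)
 thus "e : shift (fst d) ` Vc c" using e1 by (auto simp: Vc_def)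
next
 fix e assume "e : shift (fst d) ` Vc c"
 then obtain e1 where e1: "e = shift (fst d) e1" "e1 : snd c"
  "\<forall>e'\<in>snd c. fst (fst e') < fst (fst e1) + fst (snd e1) / 2" unfolding Vc_def by blast
 have "fst (fst e') < fst (fst e) + fst (snd e) / 2" if "e' : snd d" for e'
  using confs_facts(4)[OF d that] confs_facts(4)[OF c e1(2)] by (simp add: good_def e1(1) shift_def)
 thus "e : Vc (smult d c)" using e1 by (auto simp: Vc_def smult_def shift_def)
qed

lemma Vh_smult:
 assumes "d : confs j" "c : confs l" "0 < l"
 shows "Vh (smult d c) = Vh c"
 by (simp add: Vh_def Vc_smult[OF assms] image_image)

lemma card_Vh_le:
 assumes "c : confs l" "C \<subseteq> Vh c"
 shows "card C <= l" "finite C"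
proof -
 have f: "finite (Vc c)" using confs_facts(2)[OF assms(1)] Vc_subset finite_subset by blast
 hence fh: "finite (Vh c)" by (simp add: Vh_def)
 thus "finite C" using assms(2) finite_subset by blast
 have "card C <= card (Vh c)" using fh assms(2) by (rule card_mono)
 also have "\<dots> <= card (Vc c)" unfolding Vh_def by (rule card_image_le[OF f])
 also have "\<dots> <= card (snd c)" by (rule card_mono[OF confs_facts(2)[OF assms(1)] Vc_subset])
 finally show "card C <= l" using confs_facts(3)[OF assms(1)] by simp
qed

lemma Vh_rgood:
 assumes "c : confs l" "e : Vh c"
 shows "rgood e"
proof -
 obtain e' where e': "e' : snd c" "e = shift (- fst c) e'" using assms(2) Vc_subset[of c] by (auto simp: Vh_def)
 thus ?thesis using confs_facts(4)[OF assms(1) e'(1)] e'(2) by (simp add: good_def rgood_def shift_def)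
qed

text \<open>Each of two such squares begins to the left of the middle of the other, so they cannot
  be separated horizontally.\<close>

lemma Vc_ysep:
 assumes c: "c : confs l" and e: "e : Vc c" "e' : Vc c" "e ~= e'"
 shows "ysep e e'"
proof -
 have s: "sep e e'" and g: "good (fst c) e" "good (fst c) e'"
  using confs_facts(4,5)[OF c] e Vc_subset[of c] by blast+
 have "fst (fst e') < fst (fst e) + fst (snd e) / 2" "fst (fst e) < fst (fst e') + fst (snd e') / 2"
  using e by (auto simp: Vc_def)
 thus ?thesis using s g by (auto simp: sep_def good_def)
qed

lemma Vh_ysep:
 assumes "c : confs l" "e : Vh c" "e' : Vh c" "e ~= e'"
 shows "ysep e e'"
proof -
 obtain f f' where f: "f : Vc c" "f' : Vc c" "e = shift (- fst c) f" "e' = shift (- fst c) f'"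
  using assms by (auto simp: Vh_def)
 hence "ysep f f'" using Vc_ysep[OF assms(1)] assms(4) by blast
 thus ?thesis using f by (simp add: ysep_def shift_def)
qed

lemma Gs_smult:
 assumes d: "d : confs j" and c: "c : confs l" and C: "C \<subseteq> Vh c"
 shows "Gs (smult d c) \<mu> C F = smult d (Gs c \<mu> C F)"
proof -
 have sub: "shift (fst c) ` C \<subseteq> snd c" using Vh_shift[OF C] Vc_subset by blast
 have im: "shift (fst d + fst c) ` C = shift (fst d) ` shift (fst c) ` C" by (simp add: image_image)
 have "shift (fst d) ` (snd c - shift (fst c) ` C) = shift (fst d) ` snd c - shift (fst d) ` shift (fst c) ` C"
  using inj_shift[of "fst d"] by (rule image_set_diff)
 moreover have "snd d \<inter> shift (fst d) ` shift (fst c) ` C = {}"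
  using smult_disjoint[OF d c] sub by blast
 ultimately have E: "snd (smult d c) - shift (fst d + fst c) ` C = snd d \<union> shift (fst d) ` (snd c - shift (fst c) ` C)"
  by (simp only: smult_def snd_conv im Un_Diff Diff_triv)
 have "mv (fst d + fst c) ` F = shift (fst d) ` mv (fst c) ` F"
  by (simp add: image_image mv_def add_ac)
 thus ?thesis
  unfolding Gs_def fst_smult E by (simp add: smult_def image_Un Un_assoc add.assoc algebra_simps)
qed

lemma Gs_confs:
 assumes c: "c : confs l" and l: "0 < l" and C: "C \<subseteq> Vh c" and F: "validF C F" "F ~= {}"
 shows "Gs c \<mu> C F : confs (l - card C + card F)" "inj_on (mv (fst c)) F"
  "(snd c - shift (fst c) ` C) \<inter> mv (fst c) ` F = {}" "card (snd c - shift (fst c) ` C) = l - card C"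
proof -
 note cc = confs_pos[OF c l]
 have fin: "finite F" and Fp: "!!p. p : F ==> fst p : C \<and> 0 <= snd p" and injF: "inj_on fst F"
  using F by (auto simp: validF_def)
 have CV: "shift (fst c) ` C \<subseteq> Vc c" by (rule Vh_shift[OF C])
 have finC: "finite C" by (rule card_Vh_le(2)[OF c C])
 have mvp: "mv (fst c) p = shift (snd p) (shift (fst c) (fst p))" for p by (simp add: mv_def add_ac)
 have pV: "shift (fst c) (fst p) : Vc c" if "p : F" for p using CV Fp[OF that] by blast
 have g: "good (fst c + mx F) (mv (fst c) p)" if p: "p : F" for p
  using cc(4)[of "shift (fst c) (fst p)"] pV[OF p] Vc_subset[of c] mx_ge[OF fin p] Fp[OF p]
  by (auto simp: good_def mv_def shift_def)
 have ys: "ysep (mv (fst c) p) (mv (fst c) q)" if "p : F" "q : F" "p ~= q" for p q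
 proof -
  have "fst p ~= fst q" using injF that by (auto simp: inj_on_def)
  hence "ysep (fst p) (fst q)" using Vh_ysep[OF c] C Fp that by blast
  thus ?thesis by (simp add: ysep_mv)
 qed
 show inj: "inj_on (mv (fst c)) F"
 proof (rule inj_onI, rule ccontr)
  fix p q assume pq: "p : F" "q : F" "mv (fst c) p = mv (fst c) q" "p ~= q"
  hence "ysep (mv (fst c) q) (mv (fst c) q)" using ys[of p q] by simp
  thus False using g[OF pq(2)] by (auto simp: ysep_def good_def)
 qed
 \<comment> \<open>The remaining square \<open>e\<close> begins before the middle of the column
   square. Being separated from it, \<open>e\<close> lies to the left, above or below, and moving
   the column square to the right preserves this.\<close>
 have sp: "sep e (mv (fst c) p)" if e: "e : snd c - shift (fst c) ` C" and p: "p : F" for e p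
 proof -
  let ?f = "shift (fst c) (fst p)"
  have f: "?f : snd c" "fst (fst e) < fst (fst ?f) + fst (snd ?f) / 2"
   using pV[OF p] e by (auto simp: Vc_def)
  have "e ~= ?f" using e Fp[OF p] by auto
  hence "sep e ?f" using cc(5) e f(1) by blast
  thus ?thesis
   using f(2) cc(4)[OF f(1)] Fp[OF p] by (auto simp: sep_def ysep_def mv_def shift_def good_def)
 qed
 have nons: "\<not> sep (mv (fst c) p) (mv (fst c) p)" if "p : F" for p using g[OF that] sep_irrefl by blast
 show dj: "(snd c - shift (fst c) ` C) \<inter> mv (fst c) ` F = {}"
  using sp nons by (blast | (intro Int_emptyI, metis imageE))
 show cd: "card (snd c - shift (fst c) ` C) = l - card C"
  using CV Vc_subset[of c] finC cc(2,3) card_image[OF inj_on_subset[OF inj_shift subset_UNIV], of "fst c" C]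
  by (subst card_Diff_subset) auto
 show "Gs c \<mu> C F : confs (l - card C + card F)"
  unfolding Gs_def using F(2)
 proof (simp, intro confsI)
  show "0 < fst c + mx F" using cc(1) mx_ge_0[OF fin] by simp
  show "finite (snd c - shift (fst c) ` C \<union> mv (fst c) ` F)" using cc(2) fin by simp
  show "card (snd c - shift (fst c) ` C \<union> mv (fst c) ` F) = l - card C + card F"
   using dj cd cc(2) fin card_image[OF inj] by (simp add: card_Un_disjoint)
  show "good (fst c + mx F) e" if "e : snd c - shift (fst c) ` C \<union> mv (fst c) ` F" for e
   using that g good_mono[OF cc(4), of e "fst c + mx F"] mx_ge_0[OF fin] by auto
  show "sep e e'" if "e : snd c - shift (fst c) ` C \<union> mv (fst c) ` F" "e' : snd c - shift (fst c) ` C \<union> mv (fst c) ` F" "e ~= e'" for e e'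
  proof -
   have y: "sep (mv (fst c) p) (mv (fst c) q)" if "p : F" "q : F" "mv (fst c) p ~= mv (fst c) q" for p q
    using ys[of p q] that by (auto simp: sep_def)
   from that show ?thesis using sp y cc(5) sep_sym by (elim UnE imageE DiffE) blast+
  qed
  show "0 < l - card C + card F" using F(2) fin by (simp add: card_gt_0_iff)
 qed
qed


section \<open>Points of the bar construction\<close>

text \<open>The pointwise properties of a point of \<open>U_hom q p\<close>. They are closed under
  composition and do not mention topologies, which suits the inductions over k.\<close>

definition umor :: "nat => nat => conf \<times> conf mpath => bool" where
 "umor q p x \<longleftrightarrow> q <= p \<and> fst x : confs (p - q) \<and> 0 <= fst (snd x) \<and> (\<forall>r. snd (snd x) r : confs (Suc p)) \<and>
  (\<forall>r\<le>0. snd (snd x) r = spow (Suc p)) \<and> snd (snd x) (fst (snd x)) = smult (fst x) (spow (Suc q))"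

definition vm :: "nat => (nat => nat) => (nat => conf \<times> conf mpath) => bool" where
 "vm k p m \<longleftrightarrow> (\<forall>j<k. umor (p (Suc j)) (p j) (m j))"

text \<open>Concatenation of all paths of a bar simplex, running from
  \<open>spow (Suc (p 0))\<close> to d_0 ... d_(k-1) times \<open>spow (Suc (p k))\<close>, where
  d_j is \<open>fst (m j)\<close>.\<close>

primrec Om :: "nat => (nat => nat) => (nat => conf \<times> conf mpath) => conf mpath" where
 "Om 0 p m = (0, %_. spow (Suc (p 0)))"
| "Om (Suc k) p m = mconcat (snd (m 0)) (mmap (smult (fst (m 0))) (Om k (%j. p (Suc j)) (%j. m (Suc j))))"

text \<open>The weight of the vertices from i on determines which share of the length of the path in
  \<open>m (i - 1)\<close> enters \<open>ct\<close>. The share tends to 0 with this weight, as the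
  last face requires, and it is 1 as soon as the weight reaches 1/2. So the earlier morphisms split
  off as left factors on a whole region and not only on a face.\<close>

definition tau :: "nat => (nat => real) => nat => real" where
 "tau k t i = min 1 (2 * (\<Sum>l\<in>{i..k}. t l))"

definition ct :: "nat => (nat => conf \<times> conf mpath) => (nat => real) => real" where
 "ct k m t = (\<Sum>j<k. fst (snd (m j)) * tau k t (Suc j))"

definition cc :: "nat => (nat => nat) => (nat => conf \<times> conf mpath) => (nat => real) => conf" where
 "cc k p m t = snd (Om k p m) (ct k m t)"

lemma spow_confs: "spow n : confs n"
proof (induction n)
 case (Suc n)
 thus ?case using smult_confs[OF Suc \<sigma>_mem[unfolded topspace_S]] by simp
qed (simp add: confs_def)

lemma tau_Suc: "tau (Suc k) t (Suc i) = tau k (%j. t (Suc j)) i"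
 by (simp only: tau_def sum.shift_bounds_cl_Suc_ivl)

lemma ct_Suc: "ct (Suc k) m t = fst (snd (m 0)) * tau (Suc k) t 1 + ct k (%j. m (Suc j)) (%j. t (Suc j))"
 by (simp add: ct_def sum.lessThan_Suc_shift tau_Suc del: sum.lessThan_Suc)

lemma vm_Suc: "vm (Suc k) p m \<longleftrightarrow> umor (p 1) (p 0) (m 0) \<and> vm k (%j. p (Suc j)) (%j. m (Suc j))"
 by (auto simp: vm_def less_Suc_eq_0_disj)

lemma Om_facts:
 assumes "vm k p m"
 shows "fst (Om k p m) = (\<Sum>j<k. fst (snd (m j)))" "0 <= fst (Om k p m)"
  "!!r. snd (Om k p m) r : confs (Suc (p 0))" "!!r. r <= 0 ==> snd (Om k p m) r = spow (Suc (p 0))"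
 using assms
proof (induction k arbitrary: p m)
 case 0
 { case 1 show ?case by simp }
 { case 2 show ?case by simp }
 { case 3 show ?case using spow_confs[of "Suc (p 0)"] by simp }
 { case 4 show ?case by simp }
next
 case (Suc k)
 have u: "!!p m. vm (Suc k) p m ==> umor (p 1) (p 0) (m 0)"
  "!!p m. vm (Suc k) p m ==> vm k (%j. p (Suc j)) (%j. m (Suc j))"
  by (simp_all add: vm_Suc)
 { case 1
  show ?case using Suc(1)[OF u(2)[OF 1]] by (simp add: mconcat_def mmap_def sum.lessThan_Suc_shift del: sum.lessThan_Suc) }
 { case 2
  show ?case using Suc(2)[OF u(2)[OF 2]] u(1)[OF 2] by (simp add: mconcat_def mmap_def umor_def) }
 { case 3
  have "smult (fst (m 0)) (snd (Om k (%j. p (Suc j)) (%j. m (Suc j))) r) : confs (p 0 - p 1 + Suc (p 1))" for r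
   by (rule smult_confs) (use u(1)[OF 3] Suc(3)[OF u(2)[OF 3]] in \<open>auto simp: umor_def\<close>)
  thus ?case using u(1)[OF 3] by (auto simp: mconcat_def mmap_def umor_def) }
 { case 4
  thus ?case using u(1)[of p m] 4 by (auto simp: mconcat_def mmap_def umor_def simp del: spow.simps) }
qed

lemma cc_confs: "vm k p m ==> cc k p m t : confs (Suc (p 0))"
 unfolding cc_def by (rule Om_facts(3))

lemma tau_nonneg: "(!!i. i <= k ==> 0 <= t i) ==> 0 <= tau k t i"
 by (auto simp: tau_def intro!: sum_nonneg)

lemma tau_le_1: "tau k t i <= 1"
 by (simp add: tau_def)

lemma ct_nonneg: "vm k p m ==> (!!i. i <= k ==> 0 <= t i) ==> 0 <= ct k m t"
 unfolding ct_def by (intro sum_nonneg mult_nonneg_nonneg tau_nonneg) (auto simp: vm_def umor_def)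

lemma ct_le: "vm k p m ==> ct k m t <= (\<Sum>j<k. fst (snd (m j)))"
 unfolding ct_def by (intro sum_mono mult_left_le tau_le_1) (auto simp: vm_def umor_def)

text \<open>With a full share of the first path, the time reached is at or beyond the end of that
  path, where its element of the monoid has become a left factor.\<close>

lemma cc_first:
 assumes v: "vm (Suc k) p m" and t: "!!i. i <= Suc k ==> 0 <= t i" and tau1: "tau (Suc k) t 1 = 1"
 shows "cc (Suc k) p m t = smult (fst (m 0)) (cc k (%j. p (Suc j)) (%j. m (Suc j)) (%j. t (Suc j)))"
proof -
 let ?p = "%j. p (Suc j)" and ?m = "%j. m (Suc j)" and ?t = "%j. t (Suc j)"
 have v': "vm k ?p ?m" and u: "umor (p 1) (p 0) (m 0)" using v by (auto simp: vm_Suc)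
 have s: "0 <= ct k ?m ?t" using ct_nonneg[OF v'] t by simp
 show ?thesis
 proof (cases "ct k ?m ?t = 0")
  case True
  thus ?thesis
   using u Om_facts(4)[OF v', of 0] by (simp add: cc_def ct_Suc tau1[unfolded One_nat_def] mconcat_def mmap_def umor_def)
 next
  case False
  thus ?thesis using s by (auto simp: cc_def ct_Suc tau1[unfolded One_nat_def] mconcat_def mmap_def)
 qed
qed

lemma tau_eq_1:
 assumes "!!i. i <= k ==> 0 <= t i" "1 / 2 <= (\<Sum>i\<in>{l..k}. t i)" "i <= l"
 shows "tau k t i = 1"
proof -
 have "(\<Sum>i\<in>{l..k}. t i) <= (\<Sum>i\<in>{i..k}. t i)"
  by (rule sum_mono2) (use assms in auto)
 thus ?thesis using assms(2) by (simp add: tau_def)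
qed

lemma vm_decreasing: "vm k p m ==> i <= j ==> j <= k ==> p j <= p i"
proof (induction "j - i" arbitrary: j)
 case (Suc l)
 then obtain j' where j: "j = Suc j'" by (cases j) auto
 have "p j <= p j'" using Suc(3,5) j by (auto simp: vm_def umor_def)
 also have "p j' <= p i" using Suc j by (intro Suc(1)) auto
 finally show ?case .
qed simp

text \<open>If the vertices from l on carry half of the weight, d_0 ... d_(l-1) splits off to the
  left by \<open>cc_first\<close>. By \<open>Vh_smult\<close> the column comes from the remaining
  right factor, which has \<open>Suc (p l)\<close> squares.\<close>

lemma card_Vh_cc:
 assumes "vm k p m" "!!i. i <= k ==> 0 <= t i" "C \<subseteq> Vh (cc k p m t)" "l <= k" "1 / 2 <= (\<Sum>i\<in>{l..k}. t i)"
 shows "card C <= Suc (p l)"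
 using assms
proof (induction l arbitrary: k p m t)
 case 0
 thus ?case using card_Vh_le(1)[OF cc_confs[OF 0(1)]] by blast
next
 case (Suc l)
 obtain k' where k: "k = Suc k'" using Suc(5) by (cases k) simp_all
 let ?p = "%j. p (Suc j)" and ?m = "%j. m (Suc j)" and ?t = "%j. t (Suc j)"
 have v': "vm k' ?p ?m" and u: "umor (p 1) (p 0) (m 0)" using Suc(2) by (auto simp: k vm_Suc)
 have "tau k t 1 = 1" by (rule tau_eq_1[of k t "Suc l"]) (use Suc in auto)
 hence "cc k p m t = smult (fst (m 0)) (cc k' ?p ?m ?t)"
  using cc_first[of k' p m t] Suc(2,3) by (simp add: k)
 hence "Vh (cc k p m t) = Vh (cc k' ?p ?m ?t)"
  using Vh_smult[of "fst (m 0)" _ "cc k' ?p ?m ?t"] cc_confs[OF v'] u by (auto simp: umor_def)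
 thus ?case
  using Suc(1)[OF v', of ?t] Suc(3-6) by (simp add: k sum.shift_bounds_cl_Suc_ivl del: sum.cl_ivl_Suc)
qed

definition wsum :: "nat => nat => (nat => nat) => (nat => real) => real" where
 "wsum b k p t = (\<Sum>i\<le>k. if p i < b then t i else 0)"

definition dsum :: "nat => nat => (nat => nat) => (nat => conf \<times> conf mpath) => real" where
 "dsum b k p m = (\<Sum>j<k. if b <= p j then fst (fst (m j)) else 0)"

text \<open>Here \<open>wsum\<close> is the weight of the vertices with
  \<open>Suc (p i) \<le> b\<close>. If b squares are chosen and this weight exceeds 1/2, the
  configuration has a right factor with exactly b squares, whose width is the difference in
  brackets, see \<open>cc_split\<close>. The margin grows from 0 at weight 1/2 to this full width at
  weight 1.\<close>

definition mu :: "nat => nat => (nat => nat) => (nat => conf \<times> conf mpath) => (nat => real) => real" where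
 "mu b k p m t = max 0 (2 * wsum b k p t - 1) * (fst (cc k p m t) - dsum b k p m)"

lemma wsum_Suc: "wsum b (Suc k) p t = (if p 0 < b then t 0 else 0) + wsum b k (%j. p (Suc j)) (%j. t (Suc j))"
 by (simp add: wsum_def sum.atMost_Suc_shift del: sum.atMost_Suc)

lemma dsum_Suc: "dsum b (Suc k) p m = (if b <= p 0 then fst (fst (m 0)) else 0) + dsum b k (%j. p (Suc j)) (%j. m (Suc j))"
 by (simp add: dsum_def sum.lessThan_Suc_shift del: sum.lessThan_Suc)

lemma wsum_0: "wsum b 0 p t = (if p 0 < b then t 0 else 0)"
proof -
 have "{..0::nat} = {0}" by auto
 thus ?thesis unfolding wsum_def by (simp only:) simp
qed

lemma wsum_le:
 assumes "vm k p m" "!!i. i <= k ==> 0 <= t i" "b <= p l" "l <= k"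
 shows "wsum b k p t <= (\<Sum>i\<in>{Suc l..k}. t i)"
proof -
 have "p i < b ==> i <= k ==> Suc l <= i" for i
  using vm_decreasing[OF assms(1), of i l] assms(3,4) by (cases "i <= l") (auto simp: not_le)
 hence "wsum b k p t <= (\<Sum>i\<le>k. if Suc l <= i then t i else 0)"
  unfolding wsum_def using assms(2) by (intro sum_mono) auto
 also have "\<dots> = (\<Sum>i\<in>{Suc l..k}. t i)"
  by (simp add: sum.If_cases Int_def conj_commute atLeastAtMost_def atLeast_def atMost_def)
 finally show ?thesis .
qed

text \<open>The objects decrease along the chain, so those with \<open>b \<le> p i\<close> come
  first, and the morphisms into them split off to the left. At the first object with
  \<open>p i < b\<close>, \<open>card_Vh_cc\<close> finds room for b squares only if
  \<open>Suc (p i) = b\<close>.\<close>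

lemma cc_split:
 assumes "vm k p m" "!!i. i <= k ==> 0 <= t i" "C \<subseteq> Vh (cc k p m t)" "card C = b" "1 / 2 < wsum b k p t"
 shows "\<exists>D c. D : confs (Suc (p 0) - b) \<and> c : confs b \<and> cc k p m t = smult D c \<and>
  fst c = fst (cc k p m t) - dsum b k p m"
 using assms
proof (induction k arbitrary: p m t)
 case 0
 have "p 0 < b" using 0(5) by (simp add: wsum_0 split: if_splits)
 moreover have "b <= Suc (p 0)" using card_Vh_le(1)[OF cc_confs[OF 0(1)] 0(3)] 0(4) by simp
 ultimately have b: "b = Suc (p 0)" by simp
 show ?case
  using cc_confs[OF 0(1), of t] by (intro exI[of _ sunit] exI[of _ "cc 0 p m t"]) (simp add: b dsum_def confs_def[of 0])
next
 case (Suc k)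
 let ?p = "%j. p (Suc j)" and ?m = "%j. m (Suc j)" and ?t = "%j. t (Suc j)"
 have v': "vm k ?p ?m" and u: "umor (p 1) (p 0) (m 0)" using Suc(2) by (auto simp: vm_Suc)
 show ?case
 proof (cases "p 0 < b")
  case True
  moreover have "b <= Suc (p 0)" using card_Vh_le(1)[OF cc_confs[OF Suc(2)] Suc(4)] Suc(5) by simp
  ultimately have b: "b = Suc (p 0)" by simp
  have "dsum b (Suc k) p m = 0"
  proof -
   have "\<not> b <= p j" if "j < Suc k" for j using vm_decreasing[OF Suc(2), of 0 j] that b by simp
   thus ?thesis unfolding dsum_def by (intro sum.neutral) auto
  qed
  thus ?thesis
   using cc_confs[OF Suc(2), of t] by (intro exI[of _ sunit] exI[of _ "cc (Suc k) p m t"]) (simp add: b confs_def[of 0])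
 next
  case False
  have "wsum b (Suc k) p t <= (\<Sum>i\<in>{Suc 0..Suc k}. t i)" by (rule wsum_le[OF Suc(2,3)]) (use False in simp_all)
  hence "tau (Suc k) t 1 = 1" by (intro tau_eq_1[of "Suc k" t 1]) (use Suc in auto)
  hence c: "cc (Suc k) p m t = smult (fst (m 0)) (cc k ?p ?m ?t)"
   using cc_first[of k p m t] Suc(2,3) by simp
  have "Vh (cc (Suc k) p m t) = Vh (cc k ?p ?m ?t)"
   unfolding c by (rule Vh_smult[OF _ cc_confs[OF v']]) (use u in \<open>auto simp: umor_def\<close>)
  hence "\<exists>D c. D : confs (Suc (?p 0) - b) \<and> c : confs b \<and> cc k ?p ?m ?t = smult D c \<and>
   fst c = fst (cc k ?p ?m ?t) - dsum b k ?p ?m"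
   using Suc(3-6) False by (intro Suc(1)[OF v']) (auto simp: wsum_Suc)
  then obtain D c'' where D: "D : confs (Suc (p 1) - b)" "c'' : confs b" "cc k ?p ?m ?t = smult D c''"
   "fst c'' = fst (cc k ?p ?m ?t) - dsum b k ?p ?m" unfolding One_nat_def by blast
  have b: "b <= Suc (p 1)"
   using card_Vh_cc[OF Suc(2,3,4), of 1] \<open>wsum b (Suc k) p t <= _\<close> Suc(5,6) by simp
  have "smult (fst (m 0)) D : confs (p 0 - p 1 + (Suc (p 1) - b))"
   by (rule smult_confs[OF _ D(1)]) (use u in \<open>simp add: umor_def\<close>)
  moreover have "p 0 - p 1 + (Suc (p 1) - b) = Suc (p 0) - b" using b u by (simp add: umor_def)
  ultimately have "smult (fst (m 0)) D : confs (Suc (p 0) - b)" by simp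
  moreover have "cc (Suc k) p m t = smult (smult (fst (m 0)) D) c''" by (simp add: c D(3) smult_assoc)
  moreover have "fst c'' = fst (cc (Suc k) p m t) - dsum b (Suc k) p m"
   using False by (simp add: c D(4) dsum_Suc)
  ultimately show ?thesis using D(2) by blast
 qed
qed

text \<open>
 Either the margin is zero and some square is not removed, or the removed squares are
 exactly those of a right factor, whose width bounds the margin.
\<close>

lemma Gs_empty_confs:
 assumes v: "vm k p m" and t: "!!i. i <= k ==> 0 <= t i" "(\<Sum>i\<le>k. t i) = 1"
  and C: "C \<subseteq> Vh (cc k p m t)"
 shows "Gs (cc k p m t) (mu (card C) k p m t) C {} : confs (Suc (p 0) - card C)" "0 <= mu (card C) k p m t"
  "card (snd (cc k p m t) - shift (fst (cc k p m t)) ` C) = Suc (p 0) - card C"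
proof -
 let ?c = "cc k p m t" and ?b = "card C"
 note cf = cc_confs[OF v, of t]
 note cp = confs_pos[OF cf]
 have CV: "shift (fst ?c) ` C \<subseteq> snd ?c" using Vh_shift[OF C] Vc_subset by blast
 have finC: "finite C" and bl: "?b <= Suc (p 0)" using card_Vh_le[OF cf C] by auto
 have cs: "card (shift (fst ?c) ` C) = ?b" by (rule card_image) (rule inj_on_subset[OF inj_shift subset_UNIV])
 show cd: "card (snd ?c - shift (fst ?c) ` C) = Suc (p 0) - ?b"
  using CV finC cp(3) cs by (subst card_Diff_subset) auto
 have W: "wsum ?b k p t <= 1"
 proof -
  have "wsum ?b k p t <= (\<Sum>i\<le>k. t i)" unfolding wsum_def using t(1) by (intro sum_mono) auto
  thus ?thesis using t(2) by simp
 qed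
 have goal: "Gs ?c (mu ?b k p m t) C {} : confs (Suc (p 0) - ?b) \<and> 0 <= mu ?b k p m t"
 proof (cases "1 / 2 < wsum ?b k p t")
  case True
  from cc_split[OF v t(1) C refl True]
  obtain D c where D: "D : confs (Suc (p 0) - ?b)" "c : confs ?b" "?c = smult D c" "fst c = fst ?c - dsum ?b k p m"
   by blast
  have mu: "mu ?b k p m t = (2 * wsum ?b k p t - 1) * fst c" using True by (simp add: mu_def D(4))
  have c0: "0 <= fst c" "card (snd c) = ?b" "finite (snd c)" using confs_facts[OF D(2)] by auto
  have mb: "0 <= mu ?b k p m t" "mu ?b k p m t <= fst c"
   unfolding mu using True W c0 by (auto intro: mult_left_le_one_le)
  have "snd ?c - shift (fst ?c) ` C = snd D"
  proof (cases "?b = 0")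
   case True
   thus ?thesis using D(2,3) finC by (simp add: confs_def[of 0])
  next
   case False
   have "C \<subseteq> Vh c" using C Vh_smult[OF D(1,2)] False D(3) by simp
   hence "shift (fst c) ` C \<subseteq> snd c" using Vh_shift Vc_subset by blast
   moreover have "card (shift (fst c) ` C) = ?b" by (rule card_image) (rule inj_on_subset[OF inj_shift subset_UNIV])
   ultimately have "shift (fst c) ` C = snd c" using c0 by (intro card_subset_eq) auto
   hence "shift (fst D) ` shift (fst c) ` C = shift (fst D) ` snd c" by simp
   hence "shift (fst ?c) ` C = shift (fst D) ` snd c" by (simp add: D(3) image_image)
   thus ?thesis using smult_disjoint[OF D(1,2)] by (auto simp: D(3) smult_def)
  qed
  hence G: "Gs ?c (mu ?b k p m t) C {} = (fst D + (fst c - mu ?b k p m t), snd D)"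
   by (simp add: Gs_def D(3))
  show ?thesis
  proof (cases "Suc (p 0) - ?b = 0")
   case True
   \<comment> \<open>No square remains. All the weight is then counted by \<open>wsum\<close>, so
     the margin is the full width of \<open>c\<close>, and the result is the unit.\<close>
   hence "p i < ?b" if "i <= k" for i using vm_decreasing[OF v, of 0 i] that by simp
   hence "wsum ?b k p t = 1" using t(2) by (simp add: wsum_def)
   thus ?thesis using G D(1) mb True by (simp add: mu confs_def[of 0] sunit_def)
  next
   case False
   hence z: "0 < Suc (p 0) - ?b" by simp
   note dp = confs_pos[OF D(1) z]
   have "(fst D + (fst c - mu ?b k p m t), snd D) : confs (Suc (p 0) - ?b)"
   proof (rule confsI)
    show "0 < fst D + (fst c - mu ?b k p m t)" using dp(1) mb by simp
    show "good (fst D + (fst c - mu ?b k p m t)) e" if "e : snd D" for e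
     by (rule good_mono[OF dp(4)[OF that]]) (use mb in simp)
   qed (use dp z in blast)+
   with mb(1) show ?thesis unfolding G by blast
  qed
 next
  case False
  hence m0: "mu ?b k p m t = 0" by (simp add: mu_def)
  have "\<not> p 0 < ?b"
  proof
   assume "p 0 < ?b"
   hence "p i < ?b" if "i <= k" for i using vm_decreasing[OF v, of 0 i] that by simp
   hence "wsum ?b k p t = 1" using t(2) by (simp add: wsum_def)
   thus False using False by simp
  qed
  thus ?thesis
   unfolding m0 Gs_def using cp cd by (auto intro!: confsI)
 qed
 thus "Gs ?c (mu ?b k p m t) C {} : confs (Suc (p 0) - ?b)" "0 <= mu ?b k p m t" by blast+
qed

section \<open>Faces\<close>

text \<open>These are the faces of \<open>bar_face\<close> without the restriction to finite index
  sets, which would obstruct the recursions; \<open>rep_cong\<close> passes between both.\<close>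

definition fp :: "nat => (nat => nat) => nat => nat" where
 "fp i p j = (if j < i then p j else p (Suc j))"

definition fm :: "nat => (nat => conf \<times> conf mpath) => nat => conf \<times> conf mpath" where
 "fm i m j = (if j + 1 < i then m j else if j + 1 = i then U_comp (m (Suc j)) (m j) else m (Suc j))"

lemma fst_mconcat [simp]: "fst (mconcat \<gamma> \<delta>) = fst \<gamma> + fst \<delta>"
 by (simp add: mconcat_def)

lemma fst_mmap [simp]: "fst (mmap h \<gamma>) = fst \<gamma>"
 by (simp add: mmap_def)

lemma mconcat_assoc: "0 <= fst \<delta> ==> mconcat (mconcat \<gamma> \<delta>) \<zeta> = mconcat \<gamma> (mconcat \<delta> \<zeta>)"
 by (auto simp: mconcat_def fun_eq_iff algebra_simps)

lemma mmap_mconcat: "mmap h (mconcat \<gamma> \<delta>) = mconcat (mmap h \<gamma>) (mmap h \<delta>)"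
 by (auto simp: mconcat_def mmap_def fun_eq_iff)

lemma mmap_mmap: "mmap h (mmap g \<gamma>) = mmap (h \<circ> g) \<gamma>"
 by (simp add: mmap_def o_assoc)

lemma umor_comp:
 assumes x: "umor q p x" and y: "umor l q y"
 shows "umor l p (U_comp y x)"
proof -
 have U: "U_comp y x = (smult (fst x) (fst y), mconcat (snd x) (mmap (smult (fst x)) (snd y)))"
  by (simp add: U_comp_def case_prod_beta)
 have lq: "l <= q" "q <= p" using x y by (auto simp: umor_def)
 have 1: "smult (fst x) (fst y) : confs (p - q + (q - l))"
  by (rule smult_confs) (use x y in \<open>auto simp: umor_def\<close>)
 have 2: "smult (fst x) (snd (snd y) r) : confs (p - q + Suc q)" for r
  by (rule smult_confs) (use x y in \<open>auto simp: umor_def\<close>)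
 show ?thesis
  unfolding umor_def U fst_conv snd_conv
 proof (intro conjI allI impI)
  show "l <= p" using lq by simp
  show "smult (fst x) (fst y) : confs (p - l)" using 1 lq by simp
  show "0 <= fst (mconcat (snd x) (mmap (smult (fst x)) (snd y)))" using x y by (simp add: umor_def)
  show "snd (mconcat (snd x) (mmap (smult (fst x)) (snd y))) r : confs (Suc p)" for r
   using 2 x lq by (simp add: mconcat_def mmap_def umor_def)
  show "snd (mconcat (snd x) (mmap (smult (fst x)) (snd y))) r = spow (Suc p)" if "r <= 0" for r
   using x that by (simp add: mconcat_def umor_def)
  show "snd (mconcat (snd x) (mmap (smult (fst x)) (snd y))) (fst (mconcat (snd x) (mmap (smult (fst x)) (snd y)))) =
    smult (smult (fst x) (fst y)) (spow (Suc l))"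
  \<comment> \<open>At the junction \<open>mconcat\<close> takes the value of the first path, so a
    second path of length 0 has to be treated separately.\<close>
  proof (cases "fst (snd y) = 0")
   case True
   hence "spow (Suc q) = smult (fst y) (spow (Suc l))" using y unfolding umor_def by (metis order_refl)
   moreover have "snd (snd x) (fst (snd x)) = smult (fst x) (spow (Suc q))" using x by (simp add: umor_def)
   ultimately show ?thesis using True by (simp add: mconcat_def smult_assoc)
  next
   case False
   hence "0 < fst (snd y)" using y by (simp add: umor_def)
   moreover have "snd (snd y) (fst (snd y)) = smult (fst y) (spow (Suc l))" using y by (simp add: umor_def)
   ultimately show ?thesis by (simp add: mconcat_def mmap_def smult_assoc)
  qed
 qed
qed

lemma vm_face:
 assumes v: "vm (Suc k) p m" and i: "i <= Suc k"
 shows "vm k (fp i p) (fm i m)"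
 unfolding vm_def
proof (intro allI impI)
 fix j assume j: "j < k"
 have u: "umor (p (Suc j)) (p j) (m j)" "umor (p (Suc (Suc j))) (p (Suc j)) (m (Suc j))"
  using v j by (auto simp: vm_def)
 consider "j + 1 < i" | "j + 1 = i" | "i <= j" by linarith
 thus "umor (fp i p (Suc j)) (fp i p j) (fm i m j)"
 proof cases
  case 2
  thus ?thesis using umor_comp[OF u] by (auto simp: fp_def fm_def)
 qed (use u in \<open>auto simp: fp_def fm_def\<close>)
qed

text \<open>The composite in \<open>U_comp\<close> concatenates the same two paths, so the point is
  associativity of concatenation.\<close>

lemma Om_inner:
 assumes "vm (Suc k) p m" "1 <= i" "i <= k"
 shows "Om k (fp i p) (fm i m) = Om (Suc k) p m"
 using assms
proof (induction i arbitrary: k p m)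
 case (Suc i)
 then obtain k' where k: "k = Suc k'" by (cases k) auto
 let ?p = "%j. p (Suc j)" and ?m = "%j. m (Suc j)"
 have v': "vm k ?p ?m" using Suc(2) by (simp add: vm_Suc)
 show ?case
 proof (cases "i = 0")
  case True
  have e: "(%j. fp (Suc 0) p (Suc j)) = (%j. ?p (Suc j))" "(%j. fm (Suc 0) m (Suc j)) = (%j. ?m (Suc j))"
   "fm (Suc 0) m 0 = U_comp (m 1) (m 0)"
   by (auto simp: fp_def fm_def)
  have "0 <= fst (snd (m 1))" using Suc(2) by (auto simp: vm_def umor_def k)
  moreover have "smult (smult a b) = (%x. smult a (smult b x))" for a b by (rule ext) (rule smult_assoc)
  ultimately show ?thesis
   unfolding k True Om.simps e
   by (simp add: U_comp_def case_prod_beta mmap_mconcat mmap_mmap mconcat_assoc o_def)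
 next
  case False
  have e: "(%j. fp (Suc i) p (Suc j)) = fp i ?p" "(%j. fm (Suc i) m (Suc j)) = fm i ?m" "fm (Suc i) m 0 = m 0"
   using False by (auto simp: fp_def fm_def)
  have "Om k' (fp i ?p) (fm i ?m) = Om (Suc k') ?p ?m"
   using Suc(1)[of k' ?p ?m] v' Suc(4) False k by simp
  thus ?thesis unfolding k Om.simps(2)[of k'] e by (simp add: k)
 qed
qed simp

lemma Om_last:
 assumes "vm (Suc k) p m" "r <= (\<Sum>j<k. fst (snd (m j)))"
 shows "snd (Om (Suc k) p m) r = snd (Om k p m) r"
 using assms
proof (induction k arbitrary: p m r)
 case 0
 hence "umor (p 1) (p 0) (m 0)" "r <= 0" by (auto simp: vm_Suc)
 thus ?case by (simp add: mconcat_def umor_def)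
next
 case (Suc k)
 let ?p = "%j. p (Suc j)" and ?m = "%j. m (Suc j)"
 have v': "vm (Suc k) ?p ?m" using Suc(2) by (simp add: vm_Suc)
 have "snd (Om (Suc k) ?p ?m) (r - fst (snd (m 0))) = snd (Om k ?p ?m) (r - fst (snd (m 0)))"
  using Suc(3) by (intro Suc(1)[OF v']) (simp add: sum.lessThan_Suc_shift del: sum.lessThan_Suc)
 thus ?case
  unfolding Om.simps(2)[of "Suc k"] Om.simps(2)[of k p] by (simp add: mconcat_def mmap_def del: Om.simps)
qed

lemma face_Suc:
 "(%j. sface (Suc i) t (Suc j)) = sface i (%j. t (Suc j))"
 "sface (Suc i) t 0 = t 0" "(%j. sface 0 t (Suc j)) = t" "sface 0 t 0 = 0"
 by (auto simp: simplical_face_def fun_eq_iff)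

lemma face_sum: "i <= Suc k ==> (\<Sum>l\<le>Suc k. sface i t l) = (\<Sum>l\<le>k. t l)"
proof (induction i arbitrary: k t)
 case 0
 thus ?case
  using face_Suc(3,4)[of t] by (simp add: sum.atMost_Suc_shift fun_eq_iff del: sum.atMost_Suc)
next
 case (Suc i)
 show ?case
 proof (cases k)
  case 0
  thus ?thesis using Suc by (simp add: simplical_face_def)
 next
  case (Suc k')
  have "(\<Sum>l\<le>Suc k'. sface (Suc i) t (Suc l)) = (\<Sum>l\<le>Suc k'. sface i (%j. t (Suc j)) l)"
   using face_Suc(1)[of i t] by (simp add: fun_eq_iff)
  thus ?thesis
   using Suc.IH[of k' "%j. t (Suc j)"] Suc.prems Suc
   by (simp add: sum.atMost_Suc_shift[of _ "Suc k'"] sum.atMost_Suc_shift[of t k'] face_Suc(2) del: sum.atMost_Suc)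
 qed
qed

lemma wsum_face: "i <= Suc k ==> wsum b (Suc k) p (sface i t) = wsum b k (fp i p) t"
proof (induction i arbitrary: k p t)
 case 0
 have "fp 0 p = (%j. p (Suc j))" by (simp add: fp_def fun_eq_iff)
 thus ?case by (simp add: wsum_Suc face_Suc)
next
 case (Suc i)
 have e: "(%j. fp (Suc i) p (Suc j)) = fp i (%j. p (Suc j))" "fp (Suc i) p 0 = p 0"
  by (auto simp: fp_def)
 show ?case
 proof (cases k)
  case 0
  thus ?thesis using Suc.prems 0 by (simp add: wsum_Suc wsum_0 simplical_face_def fp_def)
 next
  case k: (Suc k')
  show ?thesis
   using Suc.IH[of k' "%j. p (Suc j)" "%j. t (Suc j)"] Suc.prems
   by (simp add: k wsum_Suc[of _ "Suc k'"] wsum_Suc[of _ k' "fp (Suc i) p"] face_Suc e)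
 qed
qed

lemma tau_face_tail: "tau (Suc k) (sface 1 t) (Suc 0) = tau k t 1"
proof -
 have "(\<Sum>l\<in>{Suc 0..Suc k}. sface 1 t l) = (\<Sum>l\<in>{0..k}. sface 1 t (Suc l))"
  by (rule sum.shift_bounds_cl_Suc_ivl)
 also have "\<dots> = (\<Sum>l\<in>{0..k}. if l = 0 then 0 else t l)"
  by (intro sum.cong) (auto simp: simplical_face_def)
 also have "\<dots> = (\<Sum>l\<in>{1..k}. t l)"
  by (simp add: sum.atLeast_Suc_atMost)
 finally show ?thesis by (simp add: tau_def)
qed

text \<open>At an inner face the weight of vertex i is 0, so the two paths that are composed there
  have equal shares.\<close>

lemma ct_inner: "1 <= i ==> i <= k ==> ct k (fm i m) t = ct (Suc k) m (sface i t)"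
proof (induction i arbitrary: k m t)
 case (Suc i)
 then obtain k' where k: "k = Suc k'" by (cases k) auto
 let ?m = "%j. m (Suc j)" and ?t = "%j. t (Suc j)"
 show ?case
 proof (cases "i = 0")
  case True
  have e: "(%j. fm (Suc 0) m (Suc j)) = (%j. ?m (Suc j))" "fm (Suc 0) m 0 = U_comp (m 1) (m 0)"
   by (auto simp: fm_def)
  have e2: "(%j. sface (Suc 0) t (Suc (Suc j))) = ?t"
   by (auto simp: simplical_face_def fun_eq_iff)
  have t1: "tau (Suc (Suc k')) (sface (Suc 0) t) (Suc 0) = tau (Suc k') t (Suc 0)"
   using tau_face_tail[of "Suc k'" t] by simp
  have t2: "tau (Suc k') (%j. sface (Suc 0) t (Suc j)) (Suc 0) = tau (Suc k') t (Suc 0)"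
   by (simp add: tau_Suc e2)
  show ?thesis
   by (simp add: k True ct_Suc e e2 t1 t2 U_comp_def case_prod_beta distrib_right)
 next
  case False
  have e: "(%j. fm (Suc i) m (Suc j)) = fm i ?m" "fm (Suc i) m 0 = m 0"
   using False by (auto simp: fm_def)
  have "tau (Suc (Suc k')) (sface (Suc i) t) (Suc 0) = tau (Suc k') (%j. sface i ?t j) 0"
   by (simp add: tau_Suc face_Suc)
  also have "\<dots> = tau k' ?t 0"
   using face_sum[of i k' ?t] Suc(3) k by (simp add: tau_def atLeast0AtMost)
  also have "\<dots> = tau (Suc k') t (Suc 0)" by (simp add: tau_Suc)
  finally have t1: "tau (Suc (Suc k')) (sface (Suc i) t) (Suc 0) = tau (Suc k') t (Suc 0)" .
  show ?thesis
   using Suc(1)[of k' ?m ?t] False Suc(3) k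
   by (simp add: k ct_Suc[of "Suc k'"] ct_Suc[of k' "fm (Suc i) m"] e t1 face_Suc)
 qed
qed simp

lemma ct_last: "ct (Suc k) m (sface (Suc k) t) = ct k m t"
proof -
 have "tau (Suc k) (sface (Suc k) t) (Suc j) = tau k t (Suc j)" if "j <= k" for j
 proof -
  have "(\<Sum>l\<in>{Suc j..Suc k}. sface (Suc k) t l) = (\<Sum>l\<in>{Suc j..k}. sface (Suc k) t l)"
   using that by (simp add: sum.cl_ivl_Suc simplical_face_def)
  also have "\<dots> = (\<Sum>l\<in>{Suc j..k}. t l)" by (intro sum.cong) (auto simp: simplical_face_def)
  finally show ?thesis by (simp add: tau_def)
 qed
 moreover have "tau k t (Suc k) = 0" by (simp add: tau_def)
 ultimately show ?thesis by (simp add: ct_def)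
qed

text \<open>\<open>dsum\<close> counts \<open>m j\<close> according to its target
  \<open>p j\<close>, and the composite has target \<open>p (i - 1)\<close>. So the two sides can
  differ only by the width of \<open>m i\<close>, and only if
  \<open>p i < b \<le> p (i - 1)\<close>; the last hypothesis covers this case.\<close>

lemma dsum_inner:
 assumes "1 <= i" "i <= k" "p i <= p (i - 1)" "b <= p (i - 1) ==> p i < b ==> fst (fst (m i)) = 0"
 shows "dsum b k (fp i p) (fm i m) = dsum b (Suc k) p m"
 using assms
proof (induction i arbitrary: k p m)
 case (Suc i)
 then obtain k' where k: "k = Suc k'" by (cases k) auto
 let ?p = "%j. p (Suc j)" and ?m = "%j. m (Suc j)"
 show ?case
 proof (cases "i = 0")
  case True
  have e: "(%j. fp (Suc 0) p (Suc j)) = (%j. ?p (Suc j))" "(%j. fm (Suc 0) m (Suc j)) = (%j. ?m (Suc j))"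
   "fm (Suc 0) m 0 = U_comp (m 1) (m 0)" "fp (Suc 0) p 0 = p 0"
   by (auto simp: fp_def fm_def)
  have "p (Suc 0) <= p 0" "b <= p 0 ==> p (Suc 0) < b ==> fst (fst (m (Suc 0))) = 0"
   using Suc(4,5) by (simp_all add: True)
  thus ?thesis
   by (auto simp add: k True dsum_Suc e U_comp_def case_prod_beta)
 next
  case False
  have e: "(%j. fp (Suc i) p (Suc j)) = fp i ?p" "(%j. fm (Suc i) m (Suc j)) = fm i ?m" "fm (Suc i) m 0 = m 0"
   "fp (Suc i) p 0 = p 0"
   using False by (auto simp: fp_def fm_def)
  have "dsum b k' (fp i ?p) (fm i ?m) = dsum b (Suc k') ?p ?m"
   by (rule Suc(1)) (use False Suc(3-5) k in auto)
  thus ?thesis by (simp add: k dsum_Suc[of _ "Suc k'"] dsum_Suc[of _ k' "fp (Suc i) p"] e)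
 qed
qed simp

lemma simplex_facts:
 assumes "t : spx k"
 shows "!!i. 0 <= t i" "(\<Sum>i\<le>k. t i) = 1"
proof -
 show "(\<Sum>i\<le>k. t i) = 1" using assms by (simp add: standard_simplex_def)
 show "0 <= t i" for i using assms by (cases "i <= k") (auto simp: standard_simplex_def)
qed

lemma umor_eq: "umor q p x ==> p <= q ==> fst (fst x) = 0"
 by (auto simp: umor_def confs_def[of 0] sunit_def)

lemma Om_cong:
 "(!!j. j <= k ==> p j = p' j) ==> (!!j. j < k ==> m j = m' j) ==> Om k p m = Om k p' m'"
proof (induction k arbitrary: p m p' m')
 case (Suc k)
 have "Om k (%j. p (Suc j)) (%j. m (Suc j)) = Om k (%j. p' (Suc j)) (%j. m' (Suc j))"
  by (rule Suc(1)) (use Suc(2,3) in auto)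
 thus ?case using Suc(3)[of 0] by simp
qed simp

lemma rep_cong:
 assumes "!!j. j <= k ==> p j = p' j" "!!j. j < k ==> m j = m' j"
 shows "vm k p m = vm k p' m'" "ct k m t = ct k m' t" "cc k p m t = cc k p' m' t" "mu b k p m t = mu b k p' m' t"
proof -
 show 1: "ct k m t = ct k m' t" using assms(2) by (simp add: ct_def)
 show 2: "cc k p m t = cc k p' m' t" using 1 Om_cong[of k p p' m m'] assms by (simp add: cc_def)
 show "vm k p m = vm k p' m'" using assms by (auto simp: vm_def)
 have "wsum b k p t = wsum b k p' t" "dsum b k p m = dsum b k p' m'"
  using assms by (auto simp: wsum_def dsum_def intro!: sum.cong)
 thus "mu b k p m t = mu b k p' m' t" using 2 by (simp add: mu_def)
qed

lemma cc_last:
 assumes "vm (Suc k) p m"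
 shows "cc k p m t = cc (Suc k) p m (sface (Suc k) t)"
proof -
 have "vm k p m" using assms by (simp add: vm_def)
 thus ?thesis
  using Om_last[OF assms, of "ct k m t"] ct_le[of k p m t] by (simp add: cc_def ct_last del: Om.simps)
qed

lemma fp_fm_last: "j <= k ==> fp (Suc k) p j = p j" "j < k ==> fm (Suc k) m j = m j"
 by (simp_all add: fp_def fm_def)

lemma cc_face:
 assumes v: "vm (Suc k) p m" and i: "1 <= i" "i <= Suc k"
 shows "cc k (fp i p) (fm i m) t = cc (Suc k) p m (sface i t)"
proof (cases "i = Suc k")
 case True
 show ?thesis
  unfolding True using cc_last[OF v] rep_cong(3)[of k "fp (Suc k) p" p "fm (Suc k) m" m t] fp_fm_last by simp
next
 case False
 thus ?thesis using Om_inner[OF v, of i] ct_inner[of i k m t] i by (simp add: cc_def del: Om.simps)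
qed

lemma mu_face:
 assumes v: "vm (Suc k) p m" and t: "t : spx k" and i: "1 <= i" "i <= Suc k"
  and C: "C \<subseteq> Vh (cc (Suc k) p m (sface i t))"
 shows "mu (card C) k (fp i p) (fm i m) t = mu (card C) (Suc k) p m (sface i t)"
proof (cases "1 / 2 < wsum (card C) (Suc k) p (sface i t)")
 case False
 thus ?thesis by (simp add: mu_def wsum_face[OF i(2), of "card C" p t])
next
 case w: True
 let ?t = "sface i t" and ?b = "card C"
 have t': "?t : spx (Suc k)"
  using simplical_face_in_standard_simplex[of "Suc k" i t] i t by simp
 note tf = simplex_facts(1)[OF t']
 have "dsum ?b k (fp i p) (fm i m) = dsum ?b (Suc k) p m"
 proof (cases "i = Suc k")
  case True
  \<comment> \<open>Otherwise only the last vertex could count for \<open>wsum\<close>, and its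
    weight is 0 on this face.\<close>
  have "\<not> ?b <= p k"
  proof
   assume "?b <= p k"
   from wsum_le[OF v tf this le_SucI[OF le_refl]] have "wsum ?b (Suc k) p ?t <= ?t (Suc k)" by simp
   thus False using w by (simp add: True simplical_face_def)
  qed
  moreover have "dsum ?b k (fp (Suc k) p) (fm (Suc k) m) = dsum ?b k p m"
   unfolding dsum_def by (intro sum.cong) (auto simp: fp_fm_last)
  ultimately show ?thesis by (simp add: True dsum_def)
 next
  case False
  hence ik: "i <= k" using i by simp
  show ?thesis
  proof (rule dsum_inner[OF i(1) ik])
   show "p i <= p (i - 1)" by (rule vm_decreasing[OF v]) (use ik in auto)
   assume b: "?b <= p (i - 1)" "p i < ?b"
   have "wsum ?b (Suc k) p ?t <= (\<Sum>l\<in>{Suc (i - 1)..Suc k}. ?t l)" by (rule wsum_le[OF v tf b(1)]) (use ik in simp)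
   also have "\<dots> = ?t i + (\<Sum>l\<in>{Suc i..Suc k}. ?t l)"
    using i ik by (simp add: sum.atLeast_Suc_atMost)
   finally have "1 / 2 <= (\<Sum>l\<in>{Suc i..Suc k}. ?t l)" using w by (simp add: simplical_face_def)
   \<comment> \<open>The column fits into the factor of vertex i + 1, so the objects at i and i + 1
     agree, and the morphism between them has no squares and width 0.\<close>
   from card_Vh_cc[OF v tf C _ this] have "?b <= Suc (p (Suc i))" using ik by simp
   hence "p i <= p (Suc i)" using b by simp
   moreover have "umor (p (Suc i)) (p i) (m i)" using v ik by (simp add: vm_def)
   ultimately show "fst (fst (m i)) = 0" using umor_eq by blast
  qed
 qed
 thus ?thesis by (simp add: mu_def wsum_face[OF i(2), of _ p t] cc_face[OF v i])
qed

lemma first_face: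
 assumes v: "vm (Suc k) p m" and t: "t : spx k"
 shows "tau (Suc k) (sface 0 t) 1 = 1"
  "cc (Suc k) p m (sface 0 t) = smult (fst (m 0)) (cc k (%j. p (Suc j)) (%j. m (Suc j)) t)"
  "C \<subseteq> Vh (cc (Suc k) p m (sface 0 t)) ==>
   mu (card C) k (%j. p (Suc j)) (%j. m (Suc j)) t = mu (card C) (Suc k) p m (sface 0 t)"
proof -
 let ?t = "sface 0 t"
 have t': "?t : spx (Suc k)"
  using simplical_face_in_standard_simplex[of "Suc k" 0 t] t by simp
 note tf = simplex_facts(1)[OF t']
 have s: "(\<Sum>l\<in>{1..Suc k}. ?t l) = 1"
  using simplex_facts(2)[OF t] by (simp add: sum.shift_bounds_cl_Suc_ivl simplical_face_def atLeast0AtMost del: sum.cl_ivl_Suc)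
 show t1: "tau (Suc k) ?t 1 = 1" by (rule tau_eq_1[of _ _ 1]) (use tf s in auto)
 show c: "cc (Suc k) p m ?t = smult (fst (m 0)) (cc k (%j. p (Suc j)) (%j. m (Suc j)) t)"
  using cc_first[OF v tf t1] by (simp add: face_Suc)
 assume C: "C \<subseteq> Vh (cc (Suc k) p m ?t)"
 have p0: "fp 0 p = (%j. p (Suc j))" by (simp add: fp_def fun_eq_iff)
 note W = wsum_face[of 0 k "card C" p t, unfolded p0, OF le0]
 show "mu (card C) k (%j. p (Suc j)) (%j. m (Suc j)) t = mu (card C) (Suc k) p m ?t"
 proof (cases "1 / 2 < wsum (card C) (Suc k) p ?t \<and> p 0 < card C")
  case True
  \<comment> \<open>The first morphism splits off without being counted by \<open>dsum\<close>;
    comparing \<open>p 0\<close> with \<open>p 1\<close> shows that its width is 0.\<close>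
  have "card C <= Suc (p 1)" by (rule card_Vh_cc[OF v tf C]) (use s in auto)
  hence "p 0 <= p 1" using True by simp
  hence "fst (fst (m 0)) = 0" using v umor_eq[of "p 1" "p 0" "m 0"] by (simp add: vm_Suc)
  thus ?thesis by (simp add: mu_def W c dsum_Suc)
 next
  case False
  thus ?thesis by (auto simp add: mu_def W c dsum_Suc)
 qed
qed


section \<open>Invariants of points of the resolution\<close>

type_synonym 'a rep = "nat \<times> ('a \<times> 'a mpath, conf \<times> conf mpath) bar \<times> (nat => real)"

definition vrep :: "(nat => 'a topology) => 'a action => nat => 'a rep => bool" where
 "vrep M act n w \<longleftrightarrow> (case w of (k, (p, (a, \<gamma>), m), t) => vm k p m \<and> t : spx k \<and> Suc (p 0) <= n \<and>
  a : pts (M (n - Suc (p 0))) \<and> 0 <= fst \<gamma> \<and> (\<forall>r. snd \<gamma> r : pts (M n)) \<and>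
  snd \<gamma> (fst \<gamma>) = act (n - Suc (p 0)) (Suc (p 0)) a (spow (Suc (p 0))))"

definition rV :: "'a rep => square set" where
 "rV w = (case w of (k, (p, r, m), t) => Vh (cc k p m t))"

definition rS :: "'a rep => square set => (square \<times> real) set => conf" where
 "rS w C F = (case w of (k, (p, r, m), t) => Gs (cc k p m t) (mu (card C) k p m t) C F)"

definition rM :: "'a rep => nat => real" where
 "rM w b = (case w of (k, (p, r, m), t) => mu b k p m t)"

definition rG :: "'a action => nat => 'a rep => square set => (square \<times> real) set => 'a" where
 "rG act n w C F = (case w of (k, (p, (a, \<gamma>), m), t) =>
  act (n - Suc (p 0)) (card (snd (rS w C F))) a (rS w C F))"

text \<open>A path in \<open>M n\<close> from the augmentation to the product of \<open>a\<close>
  with \<open>cc k p m t\<close>, parametrized by the fraction of the total time; see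
  \<open>zH_ends\<close>. It becomes the homotopy from the augmentation to the map that removes
  nothing.\<close>

definition rH :: "'a action => nat => 'a rep => real => 'a" where
 "rH act n w u = (case w of (k, (p, (a, \<gamma>), m), t) =>
  snd (mconcat \<gamma> (mmap (act (n - Suc (p 0)) (Suc (p 0)) a) (Om k p m))) (u * (fst \<gamma> + ct k m t)))"

lemma rS_confs:
 assumes "vrep M act n w" "C \<subseteq> rV w" "validF C F"
 shows "rS w C F : confs (Suc (fst (fst (snd w)) 0) - card C + card F)"
proof -
 obtain k p a \<gamma> m t where w: "w = (k, (p, (a, \<gamma>), m), t)" by (metis prod.collapse)
 have v: "vm k p m" and t: "t : spx k" and C: "C \<subseteq> Vh (cc k p m t)"
  using assms by (auto simp: vrep_def w rV_def)
 show ?thesis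
 proof (cases "F = {}")
  case True
  thus ?thesis
   using Gs_empty_confs(1)[OF v simplex_facts(1)[OF t] simplex_facts(2)[OF t] C] by (simp add: w rS_def)
 next
  case False
  thus ?thesis
   using Gs_confs(1)[OF cc_confs[OF v] _ C assms(3)] by (simp add: w rS_def)
 qed
qed

text \<open>Inner and last faces change neither the configuration nor the path up to the time
  reached. On the first face the left factor d_0 of the configuration passes into the point of M,
  and \<open>act_assoc\<close> shows that the products agree, while column and margin see only the
  right factor.\<close>

lemma rV_face:
 assumes M: "rmod M act" and w: "vrep M act n (Suc k, x, sface i t)"
  and t: "t : spx k" and i: "i <= Suc k"
 defines "y \<equiv> bar_face U_comp (Res_map act n) (Suc k) i x"
 shows "vrep M act n (k, y, t) \<and> rV (k, y, t) = rV (Suc k, x, sface i t) \<and>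
  (\<forall>C. C \<subseteq> rV (k, y, t) --> rM (k, y, t) (card C) = rM (Suc k, x, sface i t) (card C)) \<and>
  (\<forall>C F. C \<subseteq> rV (k, y, t) \<and> validF C F --> rG act n (k, y, t) C F = rG act n (Suc k, x, sface i t) C F) \<and>
  (\<forall>u\<in>{0..1}. rH act n (k, y, t) u = rH act n (Suc k, x, sface i t) u)"
proof -
 obtain p a \<gamma> m where x: "x = (p, (a, \<gamma>), m)" by (metis prod.collapse)
 let ?t = "sface i t"
 have v: "vm (Suc k) p m" and pn: "Suc (p 0) <= n" and a: "a : pts (M (n - Suc (p 0)))"
  and g: "0 <= fst \<gamma>" "!!r. snd \<gamma> r : pts (M n)"
   "snd \<gamma> (fst \<gamma>) = act (n - Suc (p 0)) (Suc (p 0)) a (spow (Suc (p 0)))"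
  using w by (auto simp: vrep_def x)
 have t': "?t : spx (Suc k)" using w by (auto simp: vrep_def x)
 note tf = simplex_facts(1)[OF t] simplex_facts(1)[OF t']
 have vk: "vm k (fp i p) (fm i m)" by (rule vm_face[OF v i])
 let ?p = "\<lambda>j\<in>{..<Suc k}. fp i p j" and ?m = "\<lambda>j\<in>{..<k}. fm i m j"
 have pe: "!!j. j <= k ==> ?p j = fp i p j" and me: "!!j. j < k ==> ?m j = fm i m j" by auto
 have cg: "vm k ?p ?m = vm k (fp i p) (fm i m)" "ct k ?m t = ct k (fm i m) t" "cc k ?p ?m t = cc k (fp i p) (fm i m) t"
  "!!b. mu b k ?p ?m t = mu b k (fp i p) (fm i m) t" "Om k ?p ?m = Om k (fp i p) (fm i m)"
 proof -
  show "ct k ?m t = ct k (fm i m) t" unfolding ct_def by (intro sum.cong) auto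
 qed (rule rep_cong Om_cong; simp)+
 show ?thesis
 proof (cases "i = 0")
  case False
  hence i1: "1 <= i" by simp
  have y: "y = (?p, (a, \<gamma>), ?m)"
   using False by (auto simp: y_def x bar_face_def fp_def fm_def fun_eq_iff)
  have p0: "?p 0 = p 0" using False by (simp add: fp_def)
  have ce: "cc k ?p ?m t = cc (Suc k) p m ?t" using cc_face[OF v i1 i] cg(3) by simp
  have mue: "mu (card C) k ?p ?m t = mu (card C) (Suc k) p m ?t" if "C \<subseteq> Vh (cc (Suc k) p m ?t)" for C
   using mu_face[OF v t i1 i that] cg(4) by simp
  have Se: "rS (k, y, t) C F = rS (Suc k, x, ?t) C F" if "C \<subseteq> Vh (cc (Suc k) p m ?t)" for C F
   using mue[OF that] by (simp add: y x rS_def ce)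
  have He: "rH act n (k, y, t) u = rH act n (Suc k, x, ?t) u" if u: "u : {0..1}" for u
  proof (cases "i = Suc k")
   case False
   have "Om k ?p ?m = Om (Suc k) p m" using Om_inner[OF v i1] False i cg(5) by simp
   moreover have "ct k ?m t = ct (Suc k) m ?t" using ct_inner[OF i1, of k m t] False i cg(2) by simp
   ultimately show ?thesis by (simp only: y x rH_def p0 prod.case)
  next
   case True
   have vk': "vm k p m" using v by (simp add: vm_def)
   have O: "Om k ?p ?m = Om k p m" using True by (intro Om_cong) (auto simp: fp_def fm_def)
   have c: "ct k ?m t = ct k m t" "ct (Suc k) m ?t = ct k m t"
    using True by (simp add: ct_def fm_def) (simp add: True ct_last)
   have ct0: "0 <= ct k m t" using ct_nonneg[OF vk'] tf(1) by simp
   have "u * (fst \<gamma> + ct k m t) <= fst \<gamma> + ct k m t"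
    using u g(1) ct0 by (intro mult_left_le_one_le) auto
   hence "u * (fst \<gamma> + ct k m t) - fst \<gamma> <= (\<Sum>j<k. fst (snd (m j)))"
    using ct_le[OF vk', of t] by linarith
   from Om_last[OF v this]
   show ?thesis by (simp add: y x rH_def p0[simplified] p0 O c mconcat_def mmap_def del: Om.simps)
  qed
  have "vrep M act n (k, y, t)"
   using vk cg(1) t pn a g by (simp add: y vrep_def p0 del: restrict_apply)
  thus ?thesis
   using Se He mue by (auto simp: rV_def rG_def rM_def y x ce p0 simp del: restrict_apply Om.simps)
 next
  case True
  let ?q = "%j. p (Suc j)" and ?l = "%j. m (Suc j)"
  have fe: "fp 0 p = ?q" "fm 0 m = ?l" by (auto simp: fp_def fm_def)
  define a' where "a' = act (n - Suc (p 0)) (p 0 - p 1) a (fst (m 0))"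
  define \<gamma>' where "\<gamma>' = mconcat \<gamma> (mmap (act (n - Suc (p 0)) (Suc (p 0)) a) (snd (m 0)))"
  have y: "y = (?p, (a', \<gamma>'), ?m)"
   using True by (auto simp: y_def x bar_face_def fp_def fm_def fun_eq_iff Res_map_def a'_def \<gamma>'_def case_prod_beta)
  have p0: "?p 0 = p 1" using True by (simp add: fp_def)
  have u0: "umor (p 1) (p 0) (m 0)" and vl: "vm k ?q ?l" using v by (auto simp: vm_Suc)
  have pq: "p 1 <= p 0" using u0 by (simp add: umor_def)
  have nn: "n - Suc (p 1) = n - Suc (p 0) + (p 0 - p 1)" using pq pn by simp
  have d0: "fst (m 0) : pts (\<S> (p 0 - p 1))" using u0 by (simp add: umor_def topspace_S)
  have a'M: "a' : pts (M (n - Suc (p 1)))"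
   unfolding a'_def nn by (rule act_in[OF M a d0])
  have as: "act (n - Suc (p 1)) l a' s = act (n - Suc (p 0)) (p 0 - p 1 + l) a (smult (fst (m 0)) s)"
   if "s : confs l" for s l
   unfolding a'_def nn by (rule act_assoc[OF M a d0]) (use that in \<open>simp add: topspace_S\<close>)
  have ce: "cc (Suc k) p m ?t = smult (fst (m 0)) (cc k ?p ?m t)"
   using first_face(2)[OF v t] cg(3) True by (simp add: fe)
  have cK: "cc k ?p ?m t : confs (Suc (p 1))" using cc_confs[OF vl, of t] cg(3) True by (simp add: fe)
  have Ve: "Vh (cc k ?p ?m t) = Vh (cc (Suc k) p m ?t)"
   unfolding ce by (rule Vh_smult[OF d0[unfolded topspace_S] cK, symmetric]) simp
  have mue: "mu (card C) k ?p ?m t = mu (card C) (Suc k) p m ?t" if "C \<subseteq> Vh (cc (Suc k) p m ?t)" for C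
   using first_face(3)[OF v t, of C] that cg(4) True by (simp add: fe)
  have Se: "rS (Suc k, x, ?t) C F = smult (fst (m 0)) (rS (k, y, t) C F)" if "C \<subseteq> Vh (cc (Suc k) p m ?t)" for C F
  proof -
   have "cc k ?p ?m t : confs (Suc (p 1))" by (rule cK)
   moreover have "fst (m 0) : confs (p 0 - p 1)" using u0 by (simp add: umor_def)
   ultimately show ?thesis
    using mue[OF that] that Ve Gs_smult[of "fst (m 0)" _ "cc k ?p ?m t" _ C]
    by (simp add: y x rS_def ce del: restrict_apply)
  qed
  have g': "0 <= fst \<gamma>'" "!!r. snd \<gamma>' r : pts (M n)"
   "snd \<gamma>' (fst \<gamma>') = act (n - Suc (p 1)) (Suc (p 1)) a' (spow (Suc (p 1)))"
  proof -
   show "0 <= fst \<gamma>'" using g(1) u0 by (simp add: \<gamma>'_def umor_def)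
   have "act (n - Suc (p 0)) (Suc (p 0)) a (snd (snd (m 0)) r) : pts (M (n - Suc (p 0) + Suc (p 0)))" for r
    by (rule act_in[OF M a]) (use u0 in \<open>simp add: umor_def topspace_S\<close>)
   thus "snd \<gamma>' r : pts (M n)" for r
    using g(2) pn by (simp add: \<gamma>'_def mconcat_def mmap_def)
   have e: "act (n - Suc (p 1)) (Suc (p 1)) a' (spow (Suc (p 1))) = act (n - Suc (p 0)) (Suc (p 0)) a (snd (snd (m 0)) (fst (snd (m 0))))"
    using as[OF spow_confs[of "Suc (p 1)"]] u0 pq by (simp add: umor_def del: spow.simps)
   show "snd \<gamma>' (fst \<gamma>') = act (n - Suc (p 1)) (Suc (p 1)) a' (spow (Suc (p 1)))"
   proof (cases "fst (snd (m 0)) = 0")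
    case True
    have z: "snd (snd (m 0)) 0 = spow (Suc (p 0))" using u0 unfolding umor_def by blast
    show ?thesis unfolding e using g(3) z by (simp add: \<gamma>'_def mconcat_def True del: spow.simps)
   next
    case False
    hence "0 < fst (snd (m 0))" using u0 by (simp add: umor_def)
    thus ?thesis unfolding e by (simp add: \<gamma>'_def mconcat_def mmap_def)
   qed
  qed
  have vr: "vrep M act n (k, y, t)"
   using vk cg(1) t pn pq a'M g' by (simp add: y vrep_def p0 del: restrict_apply spow.simps)
  have Ge: "rG act n (k, y, t) C F = rG act n (Suc k, x, ?t) C F" if C: "C \<subseteq> rV (k, y, t)" and F: "validF C F" for C F
  proof -
   have CV: "C \<subseteq> Vh (cc (Suc k) p m ?t)" using C Ve by (simp add: rV_def y del: restrict_apply)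
   have s: "rS (k, y, t) C F : confs (Suc (p 1) - card C + card F)"
    using rS_confs[OF vr C F] by (simp add: y p0 del: restrict_apply)
   have "smult (fst (m 0)) (rS (k, y, t) C F) : confs (p 0 - p 1 + (Suc (p 1) - card C + card F))"
    by (rule smult_confs[OF _ s]) (use u0 in \<open>simp add: umor_def\<close>)
   from confs_facts(3)[OF this] confs_facts(3)[OF s] as[OF s]
   show ?thesis
    by (simp add: rG_def Se[OF CV, unfolded x y] x y p0 del: restrict_apply)
  qed
  have O: "Om k ?p ?m = Om k ?q ?l" using True cg(5) by (simp add: fe)
  have ctt: "fst \<gamma>' + ct k ?m t = fst \<gamma> + ct (Suc k) m ?t"
   using first_face(1)[OF v t] cg(2) True by (simp add: ct_Suc face_Suc fe \<gamma>'_def)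
  have He: "rH act n (k, y, t) u = rH act n (Suc k, x, ?t) u" for u
  proof -
   have 1: "mmap (act (n - Suc (p 1)) (Suc (p 1)) a') (Om k ?q ?l) =
     mmap (act (n - Suc (p 0)) (Suc (p 0)) a) (mmap (smult (fst (m 0))) (Om k ?q ?l))"
    using as[of _ "Suc (p 1)"] Om_facts(3)[OF vl] pq by (simp add: mmap_def fun_eq_iff)
   have L: "0 <= fst (snd (m 0))" using u0 by (simp add: umor_def)
   have "mconcat \<gamma>' (mmap (act (n - Suc (p 1)) (Suc (p 1)) a') (Om k ?q ?l)) =
    mconcat \<gamma> (mmap (act (n - Suc (p 0)) (Suc (p 0)) a) (Om (Suc k) p m))"
    unfolding 1 \<gamma>'_def by (simp add: mmap_mconcat mconcat_assoc L)
   thus ?thesis using ctt O by (simp add: rH_def x y p0 del: restrict_apply Om.simps)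
  qed
  show ?thesis
   using vr Ve Ge He mue by (auto simp: rV_def rM_def y x simp del: restrict_apply)
 qed
qed

section \<open>Continuous functions on the resolution\<close>

section \<open>The topology of the resolution\<close>

lemma cm_open_sub:
 assumes "openin Z W" "!!z. z : W ==> f z : pts V" "!!U. openin V U ==> openin Z {z : W. f z : U}"
 shows "cts (stop Z W) V f"
proof -
 have W: "pts (stop Z W) = W"
  using openin_subset[OF assms(1)] by auto
 show ?thesis
  unfolding cts_def W using assms by (auto simp: openin_open_subtopology)
qed

lemma topspace_kify_sub: "pts (cg_subspace X A) = pts X \<inter> A"
 by (simp add: cg_subspace_def)

lemma mpath_facts:
 assumes "\<mu> : pts (mpath_space X)"
 shows "0 <= fst \<mu>" "!!r. r <= 0 ==> snd \<mu> r = snd \<mu> 0" "!!r. snd \<mu> r : pts X"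
proof -
 have *: "snd \<mu> : pts (cotop rtop X)" "0 <= fst \<mu>" "\<forall>t\<le>0. snd \<mu> t = snd \<mu> 0"
  using assms unfolding mpath_space_def topspace_kify_sub topspace_prod_topology Int_iff mem_Times_iff
   mem_Collect_eq case_prod_beta by blast+
 show "0 <= fst \<mu>" "r <= 0 ==> snd \<mu> r = snd \<mu> 0" for r using *(2,3) by blast+
 show "snd \<mu> r : pts X" for r
  using topspace_compact_open[OF *(1)] by (auto simp: cts_def)
qed

lemma mpath_continuous:
 assumes "cts K (mpath_space X) g"
 shows "cts K rtop (%x. fst (g x))"
  "cts K (cotop rtop X) (%x. snd (g x))"
proof -
 have "cts K (ptop rtop (cotop rtop X)) g"
  using cts_of_kify[OF assms[unfolded mpath_space_def cg_subspace_def]]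
  by (rule cts_full)
 thus "cts K rtop (%x. fst (g x))"
  "cts K (cotop rtop X) (%x. snd (g x))"
  by (auto simp: continuous_map_componentwise_UNIV continuous_map_pairwise o_def)
qed

lemma umor_U_hom:
 assumes "x : pts (U_hom q p)"
 shows "umor q p x"
proof -
 have qp: "q <= p" using assms by (auto simp: U_hom_def split: if_splits)
 hence *: "fst x : pts (\<S> (p - q))" "snd x : pts (mpath_space (\<S> (p + 1)))"
  "mstart (snd x) = spow (p + 1)" "mend (snd x) = smult (fst x) (spow (q + 1))"
  using assms by (auto simp: U_hom_def topspace_kify_sub)
 have "snd (snd x) r = spow (Suc p)" if "r <= 0" for r
  using mpath_facts(2)[OF *(2) that] *(3) by (simp add: mstart_def del: spow.simps)
 thus ?thesis
  using * mpath_facts(1,3)[OF *(2)] qp by (simp add: umor_def topspace_S mend_def del: spow.simps)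
qed

lemma Delta_hom_subset: "pts (Delta_hom q p) \<subseteq> pts (U_hom q p)"
 by (auto simp: Delta_hom_def topspace_kify_sub)

lemma continuous_Delta_hom:
 assumes g: "cts K (Delta_hom q p) g"
 shows "cts K (\<S> (p - q)) (%x. fst (g x))" "cts K rtop (%x. fst (snd (g x)))"
  "cts K (cotop rtop (\<S> (Suc p))) (%x. snd (snd (g x)))"
proof -
 have gU: "cts K (U_hom q p) g"
  using cts_of_kify[OF g[unfolded Delta_hom_def cg_subspace_def]]
  by (rule cts_full)
 have "cts K (\<S> (p - q)) (%x. fst (g x)) \<and> cts K (mpath_space (\<S> (Suc p))) (%x. snd (g x))"
 proof (cases "q <= p")
  case True
  have "cts K (ptop (\<S> (p - q)) (mpath_space (\<S> (p + 1)))) g"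
   using cts_of_kify[of K _ g] gU True unfolding U_hom_def cg_subspace_def
   by (simp) (metis (no_types, lifting) cts_full)
  thus ?thesis by (simp add: continuous_map_pairwise o_def)
 next
  case False
  have "pts K = {}"
  proof (rule equals0I)
   fix x assume "x : pts K"
   hence "g x : pts (U_hom q p)" using gU by (auto simp: cts_def Pi_iff)
   thus False using False by (simp add: U_hom_def)
  qed
  thus ?thesis by (simp add: continuous_map_on_empty)
 qed
 thus "cts K (\<S> (p - q)) (%x. fst (g x))" "cts K rtop (%x. fst (snd (g x)))"
  "cts K (cotop rtop (\<S> (Suc p))) (%x. snd (snd (g x)))"
  using mpath_continuous by blast+
qed

lemma Res_facts:
 assumes "r : pts (Res M act n p)"
 shows "Suc p <= n" "fst r : pts (M (n - Suc p))" "snd r : pts (mpath_space (M n))"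
  "snd (snd r) (fst (snd r)) = act (n - Suc p) (Suc p) (fst r) (spow (Suc p))"
proof -
 show p: "Suc p <= n" using assms by (auto simp: Res_def split: if_splits)
 thus "fst r : pts (M (n - Suc p))" "snd r : pts (mpath_space (M n))"
  "snd (snd r) (fst (snd r)) = act (n - Suc p) (Suc p) (fst r) (spow (Suc p))"
  using assms by (auto simp: Res_def topspace_kify_sub mend_def simp del: spow.simps)
qed

lemma continuous_Res:
 assumes g: "cts K (Res M act n p) g"
 shows "cts K (M (n - Suc p)) (%x. fst (g x))" "cts K rtop (%x. fst (snd (g x)))"
  "cts K (cotop rtop (M n)) (%x. snd (snd (g x)))"
proof -
 have "cts K (M (n - Suc p)) (%x. fst (g x)) \<and> cts K (mpath_space (M n)) (%x. snd (g x))"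
 proof (cases "Suc p <= n")
  case True
  have "cts K (ptop (M (n - (p + 1))) (mpath_space (M n))) g"
   using cts_of_kify[of K _ g] g True unfolding Res_def cg_subspace_def
   by (simp) (metis (no_types, lifting) cts_full)
  thus ?thesis by (simp add: continuous_map_pairwise o_def)
 next
  case False
  have "pts K = {}"
  proof (rule equals0I)
   fix x assume "x : pts K"
   hence "g x : pts (Res M act n p)" using g by (auto simp: cts_def Pi_iff)
   thus False using False by (simp add: Res_def)
  qed
  thus ?thesis by (simp add: continuous_map_on_empty)
 qed
 thus "cts K (M (n - Suc p)) (%x. fst (g x))" "cts K rtop (%x. fst (snd (g x)))"
  "cts K (cotop rtop (M n)) (%x. snd (snd (g x)))"
  using mpath_continuous by blast+
qed

abbreviation "barR M act n \<equiv> bar_space Delta_hom (Res M act n)"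

definition "relR M act n = realization_rel (barR M act n) (bar_face U_comp (Res_map act n))"

definition cls :: "(nat => 'a topology) => 'a action => nat => 'a rep => 'a rep set" where
 "cls M act n w = (relR M act n \<union> (relR M act n)\<inverse>)\<^sup>* `` {w}"

definition preR :: "(nat => 'a topology) => 'a action => nat => 'a rep topology" where
 "preR M act n = sum_topology (%k. cg_prod (barR M act n k) (Spx k)) UNIV"

lemma abs_Res_eq: "abs_Res M act n = quotient_topology (preR M act n) (cls M act n)"
 by (simp add: abs_Res_def hocolim_def realization_def preR_def cls_def[abs_def] relR_def)

lemma cls_self: "w : cls M act n w"
 by (simp add: cls_def)

lemma vrep_preR:
 assumes "w : pts (preR M act n)"
 shows "vrep M act n w"
proof -
 obtain k p a \<gamma> m t where w: "w = (k, (p, (a, \<gamma>), m), t)" by (metis prod.collapse)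
 have t: "t : spx k" and r: "(a, \<gamma>) : pts (Res M act n (p 0))"
  and m: "!!j. j < k ==> m j : pts (Delta_hom (p (Suc j)) (p j))"
  using assms by (auto simp: w preR_def bar_space_def)
 have "vm k p m" unfolding vm_def using umor_U_hom[OF subsetD[OF Delta_hom_subset m]] by blast
 thus ?thesis
  using t Res_facts[OF r] mpath_facts(1,3)[OF Res_facts(3)[OF r]] by (simp add: vrep_def w)
qed

definition rel_inv :: "(nat => 'a topology) => 'a action => nat => 'a rep => 'a rep => bool" where
 "rel_inv M act n v w \<longleftrightarrow> vrep M act n v \<and> vrep M act n w \<and> rV v = rV w \<and>
  (\<forall>C. C \<subseteq> rV v --> rM v (card C) = rM w (card C)) \<and>
  (\<forall>C F. C \<subseteq> rV v \<and> validF C F --> rG act n v C F = rG act n w C F) \<and>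
  (\<forall>u\<in>{0..1}. rH act n v u = rH act n w u)"

lemma rel_inv_refl: "vrep M act n v ==> rel_inv M act n v v"
 by (simp add: rel_inv_def)

lemma rel_inv_sym: "rel_inv M act n v w ==> rel_inv M act n w v"
 by (simp add: rel_inv_def)

lemma rel_inv_trans: "rel_inv M act n v w ==> rel_inv M act n w z ==> rel_inv M act n v z"
 by (simp add: rel_inv_def)

lemma relR_inv:
 assumes M: "rmod M act" and vw: "(v, w) : relR M act n"
 shows "rel_inv M act n v w"
proof -
 obtain k i x t where *: "v = (k, bar_face U_comp (Res_map act n) (Suc k) i x, t)" "w = (Suc k, x, sface i t)"
  "i <= Suc k" "x : pts (barR M act n (Suc k))" "t : spx k"
  using vw by (auto simp: relR_def realization_rel_def)
 have "sface i t : spx (Suc k)"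
  using simplical_face_in_standard_simplex[of "Suc k" i t] *(3,5) by simp
 hence "vrep M act n w" using *(4) by (intro vrep_preR) (simp add: *(2) preR_def)
 thus ?thesis
  using rV_face[OF M, of n k x i t] *(3,5) by (simp add: rel_inv_def *(1,2))
qed

lemma cls_inv:
 assumes M: "rmod M act" and v: "vrep M act n v" and w: "w : cls M act n v"
 shows "rel_inv M act n v w"
proof -
 have "(v, w) : (relR M act n \<union> (relR M act n)\<inverse>)\<^sup>*" using w by (simp add: cls_def)
 thus ?thesis
 proof (induction rule: rtrancl_induct)
  case base
  thus ?case using v by (rule rel_inv_refl)
 next
  case (step y z)
  hence "rel_inv M act n y z" using relR_inv[OF M] rel_inv_sym by blast
  thus ?case using step rel_inv_trans by blast
 qed
qed

definition zrep :: "'a rep set => 'a rep" where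
 "zrep z = (SOME w. w : z)"

lemma zrep_cls:
 assumes "rmod M act" "vrep M act n w"
 shows "rel_inv M act n (zrep (cls M act n w)) w"
proof -
 have "zrep (cls M act n w) : cls M act n w"
  unfolding zrep_def by (rule someI) (rule cls_self)
 from cls_inv[OF assms this] show ?thesis by (rule rel_inv_sym)
qed

lemma topspace_abs_Res: "pts (abs_Res M act n) = cls M act n ` pts (preR M act n)"
 by (simp add: abs_Res_eq)

text \<open>A continuous family of representatives with fixed simplicial degree and fixed objects.
  Local compactness of the parameter space makes \<open>cts_act\<close> available.\<close>

definition rdat :: "(nat => 'a topology) => 'a action => nat => 'x topology => nat => (nat => nat) =>
  ('x => 'a) => ('x => 'a mpath) => ('x => nat => conf \<times> conf mpath) => ('x => nat => real) => bool" where
 "rdat M act n K k p a \<gamma> m t \<longleftrightarrow> lcs K \<and> haus K \<and>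
  cts K (M (n - Suc (p 0))) a \<and> cts K rtop (%x. fst (\<gamma> x)) \<and>
  cts K (cotop rtop (M n)) (%x. snd (\<gamma> x)) \<and>
  (\<forall>j<k. cts K (\<S> (p j - p (Suc j))) (%x. fst (m x j)) \<and>
    cts K rtop (%x. fst (snd (m x j))) \<and>
    cts K (cotop rtop (\<S> (Suc (p j)))) (%x. snd (snd (m x j)))) \<and>
  (\<forall>i. cts K rtop (%x. t x i)) \<and>
  (\<forall>x\<in>pts K. vrep M act n (k, (p, (a x, \<gamma> x), m x), t x))"

lemma rdat_comp:
 assumes r: "rdat M act n K k p a \<gamma> m t" and g: "cts L K g"
  and L: "lcs L" "haus L"
 shows "rdat M act n L k p (%y. a (g y)) (%y. \<gamma> (g y)) (%y. m (g y)) (%y. t (g y))"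
proof -
 have gX: "g y : pts K" if "y : pts L" for y using g that by (auto simp: cts_def Pi_iff)
 show ?thesis
  using r L gX unfolding rdat_def
  by (elim conjE, intro conjI allI impI ballI) ((rule cts_compose[OF g, unfolded o_def], blast) | blast)+
qed

lemma sum_piece:
 assumes v: "cts K (sum_topology X I) v"
 shows "openin K {x : pts K. fst (v x) = i}"
  "cts (stop K {x : pts K. fst (v x) = i}) (X i) (%x. snd (v x))"
proof -
 have vI: "fst (v x) : I" "snd (v x) : pts (X (fst (v x)))" if "x : pts K" for x
  using v that by (auto simp: cts_def Pi_iff mem_Times_iff split: prod.splits)
 have o: "openin K {x : pts K. fst (v x) = i \<and> snd (v x) : U}" if U: "openin (X i) U" for U
 proof (cases "i : I")
  case True
  have "openin (sum_topology X I) ({i} \<times> U)"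
   unfolding openin_sum_topology using True openin_subset[OF U] U by (auto simp: Collect_conj_eq)
  from cts_preimage[OF v this]
  have "openin K {x : pts K. v x : {i} \<times> U}" .
  moreover have "{x : pts K. v x : {i} \<times> U} = {x : pts K. fst (v x) = i \<and> snd (v x) : U}"
   by (auto simp: mem_Times_iff)
  ultimately show ?thesis by simp
 next
  case False
  hence "{x : pts K. fst (v x) = i \<and> snd (v x) : U} = {}" using vI by auto
  thus ?thesis by (simp only: openin_empty)
 qed
 have "{x : pts K. fst (v x) = i \<and> snd (v x) : pts (X i)} = {x : pts K. fst (v x) = i}"
  using vI by auto
 thus 1: "openin K {x : pts K. fst (v x) = i}" using o[OF openin_topspace] by simp
 show "cts (stop K {x : pts K. fst (v x) = i}) (X i) (%x. snd (v x))"
 proof (rule cm_open_sub[OF 1])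
  show "snd (v z) : pts (X i)" if "z : {x : pts K. fst (v x) = i}" for z using that vI by auto
  show "openin K {z : {x : pts K. fst (v x) = i}. snd (v z) : U}" if "openin (X i) U" for U
   using o[OF that] by (simp add: conj_assoc)
 qed
qed

lemma test_rdat:
 assumes K: "compact_space K" "haus K"
  and u: "cts K (ptop (barR M act n k) (Spx k)) u"
 defines "Kp \<equiv> %p. {x : pts K. fst (fst (u x)) = p}"
 shows "openin K (Kp p)" "rdat M act n (stop K (Kp p)) k p (%x. fst (fst (snd (fst (u x)))))
  (%x. snd (fst (snd (fst (u x))))) (%x. snd (snd (fst (u x)))) (%x. snd (u x))"
proof -
 have u1: "cts K (barR M act n k) (%x. fst (u x))" and u2: "cts K (Spx k) (%x. snd (u x))"
  using u by (auto simp: continuous_map_pairwise o_def)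
 note sp = sum_piece[OF u1[unfolded bar_space_def], of p]
 show op: "openin K (Kp p)" using sp(1) by (simp add: Kp_def)
 let ?L = "stop K (Kp p)"
 have c: "cts ?L (cg_prod (Res M act n (p 0)) (product_topology (%j. Delta_hom (p (Suc j)) (p j)) {..<k})) (%x. snd (fst (u x)))"
  using sp(2) by (simp add: Kp_def)
 from cts_of_kify[OF this[unfolded cg_prod_def]]
 have cr: "cts ?L (Res M act n (p 0)) (%x. fst (snd (fst (u x))))"
  and cm: "cts ?L (product_topology (%j. Delta_hom (p (Suc j)) (p j)) {..<k}) (%x. snd (snd (fst (u x))))"
  by (auto simp: continuous_map_pairwise o_def)
 have cmj: "cts ?L (Delta_hom (p (Suc j)) (p j)) (%x. snd (snd (fst (u x))) j)" if "j < k" for j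
  using cm that by (auto simp: continuous_map_componentwise)
 have ct: "cts ?L rtop (%x. snd (u x) i)" for i
 proof -
  have "cts K rtop (%x. snd (u x) i)"
   using u2 by (auto simp: simplex_space_def continuous_map_in_subtopology continuous_map_componentwise_UNIV)
  thus ?thesis by (rule cts_sub)
 qed
 have val: "vrep M act n (k, (p, (fst (fst (snd (fst (u x)))), snd (fst (snd (fst (u x))))), snd (snd (fst (u x)))), snd (u x))"
  if "x : pts ?L" for x
 proof -
  have x: "x : pts K" "fst (fst (u x)) = p" using that by (auto simp: Kp_def)
  have "fst (u x) : pts (barR M act n k)" "snd (u x) : spx k"
   using u1 u2 x(1) by (auto simp: cts_def)
  hence "(k, fst (u x), snd (u x)) : pts (preR M act n)" by (simp add: preR_def mem_Times_iff)
  from vrep_preR[OF this] show ?thesis by (simp flip: x(2))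
 qed
 have "lcs ?L"
  using locally_compact_space_open_subset[of K "Kp p"] K op compact_imp_locally_compact_space by blast
 moreover have "haus ?L" using K(2) by (rule Hausdorff_space_subtopology)
 ultimately show "rdat M act n ?L k p (%x. fst (fst (snd (fst (u x)))))
  (%x. snd (fst (snd (fst (u x))))) (%x. snd (snd (fst (u x)))) (%x. snd (u x))"
  unfolding rdat_def using continuous_Res[OF cr] continuous_Delta_hom[OF cmj] ct val by blast
qed

type_synonym 'a tst = "(('a \<times> 'a mpath, conf \<times> conf mpath) bar \<times> (nat => real)) set set"

text \<open>All test maps into the levels of the bar construction. The disjoint union of their
  domains maps onto |R| by a quotient map, so continuity on |R| becomes a question about compact
  Hausdorff spaces and k-ified products disappear from view.\<close>

definition testI :: "(nat => 'a topology) => 'a action => nat =>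
  (nat \<times> 'a tst topology \<times> ('a tst => ('a \<times> 'a mpath, conf \<times> conf mpath) bar \<times> (nat => real))) set" where
 "testI M act n = {(k, K, u). compact_space K \<and> haus K \<and>
  cts K (ptop (barR M act n k) (Spx k)) u}"

abbreviation "testT M act n \<equiv> sum_topology (%i. fst (snd i)) (testI M act n)"

definition "testq M act n y = cls M act n (fst (fst y), snd (snd (fst y)) (snd y))"

lemma openin_abs_Res_iff:
 fixes M :: "nat => 'a topology"
 shows "openin (abs_Res M act n) U \<longleftrightarrow> U \<subseteq> pts (abs_Res M act n) \<and>
  (\<forall>k K u. (k, K, u) : testI M act n --> openin K {x : pts K. cls M act n (k, u x) : U})"
proof -
 have "openin (abs_Res M act n) U \<longleftrightarrow> U \<subseteq> pts (abs_Res M act n) \<and>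
   openin (preR M act n) {w : pts (preR M act n). cls M act n w : U}" if "U \<subseteq> pts (abs_Res M act n)"
  using that quotient_map_quotient_topology[of "preR M act n" "cls M act n"] unfolding abs_Res_eq quotient_map_def by blast
 moreover have "openin (preR M act n) {w : pts (preR M act n). cls M act n w : U} \<longleftrightarrow>
  (\<forall>k. openin (cg_prod (barR M act n k) (Spx k)) {x : pts (barR M act n k) \<times> spx k. cls M act n (k, x) : U})"
  unfolding preR_def openin_sum_topology by auto
 moreover have "openin (cg_prod (barR M act n k) (Spx k)) {x : pts (barR M act n k) \<times> spx k. cls M act n (k, x) : U} \<longleftrightarrow>
  (\<forall>K u. (k, K, u) : testI M act n --> openin K {x : pts K. cls M act n (k, u x) : U})" for k
 proof -
  have e: "{x : pts K. u x : pts (barR M act n k) \<times> spx k \<and> cls M act n (k, u x) : U} =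
    {x : pts K. cls M act n (k, u x) : U}"
   if "cts K (ptop (barR M act n k) (Spx k)) u" for K :: "'a tst topology" and u
   using that by (auto simp: cts_def Pi_iff)
  show ?thesis
   unfolding cg_prod_def openin_kify testI_def by (auto simp: e)
 qed
 ultimately show ?thesis using openin_subset[of "abs_Res M act n" U] by blast
qed

lemma quotient_map_testq: "quotient_map (testT M act n) (abs_Res M act n) (testq M act n)"
proof -
 have img: "testq M act n ` pts (testT M act n) = pts (abs_Res M act n)"
 proof (intro equalityI subsetI)
  fix z assume "z : testq M act n ` pts (testT M act n)"
  then obtain k K u x where "(k, K, u) : testI M act n" "x : pts K" "z = cls M act n (k, u x)"
   by (auto simp: testq_def)
  thus "z : pts (abs_Res M act n)"
   by (auto simp: topspace_abs_Res preR_def testI_def cts_def Pi_iff mem_Times_iff intro!: imageI)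
 next
  fix z assume "z : pts (abs_Res M act n)"
  then obtain k x where z: "z = cls M act n (k, x)" and x: "x : pts (ptop (barR M act n k) (Spx k))"
   by (auto simp: topspace_abs_Res preR_def)
  \<comment> \<open>Every point is hit by the constant map from a one-point space.\<close>
  have "(k, discrete_topology {{}}, %_. x) : testI M act n"
   using x by (simp add: testI_def compact_space_discrete_topology)
  hence "((k, discrete_topology {{}}, %_. x), {}) : pts (testT M act n)" by simp
  thus "z : testq M act n ` pts (testT M act n)"
   by (rule rev_image_eqI) (simp add: testq_def z)
 qed
 have "openin (testT M act n) {y : pts (testT M act n). testq M act n y : U} \<longleftrightarrow> openin (abs_Res M act n) U"
  if U: "U \<subseteq> pts (abs_Res M act n)" for U
 proof -
  have "openin (testT M act n) {y : pts (testT M act n). testq M act n y : U} \<longleftrightarrow>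
   (\<forall>i\<in>testI M act n. openin (fst (snd i)) {x : pts (fst (snd i)). testq M act n (i, x) : U})"
   unfolding openin_sum_topology by auto
  also have "\<dots> \<longleftrightarrow> (\<forall>k K u. (k, K, u) : testI M act n --> openin K {x : pts K. cls M act n (k, u x) : U})"
   by (auto simp: testq_def)
  finally show ?thesis using openin_abs_Res_iff[of M act n U] U by simp
 qed
 with img show ?thesis unfolding quotient_map_def by blast
qed

text \<open>The quotient map \<open>testq\<close> remains one after restriction to the open set
  \<open>W\<close> and after the product with the locally compact Hausdorff space \<open>L\<close>.
  On the domain of a test map the objects are locally constant, which leaves families as in
  \<open>rdat\<close>.\<close>

lemma cts_from_abs_Res:
 fixes M :: "nat => 'a topology" and g :: "'a rep set \<times> 'l => 'z"
 assumes W: "openin (abs_Res M act n) W" and L: "lcs L" "haus L"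
  and H: "!!(K :: 'a tst topology) k p a \<gamma> m t. rdat M act n K k p a \<gamma> m t ==>
   (!!x. x : pts K ==> cls M act n (k, (p, (a x, \<gamma> x), m x), t x) : W) ==>
   cts (ptop K L) Z (%y. g (cls M act n (k, (p, (a (fst y), \<gamma> (fst y)), m (fst y)), t (fst y)), snd y))"
 shows "cts (ptop (stop (abs_Res M act n) W) L) Z g"
proof -
 let ?T = "testT M act n" and ?q = "testq M act n"
 let ?W = "{y : pts ?T. ?q y : W}"
 have q: "quotient_map (stop ?T ?W) (stop (abs_Res M act n) W) ?q"
  by (rule quotient_map_restriction[OF quotient_map_testq]) (use W in auto)
 have Q: "quotient_map (ptop (stop ?T ?W) L) (ptop (stop (abs_Res M act n) W) L) (%(x, y). (?q x, y))"
  by (rule quotient_map_prod_left[OF L(1) _ q]) (use L(2) in simp)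
 have Wo: "openin ?T ?W" using quotient_imp_continuous_map[OF quotient_map_testq] W by (rule cts_preimage)
 have "cts (ptop (stop ?T ?W) L) Z (g \<circ> (%(x, y). (?q x, y)))"
 proof (rule cts_locally)
  fix y0 assume y0: "y0 : pts (ptop (stop ?T ?W) L)"
  obtain k K u x0 l0 where e0: "y0 = (((k, K, u), x0), l0)" by (metis prod.collapse)
  have i: "(k, K, u) : testI M act n" and x0: "x0 : pts K" and l0: "l0 : pts L" using y0 by (auto simp: e0)
  have K: "compact_space K" "haus K"
   and u: "cts K (ptop (barR M act n k) (Spx k)) u" using i by (auto simp: testI_def)
  define p where "p = fst (fst (u x0))"
  define K0 where "K0 = {x : pts K. fst (fst (u x)) = p} \<inter> {x. ((k, K, u), x) : ?W}"
  note tr = test_rdat[OF K u, of p]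
  have WK: "openin K {x. ((k, K, u), x) : ?W}"
   using Wo i unfolding openin_sum_topology by fastforce
  have oK: "openin K K0" unfolding K0_def by (intro openin_Int tr(1) WK)
  have lc: "lcs (stop K K0)" "haus (stop K K0)"
   using locally_compact_space_open_subset[of K K0] K oK compact_imp_locally_compact_space Hausdorff_space_subtopology by blast+
  have id: "cts (stop K K0) (stop K {x : pts K. fst (fst (u x)) = p}) (%x. x)"
   using openin_subset[OF oK] by (auto simp: continuous_map_in_subtopology K0_def intro: cts_sub)
  note r = rdat_comp[OF tr(2) id lc]
  have cl: "cls M act n (k, (p, (fst (fst (snd (fst (u x)))), snd (fst (snd (fst (u x))))), snd (snd (fst (u x)))), snd (u x)) = ?q ((k, K, u), x)"
   if "x : K0" for x
  proof -
   have "p = fst (fst (u x))" using that by (simp add: K0_def)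
   thus ?thesis by (simp add: testq_def)
  qed
  have KW: "?q ((k, K, u), x) : W" if "x : K0" for x using that by (simp add: K0_def)
  have c: "cts (ptop (stop K K0) L) Z (%y. g (?q ((k, K, u), fst y), snd y))"
   by (rule cts_eq[OF H[OF r]]) (simp_all add: cl[simplified] KW mem_Times_iff)
  let ?O = "(Pair (k, K, u) ` K0) \<times> pts L"
  have oP: "openin ?T (Pair (k, K, u) ` K0)"
   using open_map_component_injection[OF i, of "%i. fst (snd i)"] oK unfolding open_map_def by (metis fst_conv snd_conv)
  have sub: "Pair (k, K, u) ` K0 \<subseteq> ?W" by (auto simp: K0_def)
  have O: "openin (ptop (stop ?T ?W) L) ?O"
   unfolding openin_prod_Times_iff using oP sub by (auto simp: openin_subtopology intro!: exI[of _ "Pair (k, K, u) ` K0"])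
  have pr: "cts (stop (ptop (stop ?T ?W) L) ?O) (ptop (stop K K0) L) (%y. (snd (fst y), snd y))"
  proof (intro cts_pair)
   have 1: "cts (stop ?T (Pair (k, K, u) ` K0)) (stop K K0) snd"
   proof (rule cm_open_sub[OF oP])
    show "snd z : pts (stop K K0)" if "z : Pair (k, K, u) ` K0" for z
     using that by (auto simp: K0_def)
    fix U assume "openin (stop K K0) U"
    hence U: "openin K U" "U \<subseteq> K0" using oK by (auto simp: openin_open_subtopology)
    have "{z : Pair (k, K, u) ` K0. snd z : U} = Pair (k, K, u) ` U" using U(2) by auto
    moreover have "openin ?T (Pair (k, K, u) ` U)"
     using open_map_component_injection[OF i, of "%i. fst (snd i)"] U(1) unfolding open_map_def by (metis fst_conv snd_conv)
    ultimately show "openin ?T {z : Pair (k, K, u) ` K0. snd z : U}" by simp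
   qed
   have "cts (stop (ptop (stop ?T ?W) L) ?O) (stop ?T (Pair (k, K, u) ` K0)) fst"
    by (auto simp: continuous_map_in_subtopology intro!: cts_sub
      cts_full[OF cts_fst])
   from cts_compose[OF this 1]
   show "cts (stop (ptop (stop ?T ?W) L) ?O) (stop K K0) (%y. snd (fst y))"
    by (simp add: o_def)
   show "cts (stop (ptop (stop ?T ?W) L) ?O) L (%y. snd y)"
    by (rule cts_sub) (rule cts_snd)
  qed
  from cts_compose[OF pr c]
  have "cts (stop (ptop (stop ?T ?W) L) ?O) Z (g \<circ> (%(x, y). (?q x, y)))"
   by (rule cts_eq) auto
  moreover have "y0 : ?O" using y0 by (auto simp: e0 K0_def p_def)
  ultimately show "\<exists>U. openin (ptop (stop ?T ?W) L) U \<and> y0 : U \<and>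
    cts (stop (ptop (stop ?T ?W) L) U) Z (g \<circ> (%(x, y). (?q x, y)))"
   using O by (intro exI[of _ ?O] conjI)
 qed
 from continuous_compose_quotient_map[OF Q this] show ?thesis .
qed

section \<open>Continuity of the invariants\<close>

lemma cts_into_S_set:
 assumes t: "cts X rtop t"
  and e: "!!i. i < N ==> cts X euclidean (e i)"
  and S: "!!x. x : pts X ==> (t x, (%i. e i x) ` {..<N}) : confs N"
 shows "cts X (\<S> N) (%x. (t x, (%i. e i x) ` {..<N}))"
proof (cases "N = 0")
 case True
 have "cts X (\<S> N) (%x. sunit)" using True by (simp add: topspace_S confs_def)
 thus ?thesis
  by (rule cts_eq) (use S True in \<open>auto simp: confs_def\<close>)
next
 case False
 hence N: "0 < N" by simp
 show ?thesis
 proof (rule cts_into_S[OF N t e])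
  fix x assume x: "x : pts X"
  note c = confs_pos[OF S[OF x] N, unfolded fst_conv snd_conv]
  show "0 < t x" by (rule c(1))
  show "good (t x) (e i x)" if "i < N" for i using c(4) that by blast
  have "inj_on (%i. e i x) {..<N}" by (rule eq_card_imp_inj_on) (use c(3) in auto)
  thus "sep (e i x) (e j x)" if "i < N" "j < N" "i ~= j" for i j
   using that inj_onD[of "%i. e i x" "{..<N}" i j] by (intro c(5)) auto
 qed
qed

text \<open>Each concatenation is a case distinction whose two continuous branches agree where the
  paths meet.\<close>

lemma continuous_Om:
 assumes m: "!!j. j < k ==> cts K (\<S> (p j - p (Suc j))) (%x. fst (m x j))"
   "!!j. j < k ==> cts K rtop (%x. fst (snd (m x j)))"
   "!!j. j < k ==> cts K (cotop rtop (\<S> (Suc (p j)))) (%x. snd (snd (m x j)))"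
  and v: "!!x. x : pts K ==> vm k p (m x)"
  and r: "cts K rtop r"
 shows "cts K (\<S> (Suc (p 0))) (%x. snd (Om k p (m x)) (r x))"
 using assms
proof (induction k arbitrary: p m r)
 case 0
 thus ?case using spow_confs[of "Suc (p 0)"] by (simp add: topspace_S del: spow.simps)
next
 case (Suc k)
 let ?L = "%x. fst (snd (m x 0))"
 have u: "umor (p 1) (p 0) (m x 0)" if "x : pts K" for x using Suc(5)[OF that] by (simp add: vm_Suc)
 have L: "cts K rtop ?L" using Suc(3) by simp
 have 1: "cts K (\<S> (Suc (p 0))) (%x. snd (snd (m x 0)) (r x))"
  by (rule cts_eval[OF _ Suc(6)]) (use Suc(4) in simp)
 have 2: "cts K (\<S> (Suc (p 1))) (%x. snd (Om k (%j. p (Suc j)) (%j. m x (Suc j))) (r x - ?L x))"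
  using Suc(1)[of "%j. p (Suc j)" "%x j. m x (Suc j)" "%x. r x - ?L x"] Suc(2-5) continuous_map_diff[OF Suc(6) L]
  by (simp add: vm_Suc)
 have "cts K (\<S> (p 0 - p 1 + Suc (p 1))) (%x. smult (fst (m x 0)) (snd (Om k (%j. p (Suc j)) (%j. m x (Suc j))) (r x - ?L x)))"
  by (rule cts_smult[OF _ 2]) (use Suc(2) in simp)
 hence 3: "cts K (\<S> (Suc (p 0))) (%x. smult (fst (m x 0)) (snd (Om k (%j. p (Suc j)) (%j. m x (Suc j))) (r x - ?L x)))"
 proof (cases "pts K = {}")
  case False
  then obtain y where y: "y : pts K" by blast
  have "p 1 <= p 0" using u[OF y] by (simp add: umor_def)
  thus ?thesis using \<open>cts K (\<S> (p 0 - p 1 + Suc (p 1))) _\<close> by simp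
 qed (simp add: continuous_map_on_empty)
 have "cts K (\<S> (Suc (p 0))) (%x. if r x <= ?L x then snd (snd (m x 0)) (r x)
   else smult (fst (m x 0)) (snd (Om k (%j. p (Suc j)) (%j. m x (Suc j))) (r x - ?L x)))"
 proof (rule continuous_map_cases_le[OF Suc(6) L cts_sub[OF 1] cts_sub[OF 3]])
  fix x assume x: "x : pts K" and e: "r x = ?L x"
  have "vm k (%j. p (Suc j)) (%j. m x (Suc j))" using Suc(5)[OF x] by (simp add: vm_Suc)
  from Om_facts(4)[OF this, of 0] u[OF x]
  show "snd (snd (m x 0)) (r x) = smult (fst (m x 0)) (snd (Om k (%j. p (Suc j)) (%j. m x (Suc j))) (r x - ?L x))"
   by (simp add: e umor_def del: spow.simps)
 qed
 thus ?case by (simp add: mconcat_def mmap_def cong: if_cong)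
qed

lemma rdat_facts:
 assumes "rdat M act n K k p a \<gamma> m t"
 shows "lcs K" "haus K" "cts K (M (n - Suc (p 0))) a"
  "cts K rtop (%x. fst (\<gamma> x))" "cts K (cotop rtop (M n)) (%x. snd (\<gamma> x))"
  "!!j. j < k ==> cts K (\<S> (p j - p (Suc j))) (%x. fst (m x j))"
  "!!j. j < k ==> cts K rtop (%x. fst (snd (m x j)))"
  "!!j. j < k ==> cts K (cotop rtop (\<S> (Suc (p j)))) (%x. snd (snd (m x j)))"
  "!!i. cts K rtop (%x. t x i)"
  "!!x. x : pts K ==> vrep M act n (k, (p, (a x, \<gamma> x), m x), t x)"
 using assms unfolding rdat_def by blast+

lemma vrep_facts:
 assumes "vrep M act n (k, (p, (a, \<gamma>), m), t)"
 shows "vm k p m" "t : spx k" "Suc (p 0) <= n" "a : pts (M (n - Suc (p 0)))" "0 <= fst \<gamma>"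
  "!!r. snd \<gamma> r : pts (M n)" "snd \<gamma> (fst \<gamma>) = act (n - Suc (p 0)) (Suc (p 0)) a (spow (Suc (p 0)))"
 using assms by (auto simp: vrep_def)

lemma continuous_ct:
 assumes R: "rdat M act n K k p a \<gamma> m t"
 shows "cts K rtop (%x. ct k (m x) (t x))"
 unfolding ct_def tau_def
 by (intro continuous_map_sum continuous_map_real_mult continuous_map_real_min rdat_facts[OF R])
  (auto intro: rdat_facts[OF R])

lemma continuous_cc:
 assumes R: "rdat M act n K k p a \<gamma> m t"
 shows "cts K (\<S> (Suc (p 0))) (%x. cc k p (m x) (t x))"
 unfolding cc_def
 by (rule continuous_Om[of k K p m "%x. ct k (m x) (t x)"])
  (use rdat_facts(6-8)[OF R] vrep_facts(1)[OF rdat_facts(10)[OF R]] continuous_ct[OF R] in blast)+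

lemma continuous_conf_fst: "cts K (\<S> l) c ==> cts K rtop (%x. fst (c x))"
 using cts_compose[OF _ cts_S_fst] by (auto simp: o_def)

lemma continuous_mu:
 assumes R: "rdat M act n K k p a \<gamma> m t"
 shows "cts K rtop (%x. mu b k p (m x) (t x))"
proof -
 have w: "cts K rtop (%x. wsum b k p (t x))"
  unfolding wsum_def by (intro continuous_map_sum) (auto intro: rdat_facts(9)[OF R])
 have d: "cts K rtop (%x. dsum b k p (m x))"
  unfolding dsum_def by (intro continuous_map_sum) (auto intro: continuous_conf_fst[OF rdat_facts(6)[OF R]])
 show ?thesis
  unfolding mu_def
  by (intro continuous_map_real_mult continuous_map_real_max continuous_map_diff continuous_conf_fst[OF continuous_cc[OF R]] w d)
   simp_all
qed

text \<open>The squares have continuous local labels and the inequalities defining \<open>Vc\<close>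
  are strict, so a square in \<open>Vh\<close> stays there under small changes.\<close>

lemma openin_Vh_hit:
 assumes c: "cts K (\<S> l) c" and N: "open N"
 shows "openin K {x : pts K. Vh (c x) \<inter> N ~= {}}"
proof (subst openin_subopen, rule ballI)
 fix x0 assume x0: "x0 : {x : pts K. Vh (c x) \<inter> N ~= {}}"
 hence x0K: "x0 : pts K" by simp
 obtain O' e where O: "openin K O'" "x0 : O'" "!!i. i < l ==> cts (stop K O') euclidean (e i)"
  "!!x. x : O' ==> snd (c x) = (%i. e i x) ` {..<l}"
  using cts_into_confs[OF c x0K] by metis
 have OX: "O' \<subseteq> pts K" using openin_subset[OF O(1)] .
 have tO: "pts (stop K O') = O'" using OX by auto
 obtain v where v: "v : Vc (c x0)" "shift (- fst (c x0)) v : N" using x0 by (auto simp: Vh_def)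
 then obtain i where i: "i < l" "v = e i x0" using Vc_subset[of "c x0"] O(2,4) by blast
 have fc: "cts (stop K O') rtop (%x. fst (c x))"
  by (rule cts_sub[OF continuous_conf_fst[OF c]])
 let ?T = "O' \<inter> (\<Inter>j\<in>{..<l}. {x : O'. fst (fst (e j x)) - (fst (fst (e i x)) + fst (snd (e i x)) / 2) : {..<0}}) \<inter>
  {x : O'. shift (- fst (c x)) (e i x) : N}"
 have o1: "openin (stop K O') {x : O'. fst (fst (e j x)) - (fst (fst (e i x)) + fst (snd (e i x)) / 2) : {..<0}}" if "j < l" for j
 proof -
  have "cts (stop K O') rtop (%x. fst (fst (e j x)) - (fst (fst (e i x)) + fst (snd (e i x)) / 2))"
   using cm_comp[OF cm_pair[OF O(3)[OF that] O(3)[OF i(1)]], of "%(a, b). fst (fst a) - (fst (fst b) + fst (snd b) / 2)"]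
   by (simp add: case_prod_beta continuous_intros)
  from cts_preimage[OF this, of "{..<0}"] show ?thesis unfolding tO by simp
 qed
 have o2: "openin (stop K O') {x : O'. shift (- fst (c x)) (e i x) : N}"
 proof -
  have "cts (stop K O') euclidean (%x. shift (- fst (c x)) (e i x))"
   using cm_comp[OF cm_pair[OF fc O(3)[OF i(1)]], of "%(a, b). shift (- a) b"]
   by (simp add: shift_def case_prod_beta continuous_intros)
  from cts_preimage[OF this, of N] show ?thesis using N unfolding tO by simp
 qed
 have "openin (stop K O') ?T"
  using o1 o2 i(1) openin_topspace[of "stop K O'"] unfolding tO
  by (intro openin_Int) (auto intro!: openin_Inter simp: lessThan_empty_iff)
 hence "openin K ?T" using O(1) openin_trans_full by blast
 moreover have "x0 : ?T" using O(2,4) v i by (auto simp: Vc_def)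
 moreover have "?T \<subseteq> {x : pts K. Vh (c x) \<inter> N ~= {}}"
 proof
  fix x assume x: "x : ?T"
  hence "e i x : Vc (c x)" using O(4)[of x] i(1) by (auto simp: Vc_def)
  hence "shift (- fst (c x)) (e i x) : Vh (c x) \<inter> N" using x by (auto simp: Vh_def)
  thus "x : {x : pts K. Vh (c x) \<inter> N ~= {}}" using x OX by blast
 qed
 ultimately show "\<exists>T. openin K T \<and> x0 : T \<and> T \<subseteq> {x : pts K. Vh (c x) \<inter> N ~= {}}"
  by (intro exI[of _ ?T] conjI)
qed

text \<open>Near \<open>x0\<close> the i-th square of the column, shifted into the strip, coincides
  with one fixed labelled square \<open>j i\<close>, because both stay in the same set
  \<open>near\<close>. Removing the column is therefore removing a constant set of labels.\<close>

lemma continuous_Gs: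
 assumes c: "cts X (\<S> l) c" and l: "0 < l"
  and C: "!!i. i < b ==> cts X euclidean (%x. C x ! i)"
  and CV: "!!x. x : pts X ==> length (C x) = b \<and> distinct (C x) \<and> set (C x) \<subseteq> Vh (c x)"
  and r: "!!i. i < b ==> cts X rtop (r i)"
  and I: "I \<subseteq> {..<b}"
  and \<mu>: "cts X rtop \<mu>"
  and S: "!!x. x : pts X ==> Gs (c x) (\<mu> x) (set (C x)) ((%i. (C x ! i, r i x)) ` I) : confs (l - b + card I)"
 shows "cts X (\<S> (l - b + card I)) (%x. Gs (c x) (\<mu> x) (set (C x)) ((%i. (C x ! i, r i x)) ` I))"
proof (rule cts_locally)
 fix x0 assume x0: "x0 : pts X"
 have finI: "finite I" using I finite_subset by blast
 have cX: "c x : pts (\<S> l)" if "x : pts X" for x using c that by (auto simp: cts_def)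
 obtain O' e where O: "openin X O'" "x0 : O'" "!!i. i < l ==> cts (stop X O') euclidean (e i)"
  "!!x. x : O' ==> snd (c x) = (%i. e i x) ` {..<l}" "!!x. x : O' ==> inj_on (%i. e i x) {..<l}"
  using cts_into_confs[OF c x0] by metis
 have OX: "O' \<subseteq> pts X" using openin_subset[OF O(1)] .
 have tO: "pts (stop X O') = O'" using OX by auto
 let ?f = "%i x. shift (fst (c x)) (C x ! i)"
 have fin: "?f i x : snd (c x)" if "i < b" "x : pts X" for i x
 proof -
  have "C x ! i : set (C x)" using that CV by simp
  thus ?thesis using Vh_shift[of "set (C x)" "c x"] CV[OF that(2)] Vc_subset[of "c x"] by blast
 qed
 have fc: "cts (stop X O') rtop (%x. fst (c x))"
  by (rule cts_sub[OF continuous_conf_fst[OF c]])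
 have fcont: "cts (stop X O') euclidean (?f i)" if "i < b" for i
  using cm_comp[OF cm_pair[OF fc cts_sub[OF C[OF that]]], of "%(a, b). shift a b"]
  by (simp add: shift_def case_prod_beta continuous_intros)
 have "\<exists>j<l. ?f i x0 = e j x0" if "i < b" for i
  using fin[OF that x0] O(2,4) by auto
 then obtain j where j: "!!i. i < b ==> j i < l \<and> ?f i x0 = e (j i) x0" by metis
 have jin: "inj_on j {..<b}"
 proof (rule inj_onI)
  fix i i' assume "i : {..<b}" "i' : {..<b}" "j i = j i'"
  hence "?f i x0 = ?f i' x0" "i < b" "i' < b" using j by auto
  hence "C x0 ! i = C x0 ! i'" using injD[OF inj_shift] by blast
  thus "i = i'" using CV[OF x0] \<open>i < b\<close> \<open>i' < b\<close> by (simp add: nth_eq_iff_index_eq)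
 qed
 define T where "T = O' \<inter> {x : O'. \<forall>i<b. ?f i x : near (?f i x0) \<and> e (j i) x : near (?f i x0)}"
 have oT: "openin X T"
 proof -
  have 1: "openin (stop X O') {x : O'. h x : near v}" if "cts (stop X O') euclidean h" for h and v
   using cts_preimage[OF that, of "near v"] open_near[of v] unfolding tO by simp
  have "T = O' \<inter> (\<Inter>i\<in>{..<b}. {x : O'. ?f i x : near (?f i x0)} \<inter> {x : O'. e (j i) x : near (?f i x0)})"
   by (auto simp: T_def)
  moreover have "openin (stop X O') (O' \<inter> (\<Inter>i\<in>{..<b}. {x : O'. ?f i x : near (?f i x0)} \<inter> {x : O'. e (j i) x : near (?f i x0)}))"
  proof (cases "b = 0")
   case True
   thus ?thesis using openin_topspace[of "stop X O'"] unfolding tO by simp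
  next
   case False
   show ?thesis
   proof (intro openin_Int openin_Inter)
    show "openin (stop X O') O'" using openin_topspace[of "stop X O'"] unfolding tO by simp
    show "openin (stop X O') A" if "A : (%i. {x : O'. ?f i x : near (?f i x0)} \<inter> {x : O'. e (j i) x : near (?f i x0)}) ` {..<b}" for A
    proof -
     from that obtain i where i: "A = {x : O'. ?f i x : near (?f i x0)} \<inter> {x : O'. e (j i) x : near (?f i x0)}" "i : {..<b}"
      by (rule imageE)
     hence b: "i < b" by simp
     show ?thesis unfolding i(1) by (intro openin_Int 1 fcont[OF b] O(3)) (use j b in blast)
    qed
   qed (use False in auto)
  qed
  ultimately have "openin (stop X O') T" by simp
  thus ?thesis using O(1) openin_trans_full by blast
 qed
 have x0T: "x0 : T"
  unfolding T_def using O(2) j near_self[OF confs_facts(4)[OF cX[OF x0, unfolded topspace_S] fin[OF _ x0]]] by auto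
 have TO: "T \<subseteq> O'" and TX: "T \<subseteq> pts X" using OX by (auto simp: T_def)
 have fe: "?f i x = e (j i) x" if "x : T" "i < b" for i x
 proof (rule conf_near_unique)
  show "c x : pts (\<S> l)" using that TX cX by blast
  show "?f i x : snd (c x)" using fin that TX by blast
  show "e (j i) x : snd (c x)" using O(4)[of x] that TO j by blast
  show "?f i x : near (?f i x0)" "e (j i) x : near (?f i x0)" using that by (auto simp: T_def)
 qed
 define J where "J = {..<l} - j ` {..<b}"
 have jl: "j ` {..<b} \<subseteq> {..<l}" using j by auto
 have cJ: "card J = l - b" using jl jin by (simp add: J_def card_Diff_subset card_image)
 obtain h where h: "bij_betw h {..<l - b} J"
  using cJ by (metis J_def atLeast0LessThan ex_bij_betw_nat_finite finite_Diff finite_lessThan)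
 obtain g where g: "bij_betw g {..<card I} I" using finI by (metis ex_bij_betw_nat_finite atLeast0LessThan)
 have diff: "snd (c x) - shift (fst (c x)) ` set (C x) = (%i. e (h i) x) ` {..<l - b}" if x: "x : T" for x
 proof -
  have "set (C x) = (!) (C x) ` {..<b}" using CV[of x] x TX by (auto simp: set_conv_nth)
  hence "shift (fst (c x)) ` set (C x) = (%i. e (j i) x) ` {..<b}"
   using fe[OF x] by (simp add: image_image)
  moreover have "snd (c x) = (%i. e i x) ` {..<l}" using O(4) x TO by blast
  ultimately have "snd (c x) - shift (fst (c x)) ` set (C x) = (%i. e i x) ` {..<l} - (%i. e i x) ` j ` {..<b}"
   by (simp add: image_image)
  also have "\<dots> = (%i. e i x) ` J"
   unfolding J_def using inj_on_image_set_diff[OF O(5)[of x], of "{..<l}" "j ` {..<b}"] jl x TO by auto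
  also have "\<dots> = (%i. e (h i) x) ` {..<l - b}" using h by (auto simp: bij_betw_def simp flip: image_image[of "%i. e i x" h])
  finally show ?thesis .
 qed
 let ?F = "%x. (%i. (C x ! i, r i x)) ` I"
 define e' where "e' = (%i x. if i < l - b then e (h i) x else mv (fst (c x)) (C x ! g (i - (l - b)), r (g (i - (l - b))) x))"
 define t' where "t' = (%x. if I = {} then fst (c x) - \<mu> x else fst (c x) + mx (?F x))"
 have Ge: "Gs (c x) (\<mu> x) (set (C x)) (?F x) = (t' x, (%i. e' i x) ` {..<l - b + card I})" if x: "x : T" for x
 proof -
  have "(%i. e' i x) ` {..<l - b + card I} = (%i. e (h i) x) ` {..<l - b} \<union> (%i. mv (fst (c x)) (C x ! g i, r (g i) x)) ` {..<card I}"
   unfolding lessThan_add_split image_Un image_image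
   by (intro arg_cong2[where f = "(\<union>)"] image_cong) (simp_all add: e'_def)
  moreover have "mv (fst (c x)) ` ?F x = (%i. mv (fst (c x)) (C x ! g i, r (g i) x)) ` {..<card I}"
  proof -
   have "I = g ` {..<card I}" using g by (simp add: bij_betw_def)
   hence "?F x = (%i. (C x ! i, r i x)) ` g ` {..<card I}" by simp
   thus ?thesis by (simp only: image_image)
  qed
  ultimately show ?thesis
   using diff[OF x] by (auto simp: Gs_def t'_def)
 qed
 have "cts (stop X T) (\<S> (l - b + card I)) (%x. (t' x, (%i. e' i x) ` {..<l - b + card I}))"
 proof (rule cts_into_S_set)
  have cT: "cts (stop X T) rtop (%x. fst (c x))"
   by (rule cts_sub[OF continuous_conf_fst[OF c]])
  show "cts (stop X T) rtop t'"
  proof (cases "I = {}")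
   case True
   thus ?thesis unfolding t'_def
    by (simp add: continuous_map_diff[OF cT cts_sub[OF \<mu>]])
  next
   case False
   have "cts (stop X T) rtop (%x. mx (?F x))"
    by (rule cts_mx[OF finI]) (use I r in \<open>auto intro: cts_sub\<close>)
   thus ?thesis unfolding t'_def using False cT by (simp add: continuous_map_add)
  qed
  show "cts (stop X T) euclidean (e' i)" if i: "i < l - b + card I" for i
  proof (cases "i < l - b")
   case True
   hence "h i < l" using h by (auto simp: bij_betw_def J_def)
   thus ?thesis
    using True continuous_map_from_subtopology_mono[OF O(3) TO] by (simp add: e'_def[abs_def])
  next
   case False
   let ?i = "g (i - (l - b))"
   have "?i : I" using g False i by (auto simp: bij_betw_def)
   hence ib: "?i < b" using I by auto
   have "cts (stop X T) euclidean (%x. mv (fst (c x)) (C x ! ?i, r ?i x))"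
    using cm_comp[OF cm_pair[OF cm_pair[OF cT cts_sub[OF r[OF ib]]] cts_sub[OF C[OF ib]]],
      of "%((a, b), e). shift (b + a) e"]
    by (simp add: mv_def shift_def case_prod_beta continuous_intros)
   thus ?thesis using False by (simp add: e'_def[abs_def])
  qed
  show "(t' x, (%i. e' i x) ` {..<l - b + card I}) : confs (l - b + card I)" if "x : pts (stop X T)" for x
   using that S[of x] Ge[of x] by auto
 qed
 hence "cts (stop X T) (\<S> (l - b + card I)) (%x. Gs (c x) (\<mu> x) (set (C x)) (?F x))"
  by (rule cts_eq) (use Ge in auto)
 thus "\<exists>U. openin X U \<and> x0 : U \<and> cts (stop X U) (\<S> (l - b + card I)) (%x. Gs (c x) (\<mu> x) (set (C x)) (?F x))"
  using oT x0T by (intro exI[of _ T] conjI)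
qed

lemma validF_index_distinct:
 assumes "distinct C" "I \<subseteq> {..<length C}" "!!i. i : I ==> 0 <= \<rho> i"
 shows "validF (set C) ((%i. (C ! i, \<rho> i)) ` I)" "card ((%i. (C ! i, \<rho> i)) ` I) = card I"
proof -
 have "inj_on ((!) C) {..<length C}" using assms(1) by (simp add: inj_on_nth)
 hence i1: "inj_on ((!) C) I" using assms(2) inj_on_subset by blast
 hence i2: "inj_on (%i. (C ! i, \<rho> i)) I" by (auto simp: inj_on_def)
 thus "card ((%i. (C ! i, \<rho> i)) ` I) = card I" by (rule card_image)
 have "inj_on fst ((%i. (C ! i, \<rho> i)) ` I)"
  using i1 by (auto simp: inj_on_def)
 moreover have "finite I" using assms(2) finite_subset by blast
 ultimately show "validF (set C) ((%i. (C ! i, \<rho> i)) ` I)"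
  using assms(2,3) by (auto simp: validF_def)
qed

lemma continuous_rG:
 assumes M: "rmod M act" and R: "rdat M act n K k p a \<gamma> m t"
  and C: "!!i. i < b ==> cts K euclidean (%x. C x ! i)"
  and CV: "!!x. x : pts K ==> length (C x) = b \<and> distinct (C x) \<and> set (C x) \<subseteq> Vh (cc k p (m x) (t x))"
  and r: "!!i. i < b ==> cts K rtop (r i)" "!!i x. i < b ==> x : pts K ==> 0 <= r i x"
  and I: "I \<subseteq> {..<b}"
 shows "cts K (M (n - b + card I)) (%x. rG act n (k, (p, (a x, \<gamma> x), m x), t x) (set (C x)) ((%i. (C x ! i, r i x)) ` I))"
proof (cases "pts K = {}")
 case False
 then obtain y where y: "y : pts K" by blast
 note v = vrep_facts[OF rdat_facts(10)[OF R]]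
 let ?F = "%x. (%i. (C x ! i, r i x)) ` I"
 let ?l = "Suc (p 0)"
 let ?w = "%x. (k, (p, (a x, \<gamma> x), m x), t x)"
 have F: "validF (set (C x)) (?F x)" "card (?F x) = card I" if x: "x : pts K" for x
  using validF_index_distinct[of "C x" I "%i. r i x"] CV[OF x] I r(2)[OF _ x] by auto
 have cb: "card (set (C x)) = b" if "x : pts K" for x using CV[OF that] distinct_card by blast
 have S: "rS (?w x) (set (C x)) (?F x) : confs (?l - b + card I)" if x: "x : pts K" for x
  using rS_confs[OF rdat_facts(10)[OF R x] _ F(1)[OF x]] CV[OF x] F(2)[OF x] cb[OF x] by (simp add: rV_def)
 have Se: "rS (?w x) (set (C x)) (?F x) = Gs (cc k p (m x) (t x)) (mu b k p (m x) (t x)) (set (C x)) (?F x)"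
  if "x : pts K" for x by (simp add: rS_def cb[OF that])
 have bl: "b <= ?l"
  using card_Vh_le(1)[OF cc_confs[OF v(1)[OF y]]] CV[OF y] cb[OF y] by metis
 have "cts K (\<S> (?l - b + card I)) (%x. Gs (cc k p (m x) (t x)) (mu b k p (m x) (t x)) (set (C x)) (?F x))"
  by (rule continuous_Gs[OF continuous_cc[OF R] _ C CV r(1) I continuous_mu[OF R]]) (use S Se in auto)
 from cts_act[OF M rdat_facts(1,2,3)[OF R] this]
 have "cts K (M (n - b + card I)) (%x. act (n - ?l) (?l - b + card I) (a x)
   (Gs (cc k p (m x) (t x)) (mu b k p (m x) (t x)) (set (C x)) (?F x)))"
  using bl v(3)[OF y] by (simp add: algebra_simps)
 thus ?thesis
 proof (rule cts_eq)
  fix x assume x: "x : pts K"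
  show "act (n - ?l) (?l - b + card I) (a x) (Gs (cc k p (m x) (t x)) (mu b k p (m x) (t x)) (set (C x)) (?F x)) =
   rG act n (?w x) (set (C x)) (?F x)"
   using confs_facts(3)[OF S[OF x]] by (simp add: rG_def Se[OF x])
 qed
qed (simp add: continuous_map_on_empty)

lemma continuous_rH:
 assumes M: "rmod M act" and R: "rdat M act n K k p a \<gamma> m t" and u: "cts K rtop u"
 shows "cts K (M n) (%x. rH act n (k, (p, (a x, \<gamma> x), m x), t x) (u x))"
proof (cases "pts K = {}")
 case False
 then obtain y where y: "y : pts K" by blast
 note v = vrep_facts[OF rdat_facts(10)[OF R]]
 let ?r = "%x. u x * (fst (\<gamma> x) + ct k (m x) (t x))"
 let ?l = "Suc (p 0)"
 note L = rdat_facts(4)[OF R]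
 have r: "cts K rtop ?r"
  by (intro continuous_map_real_mult continuous_map_add u L continuous_ct[OF R])
 have 1: "cts K (M n) (%x. snd (\<gamma> x) (?r x))"
  by (rule cts_eval[OF rdat_facts(5)[OF R] r])
 have "cts K (\<S> ?l) (%x. snd (Om k p (m x)) (?r x - fst (\<gamma> x)))"
  by (rule continuous_Om[of k K p m "%x. ?r x - fst (\<gamma> x)"])
   (use rdat_facts(6-8)[OF R] v(1) continuous_map_diff[OF r L] in blast)+
 from cts_act[OF M rdat_facts(1,2,3)[OF R] this]
 have 2: "cts K (M n) (%x. act (n - ?l) ?l (a x) (snd (Om k p (m x)) (?r x - fst (\<gamma> x))))"
  using v(3)[OF y] by simp
 have "cts K (M n) (%x. if ?r x <= fst (\<gamma> x) then snd (\<gamma> x) (?r x)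
   else act (n - ?l) ?l (a x) (snd (Om k p (m x)) (?r x - fst (\<gamma> x))))"
 proof (rule continuous_map_cases_le[OF r L cts_sub[OF 1] cts_sub[OF 2]])
  fix x assume x: "x : pts K" and e: "?r x = fst (\<gamma> x)"
  show "snd (\<gamma> x) (?r x) = act (n - ?l) ?l (a x) (snd (Om k p (m x)) (?r x - fst (\<gamma> x)))"
   using v(7)[OF x] Om_facts(4)[OF v(1)[OF x], of 0] by (simp add: e del: spow.simps)
 qed
 thus ?thesis by (simp add: rH_def mconcat_def mmap_def cong: if_cong)
qed (simp add: continuous_map_on_empty)


section \<open>Functions on the resolution\<close>

definition zV :: "'a rep set => square set" where "zV z = rV (zrep z)"
definition zM :: "'a rep set => nat => real" where "zM z b = rM (zrep z) b"
definition zG :: "'a action => nat => 'a rep set => square set => (square \<times> real) set => 'a" where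
 "zG act n z C F = rG act n (zrep z) C F"
definition zH :: "'a action => nat => 'a rep set => real => 'a" where "zH act n z u = rH act n (zrep z) u"

lemma z_cls:
 assumes M: "rmod M act" and w: "vrep M act n w"
 shows "zV (cls M act n w) = rV w" "C \<subseteq> rV w ==> zM (cls M act n w) (card C) = rM w (card C)"
  "C \<subseteq> rV w ==> validF C F ==> zG act n (cls M act n w) C F = rG act n w C F"
  "u : {0..1} ==> zH act n (cls M act n w) u = rH act n w u"
 using zrep_cls[OF M w] by (simp_all add: rel_inv_def zV_def zM_def zG_def zH_def)

lemma zrep_vrep:
 assumes M: "rmod M act" and z: "z : pts (abs_Res M act n)"
 shows "vrep M act n (zrep z)"
proof -
 obtain w where "w : pts (preR M act n)" "z = cls M act n w" using z by (auto simp: topspace_abs_Res)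
 thus ?thesis using zrep_cls[OF M vrep_preR] by (simp add: rel_inv_def)
qed

lemma openin_zV_hit:
 fixes M :: "nat => 'a topology"
 assumes M: "rmod M act" and N: "open N"
 shows "openin (abs_Res M act n) {z : pts (abs_Res M act n). zV z \<inter> N ~= {}}"
proof -
 show ?thesis
  unfolding openin_abs_Res_iff
 proof (intro conjI allI impI)
  show "{z : pts (abs_Res M act n). zV z \<inter> N ~= {}} \<subseteq> pts (abs_Res M act n)" by blast
  fix k and K :: "'a tst topology" and u assume i: "(k, K, u) : testI M act n"
  hence K: "compact_space K" "haus K"
   and u: "cts K (ptop (barR M act n k) (Spx k)) u" by (auto simp: testI_def)
  have pre: "(k, u x) : pts (preR M act n)" if "x : pts K" for x
   using u that by (auto simp: preR_def cts_def Pi_iff mem_Times_iff)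
  have ca: "cls M act n (k, u x) : pts (abs_Res M act n)" if "x : pts K" for x
   using pre[OF that] by (auto simp: topspace_abs_Res)
  have e: "{x : pts K. cls M act n (k, u x) : {z : pts (abs_Res M act n). zV z \<inter> N ~= {}}} =
    {x : pts K. rV (k, u x) \<inter> N ~= {}}"
   using ca z_cls(1)[OF M vrep_preR[OF pre]] by auto
  show "openin K {x : pts K. cls M act n (k, u x) : {z : pts (abs_Res M act n). zV z \<inter> N ~= {}}}"
   unfolding e
  proof (subst openin_subopen, rule ballI)
   fix x0 assume x0: "x0 : {x : pts K. rV (k, u x) \<inter> N ~= {}}"
   let ?p = "fst (fst (u x0))"
   let ?K = "{x : pts K. fst (fst (u x)) = ?p}"
   note tr = test_rdat[OF K u, of ?p]
   have o: "openin (stop K ?K) {x : pts (stop K ?K). Vh (cc k ?p (snd (snd (fst (u x)))) (snd (u x))) \<inter> N ~= {}}"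
    by (rule openin_Vh_hit[OF continuous_cc[OF tr(2)] N])
   have "{x : pts (stop K ?K). Vh (cc k ?p (snd (snd (fst (u x)))) (snd (u x))) \<inter> N ~= {}} = {x : ?K. rV (k, u x) \<inter> N ~= {}}"
    by (auto simp: rV_def case_prod_beta)
   hence "openin K {x : ?K. rV (k, u x) \<inter> N ~= {}}" using openin_trans_full[OF o tr(1)] by (simp only:)
   moreover have "x0 : {x : ?K. rV (k, u x) \<inter> N ~= {}}" using x0 by simp
   moreover have "{x : ?K. rV (k, u x) \<inter> N ~= {}} \<subseteq> {x : pts K. rV (k, u x) \<inter> N ~= {}}" by blast
   ultimately show "\<exists>T. openin K T \<and> x0 : T \<and> T \<subseteq> {x : pts K. rV (k, u x) \<inter> N ~= {}}"
    by (intro exI[of _ "{x : ?K. rV (k, u x) \<inter> N ~= {}}"] conjI)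
  qed
 qed
qed

lemma zV_facts:
 assumes M: "rmod M act" and z: "z : pts (abs_Res M act n)"
 shows "!!e. e : zV z ==> rgood e" "!!e e'. e : zV z ==> e' : zV z ==> e ~= e' ==> ysep e e'" "finite (zV z)"
  "!!C. C \<subseteq> zV z ==> card C <= n"
proof -
 obtain k p a \<gamma> m t where w: "zrep z = (k, (p, (a, \<gamma>), m), t)" by (metis prod.collapse)
 note v = vrep_facts[OF zrep_vrep[OF M z, unfolded w]]
 have V: "zV z = Vh (cc k p m t)" by (simp add: zV_def w rV_def)
 note c = cc_confs[OF v(1), of t]
 show "!!e. e : zV z ==> rgood e" using Vh_rgood[OF c] V by simp
 show "!!e e'. e : zV z ==> e' : zV z ==> e ~= e' ==> ysep e e'" using Vh_ysep[OF c] V by simp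
 show "finite (zV z)" using card_Vh_le(2)[OF c order_refl] V by simp
 show "card C <= n" if "C \<subseteq> zV z" for C using card_Vh_le(1)[OF c, of C] that V v(3) by simp
qed

lemma zV_near_unique:
 assumes "rmod M act" "z : pts (abs_Res M act n)" "e : zV z" "e' : zV z" "e : near a" "e' : near a"
 shows "e = e'"
 using zV_facts(2)[OF assms(1-4)] near_not_sep[OF assms(5,6)] unfolding sep_def by blast

lemma continuous_zH:
 fixes M :: "nat => 'a topology"
 assumes M: "rmod M act"
 shows "cts (ptop (abs_Res M act n) (top_of_set {0..1})) (M n) (%y. zH act n (fst y) (snd y))"
proof -
 have lc: "lcs (top_of_set {0..1::real})" "haus (top_of_set {0..1::real})"
  using compact_Hausdorff_interval[of "{0..1}"] compact_imp_locally_compact_space by auto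
 have "cts (ptop (stop (abs_Res M act n) (pts (abs_Res M act n))) (top_of_set {0..1})) (M n)
   (%y. zH act n (fst y) (snd y))"
 proof (rule cts_from_abs_Res[OF openin_topspace lc])
  fix K :: "'a tst topology" and k p a \<gamma> m t assume R: "rdat M act n K k p a \<gamma> m t"
  let ?P = "ptop K (top_of_set {0..1::real})"
  have "rdat M act n ?P k p (%y. a (fst y)) (%y. \<gamma> (fst y)) (%y. m (fst y)) (%y. t (fst y))"
   by (rule rdat_comp[OF R cts_fst])
    (use rdat_facts(1,2)[OF R] lc in \<open>auto simp: locally_compact_space_prod_topology Hausdorff_space_prod_topology\<close>)
  from continuous_rH[OF M this cts_full[OF cts_snd]]
  have "cts ?P (M n) (%y. rH act n (k, (p, (a (fst y), \<gamma> (fst y)), m (fst y)), t (fst y)) (snd y))" .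
  hence "cts ?P (M n) (%y. zH act n (cls M act n (k, (p, (a (fst y), \<gamma> (fst y)), m (fst y)), t (fst y))) (snd y))"
   by (rule cts_eq) (use z_cls(4)[OF M rdat_facts(10)[OF R]] in auto)
  thus "cts ?P (M n) (%y. zH act n (fst (cls M act n (k, (p, (a (fst y), \<gamma> (fst y)), m (fst y)), t (fst y)), snd y))
    (snd (cls M act n (k, (p, (a (fst y), \<gamma> (fst y)), m (fst y)), t (fst y)), snd y)))" by (simp only: fst_conv snd_conv)
 qed
 thus ?thesis by simp
qed

lemma zH_ends:
 assumes M: "rmod M act" and z: "z : pts (abs_Res M act n)"
 shows "zH act n z 0 = \<epsilon> z" "zH act n z 1 = zG act n z {} {}"
proof -
 obtain w where w: "w : pts (preR M act n)" "z = cls M act n w" using z by (auto simp: topspace_abs_Res)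
 have wv: "vrep M act n w" by (rule vrep_preR[OF w(1)])
 obtain k p a \<gamma> m t where w': "w = (k, (p, (a, \<gamma>), m), t)" by (metis prod.collapse)
 note v = vrep_facts[OF wv[unfolded w']]
 have "zH act n z 0 = rH act n w 0" using z_cls(4)[OF M wv] by (simp add: w(2))
 also have "\<dots> = mstart \<gamma>" using v(5) by (simp add: w' rH_def mconcat_def mstart_def)
 also have "\<dots> = \<epsilon> z" using \<epsilon>_eq[OF z, of k p a \<gamma> m t] cls_self[of w M act n] w(2) w' by simp
 finally show "zH act n z 0 = \<epsilon> z" .
 have ct0: "0 <= ct k m t" using ct_nonneg[OF v(1)] simplex_facts(1)[OF v(2)] by simp
 have c: "cc k p m t : confs (Suc (p 0))" by (rule cc_confs[OF v(1)])
 have "wsum 0 k p t = 0" by (simp add: wsum_def)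
 hence mu0: "mu 0 k p m t = 0" by (simp add: mu_def)
 have "zH act n z 1 = rH act n w 1" using z_cls(4)[OF M wv] by (simp add: w(2))
 also have "\<dots> = act (n - Suc (p 0)) (Suc (p 0)) a (cc k p m t)"
 proof (cases "ct k m t = 0")
  case True
  thus ?thesis using v(7) Om_facts(4)[OF v(1), of 0] by (simp add: w' rH_def mconcat_def cc_def del: spow.simps)
 next
  case False
  thus ?thesis using ct0 by (simp add: w' rH_def mconcat_def cc_def mmap_def)
 qed
 also have "\<dots> = rG act n w {} {}"
  using confs_facts(3)[OF c] by (simp add: w' rG_def rS_def Gs_def mu0)
 also have "\<dots> = zG act n z {} {}" using z_cls(3)[OF M wv, of "{}" "{}"] by (simp add: w(2) validF_def)
 finally show "zH act n z 1 = zG act n z {} {}" .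
qed

lemma continuous_\<epsilon>:
 assumes M: "rmod M act"
 shows "cts (abs_Res M act n) (M n) \<epsilon>"
proof -
 have "cts (abs_Res M act n) (ptop (abs_Res M act n) (top_of_set {0..1::real})) (%z. (z, 0))"
  by (intro cts_pair) auto
 from cts_compose[OF this continuous_zH[OF M]]
 have "cts (abs_Res M act n) (M n) (%z. zH act n z 0)" by (simp add: o_def)
 thus ?thesis by (rule cts_eq) (use zH_ends(1)[OF M] in auto)
qed

text \<open>The movable squares form an etale space over |R|. A continuous column is, near
  \<open>x0\<close>, the pullback along \<open>\<tau>\<close> of local sections \<open>s i\<close>
  over an open set \<open>W\<close>, since each point of \<open>W\<close> has exactly one movable
  square in each \<open>near (C x0 ! i)\<close>. So continuity can be tested on families of
  representatives with a column, by \<open>cts_from_abs_Res\<close>.\<close>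

lemma etale_continuous:
 fixes M :: "nat => 'a topology" and X :: "'x topology"
 assumes M: "rmod M act"
  and \<tau>: "cts X (abs_Res M act n) \<tau>"
  and C: "!!i. i < b ==> cts X euclidean (%x. C x ! i)"
  and CV: "!!x. x : pts X ==> length (C x) = b \<and> distinct (C x) \<and> set (C x) \<subseteq> zV (\<tau> x)"
  and H: "!!(K :: ('a tst \<times> (nat => real)) topology) k p a \<gamma> m t D r. rdat M act n K k p a \<gamma> m t ==>
   (!!i. i < b ==> cts K euclidean (%x. D x ! i)) ==>
   (!!x. x : pts K ==> length (D x) = b \<and> distinct (D x) \<and> set (D x) \<subseteq> Vh (cc k p (m x) (t x))) ==>
   (!!i. i < b ==> cts K rtop (%x. r x i)) ==> (!!i x. i < b ==> x : pts K ==> 0 <= r x i) ==>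
   cts K Z (%x. \<Phi> (cls M act n (k, (p, (a x, \<gamma> x), m x), t x)) (D x) (r x))"
 shows "cts (ptop X (PP b)) Z (%y. \<Phi> (\<tau> (fst y)) (C (fst y)) (snd y))"
proof (rule cts_locally)
 fix y0 assume y0: "y0 : pts (ptop X (PP b))"
 let ?R = "abs_Res M act n"
 define x0 where "x0 = fst y0"
 have x0: "x0 : pts X" using y0 by (auto simp: x0_def)
 have \<tau>R: "\<tau> x : pts ?R" if "x : pts X" for x using \<tau> that by (auto simp: cts_def)
 define N where "N = (%i. near (C x0 ! i))"
 define W where "W = {z : pts ?R. \<forall>i<b. zV z \<inter> N i ~= {}}"
 have oV: "openin ?R {z : pts ?R. zV z \<inter> T ~= {}}" if "open T" for T by (rule openin_zV_hit[OF M that])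
 have oW: "openin ?R W"
 proof -
  have "W = pts ?R \<inter> (\<Inter>i\<in>{..<b}. {z : pts ?R. zV z \<inter> N i ~= {}})" by (auto simp: W_def)
  moreover have "openin ?R (pts ?R \<inter> (\<Inter>i\<in>{..<b}. {z : pts ?R. zV z \<inter> N i ~= {}}))"
  proof (cases "b = 0")
   case False
   thus ?thesis by (auto intro!: openin_Int openin_Inter oV simp: N_def open_near)
  qed simp
  ultimately show ?thesis by simp
 qed
 define s where "s = (%i (z :: 'a rep set). SOME e. e : zV z \<inter> N i)"
 have s: "s i z : zV z" "s i z : N i" if "z : W" "i < b" for i z
 proof -
  have "\<exists>e. e : zV z \<inter> N i" using that by (auto simp: W_def)
  from someI_ex[OF this] show "s i z : zV z" "s i z : N i" by (auto simp: s_def)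
 qed
 have WR: "W \<subseteq> pts ?R" by (auto simp: W_def)
 have su: "e = s i z" if "z : W" "i < b" "e : zV z" "e : N i" for e i z
  using zV_near_unique[OF M, of z n e "s i z" "C x0 ! i"] that s WR by (auto simp: N_def)
 have sinj: "s i z ~= s j z" if "z : W" "i < b" "j < b" "i ~= j" for i j z
 proof -
  have "C x0 ! i : zV (\<tau> x0)" "C x0 ! j : zV (\<tau> x0)" "C x0 ! i ~= C x0 ! j"
   using CV[OF x0] that by (auto simp: nth_eq_iff_index_eq)
  hence "ysep (C x0 ! i) (C x0 ! j)" using zV_facts(2)[OF M \<tau>R[OF x0]] by blast
  hence "sep (C x0 ! i) (C x0 ! j)" by (simp add: sep_def)
  thus ?thesis using near_disjoint s[OF that(1)] that by (metis N_def)
 qed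
 define S where "S = (%z. map (%i. s i z) [0..<b])"
 have Sp: "length (S z) = b \<and> distinct (S z) \<and> set (S z) \<subseteq> zV z" if "z : W" for z
  using sinj[OF that] s(1)[OF that] by (auto simp: S_def distinct_conv_nth)
 have lcP: "lcs (PP b)" "haus (PP b)" using PP_facts by auto
 have g: "cts (ptop (stop ?R W) (PP b)) Z (%y. \<Phi> (fst y) (S (fst y)) (snd y))"
 proof (rule cts_from_abs_Res[OF oW lcP])
  fix K :: "'a tst topology" and k p a \<gamma> m t assume R: "rdat M act n K k p a \<gamma> m t"
   and KW: "!!x. x : pts K ==> cls M act n (k, (p, (a x, \<gamma> x), m x), t x) : W"
  let ?P = "ptop K (PP b)"
  let ?c = "%x. cls M act n (k, (p, (a x, \<gamma> x), m x), t x)"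
  have zc: "zV (?c x) = Vh (cc k p (m x) (t x))" if "x : pts K" for x
   using z_cls(1)[OF M rdat_facts(10)[OF R that]] by (simp add: rV_def)
  have R': "rdat M act n ?P k p (%y. a (fst y)) (%y. \<gamma> (fst y)) (%y. m (fst y)) (%y. t (fst y))"
   by (rule rdat_comp[OF R cts_fst])
    (use rdat_facts(1,2)[OF R] lcP in \<open>auto simp: locally_compact_space_prod_topology Hausdorff_space_prod_topology\<close>)
  have sc: "cts K euclidean (%x. s i (?c x))" if i: "i < b" for i
  proof -
   have "openin K {x : pts K. s i (?c x) : T}" if T: "open T" for T
   proof -
    have "open (N i \<inter> T)" using T by (simp add: N_def open_Int open_near)
    from openin_Vh_hit[OF continuous_cc[OF R] this]
    have "openin K {x : pts K. Vh (cc k p (m x) (t x)) \<inter> (N i \<inter> T) ~= {}}" .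
    moreover have "{x : pts K. Vh (cc k p (m x) (t x)) \<inter> (N i \<inter> T) ~= {}} = {x : pts K. s i (?c x) : T}"
     using s[OF KW i] su[OF KW i] zc by fastforce
    ultimately show ?thesis by simp
   qed
   thus ?thesis by (auto simp: cts_def)
  qed
  have "cts ?P Z (%y. \<Phi> (?c (fst y)) (S (?c (fst y))) (snd y))"
  proof (rule H[OF R'])
   show "cts ?P euclidean (%y. S (?c (fst y)) ! i)" if "i < b" for i
    using cts_compose[OF cts_fst sc[OF that], of "PP b"] that by (simp add: S_def o_def)
   show "length (S (?c (fst y))) = b \<and> distinct (S (?c (fst y))) \<and> set (S (?c (fst y))) \<subseteq> Vh (cc k p (m (fst y)) (t (fst y)))"
    if "y : pts ?P" for y
    using Sp[OF KW, of "fst y"] zc[of "fst y"] that by auto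
   show "cts ?P rtop (%y. snd y i)" if "i < b" for i
    using cts_compose[OF cts_snd PP_facts(3)[OF that], of K] by (simp add: o_def)
   show "0 <= snd y i" if "i < b" "y : pts ?P" for i y
    using that by (intro PP_facts(4)[of _ b]) auto
  qed
  thus "cts ?P Z (%y. \<Phi> (fst (?c (fst y), snd y)) (S (fst (?c (fst y), snd y))) (snd (?c (fst y), snd y)))" by simp
 qed
 define X0 where "X0 = {x : pts X. \<tau> x : W} \<inter> {x : pts X. \<forall>i<b. C x ! i : N i}"
 have oX0: "openin X X0"
 proof -
  have "{x : pts X. \<forall>i<b. C x ! i : N i} = pts X \<inter> (\<Inter>i\<in>{..<b}. {x : pts X. C x ! i : N i})" by auto
  moreover have "openin X (pts X \<inter> (\<Inter>i\<in>{..<b}. {x : pts X. C x ! i : N i}))"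
  proof (cases "b = 0")
   case False
   have oi: "openin X {x : pts X. C x ! i : N i}" if "i < b" for i
    using cts_preimage[OF C[OF that], of "N i"] by (simp add: N_def open_near)
   show ?thesis using oi False by (auto intro!: openin_Int openin_Inter simp: lessThan_empty_iff)
  qed simp
  ultimately show ?thesis
   unfolding X0_def using cts_preimage[OF \<tau> oW] by (intro openin_Int) auto
 qed
 have x0X0: "x0 : X0"
 proof -
  have "C x0 ! i : zV (\<tau> x0) \<and> C x0 ! i : N i" if "i < b" for i
  proof -
   have 1: "C x0 ! i : zV (\<tau> x0)" using CV[OF x0] that by auto
   hence "rgood (C x0 ! i)" using zV_facts(1)[OF M \<tau>R[OF x0]] by blast
   thus ?thesis using 1 by (simp add: N_def near_def rgood_def)
  qed
  thus ?thesis using x0 \<tau>R[OF x0] unfolding X0_def W_def by blast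
 qed
 have CS: "C x = S (\<tau> x)" if "x : X0" for x
 proof (rule nth_equalityI)
  have x: "x : pts X" "\<tau> x : W" using that by (auto simp: X0_def)
  show "length (C x) = length (S (\<tau> x))" using CV[OF x(1)] Sp[OF x(2)] by simp
  fix i assume "i < length (C x)"
  hence i: "i < b" using CV[OF x(1)] by simp
  have "C x ! i = s i (\<tau> x)"
   by (rule su[OF x(2) i]) (use CV[OF x(1)] i that in \<open>auto simp: X0_def\<close>)
  thus "C x ! i = S (\<tau> x) ! i" using i by (simp add: S_def)
 qed
 let ?O = "X0 \<times> pts (PP b)"
 have oO: "openin (ptop X (PP b)) ?O" using oX0 by (simp add: openin_prod_Times_iff)
 have "cts (stop (ptop X (PP b)) ?O) (ptop (stop ?R W) (PP b)) (%y. (\<tau> (fst y), snd y))"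
 proof (intro cts_pair cts_into)
  show "cts (stop (ptop X (PP b)) ?O) ?R (%y. \<tau> (fst y))"
   using cts_compose[OF cts_fst \<tau>, of "PP b"] by (simp add: o_def cts_sub)
  show "(%y. \<tau> (fst y)) : pts (stop (ptop X (PP b)) ?O) \<rightarrow> W" by (auto simp: X0_def)
  show "cts (stop (ptop X (PP b)) ?O) (PP b) (%y. snd y)"
   by (rule cts_sub) (rule cts_snd)
 qed
 from cts_compose[OF this g]
 have "cts (stop (ptop X (PP b)) ?O) Z (%y. \<Phi> (\<tau> (fst y)) (C (fst y)) (snd y))"
  by (rule cts_eq) (auto simp: CS)
 moreover have "y0 : ?O" using x0X0 y0 by (auto simp: x0_def mem_Times_iff)
 ultimately show "\<exists>U. openin (ptop X (PP b)) U \<and> y0 : U \<and>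
   cts (stop (ptop X (PP b)) U) Z (%y. \<Phi> (\<tau> (fst y)) (C (fst y)) (snd y))"
  using oO by (intro exI[of _ ?O] conjI)
qed

section \<open>The first double complex: simplices of the resolution with columns\<close>

section \<open>The complex of simplices with columns\<close>

definition As :: "(nat => 'a topology) => 'a action => nat => nat => nat => ((nat => real) => 'a rep set \<times> square list) set" where
 "As M act n k q = {f. f : extensional (spx q) \<and>
  cts (Spx q) (abs_Res M act n) (%x. fst (f x)) \<and>
  (\<forall>x\<in>spx q. length (snd (f x)) = k \<and> column (snd (f x)) \<and> set (snd (f x)) \<subseteq> zV (fst (f x))) \<and>
  (\<forall>i<k. cts (Spx q) euclidean (%x. snd (f x) ! i))}"

definition adel :: "nat => 'a rep set \<times> square list => 'a rep set \<times> square list" where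
 "adel i y = (fst y, del i (snd y))"

text \<open>The map between the double complexes: it forgets the point of |R| and keeps the outcome
  of removing the column and putting parts of it back.\<close>

definition phi :: "'a action => nat => 'a rep set \<times> square list => 'a bdata" where
 "phi act n y = (snd y, zM (fst y) (length (snd y)), %F. zG act n (fst y) (set (snd y)) F)"

lemma As_facts:
 assumes "f : As M act n k q"
 shows "f : extensional (spx q)" "cts (Spx q) (abs_Res M act n) (%x. fst (f x))"
  "!!x. x : spx q ==> length (snd (f x)) = k" "!!x. x : spx q ==> column (snd (f x))"
  "!!x. x : spx q ==> set (snd (f x)) \<subseteq> zV (fst (f x))"
  "!!i. i < k ==> cts (Spx q) euclidean (%x. snd (f x) ! i)"
  "!!x. x : spx q ==> fst (f x) : pts (abs_Res M act n)"
 using assms by (auto simp: As_def cts_def)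

lemma standard_simplex_nonempty: "\<exists>x. x : spx q"
 using nonempty_standard_simplex by blast

lemma As_le:
 assumes M: "rmod M act" and f: "f : As M act n k q"
 shows "k <= n"
proof -
 obtain x where x: "x : spx q" using standard_simplex_nonempty by blast
 have "card (set (snd (f x))) <= n"
  using zV_facts(4)[OF M As_facts(7)[OF f x]] As_facts(5)[OF f x] by blast
 thus ?thesis using distinct_card[OF column_distinct[OF As_facts(4)[OF f x]]] As_facts(3)[OF f x] by simp
qed

text \<open>\<open>act_assoc\<close> reduces the law to an identity of configurations: far squares
  form a right factor of \<open>rS\<close>, with the end of the strip as in
  \<open>mlaw\<close>.\<close>

lemma zG_law:
 assumes M: "rmod M act" and z: "z : pts (abs_Res M act n)"
  and C: "column C" "set C \<subseteq> zV z"
 shows "mlaw act (n - length C) (set C) (zM z (length C)) (zG act n z (set C))" "0 <= zM z (length C)"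
proof -
 obtain k p a \<gamma> m t where w: "zrep z = (k, (p, (a, \<gamma>), m), t)" by (metis prod.collapse)
 note vr = zrep_vrep[OF M z]
 note v = vrep_facts[OF vr[unfolded w]]
 let ?l = "Suc (p 0)" and ?C = "set C" and ?c = "cc k p m t" and ?\<mu> = "mu (length C) k p m t"
 have cC: "card ?C = length C" by (rule distinct_card[OF column_distinct[OF C(1)]])
 have CV: "?C \<subseteq> rV (zrep z)" using C(2) by (simp add: zV_def)
 hence CV': "?C \<subseteq> Vh ?c" by (simp add: w rV_def)
 have bl: "length C <= ?l" using card_Vh_le(1)[OF cc_confs[OF v(1)] CV'] cC by simp
 have mu: "zM z (length C) = ?\<mu>" by (simp add: zM_def w rM_def)
 show "0 <= zM z (length C)"
  using Gs_empty_confs(2)[OF v(1) simplex_facts(1)[OF v(2)] simplex_facts(2)[OF v(2)] CV'] by (simp add: mu cC)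
 hence mu0: "0 <= ?\<mu>" by (simp add: mu)
 show "mlaw act (n - length C) (set C) (zM z (length C)) (zG act n z (set C))"
  unfolding mlaw_def
 proof (intro allI impI, elim conjE)
  fix F1 F2 assume V: "validF ?C (F1 \<union> F2)" and dis: "fst ` F1 \<inter> fst ` F2 = {}" and ne: "F2 ~= {}"
   and far: "\<forall>p\<in>F2. mx F1 <= fst (fst (fst p)) + snd p"
  have V1: "validF ?C F1" and V2: "validF ?C F2" using V validF_subset by blast+
  have fin: "finite F1" "finite F2" using V by (auto simp: validF_def)
  let ?d = "(if F1 = {} then zM z (length C) else 0) - mx F1"
  have s2: "(mx F2 + ?d, mv ?d ` F2) : confs (card F2)"
   unfolding topspace_S[symmetric]
  proof (rule column_conf(2)[OF C(1) V2 ne])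
   fix p assume "p : F2"
   thus "0 <= fst (fst (fst p)) + snd p + ?d"
    using far mu0 by (auto simp: mu)
  qed
  have s1: "rS (zrep z) ?C F1 : confs (?l - length C + card F1)"
   using rS_confs[OF vr CV V1] by (simp add: w cC)
  have s12: "rS (zrep z) ?C (F1 \<union> F2) : confs (?l - length C + card (F1 \<union> F2))"
   using rS_confs[OF vr CV V] by (simp add: w cC)
  have crd: "card (F1 \<union> F2) = card F1 + card F2" using fin dis by (intro card_Un_disjoint) auto
  have U: "mx (F1 \<union> F2) = mx F2"
   by (rule mx_union[OF fin ne]) (use far_snd[OF C(1) V2] far in blast)
  have sm: "smult (rS (zrep z) ?C F1) (mx F2 + ?d, mv ?d ` F2) = rS (zrep z) ?C (F1 \<union> F2)"
  proof (cases "F1 = {}")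
   case True
   have "shift (fst ?c - ?\<mu>) ` mv ?\<mu> ` F2 = mv (fst ?c) ` F2"
    by (simp add: image_image mv_def add.commute)
   thus ?thesis using ne True by (simp add: w rS_def Gs_def cC smult_def mu)
  next
   case False
   have "shift (fst ?c + mx F1) ` mv (- mx F1) ` F2 = mv (fst ?c) ` F2"
    by (simp add: image_image mv_def add.commute)
   thus ?thesis using ne False by (simp add: w rS_def Gs_def cC smult_def U image_Un Un_assoc)
  qed
  have nl: "n - length C + card F1 = n - ?l + (?l - length C + card F1)" using bl v(3) by simp
  show "zG act n z ?C (F1 \<union> F2) = act (n - length C + card F1) (card F2) (zG act n z ?C F1) (mx F2 + ?d, mv ?d ` F2)"
   unfolding nl
   using act_assoc[OF M v(4), of "rS (zrep z) ?C F1" "?l - length C + card F1" "(mx F2 + ?d, mv ?d ` F2)" "card F2"]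
    s1 s2 sm confs_facts(3)[OF s1] confs_facts(3)[OF s12] crd
   by (simp add: zG_def w rG_def topspace_S add.assoc)
 qed
qed

text \<open>By \<open>card_Vh_cc\<close>, more than b movable squares prevent the vertices with
  \<open>p i < b\<close> from carrying more than half of the weight. So the margin vanishes as soon
  as a square of the column is kept, as \<open>bdel\<close> demands.\<close>

lemma zM_smaller:
 assumes M: "rmod M act" and z: "z : pts (abs_Res M act n)" and C: "C \<subseteq> zV z" "b < card C"
 shows "zM z b = 0"
proof -
 obtain k p a \<gamma> m t where w: "zrep z = (k, (p, (a, \<gamma>), m), t)" by (metis prod.collapse)
 note v = vrep_facts[OF zrep_vrep[OF M z, unfolded w]]
 note tf = simplex_facts[OF v(2)]
 have CV: "C \<subseteq> Vh (cc k p m t)" using C(1) by (simp add: zV_def w rV_def)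
 have "wsum b k p t <= 1 / 2"
 proof (rule ccontr)
  assume w: "\<not> wsum b k p t <= 1 / 2"
  have "\<exists>i\<le>k. p i < b"
  proof (rule ccontr)
   assume "\<not> ?thesis"
   hence "wsum b k p t = 0" unfolding wsum_def by (intro sum.neutral) auto
   thus False using w by simp
  qed
  then obtain i where i: "i <= k" "p i < b" by blast
  define l where "l = (LEAST i. p i < b)"
  have l: "p l < b" "l <= k" using LeastI[of "%i. p i < b", OF i(2)] Least_le[of "%i. p i < b", OF i(2)] i(1) by (auto simp: l_def)
  have "1 / 2 <= (\<Sum>i\<in>{l..k}. t i)"
  proof (cases l)
   case 0
   thus ?thesis using tf(2) by (simp add: atLeast0AtMost)
  next
   case (Suc l')
   have "b <= p l'" using not_less_Least[of l' "%i. p i < b"] Suc by (simp add: l_def)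
   from wsum_le[of k p m t b l', OF v(1) tf(1) this Suc_leD[OF l(2)[unfolded Suc]]] show ?thesis using w Suc by simp
  qed
  from card_Vh_cc[OF v(1) tf(1) CV l(2) this] show False using l(1) C(2) by simp
 qed
 thus ?thesis by (simp add: zM_def w rM_def mu_def)
qed

text \<open>Not removing a square amounts to putting it back at distance 0, and the margins agree
  because both are 0, by \<open>zM_smaller\<close>.\<close>

lemma phi_adel:
 assumes M: "rmod M act" and f: "f : As M act n k q" and x: "x : spx q" and i: "i < k"
 shows "phi act n (adel i (f x)) = bdel i (phi act n (f x))"
proof -
 let ?z = "fst (f x)" and ?C = "snd (f x)"
 note F = As_facts(3-5)[OF f x] and z = As_facts(7)[OF f x]
 have dC: "distinct ?C" by (rule column_distinct[OF F(2)])
 have iC: "i < length ?C" using F(1) i by simp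
 obtain l p a \<gamma> m t where w: "zrep ?z = (l, (p, (a, \<gamma>), m), t)" by (metis prod.collapse)
 let ?c = "cc l p m t"
 have cC: "card (set ?C) = k" using distinct_card[OF dC] F(1) by simp
 have m0: "zM ?z (k - 1) = 0" by (rule zM_smaller[OF M z F(3)]) (use cC i in simp)
 have sd: "set (del i ?C) = set ?C - {?C ! i}" by (rule set_del[OF dC iC])
 have cd: "card (set ?C - {?C ! i}) = k - 1" using cC iC by (simp add: card_Diff_singleton)
 have e: "?C ! i : set ?C" using iC by simp
 have V: "set ?C \<subseteq> Vh ?c" using F(3) by (simp add: zV_def w rV_def)
 have se: "shift (fst ?c) (?C ! i) : snd ?c" using Vh_shift[OF V] Vc_subset[of ?c] e by blast
 have "shift (fst ?c) ` (set ?C - {?C ! i}) = shift (fst ?c) ` set ?C - {shift (fst ?c) (?C ! i)}"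
  using image_set_diff[OF inj_shift[of "fst ?c"], of "set ?C" "{?C ! i}"] by simp
 hence E: "snd ?c - shift (fst ?c) ` (set ?C - {?C ! i}) = insert (shift (fst ?c) (?C ! i)) (snd ?c - shift (fst ?c) ` set ?C)"
  using se imageI[OF e, of "shift (fst ?c)"] by (simp only:) blast
 have "rS (zrep ?z) (set ?C - {?C ! i}) G = rS (zrep ?z) (set ?C) (insert (?C ! i, 0) G)" for G
  using m0 by (auto simp: w rS_def Gs_def E cd mx_insert_0 mv_def zM_def rM_def mx_insert_0[of _ "{}", simplified])
 hence "zG act n ?z (set ?C - {?C ! i}) G = zG act n ?z (set ?C) (insert (?C ! i, 0) G)" for G
  by (simp add: zG_def w rG_def)
 thus ?thesis
  using m0 F(1) iC by (simp add: phi_def adel_def bdel_def sd)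
qed

lemma phi_Bs:
 fixes M :: "nat => 'a topology"
 assumes M: "rmod M act" and f: "f : As M act n k q"
 shows "smap q (phi act n) f : Bs M act n k q"
proof -
 note F = As_facts[OF f]
 let ?z = "%x. fst (f x)" and ?C = "%x. snd (f x)"
 have CV: "length (?C x) = k \<and> distinct (?C x) \<and> set (?C x) \<subseteq> zV (?z x)" if "x : pts (Spx q)" for x
  using F(3-5) that column_distinct by simp
 have kn: "k <= n" by (rule As_le[OF M f])
 have "Bfam M act n k (Spx q) (%x. phi act n (f x))"
  unfolding Bfam_def phi_def fst_conv snd_conv
 proof (intro conjI allI impI ballI kn)
  fix x assume "x : pts (Spx q)"
  hence x: "x : spx q" by simp
  show "length (?C x) = k" "column (?C x)" using F(3,4)[OF x] by auto
  show "mlaw act (n - k) (set (?C x)) (zM (?z x) (length (?C x))) (%Fa. zG act n (?z x) (set (?C x)) Fa)" "0 <= zM (?z x) (length (?C x))"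
   using zG_law[OF M F(7)[OF x] F(4)[OF x] F(5)[OF x]] F(3)[OF x] by simp_all
 next
  show "cts (Spx q) euclidean (%x. ?C x ! i)" if "i < k" for i by (rule F(6)[OF that])
  have "cts (ptop (Spx q) (PP k)) rtop (%y. (%z C r. zM z k) (?z (fst y)) (?C (fst y)) (snd y))"
  proof (rule etale_continuous[OF M F(2) F(6) CV])
   fix K :: "('a tst \<times> (nat => real)) topology" and l p a \<gamma> m t D r
   assume R: "rdat M act n K l p a \<gamma> m t"
    and D: "!!x. x : pts K ==> length (D x) = k \<and> distinct (D x) \<and> set (D x) \<subseteq> Vh (cc l p (m x) (t x))"
   show "cts K rtop (%x. zM (cls M act n (l, (p, (a x, \<gamma> x), m x), t x)) k)"
   proof (rule cts_eq[OF continuous_mu[OF R, of k]])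
    fix x assume x: "x : pts K"
    have "card (set (D x)) = k" using D[OF x] distinct_card by blast
    thus "mu k l p (m x) (t x) = zM (cls M act n (l, (p, (a x, \<gamma> x), m x), t x)) k"
     using z_cls(2)[OF M rdat_facts(10)[OF R x], of "set (D x)"] D[OF x] by (simp add: rV_def rM_def)
   qed
  qed
  hence c1: "cts (ptop (Spx q) (PP k)) rtop (%y. zM (?z (fst y)) k)" by simp
  have "cts (Spx q) (ptop (Spx q) (PP k)) (%x. (x, \<lambda>i\<in>{..<k}. 0))"
   by (intro cts_pair) (auto simp: PP_def)
  from cts_compose[OF this c1]
  have "cts (Spx q) rtop (%x. zM (?z x) k)" by (simp add: o_def)
  thus "cts (Spx q) rtop (%x. zM (?z x) (length (?C x)))"
   by (rule cts_eq) (use F(3) in simp)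
 next
  fix I assume I: "I \<subseteq> {..<k}"
  have "cts (ptop (Spx q) (PP k)) (M (n - k + card I))
   (%y. (%z C r. zG act n z (set C) ((%i. (C ! i, r i)) ` I)) (?z (fst y)) (?C (fst y)) (snd y))"
  proof (rule etale_continuous[OF M F(2) F(6) CV])
   fix K :: "('a tst \<times> (nat => real)) topology" and l p a \<gamma> m t D r
   assume R: "rdat M act n K l p a \<gamma> m t" and Dc: "!!i. i < k ==> cts K euclidean (%x. D x ! i)"
    and D: "!!x. x : pts K ==> length (D x) = k \<and> distinct (D x) \<and> set (D x) \<subseteq> Vh (cc l p (m x) (t x))"
    and r: "!!i. i < k ==> cts K rtop (%x. r x i)" "!!i x. i < k ==> x : pts K ==> 0 <= r x i"
   show "cts K (M (n - k + card I))
    (%x. zG act n (cls M act n (l, (p, (a x, \<gamma> x), m x), t x)) (set (D x)) ((%i. (D x ! i, r x i)) ` I))"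
   proof (rule cts_eq[OF continuous_rG[OF M R Dc D r I]])
    fix x assume x: "x : pts K"
    have "validF (set (D x)) ((%i. (D x ! i, r x i)) ` I)"
     by (rule validF_index_distinct) (use D[OF x] I r(2)[OF _ x] in auto)
    thus "rG act n (l, (p, (a x, \<gamma> x), m x), t x) (set (D x)) ((%i. (D x ! i, r x i)) ` I) =
     zG act n (cls M act n (l, (p, (a x, \<gamma> x), m x), t x)) (set (D x)) ((%i. (D x ! i, r x i)) ` I)"
     using z_cls(3)[OF M rdat_facts(10)[OF R x], of "set (D x)"] D[OF x] by (simp add: rV_def)
   qed
  qed
  thus "cts (ptop (Spx q) (PP k)) (M (n - k + card I))
   (%y. zG act n (?z (fst y)) (set (?C (fst y))) ((%i. (?C (fst y) ! i, snd y i)) ` I))" by simp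
 qed
 from Bs_restrict[OF this] show ?thesis by (simp add: simplex_map_def o_def)
qed


section \<open>Exactness of the rows\<close>

definition sect :: "nat => ((nat => real) => 'a rep set) => ((nat => real) => square) set" where
 "sect q \<tau> = {e. cts (Spx q) euclidean e \<and> (\<forall>x\<in>spx q. e x : zV (\<tau> x))}"

abbreviation ylow :: "square => real" where "ylow e \<equiv> snd (fst e)"

text \<open>The difference of the lower edges divided by the smaller of the two heights is
  continuous. It is 0 where the sections agree and has absolute value at least 1 elsewhere; on the
  connected simplex it cannot jump over 1/2 or - 1/2.\<close>

lemma sect_order:
 assumes M: "rmod M act" and \<tau>: "cts (Spx q) (abs_Res M act n) \<tau>"
  and e: "e : sect q \<tau>" "e' : sect q \<tau>" and x: "x : spx q" "y : spx q"
 shows "e x = e' x ==> e y = e' y"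
  "ylow (e x) + snd (snd (e x)) <= ylow (e' x) ==> ylow (e y) + snd (snd (e y)) <= ylow (e' y)"
proof -
 let ?h = "%x. min (snd (snd (e x))) (snd (snd (e' x)))"
 let ?g = "%x. (ylow (e' x) - ylow (e x)) / ?h x"
 have zR: "\<tau> x : pts (abs_Res M act n)" if "x : spx q" for x
  using \<tau> that by (auto simp: cts_def)
 have V: "e x : zV (\<tau> x)" "e' x : zV (\<tau> x)" if "x : spx q" for x using e that by (auto simp: sect_def)
 have h: "0 < snd (snd (e x))" "0 < snd (snd (e' x))" if "x : spx q" for x
  using zV_facts(1)[OF M zR[OF that]] V[OF that] by (auto simp: rgood_def)
 have h': "0 < ?h x" if "x : spx q" for x using h[OF that] by simp
 have c: "cts (Spx q) euclidean e" "cts (Spx q) euclidean e'"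
  using e by (auto simp: sect_def)
 have "cts (Spx q) rtop (%x. ylow (e' x) - ylow (e x))"
  using cm_comp[OF cm_pair[OF c], of "%(a, b). ylow b - ylow a"] by (simp add: case_prod_beta continuous_intros)
 moreover have "cts (Spx q) rtop ?h"
  using cm_comp[OF cm_pair[OF c], of "%(a, b). min (snd (snd a)) (snd (snd b))"] by (simp add: case_prod_beta continuous_intros)
 ultimately have g: "cts (Spx q) rtop ?g"
  by (rule continuous_map_real_divide) (use h' in fastforce)
 have tri: "(e x = e' x \<and> ?g x = 0) \<or> (ylow (e x) + snd (snd (e x)) <= ylow (e' x) \<and> 1 <= ?g x) \<or> ?g x <= - 1"
  if x: "x : spx q" for x
 proof (cases "e x = e' x")
  case False
  hence "ysep (e x) (e' x)" using zV_facts(2)[OF M zR[OF x]] V[OF x] by blast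
  thus ?thesis
  proof (unfold ysep_def, elim disjE)
   assume a: "ylow (e x) + snd (snd (e x)) <= ylow (e' x)"
   hence "?h x <= ylow (e' x) - ylow (e x)" by simp
   thus ?thesis using a h'[OF x] by (simp add: le_divide_eq)
  next
   assume "ylow (e' x) + snd (snd (e' x)) <= ylow (e x)"
   hence "ylow (e' x) - ylow (e x) <= - ?h x" by simp
   thus ?thesis using h'[OF x] by (simp add: divide_le_eq)
  qed
 qed simp
 have "connectedin (Spx q) (spx q)"
  using connectedin_standard_simplex[of q] by (simp add: simplex_space_def connectedin_subtopology)
 from connectedin_continuous_map_image[OF g this]
 have conn: "connected (?g ` spx q)" by simp
 have iv: "\<exists>z\<in>spx q. ?g z = c" if "?g u <= c" "c <= ?g v" "u : spx q" "v : spx q" for c u v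
  using connectedD_interval[OF conn, of "?g u" "?g v" c] that by auto
 have no: "?g z ~= 1 / 2 \<and> ?g z ~= - (1 / 2)" if "z : spx q" for z
  using tri[OF that] by (elim disjE conjE; intro conjI notI; linarith)
 show "e y = e' y" if "e x = e' x"
 proof -
  have "?g x = 0" using that by simp
  thus ?thesis
   using tri[OF x(2)] iv[of x "1 / 2" y] iv[of y "- (1 / 2)" x] no x by fastforce
 qed
 show "ylow (e y) + snd (snd (e y)) <= ylow (e' y)" if "ylow (e x) + snd (snd (e x)) <= ylow (e' x)"
 proof -
  have "0 < ylow (e' x) - ylow (e x)" using that h[OF x(1)] by simp
  hence "0 < ?g x" using h'[OF x(1)] by simp
  hence "1 <= ?g x" using tri[OF x(1)] by (elim disjE conjE) linarith+
  thus ?thesis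
   using tri[OF x(2)] iv[of y "1 / 2" x] no x by fastforce
 qed
qed

definition vtx :: "nat => nat => real" where "vtx q = (SOME x. x : spx q)"

lemma vtx: "vtx q : spx q"
 unfolding vtx_def by (rule someI_ex[OF standard_simplex_nonempty])

text \<open>By \<open>sect_order\<close> the vertical order of the sections is the same at all
  points of the simplex, so comparing them at the one point \<open>vtx q\<close> finds the lowest
  section.\<close>

definition lows :: "nat => ((nat => real) => 'a rep set) => (nat => real) => square" where
 "lows q \<tau> = (SOME e. e : sect q \<tau> \<and> (\<forall>e'\<in>sect q \<tau>. ylow (e (vtx q)) <= ylow (e' (vtx q))))"

lemma lows:
 assumes M: "rmod M act" and \<tau>: "\<tau> (vtx q) : pts (abs_Res M act n)" and s: "sect q \<tau> ~= {}"
 shows "lows q \<tau> : sect q \<tau>" "e' : sect q \<tau> ==> ylow (lows q \<tau> (vtx q)) <= ylow (e' (vtx q))"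
proof -
 have "(%e. ylow (e (vtx q))) ` sect q \<tau> \<subseteq> ylow ` zV (\<tau> (vtx q))" using vtx by (auto simp: sect_def)
 hence fin: "finite ((%e. ylow (e (vtx q))) ` sect q \<tau>)" using zV_facts(3)[OF M \<tau>] finite_subset by blast
 have "Min ((%e. ylow (e (vtx q))) ` sect q \<tau>) : (%e. ylow (e (vtx q))) ` sect q \<tau>" using fin s by (intro Min_in) auto
 then obtain e where e: "e : sect q \<tau>" "ylow (e (vtx q)) = Min ((%e. ylow (e (vtx q))) ` sect q \<tau>)" by auto
 have "\<forall>e'\<in>sect q \<tau>. ylow (e (vtx q)) <= ylow (e' (vtx q))" unfolding e(2) using fin by auto
 hence "\<exists>e. e : sect q \<tau> \<and> (\<forall>e'\<in>sect q \<tau>. ylow (e (vtx q)) <= ylow (e' (vtx q)))" using e(1) by blast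
 from someI_ex[OF this]
 show "lows q \<tau> : sect q \<tau>" "e' : sect q \<tau> ==> ylow (lows q \<tau> (vtx q)) <= ylow (e' (vtx q))"
  by (auto simp: lows_def)
qed

definition acons :: "nat => ((nat => real) => 'a rep set \<times> square list) => (nat => real) => 'a rep set \<times> square list" where
 "acons q f = (\<lambda>x\<in>spx q. (fst (f x), lows q (%x. fst (f x)) x # snd (f x)))"

definition starts :: "nat => ((nat => real) => 'a rep set \<times> square list) => bool" where
 "starts q f \<longleftrightarrow> snd (f (vtx q)) ~= [] \<and> snd (f (vtx q)) ! 0 = lows q (%x. fst (f x)) (vtx q)"

text \<open>Contracting homotopy of the rows over simplices that have a section; the case
  distinction avoids choosing the lowest section twice.\<close>

definition ahom :: "nat => ((nat => real) => 'a rep set \<times> square list) => ('a rep set \<times> square list) chain" where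
 "ahom q f = (if starts q f then 0 else frag_of (acons q f))"

definition small :: "nat => ((nat => real) => 'a rep set \<times> square list) => bool" where
 "small q f \<longleftrightarrow> sect q (%x. fst (f x)) ~= {}"

lemma As_sect:
 assumes f: "f : As M act n k q" and i: "i < k"
 shows "(%x. snd (f x) ! i) : sect q (%x. fst (f x))"
proof -
 have "snd (f x) ! i : zV (fst (f x))" if "x : spx q" for x
  using subsetD[OF As_facts(5)[OF f that] nth_mem[of i]] As_facts(3)[OF f that] i by simp
 thus ?thesis using As_facts[OF f] i by (auto simp: sect_def)
qed

lemma lows_below:
 assumes M: "rmod M act" and f: "f : As M act n k q" and sm: "small q f" and ns: "\<not> starts q f"
  and i: "i < k" and x: "x : spx q"
 shows "ylow (lows q (%x. fst (f x)) x) + snd (snd (lows q (%x. fst (f x)) x)) <= ylow (snd (f x) ! i)"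
proof -
 let ?l = "lows q (%x. fst (f x))" and ?v = "vtx q"
 note F = As_facts[OF f]
 note L = lows[OF M, of "%x. fst (f x)" q n, OF F(7)[OF vtx] sm[unfolded small_def]]
 have s: "(%x. snd (f x) ! j) : sect q (%x. fst (f x))" if "j < k" for j using As_sect[OF f that] .
 have b0: "ylow (?l ?v) + snd (snd (?l ?v)) <= ylow (snd (f ?v) ! 0)"
 proof -
  have k: "0 < k" using i by simp
  have "snd (f ?v) ! 0 ~= ?l ?v" using ns F(3)[OF vtx] k by (auto simp: starts_def)
  moreover have "?l ?v : zV (fst (f ?v))" "snd (f ?v) ! 0 : zV (fst (f ?v))"
   using L(1) s[OF k] vtx by (auto simp: sect_def)
  ultimately have "ysep (?l ?v) (snd (f ?v) ! 0)" using zV_facts(2)[OF M F(7)[OF vtx]] by metis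
  moreover have "ylow (?l ?v) <= ylow (snd (f ?v) ! 0)" using L(2)[OF s[OF k]] .
  moreover have "rgood (snd (f ?v) ! 0)" using zV_facts(1)[OF M F(7)[OF vtx]] \<open>snd (f ?v) ! 0 : zV _\<close> by blast
  ultimately show ?thesis by (auto simp: ysep_def rgood_def)
 qed
 have "ylow (?l x) + snd (snd (?l x)) <= ylow (snd (f x) ! 0)"
  by (rule sect_order(2)[OF M F(2) L(1) s vtx x b0]) (use i in simp)
 moreover have "ylow (snd (f x) ! 0) <= ylow (snd (f x) ! i)"
 proof (cases "i = 0")
  case False
  hence "ylow (snd (f x) ! 0) + snd (snd (snd (f x) ! 0)) <= ylow (snd (f x) ! i)" "rgood (snd (f x) ! 0)"
   using F(3,4)[OF x] i by (auto simp: column_nth_iff)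
  thus ?thesis by (simp add: rgood_def)
 qed simp
 ultimately show ?thesis by simp
qed

lemma acons_As:
 assumes M: "rmod M act" and f: "f : As M act n k q" and sm: "small q f" and ns: "\<not> starts q f"
 shows "acons q f : As M act n (Suc k) q"
proof -
 let ?l = "lows q (%x. fst (f x))"
 note F = As_facts[OF f]
 note L = lows[OF M, of "%x. fst (f x)" q n, OF F(7)[OF vtx] sm[unfolded small_def]]
 have v: "acons q f x = (fst (f x), ?l x # snd (f x))" if "x : spx q" for x
  using that by (simp add: acons_def)
 have lV: "?l x : zV (fst (f x))" if "x : spx q" for x using L(1) that by (auto simp: sect_def)
 show ?thesis
  unfolding As_def
 proof (rule CollectI, intro conjI ballI allI impI)
  show "acons q f : extensional (spx q)" by (simp add: acons_def)
  show "cts (Spx q) (abs_Res M act n) (%x. fst (acons q f x))"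
   by (rule cts_eq[OF F(2)]) (simp add: v)
  show "length (snd (acons q f x)) = Suc k" "set (snd (acons q f x)) \<subseteq> zV (fst (acons q f x))" if x: "x : spx q" for x
   using F(3-5)[OF x] lV[OF x] by (auto simp: v[OF x])
  show "column (snd (acons q f x))" if x: "x : spx q" for x
  proof -
   have "\<forall>e\<in>set (snd (f x)). ylow (?l x) + snd (snd (?l x)) <= ylow e"
   proof
    fix e assume "e : set (snd (f x))"
    then obtain j where j: "j < k" "e = snd (f x) ! j" using F(3)[OF x] by (metis in_set_conv_nth)
    show "ylow (?l x) + snd (snd (?l x)) <= ylow e" using lows_below[OF M f sm ns j(1) x] j(2) by simp
   qed
   moreover have "rgood (?l x)" using zV_facts(1)[OF M F(7)[OF x] lV[OF x]] .
   ultimately show ?thesis using F(4)[OF x] by (simp add: v[OF x] column_def)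
  qed
  fix i assume i: "i < Suc k"
  have "cts (Spx q) euclidean (%x. (?l x # snd (f x)) ! i)"
   using F(6) L(1) i by (cases i) (auto simp: sect_def)
  thus "cts (Spx q) euclidean (%x. snd (acons q f x) ! i)"
   by (rule cts_eq) (simp add: v)
 qed
qed

lemma dd_ext: "dd D k q c = ext (%s. \<Sum>i<k. sg i (frag_of (smap q (D i) s))) c"
proof (induction k)
 case 0
 thus ?case by (simp add: dd_def ext_zero_fun)
next
 case (Suc k)
 have u: "ext (%s. - g s) c = - ext g c" for g :: "_ => ('x \<Rightarrow>\<^sub>0 int)"
  using ext_diff_fun[of "%_. 0" g c] by (simp add: ext_zero_fun)
 show ?case using Suc by (simp add: dd_def ext_add_fun sg_def cmap_def u)
qed

lemma sect_adel:
 "x : spx q ==> fst (smap q (adel i) f x) = fst (f x)"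
 by (simp add: simplex_map_def adel_def)

lemma sect_cong: "(!!x. x : spx q ==> \<tau> x = \<tau>' x) ==> sect q \<tau> = sect q \<tau>'"
 by (auto simp: sect_def)

lemma lows_cong: "(!!x. x : spx q ==> \<tau> x = \<tau>' x) ==> lows q \<tau> = lows q \<tau>'"
 unfolding lows_def using sect_cong[of q \<tau> \<tau>'] by simp

text \<open>If the column does not start with the lowest section, face 0 of \<open>acons q f\<close>
  is \<open>f\<close>, and the other faces cancel against the second sum. If it does, the first sum
  is 0, all faces of \<open>f\<close> but face 0 still start with the lowest section, and extending
  face 0 gives \<open>f\<close> back.\<close>

lemma ahom_identity:
 assumes M: "rmod M act" and f: "f : As M act n k q" and sm: "small q f"
 shows "frag_extend (%s. \<Sum>i<Suc k. sg i (frag_of (smap q (adel i) s))) (ahom q f) +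
  (\<Sum>i<k. sg i (ahom q (smap q (adel i) f))) = frag_of f"
proof -
 note F = As_facts[OF f]
 let ?l = "lows q (%x. fst (f x))" and ?v = "vtx q"
 have le: "lows q (%x. fst (smap q (adel i) f x)) = ?l" for i
  by (rule lows_cong) (simp add: sect_adel)
 have sv: "snd (smap q (adel i) f ?v) = del i (snd (f ?v))" for i
  using vtx by (simp add: simplex_map_def adel_def)
 note L = lows[OF M, of "%x. fst (f x)" q n, OF F(7)[OF vtx] sm[unfolded small_def]]
 have pos: "0 < snd (snd (?l ?v))"
  using zV_facts(1)[OF M F(7)[OF vtx]] L(1) vtx by (auto simp: sect_def rgood_def)
 show ?thesis
 proof (cases "starts q f")
  case False
  have ns: "\<not> starts q (smap q (adel i) f)" if i: "i < k" for i
  proof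
   assume "starts q (smap q (adel i) f)"
   hence "del i (snd (f ?v)) ~= []" "del i (snd (f ?v)) ! 0 = ?l ?v" by (auto simp: starts_def le sv)
   moreover have k1: "1 < k"
    using \<open>del i (snd (f ?v)) ~= []\<close> length_del[of i "snd (f ?v)"] F(3)[OF vtx] i
    by (metis One_nat_def length_greater_0_conv zero_less_diff)
   moreover have "del i (snd (f ?v)) ! 0 = snd (f ?v) ! (if 0 < i then 0 else Suc 0)"
    using nth_del[of i "snd (f ?v)" 0] F(3)[OF vtx] i k1 by simp
   ultimately have "snd (f ?v) ! (if 0 < i then 0 else Suc 0) = ?l ?v" by metis
   moreover have "(if 0 < i then 0 else Suc 0) < k" using k1 by simp
   ultimately obtain j where j: "j < k" "snd (f ?v) ! j = ?l ?v" by blast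
   from lows_below[OF M f sm False j(1) vtx] show False using j(2) pos by simp
  qed
  have a0: "smap q (adel 0) (acons q f) = f"
   using F(1) by (auto simp: simplex_map_def adel_def acons_def del_def fun_eq_iff extensional_def)
  have aS: "smap q (adel (Suc i)) (acons q f) = acons q (smap q (adel i) f)" for i
   by (auto simp: simplex_map_def adel_def acons_def del_def fun_eq_iff le[unfolded simplex_map_def restrict_apply])
  have "(\<Sum>i<k. sg i (ahom q (smap q (adel i) f))) = (\<Sum>i<k. sg i (frag_of (acons q (smap q (adel i) f))))"
   using ns by (intro sum.cong) (auto simp: ahom_def)
  moreover have "(\<Sum>i<Suc k. sg i (frag_of (smap q (adel i) (acons q f)))) =
    frag_of f - (\<Sum>i<k. sg i (frag_of (acons q (smap q (adel i) f))))"
   unfolding sum.lessThan_Suc_shift aS a0 by (simp add: sg_def sum_negf[symmetric] del: sum.lessThan_Suc) (intro sum.cong, auto)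
  ultimately show ?thesis using False by (simp add: ahom_def del: sum.lessThan_Suc)
 next
  case True
  hence k: "0 < k" and st: "snd (f ?v) ! 0 = ?l ?v" using F(3)[OF vtx] by (auto simp: starts_def)
  then obtain k' where k': "k = Suc k'" by (cases k) auto
  have all: "snd (f x) ! 0 = ?l x" if "x : spx q" for x
   by (rule sect_order(1)[OF M F(2) As_sect[OF f k] L(1) vtx that st])
  have nth: "del i (snd (f ?v)) ! 0 = snd (f ?v) ! (if 0 < i then 0 else Suc 0)" if "i < k" "1 < k" for i
   using F(3)[OF vtx] that nth_del[of i "snd (f ?v)" 0] by simp
  have s1: "starts q (smap q (adel (Suc i)) f)" if "i < k'" for i
   using that nth[of "Suc i"] st F(3)[OF vtx] length_del[of "Suc i" "snd (f ?v)"] unfolding starts_def le sv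
   by (auto simp: k' simp del: length_del)
  have s0: "\<not> starts q (smap q (adel 0) f)"
  proof
   assume s: "starts q (smap q (adel 0) f)"
   hence "del 0 (snd (f ?v)) ~= []" "del 0 (snd (f ?v)) ! 0 = ?l ?v" by (auto simp: starts_def le sv)
   hence k1: "1 < k" using F(3)[OF vtx] k length_del[of 0 "snd (f ?v)"] by (cases "k = 1") (auto simp del: length_del)
   hence "snd (f ?v) ! Suc 0 = snd (f ?v) ! 0" using nth[of 0] \<open>del 0 (snd (f ?v)) ! 0 = ?l ?v\<close> st k by simp
   thus False using column_distinct[OF F(4)[OF vtx]] F(3)[OF vtx] k1 by (simp add: nth_eq_iff_index_eq)
  qed
  have "acons q (smap q (adel 0) f) = f"
  proof
   fix x
   show "acons q (smap q (adel 0) f) x = f x"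
   proof (cases "x : spx q")
    case x: True
    have "snd (f x) = snd (f x) ! 0 # del 0 (snd (f x))"
     using F(3)[OF x] k by (cases "snd (f x)") (auto simp: del_def)
    thus ?thesis
     using all[OF x] x by (simp add: acons_def le prod_eq_iff) (simp add: simplex_map_def adel_def)
   next
    case False
    thus ?thesis using F(1) by (simp add: acons_def extensional_def)
   qed
  qed
  hence "(\<Sum>i<k. sg i (ahom q (smap q (adel i) f))) = frag_of f"
   unfolding k' sum.lessThan_Suc_shift using s0 s1 by (simp add: ahom_def sg_def cong: if_cong del: sum.lessThan_Suc)
  thus ?thesis using True by (simp add: ahom_def)
 qed
qed

lemma row_exact:
 fixes y :: "('a rep set \<times> square list, 'k::ab_group_add) coeff_chain"
 assumes M: "rmod M act" and y: "supp y \<subseteq> As M act n k q"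
  and sm: "!!f. f : supp y ==> small q f" and d: "dd adel k q y = 0"
 obtains y1 :: "('a rep set \<times> square list, 'k) coeff_chain"
  where "supp y1 \<subseteq> As M act n (Suc k) q" "dd adel (Suc k) q y1 = y"
proof
 let ?y1 = "ext (ahom q) y"
 show "supp ?y1 \<subseteq> As M act n (Suc k) q"
 proof (rule keys_ext_subset[of y "{f : As M act n k q. small q f}"])
  show "supp y \<subseteq> {f : As M act n k q. small q f}" using y sm by blast
  show "supp (ahom q f) \<subseteq> As M act n (Suc k) q" if "f : {f : As M act n k q. small q f}" for f
   using acons_As[OF M, of f n k q] that by (auto simp: ahom_def)
 qed
 have "dd adel (Suc k) q ?y1 + ext (ahom q) (dd adel k q y) =
  ext (%f. frag_extend (%s. \<Sum>i<Suc k. sg i (frag_of (smap q (adel i) s))) (ahom q f) +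
   frag_extend (ahom q) (\<Sum>i<k. sg i (frag_of (smap q (adel i) f)))) y"
  unfolding dd_ext ext_ext by (rule ext_add_fun[symmetric])
 also have "\<dots> = ext frag_of y"
 proof (rule ext_cong)
  fix f assume f: "f : supp y"
  have "frag_extend (ahom q) (\<Sum>i<k. sg i (frag_of (smap q (adel i) f))) = (\<Sum>i<k. sg i (ahom q (smap q (adel i) f)))"
   by (simp add: frag_extend_sum o_def) (intro sum.cong, auto simp: sg_def frag_extend_minus)
  thus "frag_extend (%s. \<Sum>i<Suc k. sg i (frag_of (smap q (adel i) s))) (ahom q f) +
   frag_extend (ahom q) (\<Sum>i<k. sg i (frag_of (smap q (adel i) f))) = frag_of f"
   using ahom_identity[OF M, of f n k q] y f sm by auto
 qed
 finally show "dd adel (Suc k) q ?y1 = y" by (simp add: d ext_frag_of)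
qed

lemma small_As: "f : As M act n (Suc k) q ==> small q f"
 using As_sect[of f M act n "Suc k" q 0] by (auto simp: small_def)

text \<open>A square whose left edge is farthest to the right is movable.\<close>

lemma zV_nonempty:
 assumes M: "rmod M act" and z: "z : pts (abs_Res M act n)"
 shows "zV z ~= {}"
proof -
 obtain k p a \<gamma> m t where w: "zrep z = (k, (p, (a, \<gamma>), m), t)" by (metis prod.collapse)
 note v = vrep_facts[OF zrep_vrep[OF M z, unfolded w]]
 let ?c = "cc k p m t"
 note c = confs_pos[OF cc_confs[OF v(1), of t] zero_less_Suc]
 have ne: "snd ?c ~= {}" using c(3) by auto
 have "Max ((%e. fst (fst e)) ` snd ?c) : (%e. fst (fst e)) ` snd ?c" using c(2) ne by (intro Max_in) auto
 then obtain e where e: "e : snd ?c" "fst (fst e) = Max ((%e. fst (fst e)) ` snd ?c)" by auto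
 have "fst (fst e') <= fst (fst e)" if "e' : snd ?c" for e' unfolding e(2) using c(2) that by simp
 hence "e : Vc ?c" using e(1) c(4)[OF e(1)] by (fastforce simp: Vc_def good_def)
 thus ?thesis by (auto simp: zV_def w rV_def Vh_def)
qed

text \<open>The sets of points with a movable square in \<open>near a\<close> form an open cover.
  Over a simplex inside one of them, the unique such square is a continuous section.\<close>

lemma small_subdiv:
 fixes c :: "('a rep set, 'k::ab_group_add) coeff_chain"
 assumes M: "rmod M act" and c: "supp c \<subseteq> SS (abs_Res M act n) q"
 shows "\<exists>N. \<forall>f\<in>supp (subdiv N q c). sect q f ~= {}"
proof -
 let ?R = "abs_Res M act n"
 let ?U = "%a. {z : pts ?R. zV z \<inter> near a ~= {}}"
 have o: "openin ?R {z : pts ?R. zV z \<inter> T ~= {}}" if "open T" for T by (rule openin_zV_hit[OF M that])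
 have cov: "pts ?R \<subseteq> \<Union>(range ?U)"
 proof
  fix z assume z: "z : pts ?R"
  obtain e where e: "e : zV z" using zV_nonempty[OF M z] by blast
  hence "e : near e" using zV_facts(1)[OF M z e] by (simp add: near_def rgood_def)
  hence "z : ?U e" using z e by blast
  thus "z : \<Union>(range ?U)" by blast
 qed
 have "\<exists>N. \<forall>f\<in>supp (subdiv N q c). \<exists>V\<in>range ?U. f : spx q \<rightarrow> V"
  by (rule subdiv_small[OF _ cov c]) (use o open_near in auto)
 then obtain N where N: "!!f. f : supp (subdiv N q c) ==> \<exists>a. f : spx q \<rightarrow> ?U a" by blast
 have "sect q f ~= {}" if f: "f : supp (subdiv N q c)" for f
 proof -
  obtain a where a: "f : spx q \<rightarrow> ?U a" using N[OF f] by blast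
  have fS: "cts (Spx q) ?R f" using keys_subdiv[OF c, of N] f SS_continuous by blast
  define s where "s = (%x. SOME e. e : zV (f x) \<inter> near a)"
  have s: "s x : zV (f x)" "s x : near a" if "x : spx q" for x
  proof -
   have "\<exists>e. e : zV (f x) \<inter> near a" using a that by blast
   from someI_ex[OF this] show "s x : zV (f x)" "s x : near a" by (auto simp: s_def)
  qed
  have fR: "f x : pts ?R" if "x : spx q" for x using a that by blast
  have su: "e = s x" if "x : spx q" "e : zV (f x)" "e : near a" for e x
   using zV_near_unique[OF M fR[OF that(1)] that(2) s(1)[OF that(1)] that(3) s(2)[OF that(1)]] .
  have "openin (Spx q) {x : pts (Spx q). s x : T}" if T: "open T" for T
  proof -
   have "open (near a \<inter> T)" using T by (simp add: open_Int open_near)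
   from cts_preimage[OF fS o[OF this]]
   have "openin (Spx q) {x : pts (Spx q). f x : {z : pts ?R. zV z \<inter> (near a \<inter> T) ~= {}}}" .
   moreover have "{x : pts (Spx q). f x : {z : pts ?R. zV z \<inter> (near a \<inter> T) ~= {}}} =
     {x : pts (Spx q). s x : T}"
    using s su fR by fastforce
   ultimately show ?thesis by simp
  qed
  hence "cts (Spx q) euclidean s" by (auto simp: cts_def)
  hence "s : sect q f" using s(1) by (simp add: sect_def)
  thus ?thesis by blast
 qed
 thus ?thesis by blast
qed

section \<open>Stabilization, the zigzag and the vanishing range\<close>

section \<open>Stabilization lifted to the resolution\<close>

definition vtx0 :: "nat => real" where "vtx0 = (%i. if i = 0 then 1 else 0)"

text \<open>A lift of stabilization through the augmentation: the vertex with object 0, the point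
  \<open>a\<close>, and the constant path at the product of \<open>a\<close> and
  \<open>\<sigma>\<close>.\<close>

definition srep :: "'a action => nat => 'a => 'a rep" where
 "srep act n a = (0, ((\<lambda>_\<in>{..0}. 0), (a, (0, %_. act (n - 1) 1 a \<sigma>)), %_. undefined), vtx0)"

definition sz :: "(nat => 'a topology) => 'a action => nat => 'a => 'a rep set" where
 "sz M act n a = cls M act n (srep act n a)"

definition sA :: "(nat => 'a topology) => 'a action => nat => 'a => 'a rep set \<times> square list" where
 "sA M act n a = (sz M act n a, [((- 1, 0), (1, 1))])"

lemma vtx0_simplex: "vtx0 : spx 0"
 by (simp add: vtx0_def standard_simplex_def)

lemma continuous_const_path:
 assumes "cts X Y h"
 shows "cts X (cotop rtop Y) (%x. %_. h x)"
 unfolding compact_open_topology_def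
proof (rule continuous_on_generated_topo)
 let ?S = "{{f. continuous_map rtop Y f \<and> f ` K \<subseteq> U} | K U. compactin rtop K \<and> openin Y U}"
 have hY: "h x : pts Y" if "x : pts X" for x using assms that by (auto simp: cts_def)
 have "(%_. h x) : {f. continuous_map rtop Y f \<and> f ` {} \<subseteq> pts Y}" if "x : pts X" for x
  using hY[OF that] by simp
 thus "(%x. %_. h x) ` pts X \<subseteq> \<Union> ?S"
  by (intro image_subsetI UnionI[of "{f. continuous_map rtop Y f \<and> f ` {} \<subseteq> pts Y}"] CollectI exI[of _ "{}"] exI[of _ "pts Y"]) auto
 fix W assume "W : ?S"
 then obtain K U where W: "W = {f. continuous_map rtop Y f \<and> f ` K \<subseteq> U}" "openin Y U" by blast
 have "(%x. %_. h x) -` W \<inter> pts X = (if K = {} then pts X else {x : pts X. h x : U})"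
  using hY by (auto simp: W(1))
 thus "openin X ((%x. %_. h x) -` W \<inter> pts X)"
  using cts_preimage[OF assms W(2)] by simp
qed

lemma continuous_simplex_mpath:
 assumes "cts (Spx q) X h"
 shows "cts (Spx q) (mpath_space X) (%x. (0, %_. h x))"
 unfolding mpath_space_def cg_subspace_def
proof (rule cts_simplex_into_kify[of "%r. (r, undefined)"])
 show "cts (Spx q) (stop (ptop rtop (cotop rtop X))
  {(r, \<gamma>). 0 <= r \<and> (\<forall>t\<le>0. \<gamma> t = \<gamma> 0) \<and> (\<forall>t\<ge>r. \<gamma> t = \<gamma> r)}) (%x. (0, %_. h x))"
  by (intro cts_into cts_pair continuous_const_path[OF assms]) auto
qed (auto simp: inj_def)

lemma continuous_srep:
 fixes M :: "nat => 'a topology"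
 assumes M: "rmod M act" and n: "0 < n" and f: "cts (Spx q) (M (n - 1)) f"
 shows "cts (Spx q) (preR M act n) (%x. srep act n (f x))"
proof -
 let ?X = "Spx q"
 let ?p = "\<lambda>_\<in>{..0::nat}. 0::nat"
 have h: "cts ?X (M n) (%x. act (n - 1) 1 (f x) \<sigma>)"
  using cts_act[OF M locally_compact_simplex Hausdorff_space_simplex_space f, of 1 "%_. \<sigma>"] \<sigma>_mem n by simp
 have r: "cts ?X (Res M act n 0) (%x. (f x, (0, %_. act (n - 1) 1 (f x) \<sigma>)))"
 proof -
  have "cts ?X (cg_subspace (ptop (M (n - (0 + 1))) (mpath_space (M n)))
      {(a, \<gamma>). mend \<gamma> = act (n - (0 + 1)) (0 + 1) a (spow (0 + 1))}) (%x. (f x, (0, %_. act (n - 1) 1 (f x) \<sigma>)))"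
   unfolding cg_subspace_def
  proof (rule cts_simplex_into_kify[of "%r. (undefined, (r, undefined))"])
   show "cts ?X (stop (ptop (M (n - (0 + 1))) (mpath_space (M n)))
      {(a, \<gamma>). mend \<gamma> = act (n - (0 + 1)) (0 + 1) a (spow (0 + 1))}) (%x. (f x, (0, %_. act (n - 1) 1 (f x) \<sigma>)))"
    using f by (intro cts_into cts_pair continuous_simplex_mpath h)
     (auto simp: mend_def)
  qed (auto simp: inj_def)
  thus ?thesis using n by (simp add: Res_def)
 qed
 have b: "cts ?X (barR M act n 0) (%x. (?p, (f x, (0, %_. act (n - 1) 1 (f x) \<sigma>)), %_. undefined))"
 proof -
  have "cts ?X (cg_prod (Res M act n (?p 0)) (product_topology (%j. Delta_hom (?p (Suc j)) (?p j)) {..<0}))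
    (%x. ((f x, (0, %_. act (n - 1) 1 (f x) \<sigma>)), %_. undefined))"
   unfolding cg_prod_def
  proof (rule cts_simplex_into_kify[of "%r. ((undefined, (r, undefined)), undefined)"])
   show "cts ?X (ptop (Res M act n (?p 0)) (product_topology (%j. Delta_hom (?p (Suc j)) (?p j)) {..<0}))
    (%x. ((f x, (0, %_. act (n - 1) 1 (f x) \<sigma>)), %_. undefined))"
    using r by (intro cts_pair) auto
  qed (auto simp: inj_def)
  from cts_compose[OF this continuous_map_component_injection[of ?p "{..0} \<rightarrow>\<^sub>E UNIV"
     "%p. cg_prod (Res M act n (p 0)) (product_topology (%j. Delta_hom (p (Suc j)) (p j)) {..<0})"]]
  show ?thesis by (simp add: bar_space_def o_def)
 qed
 have c: "cts ?X (cg_prod (barR M act n 0) (Spx 0))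
   (%x. ((?p, (f x, (0, %_. act (n - 1) 1 (f x) \<sigma>)), %_. undefined), vtx0))"
  unfolding cg_prod_def
 proof (rule cts_simplex_into_kify[of "%r. (undefined, %_. r)"])
  show "cts ?X (ptop (barR M act n 0) (Spx 0))
   (%x. ((?p, (f x, (0, %_. act (n - 1) 1 (f x) \<sigma>)), %_. undefined), vtx0))"
   using b vtx0_simplex by (intro cts_pair) auto
 qed (auto simp: inj_def fun_eq_iff)
 from cts_compose[OF this continuous_map_component_injection[of 0 UNIV "%k. cg_prod (barR M act n k) (Spx k)"]]
 show ?thesis by (simp add: preR_def srep_def o_def)
qed

lemma continuous_sz:
 assumes "rmod M act" "0 < n" "cts (Spx q) (M (n - 1)) f"
 shows "cts (Spx q) (abs_Res M act n) (%x. sz M act n (f x))"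
 using cts_compose[OF continuous_srep[OF assms] quotient_imp_continuous_map[OF quotient_map_quotient_topology[of "preR M act n" "cls M act n"]]]
 by (simp add: abs_Res_eq sz_def o_def)

lemma srep_facts:
 assumes M: "rmod M act" and n: "0 < n" and a: "a : pts (M (n - 1))"
 shows "sz M act n a : pts (abs_Res M act n)" "\<epsilon> (sz M act n a) = act (n - 1) 1 a \<sigma>"
  "zV (sz M act n a) = {((- 1, 0), (1, 1))}" "brho (phi act n (sA M act n a)) = a"
proof -
 have "cts (Spx 0) (M (n - 1)) (%_. a)" using a by simp
 from continuous_srep[OF M n this, unfolded cts_def] have pre: "srep act n a : pts (preR M act n)"
  using vtx0_simplex by (auto simp: Pi_iff)
 thus R: "sz M act n a : pts (abs_Res M act n)" by (simp add: sz_def topspace_abs_Res)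
 note v = vrep_preR[OF pre]
 show "\<epsilon> (sz M act n a) = act (n - 1) 1 a \<sigma>"
  using \<epsilon>_eq[OF R] cls_self[of "srep act n a" M act n] by (simp add: sz_def srep_def mstart_def)
 have c: "cc 0 p m t = \<sigma>" if "p 0 = 0" for p m t using that by (simp add: cc_def)
 have V: "rV (srep act n a) = {((- 1, 0), (1, 1))}"
  by (auto simp: rV_def srep_def c Vh_def Vc_def \<sigma>_def shift_def)
 thus "zV (sz M act n a) = {((- 1, 0), (1, 1))}" using z_cls(1)[OF M v] by (simp add: sz_def)
 \<comment> \<open>The single vertex has object 0 < 1 and carries all the weight, so the margin is
   the full width 1, and removing the square leaves the unit.\<close>
 have "mu 1 0 (\<lambda>_\<in>{..0::nat}. 0::nat) (%_. undefined) vtx0 = 1"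
  by (simp add: mu_def wsum_def dsum_def c vtx0_def \<sigma>_def)
 hence S: "rS (srep act n a) {((- 1, 0), (1, 1))} {} = sunit"
  by (simp add: rS_def srep_def c Gs_def \<sigma>_def shift_def sunit_def)
 have "zG act n (sz M act n a) {((- 1, 0), (1, 1))} {} = rG act n (srep act n a) {((- 1, 0), (1, 1))} {}"
  unfolding sz_def by (rule z_cls(3)[OF M v]) (use V in \<open>auto simp: validF_def\<close>)
 also have "\<dots> = act (n - 1) 0 a sunit"
  unfolding rG_def S by (simp add: srep_def sunit_def)
 also have "\<dots> = a" by (rule act_unit[OF M a])
 finally show "brho (phi act n (sA M act n a)) = a" by (simp add: brho_def phi_def sA_def)
qed

lemma sA_As:
 assumes M: "rmod M act" and n: "0 < n" and f: "f : SS (M (n - 1)) q"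
 shows "smap q (sA M act n) f : As M act n 1 q"
proof -
 have v: "smap q (sA M act n) f x = (sz M act n (f x), [((- 1, 0), (1, 1))])" if "x : spx q" for x
  using that by (simp add: simplex_map_def sA_def)
 show ?thesis
  unfolding As_def
 proof (rule CollectI, intro conjI ballI allI impI)
  show "smap q (sA M act n) f : extensional (spx q)" by (simp add: simplex_map_def)
  show "cts (Spx q) (abs_Res M act n) (%x. fst (smap q (sA M act n) f x))"
   by (rule cts_eq[OF continuous_sz[OF M n SS_continuous[OF f]]]) (simp add: v)
  show "length (snd (smap q (sA M act n) f x)) = 1" "column (snd (smap q (sA M act n) f x))"
   "set (snd (smap q (sA M act n) f x)) \<subseteq> zV (fst (smap q (sA M act n) f x))" if x: "x : spx q" for x
   using srep_facts(3)[OF M n SS_image[OF f x]] by (auto simp: v[OF x] column_def rgood_def)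
  show "cts (Spx q) euclidean (%x. snd (smap q (sA M act n) f x) ! i)" if "i < 1" for i
   by (rule cts_eq[of _ _ "%_. ((- 1, 0), (1, 1))"]) (use that in \<open>auto simp: v\<close>)
 qed
qed


section \<open>Faces of simplices with columns\<close>

lemma As_face:
 assumes f: "f : As M act n k (Suc q)" and i: "i <= Suc q"
 shows "singular_face (Suc q) i f : As M act n k q"
proof -
 note F = As_facts[OF f]
 have mem: "sface i x : spx (Suc q)" if "x : spx q" for x
  using simplical_face_in_standard_simplex[of "Suc q" i x] i that by simp
 have v: "singular_face (Suc q) i f x = f (sface i x)" if "x : spx q" for x
  using that by (simp add: singular_face_def)
 have c: "cts (Spx q) (Spx (Suc q)) (sface i)"
  unfolding simplex_space_def
 proof (intro cts_into)
  show "cts (stop (powertop_real UNIV) (spx q)) (powertop_real UNIV) (sface i)"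
   unfolding continuous_map_componentwise_UNIV simplical_face_def
   by (auto intro!: cts_sub continuous_map_product_projection)
  show "sface i : pts (stop (powertop_real UNIV) (spx q)) \<rightarrow> spx (Suc q)"
   using mem by auto
 qed
 have cc: "cts (Spx q) Z (%x. g (sface i x))" if "cts (Spx (Suc q)) Z g" for Z and g :: "_ => 'z"
  using cts_compose[OF c that] by (simp add: o_def)
 show ?thesis
  unfolding As_def
 proof (rule CollectI, intro conjI ballI allI impI)
  show "singular_face (Suc q) i f : extensional (spx q)" by (simp add: singular_face_def)
  show "cts (Spx q) (abs_Res M act n) (%x. fst (singular_face (Suc q) i f x))"
   by (rule cts_eq[OF cc[OF F(2)]]) (simp add: v)
  show "length (snd (singular_face (Suc q) i f x)) = k" "column (snd (singular_face (Suc q) i f x))"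
   "set (snd (singular_face (Suc q) i f x)) \<subseteq> zV (fst (singular_face (Suc q) i f x))" if x: "x : spx q" for x
   using F(3-5)[OF mem[OF x]] by (auto simp: v[OF x])
  show "cts (Spx q) euclidean (%x. snd (singular_face (Suc q) i f x) ! j)" if "j < k" for j
   by (rule cts_eq[OF cc[OF F(6)[OF that]]]) (simp add: v)
 qed
qed

lemma keys_coeff_boundary_gen:
 assumes "supp c \<subseteq> A" "!!s i. s : A ==> i <= p ==> 0 < p ==> singular_face p i s : B"
 shows "supp (cbd p c) \<subseteq> B"
proof (cases "p = 0")
 case False
 show ?thesis
  unfolding coeff_boundary_def if_not_P[OF False]
 proof (rule keys_sum_subset, rule keys_sum_subset)
  fix s i assume "s : supp c" "i : {..p}"
  hence "singular_face p i s : B" using assms False by blast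
  thus "supp (Poly_Mapping.single (singular_face p i s)
    (if even i then Poly_Mapping.lookup c s else - Poly_Mapping.lookup c s)) \<subseteq> B"
   using keys_single[of "singular_face p i s"] by auto
 qed
qed (simp add: coeff_boundary_def)

lemma keys_boundary_As:
 "supp c \<subseteq> As M act n k (Suc q) ==> supp (cbd (Suc q) c) \<subseteq> As M act n k q"
 by (rule keys_coeff_boundary_gen) (use As_face in blast)+


section \<open>The zigzag\<close>

abbreviation stabdom :: "(nat => 'a topology) => nat => 'a topology" where
 "stabdom M n \<equiv> (if n = 0 then empty_space else M (n - 1))"

abbreviation stab :: "'a action => nat => 'a => 'a" where
 "stab act n \<equiv> %a. act (n - 1) 1 a \<sigma>"

definition vanish :: "'k::ab_group_add itself => (nat => 'a topology) => 'a action => nat => nat => bool" where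
 "vanish K M act n d \<longleftrightarrow> hsurj K (stabdom M n) (M n) (stab act n) d \<and>
  (0 < d --> hinj K (stabdom M n) (M n) (stab act n) (d - 1))"

lemma SS_empty: "SS empty_space q = {}"
proof -
 have "s \<notin> SS empty_space q" for s :: "(nat => real) => 'b"
  using SS_image[of s q empty_space "vtx q"] vtx by auto
 thus ?thesis by blast
qed

lemma Bs_empty: "n < k ==> Bs M act n k q = {}"
 by (auto simp: Bs_def Bfam_def)

lemma keys_dd_Bs:
 assumes "supp c \<subseteq> Bs M act n (Suc k) q"
 shows "supp (dd bdel (Suc k) q c) \<subseteq> Bs M act n k q"
 by (rule keys_dd[OF assms]) (use bdel_Bs[of _ "Suc k"] in auto)

lemma dd_dd_Bs:
 assumes "supp c \<subseteq> Bs M act n (Suc k) q"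
 shows "dd bdel k q (dd bdel (Suc k) q c) = 0"
proof (rule dd_dd, rule bdel_bdel)
 fix i j s x assume *: "i < j" "j < Suc k" "s : supp c" "x : spx q"
 hence "s : Bs M act n (Suc k) q" using assms by blast
 thus "j < length (fst (s x))" using *(2,4) by (auto simp: Bs_def Bfam_def)
qed

text \<open>For even k the columns k + 1 and k model the cofibre of stabilization into
  \<open>M (n - k)\<close>. Injectivity makes \<open>b1\<close> the boundary of some
  \<open>c0\<close>; surjectivity then writes the cycle \<open>b0 - dd bdel (Suc k) r c0\<close> as
  a value of the differential up to a boundary.\<close>

lemma pair_exact:
 fixes b0 b1 :: "('a bdata, 'k::ab_group_add) coeff_chain" and M :: "nat => 'a topology"
 assumes M: "rmod M act" and k: "even k"
  and V: "k <= n ==> vanish TYPE('k) M act (n - k) r"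
  and b0: "supp b0 \<subseteq> Bs M act n k r"
  and b1: "0 < r ==> cyc (Bs M act n (Suc k)) (r - 1) b1" "0 < r ==> cbd r b0 = dd bdel (Suc k) (r - 1) b1"
 shows "\<exists>c c'. supp c \<subseteq> Bs M act n (Suc k) r \<and> supp c' \<subseteq> Bs M act n k (Suc r) \<and>
  b0 = dd bdel (Suc k) r c + cbd (Suc r) c'"
proof (cases "k <= n")
 case False
 hence "b0 = 0" using b0 Bs_empty[of n k M act r] by auto
 thus ?thesis by (intro exI[of _ 0]) simp
next
 case True
 let ?N = "n - k"
 have S: "hsurj TYPE('k) (stabdom M ?N) (M ?N) (stab act ?N) r"
  and I: "0 < r ==> hinj TYPE('k) (stabdom M ?N) (M ?N) (stab act ?N) (r - 1)"
  using V[OF True] by (auto simp: vanish_def)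
 have N1: "n - Suc k = ?N - 1" by simp
 have "\<exists>c0. supp c0 \<subseteq> Bs M act n (Suc k) r \<and> (0 < r --> cbd r c0 = b1)"
 proof (cases "0 < r \<and> Suc k <= n")
  case False
  have "b1 = 0" if "0 < r"
  proof -
   have "n < Suc k" using that False by simp
   thus ?thesis using b1(1)[OF that] Bs_empty[of n "Suc k" M act "r - 1"] by (auto simp: cyc_def)
  qed
  thus ?thesis by (intro exI[of _ 0]) auto
 next
  case T: True
  then obtain r' where r: "r = Suc r'" by (cases r) auto
  have sd: "stabdom M ?N = M (n - Suc k)" using T by simp
  have cb: "cyc (Bs M act n (Suc k)) r' b1" using b1(1) r by simp
  have "bdr (SS (M ?N)) r' (cmap r' brho (dd bdel (Suc k) r' b1) - cmap r' (stab act ?N) (cmap r' brho b1))"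
   using brho_dd[OF M cb] T k by simp
  moreover have "bdr (SS (M ?N)) r' (cmap r' brho (dd bdel (Suc k) r' b1))"
  proof -
   have "dd bdel (Suc k) r' b1 = cbd (Suc r') b0" using b1(2) r by simp
   hence "cmap r' brho (dd bdel (Suc k) r' b1) = cbd (Suc r') (cmap (Suc r') brho b0)"
    by (simp add: cbd_cmap)
   moreover have "supp (cmap (Suc r') brho b0) \<subseteq> SS (M ?N) (Suc r')"
    by (rule keys_cmap[OF b0[unfolded r]]) (rule brho_SS)
   ultimately show ?thesis unfolding bdr_def by metis
  qed
  ultimately have "bdr (SS (M ?N)) r' (cmap r' (stab act ?N) (cmap r' brho b1))"
   using bdr_diff by fastforce
  moreover have "cyc (SS (M (n - Suc k))) r' (cmap r' brho b1)" by (rule cyc_cmap[OF cb]) (rule brho_SS)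
  hence "cyc (SS (stabdom M ?N)) r' (cmap r' brho b1)" unfolding sd .
  ultimately have "bdr (SS (M (n - Suc k))) r' (cmap r' brho b1)"
   using I[unfolded r, OF zero_less_Suc] unfolding hinj_def sd diff_Suc_1 by blast
  from bdr_brho_imp[OF M cb _ this] T r show ?thesis by (auto simp: bdr_def)
 qed
 then obtain c0 where c0: "supp c0 \<subseteq> Bs M act n (Suc k) r" "0 < r ==> cbd r c0 = b1" by blast
 let ?w = "b0 - dd bdel (Suc k) r c0"
 have w: "cyc (Bs M act n k) r ?w"
 proof -
  have "supp ?w \<subseteq> Bs M act n k r"
   using b0 keys_dd_Bs[OF c0(1)] by (rule keys_diff_subset)
  moreover have "cbd r ?w = 0"
   using b1(2) c0(2) by (cases "r = 0") (simp_all add: cbd_diff cbd_dd)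
  ultimately show ?thesis by (simp add: cyc_def)
 qed
 have rw: "cyc (SS (M ?N)) r (cmap r brho ?w)" by (rule cyc_cmap[OF w]) (rule brho_SS)
 obtain x where x: "cyc (SS (stabdom M ?N)) r x" "bdr (SS (M ?N)) r (cmap r brho ?w - cmap r (stab act ?N) x)"
  using S rw unfolding hsurj_def by blast
 show ?thesis
 proof (cases "?N = 0")
  case N0: True
  hence "x = 0" using x(1) by (simp add: cyc_def SS_empty)
  hence "bdr (Bs M act n k) r ?w" using bdr_brho_imp[OF M w True] x(2) by simp
  then obtain c' where c': "supp c' \<subseteq> Bs M act n k (Suc r)" "cbd (Suc r) c' = ?w" by (auto simp: bdr_def)
  show ?thesis using c0(1) c' by (intro exI[of _ c0] exI[of _ c']) simp
 next
  case False
  hence kn: "Suc k <= n" by simp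
  let ?i = "cmap r (iota act n (Suc k)) x"
  have x': "cyc (SS (M (n - Suc k))) r x" using x(1) False N1 by simp
  have i: "cyc (Bs M act n (Suc k)) r ?i" by (rule cyc_cmap[OF x']) (rule iota_Bs[OF M kn])
  have ri: "cmap r brho ?i = x"
  proof -
   have "cmap r brho ?i = cmap r (%x. x) x" by (simp add: cmap_cmap)
   thus ?thesis using cmap_ident[of x r] x' SS_extensional by (fastforce simp: cyc_def)
  qed
  have "bdr (SS (M ?N)) r (cmap r brho (dd bdel (Suc k) r ?i) - cmap r (stab act ?N) x)"
   using brho_dd[OF M i kn] k ri by simp
  from bdr_diff[OF x(2) this]
  have "bdr (SS (M ?N)) r (cmap r brho (?w - dd bdel (Suc k) r ?i))" by (simp add: cmap_diff)
  moreover have "cyc (Bs M act n k) r (?w - dd bdel (Suc k) r ?i)"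
  proof (rule cyc_diff[OF w])
   show "cyc (Bs M act n k) r (dd bdel (Suc k) r ?i)"
    using keys_dd_Bs[of ?i M act n k r] i by (simp add: cyc_def cbd_dd)
  qed
  ultimately have "bdr (Bs M act n k) r (?w - dd bdel (Suc k) r ?i)" using bdr_brho_imp[OF M _ True] by blast
  then obtain c' where c': "supp c' \<subseteq> Bs M act n k (Suc r)" "cbd (Suc r) c' = ?w - dd bdel (Suc k) r ?i"
   by (auto simp: bdr_def)
  have "supp (c0 + ?i) \<subseteq> Bs M act n (Suc k) r"
   using c0(1) i by (intro keys_add_subset) (auto simp: cyc_def)
  thus ?thesis using c' by (intro exI[of _ "c0 + ?i"] exI[of _ c']) (simp add: dd_add)
 qed
qed

text \<open>Two columns at a time: the induction hypothesis for k + 2 allows \<open>b 1\<close> to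
  be replaced by a cycle without changing its horizontal differential, after which
  \<open>pair_exact\<close> applies to the columns k + 1 and k.\<close>

lemma descend:
 fixes b :: "nat => ('a bdata, 'k::ab_group_add) coeff_chain" and M :: "nat => 'a topology"
 assumes M: "rmod M act" and k: "even k"
  and V: "!!j. 2 * j <= r ==> k + 2 * j <= n ==> vanish TYPE('k) M act (n - (k + 2 * j)) (r - 2 * j)"
  and b: "!!i. i <= r ==> supp (b i) \<subseteq> Bs M act n (k + i) (r - i)"
  and db: "!!i. i < r ==> cbd (r - i) (b i) = dd bdel (k + Suc i) (r - Suc i) (b (Suc i))"
 shows "\<exists>c'. supp c' \<subseteq> Bs M act n k (Suc r) \<and> dd bdel k r (b 0) = dd bdel k r (cbd (Suc r) c')"
 using k V b db
proof (induction r arbitrary: k b rule: less_induct)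
 case (less r)
 have "\<exists>b1. (0 < r --> cyc (Bs M act n (Suc k)) (r - 1) b1) \<and> (0 < r --> cbd r (b 0) = dd bdel (Suc k) (r - 1) b1)"
 proof (cases "r < 2")
  case True
  have "cyc (Bs M act n (Suc k)) (r - 1) (b 1)" if "0 < r"
   using less.prems(3)[of 1] that True by (simp add: cyc_def)
  thus ?thesis using less.prems(4)[of 0] by (intro exI[of _ "b 1"]) simp
 next
  case False
  then obtain r' where r: "r = Suc (Suc r')" by (metis Suc_pred not_less_eq less_2_cases_iff neq0_conv One_nat_def)
  have "\<exists>c2. supp c2 \<subseteq> Bs M act n (k + 2) (Suc r') \<and>
   dd bdel (k + 2) r' ((%i. b (i + 2)) 0) = dd bdel (k + 2) r' (cbd (Suc r') c2)"
  proof (rule less.IH)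
   show "r' < r" "even (k + 2)" using r less.prems(1) by auto
   show "vanish TYPE('k) M act (n - (k + 2 + 2 * j)) (r' - 2 * j)" if "2 * j <= r'" "k + 2 + 2 * j <= n" for j
    using less.prems(2)[of "Suc j"] that r by (simp add: add_ac)
   show "supp (b (i + 2)) \<subseteq> Bs M act n (k + 2 + i) (r' - i)" if "i <= r'" for i
    using less.prems(3)[of "i + 2"] that r by (simp add: add_ac)
   show "cbd (r' - i) (b (i + 2)) = dd bdel (k + 2 + Suc i) (r' - Suc i) (b (Suc i + 2))" if "i < r'" for i
    using less.prems(4)[of "i + 2"] that r by (simp add: add_ac)
  qed
  then obtain c2 where c2: "supp c2 \<subseteq> Bs M act n (Suc (Suc k)) (Suc r')"
   "dd bdel (Suc (Suc k)) r' (b 2) = dd bdel (Suc (Suc k)) r' (cbd (Suc r') c2)" by (auto simp: numeral_2_eq_2)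
  let ?b = "b 1 - dd bdel (Suc (Suc k)) (Suc r') c2"
  have "supp ?b \<subseteq> Bs M act n (Suc k) (Suc r')"
   using less.prems(3)[of 1] r keys_dd_Bs[OF c2(1)] by (intro keys_diff_subset) simp_all
  moreover have "cbd (Suc r') (b 1) = dd bdel (Suc (Suc k)) r' (b 2)"
   using less.prems(4)[of 1] r by (simp add: numeral_2_eq_2)
  hence "cbd (Suc r') ?b = 0"
   using c2(2) by (simp add: cbd_diff cbd_dd)
  moreover have "cbd r (b 0) = dd bdel (Suc k) (Suc r') ?b"
   using less.prems(4)[of 0] r dd_dd_Bs[OF c2(1)] by (simp add: dd_diff)
  ultimately show ?thesis using r by (intro exI[of _ ?b]) (simp add: cyc_def)
 qed
 then obtain b1 where b1: "0 < r ==> cyc (Bs M act n (Suc k)) (r - 1) b1"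
  "0 < r ==> cbd r (b 0) = dd bdel (Suc k) (r - 1) b1" by blast
 have "supp (b 0) \<subseteq> Bs M act n k r" using less.prems(3)[of 0] by simp
 moreover have "k <= n ==> vanish TYPE('k) M act (n - k) r" using less.prems(2)[of 0] by simp
 ultimately obtain c c' where c: "supp c \<subseteq> Bs M act n (Suc k) r" "supp c' \<subseteq> Bs M act n k (Suc r)"
  "b 0 = dd bdel (Suc k) r c + cbd (Suc r) c'"
  using pair_exact[OF M less.prems(1) _ _ b1] by blast
 thus ?case using dd_dd_Bs[OF c(1)] by (intro exI[of _ c']) (simp add: dd_add)
qed

text \<open>A staircase: the vertical boundary of each term is a row cycle and lifts to the next
  column by \<open>row_exact\<close>. Smallness is automatic for k \<ge> 1, where a section is part
  of the data.\<close>

lemma resolve: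
 fixes y :: "('a rep set \<times> square list, 'k::ab_group_add) coeff_chain" and M :: "nat => 'a topology"
 assumes M: "rmod M act" and "0 < k" "supp y \<subseteq> As M act n k r"
  "0 < r ==> dd adel k (r - 1) (cbd r y) = 0"
 shows "\<exists>Y :: nat => ('a rep set \<times> square list, 'k) coeff_chain. Y 0 = y \<and>
  (\<forall>i\<le>r. supp (Y i) \<subseteq> As M act n (k + i) (r - i)) \<and>
  (\<forall>i<r. cbd (r - i) (Y i) = dd adel (k + Suc i) (r - Suc i) (Y (Suc i)))"
 using assms(2-)
proof (induction r arbitrary: k y)
 case 0
 thus ?case by (intro exI[of _ "%_. y"]) simp
next
 case (Suc r)
 have k: "supp (cbd (Suc r) y) \<subseteq> As M act n k r" by (rule keys_boundary_As[OF Suc(3)])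
 obtain k' where k': "k = Suc k'" using Suc(2) by (cases k) auto
 have sm: "small r f" if "f : supp (cbd (Suc r) y)" for f
  using small_As k that k' by blast
 obtain y' :: "('a rep set \<times> square list, 'k) coeff_chain" where y': "supp y' \<subseteq> As M act n (Suc k) r"
  "dd adel (Suc k) r y' = cbd (Suc r) y"
  using row_exact[OF M k sm] Suc(4) by auto
 have "dd adel (Suc k) (r - 1) (cbd r y') = 0" if "0 < r"
 proof -
  have "dd adel (Suc k) (r - 1) (cbd r y') = cbd r (cbd (Suc r) y)"
   by (simp add: y'(2)[symmetric] cbd_dd)
  thus ?thesis by (simp add: coeff_boundary_boundary)
 qed
 then obtain Y where Y: "Y 0 = y'" "!!i. i <= r ==> supp (Y i) \<subseteq> As M act n (Suc k + i) (r - i)"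
  "!!i. i < r ==> cbd (r - i) (Y i) = dd adel (Suc k + Suc i) (r - Suc i) (Y (Suc i))"
  using Suc(1)[of "Suc k" y'] y'(1) by auto
 show ?case
 proof (intro exI[of _ "case_nat y Y"] conjI allI impI)
  show "case_nat y Y 0 = y" by simp
  show "supp (case_nat y Y i) \<subseteq> As M act n (k + i) (Suc r - i)" if "i <= Suc r" for i
   using that Suc(3) Y(2) by (cases i) auto
  show "cbd (Suc r - i) (case_nat y Y i) = dd adel (k + Suc i) (Suc r - Suc i) (case_nat y Y (Suc i))" if "i < Suc r" for i
   using that y'(2) Y(1,3) by (cases i) auto
 qed
qed

lemma cmap_phi_dd:
 assumes M: "rmod M act" and c: "supp c \<subseteq> As M act n k q"
 shows "cmap q (phi act n) (dd adel k q c) = dd bdel k q (cmap q (phi act n) c)"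
 by (rule cmap_dd) (use phi_adel[OF M] c in blast)

lemma keys_phi:
 assumes M: "rmod M act" and c: "supp c \<subseteq> As M act n k q"
 shows "supp (cmap q (phi act n) c) \<subseteq> Bs M act n k q"
 by (rule keys_cmap[OF c]) (rule phi_Bs[OF M])

text \<open>\<open>x0\<close> is 0 in the proof of surjectivity and a lift of the given cycle in
  that of injectivity. In the first complex \<open>y\<close> lifts to \<open>y1\<close>, and
  \<open>cbd (Suc r) y1 - x0\<close> is a row cycle that starts a staircase in the columns from 2
  on. The vanishing hypotheses speak about the second complex, so \<open>phi\<close> carries the
  staircase there, and \<open>descend\<close> yields the correction of the image of
  \<open>y1\<close>.\<close>

lemma zigzag:
 fixes y x0 :: "('a rep set \<times> square list, 'k::ab_group_add) coeff_chain" and M :: "nat => 'a topology"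
 assumes M: "rmod M act"
  and V: "!!j. 1 <= j ==> 2 * j <= Suc q ==> 2 * j <= n ==> vanish TYPE('k) M act (n - 2 * j) (Suc q - 2 * j)"
  and y: "supp y \<subseteq> As M act n 0 q" "!!f. f : supp y ==> small q f"
  and x0: "q = 0 ==> x0 = 0" "0 < q ==> cyc (As M act n 1) (q - 1) x0" "0 < q ==> cbd q y = dd adel 1 (q - 1) x0"
 shows "\<exists>b. supp b \<subseteq> Bs M act n 1 q \<and> dd bdel 1 q b = cmap q (phi act n) y \<and>
  cbd q b = cmap (q - 1) (phi act n) x0"
proof -
 have "dd adel 0 q y = 0" by (simp add: dd_def)
 from row_exact[OF M y this]
 obtain y1 :: "('a rep set \<times> square list, 'k) coeff_chain" where y1: "supp y1 \<subseteq> As M act n 1 q" "dd adel 1 q y1 = y"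
  by auto
 let ?p = "phi act n"
 have p1: "supp (cmap q ?p y1) \<subseteq> Bs M act n 1 q" "dd bdel 1 q (cmap q ?p y1) = cmap q ?p y"
  using keys_phi[OF M y1(1)] cmap_phi_dd[OF M y1(1)] y1(2) by auto
 show ?thesis
 proof (cases q)
  case 0
  thus ?thesis using p1 x0(1) by (intro exI[of _ "cmap q ?p y1"]) simp
 next
  case (Suc r)
  have x: "supp x0 \<subseteq> As M act n 1 r" "cbd r x0 = 0" "cbd q y = dd adel 1 r x0"
   using x0(2,3) Suc by (auto simp: cyc_def)
  let ?u = "cbd (Suc r) y1 - x0"
  have u: "supp ?u \<subseteq> As M act n 1 r"
   using keys_boundary_As[of y1 M act n 1 r] y1(1) x(1) Suc by (intro keys_diff_subset) auto
  have us: "small r f" if "f : supp ?u" for f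
   using small_As[of f M act n 0 r] u that by auto
  have "dd adel 1 r ?u = cbd (Suc r) (dd adel 1 (Suc r) y1) - dd adel 1 r x0"
   by (simp add: dd_diff cbd_dd)
  hence "dd adel 1 r ?u = 0" using y1(2) x(3) Suc by simp
  from row_exact[OF M u us this]
  obtain y2 :: "('a rep set \<times> square list, 'k) coeff_chain" where y2: "supp y2 \<subseteq> As M act n 2 r" "dd adel 2 r y2 = ?u"
   by (auto simp: numeral_2_eq_2)
  have "dd adel 2 (r - 1) (cbd r y2) = 0" if "0 < r"
  proof -
   have "dd adel 2 (r - 1) (cbd r y2) = cbd r ?u"
    by (simp add: y2(2)[symmetric] cbd_dd)
   also have "\<dots> = 0" using x(2) by (simp add: cbd_diff coeff_boundary_boundary)
   finally show ?thesis .
  qed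
  then obtain Y :: "nat => ('a rep set \<times> square list, 'k) coeff_chain" where Y: "Y 0 = y2"
   "!!i. i <= r ==> supp (Y i) \<subseteq> As M act n (2 + i) (r - i)"
   "!!i. i < r ==> cbd (r - i) (Y i) = dd adel (2 + Suc i) (r - Suc i) (Y (Suc i))"
   using resolve[OF M _ y2(1)] by auto
  let ?b = "%i. cmap (r - i) ?p (Y i)"
  have "\<exists>c. supp c \<subseteq> Bs M act n 2 (Suc r) \<and> dd bdel 2 r (?b 0) = dd bdel 2 r (cbd (Suc r) c)"
  proof (rule descend[OF M])
   show "even (2::nat)" by simp
   show "vanish TYPE('k) M act (n - (2 + 2 * j)) (r - 2 * j)" if "2 * j <= r" "2 + 2 * j <= n" for j
    using V[of "Suc j"] that Suc by simp
   show "supp (?b i) \<subseteq> Bs M act n (2 + i) (r - i)" if "i <= r" for i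
    by (rule keys_phi[OF M Y(2)[OF that]])
   show "cbd (r - i) (?b i) = dd bdel (2 + Suc i) (r - Suc i) (?b (Suc i))" if "i < r" for i
   proof -
    have "cbd (r - i) (?b i) = cmap (r - i - 1) ?p (cbd (r - i) (Y i))"
     by (simp add: cbd_cmap)
    also have "\<dots> = cmap (r - Suc i) ?p (dd adel (2 + Suc i) (r - Suc i) (Y (Suc i)))"
     using Y(3)[OF that] by simp
    also have "\<dots> = dd bdel (2 + Suc i) (r - Suc i) (?b (Suc i))"
     by (rule cmap_phi_dd[OF M Y(2)]) (use that in simp)
    finally show ?thesis .
   qed
  qed
  then obtain c where c: "supp c \<subseteq> Bs M act n (Suc 1) q"
   "dd bdel 2 r (cmap r ?p y2) = dd bdel 2 r (cbd (Suc r) c)" using Y(1) Suc by (auto simp: numeral_2_eq_2)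
  let ?b1 = "cmap q ?p y1 - dd bdel (Suc 1) q c"
  have "dd bdel 2 r (cmap r ?p y2) = cmap r ?p ?u" using cmap_phi_dd[OF M y2(1)] y2(2) by simp
  hence "cbd q ?b1 = cmap r ?p x0"
   using c(2) Suc by (simp add: cbd_diff cbd_cmap cbd_dd cmap_diff numeral_2_eq_2 diff_eq_eq add.commute)
  moreover have "dd bdel 1 q ?b1 = cmap q ?p y" using p1(2) dd_dd_Bs[OF c(1)] by (simp add: dd_diff)
  moreover have "supp ?b1 \<subseteq> Bs M act n 1 q"
   using p1(1) keys_dd_Bs[OF c(1)] by (rule keys_diff_subset)
  ultimately show ?thesis using Suc by (intro exI[of _ ?b1]) simp
 qed
qed

lemma pair_As:
 assumes "f : SS (abs_Res M act n) q"
 shows "smap q (%z. (z, [])) f : As M act n 0 q"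
proof -
 have v: "smap q (%z. (z, [])) f x = (f x, [])" if "x : spx q" for x
  using that by (simp add: simplex_map_def)
 show ?thesis
  unfolding As_def
 proof (rule CollectI, intro conjI ballI allI impI)
  show "smap q (%z. (z, [])) f : extensional (spx q)" by (simp add: simplex_map_def)
  show "cts (Spx q) (abs_Res M act n) (%x. fst (smap q (%z. (z, [])) f x))"
   by (rule cts_eq[OF SS_continuous[OF assms]]) (simp add: v)
 qed (auto simp: v column_def)
qed

lemma keys_cmap_ex: "s : supp (cmap q g c) ==> \<exists>f\<in>supp c. s = smap q g f"
 using keys_cmap[of c "supp c" q g "smap q g ` supp c"] by blast

lemma small_pair:
 assumes "!!f. f : supp c ==> sect q f ~= {}" "g : supp (cmap q (%z. (z, [])) c)"
 shows "small q g"
proof -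
 obtain f where f: "f : supp c" "g = smap q (%z. (z, [])) f" using keys_cmap_ex[OF assms(2)] by blast
 have "sect q (%x. fst (g x)) = sect q f" by (rule sect_cong) (simp add: f(2) simplex_map_def)
 thus ?thesis using assms(1)[OF f(1)] by (simp add: small_def)
qed

lemma vanish_step:
 fixes M :: "nat => 'a topology"
 assumes M: "rmod M act"
  and V: "!!j. 1 <= j ==> 2 * j <= Suc q ==> 2 * j <= n ==> vanish TYPE('k::ab_group_add) M act (n - 2 * j) (Suc q - 2 * j)"
  and S: "hsurj TYPE('k) (abs_Res M act n) (M n) \<epsilon> q"
  and I: "0 < q ==> hinj TYPE('k) (abs_Res M act n) (M n) \<epsilon> (q - 1)"
 shows "vanish TYPE('k) M act n q"
 unfolding vanish_def
proof (intro conjI impI)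
 let ?R = "abs_Res M act n" and ?i = "%z. (z, []) :: 'a rep set \<times> square list" and ?p = "phi act n"
 have bp: "brho (?p (?i z)) = zH act n z 1" if "z : pts ?R" for z
  using zH_ends(2)[OF M that] by (simp add: brho_def phi_def)
 show "hsurj TYPE('k) (stabdom M n) (M n) (stab act n) q"
  unfolding hsurj_def
 proof (intro allI impI)
  fix w :: "('a, 'k) coeff_chain" assume w: "cyc (SS (M n)) q w"
  obtain y0 where y0: "cyc (SS ?R) q y0" "bdr (SS (M n)) q (w - cmap q \<epsilon> y0)" using S w unfolding hsurj_def by blast
  have ky: "supp y0 \<subseteq> SS ?R q" using y0(1) by (simp add: cyc_def)
  obtain N where N: "!!f. f : supp (subdiv N q y0) ==> sect q f ~= {}" using small_subdiv[OF M ky] by blast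
  let ?y = "subdiv N q y0"
  have y: "cyc (SS ?R) q ?y"
   using keys_subdiv[OF ky] cbd_subdiv[OF ky] y0(1) by (simp add: cyc_def)
  have ky': "supp ?y \<subseteq> SS ?R q" using y by (simp add: cyc_def)
  let ?Y = "cmap q ?i ?y"
  have Y: "cyc (As M act n 0) q ?Y" by (rule cyc_cmap[OF y]) (rule pair_As)
  obtain b where b: "supp b \<subseteq> Bs M act n 1 q" "dd bdel 1 q b = cmap q ?p ?Y" "cbd q b = 0"
   using zigzag[OF M V, of ?Y 0] Y small_pair[OF N] by (auto simp: cyc_def)
  have b': "cyc (Bs M act n 1) q b" using b by (simp add: cyc_def)
  \<comment> \<open>Following the Moore paths is a homotopy from \<open>\<epsilon>\<close> to the
    map that removes nothing, which is \<open>brho\<close> after \<open>phi\<close> on empty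
    columns.\<close>
  have hom: "bdr (SS (M n)) q (cmap q (%z. zH act n z 1) ?y - cmap q (%z. zH act n z 0) ?y)"
  proof -
   have "bdr (SS (M n)) q (cmap q (%z. (%(z, u). zH act n z u) (z, 1)) ?y - cmap q (%z. (%(z, u). zH act n z u) (z, 0)) ?y)"
   proof (rule homotopy_bdr[OF SS_extensional _ y])
    fix f g assume f: "f : SS ?R q" and g: "cts (Spx (Suc q)) (cylinder q) g"
    have "cts (Spx (Suc q)) (ptop ?R (top_of_set {0..1})) (%y. (f (fst (g y)), snd (g y)))"
     using cts_compose[OF g cts_apply_simplex[OF f]] by (simp add: o_def case_prod_beta)
    from cts_compose[OF this continuous_zH[OF M]]
    have "cts (Spx (Suc q)) (M n) (%y. zH act n (f (fst (g y))) (snd (g y)))" by (simp add: o_def)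
    from restrict_SS[OF this]
    show "(\<lambda>y\<in>spx (Suc q). (%(z, u). zH act n z u) (f (fst (g y)), snd (g y))) : SS (M n) (Suc q)" by simp
   qed
   thus ?thesis by simp
  qed
  have e1: "cmap q (%z. zH act n z 1) ?y = cmap q brho (cmap q ?p ?Y)"
   unfolding cmap_cmap by (rule cmap_cong) (use bp ky' SS_image in fastforce)
  have e0: "cmap q (%z. zH act n z 0) ?y = cmap q \<epsilon> ?y"
   by (rule cmap_cong) (use zH_ends(1)[OF M] ky' SS_image in fastforce)
  have "bdr (SS (M n)) q (cmap q \<epsilon> (?y - y0))"
   by (rule bdr_cmap[OF bdr_subdiv[OF y0(1)]]) (rule simplex_map_SS[OF continuous_\<epsilon>[OF M]])
  from bdr_add[OF hom[unfolded e0 e1] this]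
  have "bdr (SS (M n)) q (cmap q brho (cmap q ?p ?Y) - cmap q \<epsilon> y0)" by (simp add: cmap_diff)
  from bdr_diff[OF y0(2) this] have wb: "bdr (SS (M n)) q (w - cmap q brho (dd bdel 1 q b))" unfolding b(2) by simp
  show "\<exists>x. cyc (SS (stabdom M n)) q x \<and> bdr (SS (M n)) q (w - cmap q (stab act n) x)"
  proof (cases "n = 0")
   case True
   hence "b = 0" using b(1) Bs_empty[of n 1 M act q] by auto
   hence "bdr (SS (M n)) q w" using wb by simp
   thus ?thesis by (intro exI[of _ 0]) (simp add: cyc_def)
  next
   case False
   have "bdr (SS (M n)) q (cmap q brho (dd bdel 1 q b) - cmap q (stab act n) (cmap q brho b))"
    using brho_dd[OF M b'] False by simp
   from bdr_add[OF wb this] have "bdr (SS (M n)) q (w - cmap q (stab act n) (cmap q brho b))" by simp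
   moreover have "cyc (SS (M (n - 1))) q (cmap q brho b)" by (rule cyc_cmap[OF b']) (rule brho_SS)
   ultimately show ?thesis using False by auto
  qed
 qed
 assume q: "0 < q"
 then obtain r where r: "q = Suc r" by (cases q) auto
 show "hinj TYPE('k) (stabdom M n) (M n) (stab act n) (q - 1)"
  unfolding hinj_def
 proof (intro allI impI)
  fix x :: "('a, 'k) coeff_chain" assume x: "cyc (SS (stabdom M n)) (q - 1) x" and sx: "bdr (SS (M n)) (q - 1) (cmap (q - 1) (stab act n) x)"
  show "bdr (SS (stabdom M n)) (q - 1) x"
  proof (cases "n = 0")
   case True
   hence "x = 0" using x by (simp add: cyc_def SS_empty)
   thus ?thesis by (simp add: bdr_0)
  next
   case False
   hence n: "0 < n" by simp
   have x': "cyc (SS (M (n - 1))) r x" using x False r by simp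
   hence kx: "supp x \<subseteq> SS (M (n - 1)) r" by (simp add: cyc_def)
   have szS: "smap l (sz M act n) f : SS ?R l" if "f : SS (M (n - 1)) l" for f l
    using restrict_SS[OF continuous_sz[OF M n SS_continuous[OF that]]] by (simp add: simplex_map_def o_def)
   \<comment> \<open>\<open>\<epsilon>\<close> after \<open>sz\<close> is stabilization, so
     injectivity of \<open>\<epsilon>\<close> makes the lifted cycle bound.\<close>
   let ?s = "cmap r (sz M act n) x"
   have s: "cyc (SS ?R) r ?s" by (rule cyc_cmap[OF x']) (rule szS)
   have "cmap r \<epsilon> ?s = cmap r (stab act n) x"
    unfolding cmap_cmap by (rule cmap_cong) (use srep_facts(2)[OF M n] kx SS_image in fastforce)
   hence "bdr (SS ?R) r ?s" using I[OF q] s sx r by (simp add: hinj_def)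
   then obtain Y0 where Y0: "supp Y0 \<subseteq> SS ?R q" "cbd q Y0 = ?s" using r by (auto simp: bdr_def)
   obtain N where N: "!!f. f : supp (subdiv N q Y0) ==> sect q f ~= {}" using small_subdiv[OF M Y0(1)] by blast
   let ?x = "subdiv N r x" and ?Y = "cmap q ?i (subdiv N q Y0)"
   have sx: "cyc (SS (M (n - 1))) r ?x"
    using keys_subdiv[OF kx] cbd_subdiv[OF kx] x' by (simp add: cyc_def)
   hence ksx: "supp ?x \<subseteq> SS (M (n - 1)) r" by (simp add: cyc_def)
   \<comment> \<open>The same lift with its only square chosen; \<open>brho\<close> after
     \<open>phi\<close> takes it back to the chain in \<open>M (n - 1)\<close>.\<close>
   let ?xz = "cmap r (sA M act n) ?x"
   have x0: "cyc (As M act n 1) r ?xz" by (rule cyc_cmap[OF sx]) (rule sA_As[OF M n])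
   have Yk: "supp ?Y \<subseteq> As M act n 0 q" by (rule keys_cmap[OF keys_subdiv[OF Y0(1)]]) (rule pair_As)
   have "cbd q ?Y = cmap r ?i (subdiv N r ?s)"
    using cbd_subdiv[OF Y0(1), of N] Y0(2) r by (simp add: cbd_cmap)
   also have "\<dots> = cmap r (%a. ?i (sz M act n a)) ?x"
    by (simp add: subdiv_cmap[OF kx] cmap_cmap)
   also have "\<dots> = dd adel 1 r ?xz"
    by (simp add: dd_def sg_def cmap_cmap adel_def sA_def del_def)
   finally have bY: "cbd q ?Y = dd adel 1 (q - 1) ?xz" using r by simp
   have sm: "small q f" if "f : supp ?Y" for f 
    by (rule small_pair[where c = "subdiv N q Y0"]) (use N that in blast)+
   obtain b where b: "supp b \<subseteq> Bs M act n 1 q" "cbd q b = cmap r ?p ?xz"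
    using zigzag[OF M V Yk sm _ _ bY] x0 r by auto
   have "cmap r brho (cmap r ?p ?xz) = cmap r (%a. a) ?x"
    unfolding cmap_cmap by (rule cmap_cong) (use srep_facts(4)[OF M n] ksx SS_image in fastforce)
   also have "\<dots> = ?x" by (rule cmap_ident) (use ksx SS_extensional in blast)
   finally have "cbd q (cmap q brho b) = ?x" using b(2) r by (simp add: cbd_cmap)
   moreover have "supp (cmap q brho b) \<subseteq> SS (M (n - 1)) q" by (rule keys_cmap[OF b(1)]) (rule brho_SS)
   ultimately have "bdr (SS (M (n - 1))) r ?x" unfolding bdr_def r by blast
   from bdr_diff[OF this bdr_subdiv[OF x', of N]] have "bdr (SS (M (n - 1))) r x" by simp
   thus ?thesis using False r by simp
  qed
 qed
qed

text \<open>\<open>cts_act\<close> asks for a locally compact parameter space. Since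
  \<open>M (n - 1)\<close> is compactly generated, it suffices to test on compact Hausdorff
  spaces.\<close>

lemma continuous_stab:
 assumes M: "rmod M act"
 shows "cts (stabdom M n) (M n) (stab act n)"
proof (cases "n = 0")
 case True
 thus ?thesis by (simp add: continuous_map_on_empty)
next
 case False
 have M': "kify (M (n - 1)) = M (n - 1)" using M by (simp add: right_S_module_def CGWH_def compactly_generated_def)
 have in_M: "act (n - 1) 1 a \<sigma> : pts (M n)" if "a : pts (M (n - 1))" for a
  using act_in[OF M that \<sigma>_mem] False by simp
 have "openin (M (n - 1)) {a : pts (M (n - 1)). act (n - 1) 1 a \<sigma> : U}" if U: "openin (M n) U" for U
 proof -
  have "openin (kify (M (n - 1))) {a : pts (M (n - 1)). act (n - 1) 1 a \<sigma> : U}"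
   unfolding openin_kify
  proof (intro conjI allI impI)
   fix K :: "'a set set topology" and u assume K: "compact_space K" "haus K" and u: "cts K (M (n - 1)) u"
   have "cts K (M n) (%x. act (n - 1) 1 (u x) \<sigma>)"
    using cts_act[OF M compact_imp_locally_compact_space[OF K(1)] K(2) u, of 1 "%_. \<sigma>"] \<sigma>_mem False by simp
   from cts_preimage[OF this U]
   have "openin K {x : pts K. act (n - 1) 1 (u x) \<sigma> : U}" .
   moreover have "{x : pts K. u x : {a : pts (M (n - 1)). act (n - 1) 1 a \<sigma> : U}} = {x : pts K. act (n - 1) 1 (u x) \<sigma> : U}"
    using u by (auto simp: cts_def)
   ultimately show "openin K {x : pts K. u x : {a : pts (M (n - 1)). act (n - 1) 1 a \<sigma> : U}}" by simp
  qed auto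
  thus ?thesis by (simp only: M')
 qed
 thus ?thesis using False in_M by (auto simp: cts_def)
qed


section \<open>The vanishing range\<close>

lemma f_bar_le: "p <= n ==> f_bar f n <= \<lfloor>real (f p) + 1/2 * (real n - real p)\<rfloor>"
 unfolding f_bar_def by (rule Min_le) auto

lemma f_bar_Min: "\<exists>p\<le>n. f_bar f n = \<lfloor>real (f p) + 1/2 * (real n - real p)\<rfloor>"
proof -
 let ?A = "{\<lfloor>real (f p) + 1/2 * (real n - real p)\<rfloor> | p. 0 <= p \<and> p <= n}"
 have "Min ?A : ?A" by (rule Min_in) auto
 thus ?thesis unfolding f_bar_def by blast
qed

text \<open>Every p \<le> n - 2 j also occurs in the minimum for n, where its term is larger by
  exactly j.\<close>

lemma f_bar_shift:
 assumes "2 * j <= n"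
 shows "f_bar f n <= f_bar f (n - 2 * j) + int j"
proof -
 obtain p where p: "p <= n - 2 * j" "f_bar f (n - 2 * j) = \<lfloor>real (f p) + 1/2 * (real (n - 2 * j) - real p)\<rfloor>"
  using f_bar_Min by blast
 have "real (f p) + 1/2 * (real n - real p) = real (f p) + 1/2 * (real (n - 2 * j) - real p) + of_int (int j)"
  using assms by (simp add: of_nat_diff field_simps)
 hence "\<lfloor>real (f p) + 1/2 * (real n - real p)\<rfloor> = \<lfloor>real (f p) + 1/2 * (real (n - 2 * j) - real p)\<rfloor> + int j"
  by (simp only: floor_add_int)
 thus ?thesis using f_bar_le[of p n f] order_trans[OF p(1) diff_le_self] p(2) by simp
qed

theorem proposition4p1:
  fixes M :: "nat \<Rightarrow> 'a topology" and act :: "'a action" and f :: "nat \<Rightarrow> nat"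
  assumes "right_S_module M act"
    and "\<forall>n d. d < f n \<longrightarrow>
      trivial_group (rel_homology_Res TYPE('k::{comm_ring, comm_monoid_mult}) n d M act)"
  shows "\<forall>n d. int d < f_bar f n \<longrightarrow> trivial_group (homology_M_mod_\<sigma> TYPE('k) n d M act)"
proof (intro allI impI)
 note M = assms(1)
 have v: "vanish TYPE('k) M act n d" if "int d < f_bar f n" for n d
  using that
 proof (induction n arbitrary: d rule: less_induct)
  case (less n)
  \<comment> \<open>The term p = n of the minimum is \<open>f n\<close>.\<close>
  have "d < f n" using less(2) f_bar_le[of n n f] by simp
  hence tr: "trivial_group (reduced_homology TYPE('k) d (hcofibre (abs_Res M act n) (M n) \<epsilon>) Apex)"
   using assms(2) by (simp add: rel_homology_Res_def)
  show ?case
  proof (rule vanish_step[OF M])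
   show "hsurj TYPE('k) (abs_Res M act n) (M n) \<epsilon> d" "0 < d ==> hinj TYPE('k) (abs_Res M act n) (M n) \<epsilon> (d - 1)"
    using hcofibre_trivial_imp[OF continuous_\<epsilon>[OF M] tr] by blast+
   fix j assume j: "1 <= j" "2 * j <= Suc d" "2 * j <= n"
   show "vanish TYPE('k) M act (n - 2 * j) (Suc d - 2 * j)"
   proof (rule less(1))
    show "n - 2 * j < n" using j by simp
    \<comment> \<open>From d < \<open>f_bar f n\<close> \<le> \<open>f_bar f (n - 2 * j)\<close> + j
      follows d + 1 - 2 j < \<open>f_bar f (n - 2 * j)\<close> + 1 - j, and j \<ge> 1.\<close>
    show "int (Suc d - 2 * j) < f_bar f (n - 2 * j)"
     using f_bar_shift[OF j(3), of f] less(2) j by (simp add: of_nat_diff)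
   qed
  qed
 qed
 fix n d assume "int d < f_bar f n"
 hence "vanish TYPE('k) M act n d" by (rule v)
 thus "trivial_group (homology_M_mod_\<sigma> TYPE('k) n d M act)"
  unfolding homology_M_mod_\<sigma>_def M_mod_\<sigma>_def vanish_def
  using hcofibre_trivialI[OF continuous_stab[OF M]] by blast
qed

end
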